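(* Let $k$ be a positive integer. Let $S^{-}_{k+1/2}(4)$ be the orthogonal complement, under the Petersson inner product, of $S^{+}(4)\oplus A^{+}(4)$ in $S_{k+1/2}(\Gamma_0(4))$. Then $S^{-}_{k+1/2}(4)$ has a basis of eigenforms for all the operators $T_{p^2}$, $p$ an odd prime; these eigenforms are also eigenfunctions under $U_4$. If two eigenforms in $S^{-}_{k+1/2}(4)$ share the same eigenvalues for all $T_{p^2}$ ($p$ odd prime), then they are scalar multiples of each other. The Niwa map $\psi$ induces a Hecke algebra isomorphism $$S^{-}_{k+1/2}(4)\cong S^{\mathrm{new}}_{2k}(\Gamma_0(2)).$$
   Context: $S_{k+1/2}(\Gamma_0(4))$ is the space of holomorphic cusp forms $f$ on the upper half plane with $f(\alpha z)=j(\alpha,z)^{2k+1}f(z)$ for $\alpha=\begin{pmatrix}a&b\\c&d\end{pmatrix}\in\Gamma_0(4)$, where $j(\alpha,z)=\varepsilon_d^{-1}\left(\frac cd\right)(cz+d)^{1/2}$, $\varepsilon_d=1$ or $i$ according as $d\equiv1$ or $3\pmod 4$, square roots have argument in $(-\pi/2,\pi/2]$ and $\left(\frac cd\right)$ is Shimura's quadratic symbol. $S_{2k}(\Gamma_0(2))$ is the space of weight $2k$ cusp forms on $\Gamma_0(2)$, and $S_{2k}^{\mathrm{new}}(\Gamma_0(2))$ its Atkin–Lehner newspace. On $f=\sum_{n\ge1}a_nq^n$ of weight $k+1/2$: $U_4(f)=\sum_n a_{4n}q^n$ and, for $p$ an odd prime, $T_{p^2}(f)=\sum_n\left(a_{p^2n}+\left(\frac{(-1)^kn}{p}\right)p^{k-1}a_n+p^{2k-1}a_{n/p^2}\right)q^n$.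 On weight $2k$: $T_p(f)=\sum_n(a_{pn}+p^{2k-1}a_{n/p})q^n$ for $p$ an odd prime, $U_2(f)=\sum_n a_{2n}q^n$. $S^+(4)\subseteq S_{k+1/2}(\Gamma_0(4))$ is Kohnen's plus space: the forms $\sum a_nq^n$ with $a_n=0$ unless $(-1)^kn\equiv0,1\pmod4$. $\widetilde W_4$ is the involution of $S_{k+1/2}(\Gamma_0(4))$ given by $\widetilde W_4(f)(z)=\left(\frac{2}{2k+1}\right)(-2iz)^{-k-1/2}f(-1/4z)$, and $A^+(4)=\widetilde W_4S^+(4)$. (The sum $S^+(4)+A^+(4)$ is direct.) By a theorem of Niwa there is a vector space isomorphism $\psi:S_{k+1/2}(\Gamma_0(4))\to S_{2k}(\Gamma_0(2))$ with $T_p(\psi(f))=\psi(T_{p^2}(f))$ for all odd primes $p$ and $U_2(\psi(f))=\psi(U_4(f))$; $\psi$ ("the Niwa map") denotes such an isomorphism. "Hecke algebra isomorphism" means that $\psi$ restricts to a linear isomorphism compatible with Hecke operators in this sense. *)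

theory Defs
  imports
    "HOL-Analysis.Analysis"
    "HOL-Number_Theory.Number_Theory"
    "HOL-Library.Function_Algebras"
begin

global_interpretation fun_vs: vector_space "\<lambda>(c::complex) (f::complex \<Rightarrow> complex) z. c * f z"
  by unfold_locales (auto simp: fun_eq_iff algebra_simps)

definition upper_half_plane :: "complex set"
  where "upper_half_plane = {z. Im z > 0}"

definition Gamma0 :: "nat \<Rightarrow> (int^2^2) set"
  where "Gamma0 N = {\<gamma>. det \<gamma> = 1 \<and> int N dvd \<gamma>$2$1}"

definition cocycle :: "int^2^2 \<Rightarrow> complex \<Rightarrow> complex"
  where "cocycle \<gamma> z = of_int (\<gamma>$2$1) * z + of_int (\<gamma>$2$2)"

definition moebius :: "int^2^2 \<Rightarrow> complex \<Rightarrow> complex"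
  where "moebius \<gamma> z = (of_int (\<gamma>$1$1) * z + of_int (\<gamma>$1$2)) / cocycle \<gamma> z"

text \<open>
  Shimura's symbol \<open>(c/d)\<close> for odd \<open>d\<close>: the Jacobi symbol \<open>(c/\<bar>d\<bar>)\<close>, with an additional sign
  if both entries are negative; the empty product gives \<open>(0/1) = (0/-1) = 1\<close>.
\<close>
definition shimura_symbol :: "int \<Rightarrow> int \<Rightarrow> int"
  where "shimura_symbol c d =
    (if c < 0 \<and> d < 0 then -1 else 1) * (\<Prod>p\<in>#prime_factorization \<bar>d\<bar>. Legendre c p)"

definition theta_eps :: "int \<Rightarrow> complex"
  where "theta_eps d = (if d mod 4 = 1 then 1 else \<i>)"

definition theta_factor :: "int^2^2 \<Rightarrow> complex \<Rightarrow> complex"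
  where "theta_factor \<gamma> z =
    inverse (theta_eps (\<gamma>$2$2)) * of_int (shimura_symbol (\<gamma>$2$1) (\<gamma>$2$2)) * csqrt (cocycle \<gamma> z)"

text \<open>
  Vanishing at all cusps: for every \<open>\<gamma>\<close> in the full modular group, \<open>f(\<gamma>z) / \<mu> \<gamma> z\<close> has
  a Fourier expansion at infinity without constant term. The period \<open>h\<close> need not be minimal, which also
  covers the expansions in \<open>e((n + r)z/h)\<close> with \<open>r\<close> rational that occur at irregular cusps
  in half-integral weight. There \<open>f\<close> slashed with \<open>\<gamma>\<close> is only defined up to a constant
  factor of absolute value 1, which does not affect the condition.
\<close>
definition vanishes_at_cusps ::
    "(int^2^2 \<Rightarrow> complex \<Rightarrow> complex) \<Rightarrow> (complex \<Rightarrow> complex) \<Rightarrow> bool"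
  where "vanishes_at_cusps \<mu> f \<longleftrightarrow>
    (\<forall>\<gamma>\<in>Gamma0 1. \<exists>h::nat. h > 0 \<and> (\<exists>a::nat \<Rightarrow> complex. a 0 = 0 \<and>
      (\<forall>z\<in>upper_half_plane.
        (\<lambda>n. a n * exp (2 * of_real pi * \<i> * of_nat n * z / of_nat h)) sums
          (f (moebius \<gamma> z) / \<mu> \<gamma> z))))"

text \<open>
  Cusp forms are total functions set to \<open>0\<close> off the upper half plane, so that they are
  equal as functions iff they agree on the upper half plane.
\<close>
definition cusp_forms ::
    "nat \<Rightarrow> (int^2^2 \<Rightarrow> complex \<Rightarrow> complex) \<Rightarrow> (int^2^2 \<Rightarrow> complex \<Rightarrow> complex) \<Rightarrow>
     (complex \<Rightarrow> complex) set"
  where "cusp_forms N J \<mu> = {f.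
    f holomorphic_on upper_half_plane \<and>
    (\<forall>z. z \<notin> upper_half_plane \<longrightarrow> f z = 0) \<and>
    (\<forall>\<gamma>\<in>Gamma0 N. \<forall>z\<in>upper_half_plane. f (moebius \<gamma> z) = J \<gamma> z * f z) \<and>
    vanishes_at_cusps \<mu> f}"

definition S_half :: "nat \<Rightarrow> (complex \<Rightarrow> complex) set"
  where "S_half k = cusp_forms 4
    (\<lambda>\<gamma> z. theta_factor \<gamma> z ^ (2 * k + 1))
    (\<lambda>\<gamma> z. csqrt (cocycle \<gamma> z) ^ (2 * k + 1))"

definition S_int :: "nat \<Rightarrow> nat \<Rightarrow> (complex \<Rightarrow> complex) set"
  where "S_int w N = cusp_forms N (\<lambda>\<gamma> z. cocycle \<gamma> z ^ w) (\<lambda>\<gamma> z. cocycle \<gamma> z ^ w)"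

text \<open>
  The integral over the quotient of the upper half plane by \<open>\<Gamma>\<^sub>0(N)\<close> is taken over the
  Ford fundamental domain: the points of the strip \<open>\<bar>Re z\<bar> \<le> 1/2\<close> that lie outside all isometric circles.
\<close>
definition ford_domain :: "nat \<Rightarrow> complex set"
  where "ford_domain N = {z \<in> upper_half_plane. \<bar>Re z\<bar> \<le> 1 / 2 \<and>
    (\<forall>\<gamma>\<in>Gamma0 N. \<gamma>$2$1 \<noteq> 0 \<longrightarrow> cmod (cocycle \<gamma> z) \<ge> 1)}"

definition petersson ::
    "real \<Rightarrow> nat \<Rightarrow> (complex \<Rightarrow> complex) \<Rightarrow> (complex \<Rightarrow> complex) \<Rightarrow> complex"
  where "petersson w N f g =
    (LINT z:ford_domain N|lborel. f z * cnj (g z) * of_real (Im z powr w / (Im z)\<^sup>2))"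

definition orth_complement ::
    "real \<Rightarrow> nat \<Rightarrow> (complex \<Rightarrow> complex) set \<Rightarrow> (complex \<Rightarrow> complex) set \<Rightarrow>
     (complex \<Rightarrow> complex) set"
  where "orth_complement w N V W = {f \<in> V. \<forall>g\<in>W. petersson w N f g = 0}"

definition S_old :: "nat \<Rightarrow> nat \<Rightarrow> (complex \<Rightarrow> complex) set"
  where "S_old w N = fun_vs.span
    {\<lambda>z. f (of_nat d * z) | M d f. M * d dvd N \<and> M \<noteq> N \<and> f \<in> S_int w M}"

definition S_new :: "nat \<Rightarrow> nat \<Rightarrow> (complex \<Rightarrow> complex) set"
  where "S_new w N = orth_complement (real w) N (S_int w N) (S_old w N)"

definition qseries :: "(nat \<Rightarrow> complex) \<Rightarrow> complex \<Rightarrow> complex"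
  where "qseries a z =
    (if z \<in> upper_half_plane then \<Sum>n. a n * exp (2 * of_real pi * \<i> * of_nat n * z) else 0)"

definition qcoeff :: "(complex \<Rightarrow> complex) \<Rightarrow> nat \<Rightarrow> complex"
  where "qcoeff f = (THE a. \<forall>z\<in>upper_half_plane.
    (\<lambda>n. a n * exp (2 * of_real pi * \<i> * of_nat n * z)) sums f z)"

definition U_op :: "nat \<Rightarrow> (complex \<Rightarrow> complex) \<Rightarrow> complex \<Rightarrow> complex"
  where "U_op m f = qseries (\<lambda>n. qcoeff f (m * n))"

definition T_half :: "nat \<Rightarrow> nat \<Rightarrow> (complex \<Rightarrow> complex) \<Rightarrow> complex \<Rightarrow> complex"
  where "T_half k p f = qseries (\<lambda>n.
    qcoeff f (p\<^sup>2 * n)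
    + of_int (Legendre ((-1) ^ k * int n) (int p)) * of_nat p ^ (k - 1) * qcoeff f n
    + of_nat p ^ (2 * k - 1) * (if p\<^sup>2 dvd n then qcoeff f (n div p\<^sup>2) else 0))"

definition T_int :: "nat \<Rightarrow> nat \<Rightarrow> (complex \<Rightarrow> complex) \<Rightarrow> complex \<Rightarrow> complex"
  where "T_int w p f = qseries (\<lambda>n.
    qcoeff f (p * n) + of_nat p ^ (w - 1) * (if p dvd n then qcoeff f (n div p) else 0))"

definition S_plus :: "nat \<Rightarrow> (complex \<Rightarrow> complex) set"
  where "S_plus k = {f \<in> S_half k.
    \<forall>n. \<not> ([(-1) ^ k * int n = 0] (mod 4) \<or> [(-1) ^ k * int n = 1] (mod 4)) \<longrightarrow> qcoeff f n = 0}"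

definition W4 :: "nat \<Rightarrow> (complex \<Rightarrow> complex) \<Rightarrow> complex \<Rightarrow> complex"
  where "W4 k f z =
    (if z \<in> upper_half_plane
     then of_int (shimura_symbol 2 (2 * int k + 1)) * inverse (csqrt (-2 * \<i> * z) ^ (2 * k + 1))
            * f (-1 / (4 * z))
     else 0)"

definition A_plus :: "nat \<Rightarrow> (complex \<Rightarrow> complex) set"
  where "A_plus k = W4 k ` S_plus k"

definition S_minus :: "nat \<Rightarrow> (complex \<Rightarrow> complex) set"
  where "S_minus k = orth_complement (real k + 1 / 2) 4 (S_half k)
    {f + g | f g. f \<in> S_plus k \<and> g \<in> A_plus k}"

definition eigenfunction ::
    "((complex \<Rightarrow> complex) \<Rightarrow> complex \<Rightarrow> complex) \<Rightarrow> complex \<Rightarrow> (complex \<Rightarrow> complex) \<Rightarrow> bool"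
  where "eigenfunction T l f \<longleftrightarrow> f \<noteq> 0 \<and> T f = (\<lambda>z. l * f z)"

definition hecke_eigenform :: "nat \<Rightarrow> (complex \<Rightarrow> complex) \<Rightarrow> bool"
  where "hecke_eigenform k f \<longleftrightarrow>
    (\<forall>p. prime p \<and> odd p \<longrightarrow> (\<exists>l. eigenfunction (T_half k p) l f))"

definition linear_iso_on ::
    "(complex \<Rightarrow> complex) set \<Rightarrow> (complex \<Rightarrow> complex) set \<Rightarrow>
     ((complex \<Rightarrow> complex) \<Rightarrow> (complex \<Rightarrow> complex)) \<Rightarrow> bool"
  where "linear_iso_on V W \<psi> \<longleftrightarrow> bij_betw \<psi> V W \<and>
    (\<forall>f\<in>V. \<forall>g\<in>V. \<psi> (f + g) = \<psi> f + \<psi> g) \<and>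
    (\<forall>c. \<forall>f\<in>V. \<psi> (\<lambda>z. c * f z) = (\<lambda>z. c * \<psi> f z))"

definition hecke_iso ::
    "nat \<Rightarrow> (complex \<Rightarrow> complex) set \<Rightarrow> (complex \<Rightarrow> complex) set \<Rightarrow>
     ((complex \<Rightarrow> complex) \<Rightarrow> (complex \<Rightarrow> complex)) \<Rightarrow> bool"
  where "hecke_iso k V W \<psi> \<longleftrightarrow> linear_iso_on V W \<psi> \<and>
    (\<forall>f\<in>V. (\<forall>p. prime p \<and> odd p \<longrightarrow> T_int (2 * k) p (\<psi> f) = \<psi> (T_half k p f)) \<and>
      U_op 2 (\<psi> f) = \<psi> (U_op 4 f))"

definition hecke_stable :: "nat \<Rightarrow> (complex \<Rightarrow> complex) set \<Rightarrow> bool"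
  where "hecke_stable k V \<longleftrightarrow>
    (\<forall>f\<in>V. (\<forall>p. prime p \<and> odd p \<longrightarrow> T_half k p f \<in> V) \<and> U_op 4 f \<in> V)"

definition niwa_map :: "nat \<Rightarrow> ((complex \<Rightarrow> complex) \<Rightarrow> (complex \<Rightarrow> complex)) \<Rightarrow> bool"
  where "niwa_map k \<psi> \<longleftrightarrow> hecke_iso k (S_half k) (S_int (2 * k) 2) \<psi>"

end

theory Submission
 imports Defs "HOL-Complex_Analysis.Complex_Analysis" "HOL-Real_Asymp.Real_Asymp"
  "HOL-Computational_Algebra.Fundamental_Theorem_Algebra"
begin

text \<open>
  Put \<open>K = \<plusminus> W U\<^sub>4\<close>, with \<open>W\<close> the involution \<open>z \<mapsto> -1/4z\<close> and the sign of \<open>W\<^sub>4\<close>. It is Hermitian for the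
  Petersson product, the plus space is its eigenspace for \<open>2\<^sup>k\<close>, and its only other eigenvalue is
  \<open>-2\<^sup>k\<^sup>-\<^sup>1\<close>. Hence \<open>S\<^sup>-\<close> consists of the \<open>f\<close> for which \<open>f\<close> and \<open>W f\<close> both lie in the eigenspace for
  \<open>-2\<^sup>k\<^sup>-\<^sup>1\<close>. The Hermitian operators \<open>T\<^sub>p\<^sub>2\<close> commute with \<open>U\<^sub>4\<close>, and with \<open>W\<close> by the evaluation of the
  quadratic Gauss sum, so they act on \<open>S\<^sup>-\<close> and are diagonalisable there.

  If \<open>\<psi> f\<close> is a new eigenform, multiplicity one in level 2 makes \<open>f\<close> an eigenfunction of \<open>W\<close> and of
  \<open>U\<^sub>4\<close>. Thus \<open>K f = 2\<^sup>k f\<close> or \<open>K f = -2\<^sup>k\<^sup>-\<^sup>1 f\<close>; the first is impossible, as \<open>U\<^sub>2\<close> has no eigenvalue of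
  modulus \<open>2\<^sup>k\<close> in weight \<open>2k\<close>. So \<open>f \<in> S\<^sup>-\<close>. Conversely \<open>U\<^sub>2\<^sup>2\<close> is the scalar \<open>4\<^sup>k\<^sup>-\<^sup>1\<close> on \<open>\<psi>(S\<^sup>-)\<close>,
  which no nonzero oldform allows.
\<close>

text \<open>The conditions at the cusps are the main obstacle: they involve the whole modular group
  and are not visibly preserved by \<open>W\<close>, \<open>U_4\<close> or \<open>T_(p^2)\<close>.
  Given the transformation law, they amount to boundedness of \<open>|f| y^(weight/2)\<close>, which
  affine substitutions and inversions respect. The theta multiplier is never computed on products
  either: a nonzero form certifies that it is a cocycle, so membership in \<open>S_half\<close> only
  needs invariance of \<open>f\<close> and \<open>W f\<close> under \<open>z + 1\<close>.

  The second eigenvalue of \<open>K\<close> comes from the four terms of \<open>U_4\<close> seen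
  through \<open>W\<close>. Two of them form \<open>2^(k-1) P f\<close>, where \<open>P\<close>
  multiplies the \<open>n\<close>-th coefficient by 1 or -1 according to the plus condition;
  \<open>P\<close> fixes the other two, so it fixes \<open>K f + 2^(k-1) f\<close>.

  Diagonalisability is proved for the Hermitian \<open>T_p\<close> on the newspace and carried back
  by \<open>\<psi>\<close>. The bound for \<open>U_2\<close> serves twice: an oldform with
  \<open>U_2 f = c f\<close> and \<open>c^2 = 4^(k-1)\<close> comes from a level 1 form with a
  second stabilisation of eigenvalue \<open>2c\<close>, of modulus \<open>2^k\<close>.\<close>

abbreviation "\<omega> \<equiv> 2 * complex_of_real pi * \<i>"

type_synonym cfun = "complex => complex"

no_notation fps_nth (infixl "$" 75)

abbreviation "\<H> \<equiv> upper_half_plane"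

lemma H_iff: "z \<in> \<H> \<longleftrightarrow> Im z > 0" by (simp add: upper_half_plane_def)

lemma open_upper_half_plane [simp, intro]: "open \<H>"
 unfolding upper_half_plane_def by (simp add: open_halfspace_Im_gt)

lemma convex_upper_half_plane [simp, intro]: "convex \<H>"
 unfolding upper_half_plane_def by (simp add: convex_halfspace_Im_gt)

lemma connected_upper_half_plane [simp, intro]: "connected \<H>" by (simp add: convex_connected)

section \<open>Integral 2 x 2 matrices and their action on the upper half plane\<close>

definition mat2 :: "int => int => int => int => int^2^2"
 where "mat2 a b c d = vector [vector [a, b], vector [c, d]]"

lemma mat2_nth [simp]:
 "mat2 a b c d $ 1 $ 1 = a" "mat2 a b c d $ 1 $ 2 = b"
 "mat2 a b c d $ 2 $ 1 = c" "mat2 a b c d $ 2 $ 2 = d" by (simp_all add: mat2_def)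

lemma mat2_eq_iff: "A = B \<longleftrightarrow> A$1$1 = B$1$1 \<and> A$1$2 = B$1$2 \<and> A$2$1 = B$2$1 \<and> A$2$2 = B$2$2"
 for A B :: "int^2^2" unfolding vec_eq_iff forall_2 by blast

lemma mat2_inject [simp]:
 "mat2 a b c d = mat2 a' b' c' d' \<longleftrightarrow> a = a' \<and> b = b' \<and> c = c' \<and> d = d'" by (simp add: mat2_eq_iff)

lemma matmul_nth:
 fixes A B :: "int^2^2"
 shows "(A ** B) $ i $ j = A$i$1 * B$1$j + A$i$2 * B$2$j"
 by (simp add: matrix_matrix_mult_def sum_2)

lemma mat2_mult [simp]:
 "mat2 a b c d ** mat2 a' b' c' d' =
   mat2 (a * a' + b * c') (a * b' + b * d') (c * a' + d * c') (c * b' + d * d')"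
 by (simp add: mat2_eq_iff matmul_nth)

lemma det_mat2 [simp]: "det (mat2 a b c d) = a * d - b * c" by (simp add: det_2)

lemma cocycle_mat2 [simp]: "cocycle (mat2 a b c d) z = of_int c * z + of_int d" by (simp add: cocycle_def)

lemma moebius_mat2: "moebius (mat2 a b c d) z = (of_int a * z + of_int b) / (of_int c * z + of_int d)"
 by (simp add: moebius_def)

text \<open>The adjugate. It stays integral in every determinant, and since scalar matrices act
  trivially it acts as the inverse of \<open>A\<close> also for the matrices of determinant
  \<open>p\<close> behind the Hecke operators.\<close>

definition adj2 :: "int^2^2 => int^2^2"
 where "adj2 A = mat2 (A$2$2) (- A$1$2) (- A$2$1) (A$1$1)"

lemma adj2_nth [simp]:
 "adj2 A $ 1 $ 1 = A$2$2" "adj2 A $ 1 $ 2 = - A$1$2" "adj2 A $ 2 $ 1 = - A$2$1" "adj2 A $ 2 $ 2 = A$1$1"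
 by (simp_all add: adj2_def)

lemma adj2_adj2 [simp]: "adj2 (adj2 A) = A" by (simp add: mat2_eq_iff)

lemma det_adj2 [simp]: "det (adj2 A) = det A" by (simp add: det_2 algebra_simps)

lemma mult_adj2: "A ** adj2 A = mat2 (det A) 0 0 (det A)"
 by (simp add: mat2_eq_iff matmul_nth det_2 algebra_simps)

lemma adj2_mult_self: "adj2 A ** A = mat2 (det A) 0 0 (det A)"
 by (simp add: mat2_eq_iff matmul_nth det_2 algebra_simps)

lemma mat2_scalar_mult: "mat2 1 0 0 1 ** A = A" "A ** mat2 1 0 0 1 = A"
 by (simp_all add: mat2_eq_iff matmul_nth)

lemma cocycle_nonzero:
 assumes "det A > 0" "z \<in> \<H>"
 shows "cocycle A z \<noteq> 0"
proof
 assume eq: "cocycle A z = 0"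
 have "Im (cocycle A z) = of_int (A$2$1) * Im z" by (simp add: cocycle_def)
 with eq assms(2) have "A$2$1 = 0" by (simp add: H_iff)
 with eq have "A$2$2 = 0" by (simp add: cocycle_def)
 with `A$2$1 = 0` assms(1) show False by (simp add: det_2)
qed

lemma Im_moebius:
 assumes "det A > 0" "z \<in> \<H>"
 shows "Im (moebius A z) = of_int (det A) * Im z / (cmod (cocycle A z))\<^sup>2"
 unfolding moebius_def Im_divide cmod_power2 by (simp add: cocycle_def det_2 algebra_simps)

lemma moebius_in_H [simp, intro]:
 assumes "det A > 0" "z \<in> \<H>"
 shows "moebius A z \<in> \<H>"
 using assms cocycle_nonzero[OF assms] Im_moebius[OF assms] by (simp add: H_iff)

lemma cocycle_mult:
 assumes "det B > 0" "z \<in> \<H>"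
 shows "cocycle (A ** B) z = cocycle A (moebius B z) * cocycle B z"
proof -
 have *: "(c * (n / q) + d) * q = c * n + d * q" if "q \<noteq> 0" for c d n q :: complex
  using that by (simp add: distrib_right)
 have nz: "cocycle B z \<noteq> 0" by (rule cocycle_nonzero[OF assms])
 show ?thesis unfolding moebius_def[of B] cocycle_def[of A] *[OF nz]
  unfolding cocycle_def by (simp add: matmul_nth algebra_simps)
qed

lemma moebius_mult:
 assumes "det A > 0" "det B > 0" "z \<in> \<H>"
 shows "moebius (A ** B) z = moebius A (moebius B z)"
proof -
 have *: "(a * (n / q) + b) / (c * (n / q) + d) = (a * n + b * q) / (c * n + d * q)"
  if "q \<noteq> 0" for a b c d n q :: complex
 proof -
  have "a * (n / q) + b = (a * n + b * q) / q" "c * (n / q) + d = (c * n + d * q) / q"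
   using that by (simp_all add: add_divide_distrib)
  thus ?thesis using that by simp
 qed
 have nz: "cocycle B z \<noteq> 0" by (rule cocycle_nonzero[OF assms(2,3)])
 show ?thesis unfolding moebius_def[of A] moebius_def[of B] cocycle_def[of A] *[OF nz]
  unfolding moebius_def cocycle_def by (simp add: matmul_nth algebra_simps)
qed

lemma moebius_scalar [simp]: "n \<noteq> 0 ==> moebius (mat2 n 0 0 n) z = z" by (simp add: moebius_mat2)

lemma moebius_adj2_left:
 assumes "det A > 0" "z \<in> \<H>"
 shows "moebius (adj2 A) (moebius A z) = z"
 using assms moebius_mult[of "adj2 A" A z] by (simp add: adj2_mult_self)

lemma moebius_adj2_right:
 assumes "det A > 0" "z \<in> \<H>"
 shows "moebius A (moebius (adj2 A) z) = z"
 using assms moebius_mult[of A "adj2 A" z] by (simp add: mult_adj2)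

lemma moebius_uminus [simp]: "moebius (- A) z = moebius A z"
proof -
 have "moebius (- A) z = (- (of_int (A$1$1) * z + of_int (A$1$2))) / (- cocycle A z)"
  unfolding moebius_def cocycle_def by simp
 also have "... = moebius A z" unfolding moebius_def by (rule minus_divide_divide)
 finally show ?thesis .
qed

lemma holomorphic_moebius:
 assumes "det A > 0"
 shows "moebius A holomorphic_on \<H>"
 unfolding moebius_def using cocycle_nonzero[OF assms] unfolding cocycle_def by (intro holomorphic_intros) auto

lemma continuous_on_moebius:
 assumes "det A > 0"
 shows "continuous_on \<H> (moebius A)"
 using holomorphic_moebius[OF assms] holomorphic_on_imp_continuous_on by blast

section \<open>The congruence groups \<open>Gamma0 N\<close>\<close>

lemma Gamma0_iff: "A \<in> Gamma0 N \<longleftrightarrow> det A = 1 \<and> int N dvd A$2$1" by (simp add: Gamma0_def)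

lemma Gamma0_det [simp]: "A \<in> Gamma0 N ==> det A = 1" by (simp add: Gamma0_iff)

lemma Gamma0_mult:
 assumes "A \<in> Gamma0 N" "B \<in> Gamma0 N"
 shows "A ** B \<in> Gamma0 N"
 using assms by (auto simp: Gamma0_iff det_mul matmul_nth)

lemma Gamma0_adj2: "A \<in> Gamma0 N ==> adj2 A \<in> Gamma0 N" by (simp add: Gamma0_iff)

lemma Gamma0_one: "mat2 1 0 0 1 \<in> Gamma0 N" by (simp add: Gamma0_iff)

lemma Gamma0_T: "mat2 1 n 0 1 \<in> Gamma0 N" by (simp add: Gamma0_iff)

lemma Gamma0_uminus: "A \<in> Gamma0 N ==> - A \<in> Gamma0 N" by (simp add: Gamma0_iff det_2)

lemma Gamma0_subset: "M dvd N ==> Gamma0 N \<subseteq> Gamma0 M" by (auto simp: Gamma0_iff dvd_trans[of "int M" "int N"])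

lemma countable_Gamma0 [simp, intro]: "countable (A :: (int^2^2) set)" by (rule countableI_type)

text \<open>Right multiplication by powers of the two unipotent generators runs the Euclidean algorithm
  with remainders of least absolute value on the bottom row; for \<open>N = 4\<close> it
  terminates because \<open>d\<close> is odd, hence \<open>\<bar>d\<bar> = \<bar>c\<bar>/2\<close> cannot occur.\<close>
lemma Gamma0_induct:
 fixes P :: "int^2^2 => bool"
 assumes N: "0 < N" "N \<le> 4"
  and A: "A \<in> Gamma0 N"
  and base: "P (mat2 1 0 0 1)" "P (mat2 (-1) 0 0 (-1))"
  and T: "\<And>A n. A \<in> Gamma0 N ==> P A ==> P (A ** mat2 1 n 0 1)"
  and V: "\<And>A n. A \<in> Gamma0 N ==> P A ==> P (A ** mat2 1 0 (int N * n) 1)"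
 shows "P A"
 using A
proof (induction "nat \<bar>A$2$1\<bar>" arbitrary: A rule: less_induct)
 case less
 \<comment> \<open>Division with remainder of least absolute value: rounding \<open>x / m\<close> to
   the nearest integer leaves at most half of \<open>m\<close>.\<close>
 have red: "\<exists>n. 2 * \<bar>x + m * n\<bar> \<le> \<bar>m\<bar>" if "m \<noteq> 0" for x m :: int
 proof -
  let ?n = "- round (of_int x / of_int m :: real)"
  have "\<bar>of_int (round (of_int x / of_int m :: real)) - (of_int x / of_int m :: real)\<bar> \<le> 1/2"
   by (rule of_int_round_abs_le)
  hence "\<bar>of_int m\<bar> * \<bar>of_int (round (of_int x / of_int m :: real)) - (of_int x / of_int m :: real)\<bar> \<le> \<bar>of_int m\<bar> * (1/2)"
   by (rule mult_left_mono) simp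
  also have "\<bar>of_int m\<bar> * \<bar>of_int (round (of_int x / of_int m :: real)) - (of_int x / of_int m :: real)\<bar>
    = \<bar>of_int (x + m * ?n)\<bar>" using that by (simp flip: abs_mult add: algebra_simps)
  finally have "real_of_int (2 * \<bar>x + m * ?n\<bar>) \<le> real_of_int \<bar>m\<bar>" by simp
  hence "2 * \<bar>x + m * ?n\<bar> \<le> \<bar>m\<bar>" by (simp only: of_int_le_iff)
  thus ?thesis by blast
 qed
 let ?c = "A$2$1" and ?d = "A$2$2"
 have det: "A$1$1 * ?d - A$1$2 * ?c = 1" and Nc: "int N dvd ?c"
  using less.prems by (auto simp: Gamma0_iff det_2)
 show ?case
 proof (cases "?c = 0")
  case True
  hence "A$1$1 * ?d = 1" using det by simp
  hence "?d = 1 \<and> A$1$1 = 1 \<or> ?d = -1 \<and> A$1$1 = -1" using zmult_eq_1_iff by blast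
  hence "A = mat2 1 0 0 1 ** mat2 1 (A$1$2) 0 1 \<or> A = mat2 (-1) 0 0 (-1) ** mat2 1 (- A$1$2) 0 1"
   using True by (auto simp: mat2_eq_iff)
  moreover have "mat2 1 0 0 1 \<in> Gamma0 N" "mat2 (-1) 0 0 (-1) \<in> Gamma0 N" by (auto simp: Gamma0_iff)
  ultimately show ?thesis using base T by metis
 next
  case False
  from red[OF False, of ?d] obtain n where n: "2 * \<bar>?d + ?c * n\<bar> \<le> \<bar>?c\<bar>" by blast
  define B where "B = A ** mat2 1 n 0 1"
  have B: "B \<in> Gamma0 N" unfolding B_def by (intro Gamma0_mult less.prems Gamma0_T)
  have Bn: "B$2$1 = ?c" "B$2$2 = ?d + ?c * n" by (auto simp: B_def matmul_nth)
  have AB: "A = B ** mat2 1 (-n) 0 1" by (simp add: B_def mat2_eq_iff matmul_nth)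
  have dB: "B$1$1 * B$2$2 - B$1$2 * B$2$1 = 1" using B by (simp add: Gamma0_iff det_2)
  have PB: "P B"
  proof (cases "B$2$2 = 0")
   \<comment> \<open>Here the second reduction would divide by 0. The determinant forces
     \<open>c = 1\<close> or \<open>c = -1\<close>, hence \<open>N = 1\<close>. Adding
     \<open>c\<close> times the first column to the second makes the lower right entry
     \<open>c * c = 1\<close>, after which \<open>c\<close> can be cleared.\<close>
   case True
   hence "\<bar>?c\<bar> = 1" using dB Bn by (metis abs_1 abs_minus mult_zero_right diff_0 abs_zmult_eq_1 mult.commute)
   with Nc have N1: "N = 1" by (cases "?c = 1") (auto simp: abs_if split: if_splits)
   define C where "C = B ** mat2 1 0 (int N * 0) 1"
   define D where "D = B ** mat2 1 ?c 0 1"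
   have D: "D \<in> Gamma0 N" "D$2$1 = ?c" "D$2$2 = 1" using `\<bar>?c\<bar> = 1` True Bn unfolding D_def
    by (auto intro!: Gamma0_mult B Gamma0_T simp: matmul_nth abs_if split: if_splits)
   define E where "E = D ** mat2 1 0 (int N * (-?c)) 1"
   have E: "E \<in> Gamma0 N" unfolding E_def by (intro Gamma0_mult D) (auto simp: Gamma0_iff)
   have "E$2$1 = 0" using D by (simp add: E_def matmul_nth N1)
   hence "P E" using less.hyps[of E] E False by simp
   moreover have "D = E ** mat2 1 0 (int N * ?c) 1" by (simp add: E_def mat2_eq_iff matmul_nth algebra_simps)
   ultimately have "P D" using V[OF E] by metis
   moreover have "B = D ** mat2 1 (-?c) 0 1" by (simp add: D_def mat2_eq_iff matmul_nth)
   ultimately show ?thesis using T[OF D(1)] by metis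
  next
   case nz: False
   with N red[of "int N * B$2$2" "B$2$1"] obtain m 
    where m: "2 * \<bar>B$2$1 + int N * B$2$2 * m\<bar> \<le> \<bar>int N * B$2$2\<bar>" by auto
   define C where "C = B ** mat2 1 0 (int N * m) 1"
   have C: "C \<in> Gamma0 N" unfolding C_def by (intro Gamma0_mult B) (auto simp: Gamma0_iff)
   have Cn: "C$2$1 = B$2$1 + int N * B$2$2 * m" by (simp add: C_def matmul_nth algebra_simps)
   have BC: "B = C ** mat2 1 0 (int N * (-m)) 1" by (simp add: C_def mat2_eq_iff matmul_nth algebra_simps)
   have "\<bar>C$2$1\<bar> < \<bar>?c\<bar>"
   proof (cases "N = 4")
    case True
    hence "4 dvd ?c" using Nc by simp
    hence "even (B$1$2 * B$2$1)" using Bn by (metis dvd_mult dvd_mult2 dvd_trans mult_2 numeral_Bit0 dvd_triv_left)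
    moreover have "B$1$1 * B$2$2 = 1 + B$1$2 * B$2$1" using dB by simp
    ultimately have "odd (B$1$1 * B$2$2)" by (metis even_add odd_one)
    hence "odd (B$2$2)" by simp
    with `4 dvd ?c` have "2 * \<bar>B$2$2\<bar> \<noteq> \<bar>?c\<bar>" by presburger
    with n Bn have "2 * \<bar>B$2$2\<bar> < \<bar>?c\<bar>" by simp
    with m Cn True show ?thesis by (simp add: abs_mult)
   next
    case False
    \<comment> \<open>For \<open>N \<le> 3\<close> the crude chain
      \<open>2|c'| \<le> N|d| \<le> 3|d| < 4|d| \<le> 2|c|\<close> suffices.\<close>
    with N have "N \<le> 3" by simp
    hence "int N * \<bar>B$2$2\<bar> \<le> 3 * \<bar>B$2$2\<bar>" by (intro mult_right_mono) auto
    moreover have "2 * \<bar>C$2$1\<bar> \<le> int N * \<bar>B$2$2\<bar>" using m unfolding Cn by (simp add: abs_mult)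
    moreover have "2 * \<bar>B$2$2\<bar> \<le> \<bar>?c\<bar>" using n unfolding Bn .
    moreover have "\<bar>B$2$2\<bar> > 0" using nz by simp
    ultimately show ?thesis by linarith
   qed
   hence "P C" using less.hyps[of C] C by simp
   thus ?thesis using V[OF C] BC by metis
  qed
  thus ?thesis using T[OF B] AB by metis
 qed
qed

declare csqrt.simps [simp del]

subsection \<open>The principal square root\<close>

text \<open>The root of a number with positive real part has argument below \<open>pi/4\<close> in
  modulus. Products and quotients of two such roots therefore stay in the right half plane, where
  the principal branch is the correct one.\<close>

lemma Re_csqrt_gt_abs_Im:
 assumes "Re z > 0"
 shows "\<bar>Im (csqrt z)\<bar> < Re (csqrt z)"
proof -
 have "Re z = (Re (csqrt z))\<^sup>2 - (Im (csqrt z))\<^sup>2" using Re_power2[of "csqrt z"] by simp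
 with assms have "(Im (csqrt z))\<^sup>2 < (Re (csqrt z))\<^sup>2" by simp
 thus ?thesis using Re_csqrt[of z] by (metis abs_of_nonneg power2_abs power2_less_imp_less)
qed

lemma csqrt_divide:
 assumes "Re w > 0" "Re v > 0"
 shows "csqrt (w / v) = csqrt w / csqrt v"
proof (rule csqrt_unique)
 show "(csqrt w / csqrt v)\<^sup>2 = w / v" by (simp add: power_divide)
 let ?a = "csqrt w" and ?b = "csqrt v"
 have a: "\<bar>Im ?a\<bar> < Re ?a" and b: "\<bar>Im ?b\<bar> < Re ?b" using assms Re_csqrt_gt_abs_Im by blast+
 have "\<bar>Im ?a * Im ?b\<bar> < Re ?a * Re ?b" unfolding abs_mult using a b by (intro mult_strict_mono) auto
 hence "0 < Re ?a * Re ?b + Im ?a * Im ?b" by linarith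
 moreover have "v \<noteq> 0" using assms(2) by auto
 ultimately have "0 < Re (?a / ?b)" by (simp add: Re_divide cmod_power2[symmetric])
 thus "0 < Re (?a / ?b) \<or> Re (?a / ?b) = 0 \<and> 0 \<le> Im (?a / ?b)" by blast
qed

lemma csqrt_of_real_mult:
 assumes "r \<ge> 0"
 shows "csqrt (of_real r * z) = of_real (sqrt r) * csqrt z"
proof (cases "r = 0")
 case False
 show ?thesis
 proof (rule csqrt_unique)
  show "(of_real (sqrt r) * csqrt z)\<^sup>2 = of_real r * z"
   using assms by (simp add: power_mult_distrib flip: of_real_power)
  show "0 < Re (of_real (sqrt r) * csqrt z) \<or>
   Re (of_real (sqrt r) * csqrt z) = 0 \<and> 0 \<le> Im (of_real (sqrt r) * csqrt z)"
   using csqrt_principal[of z] assms False by auto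
 qed
qed simp

text \<open>Relates the root in \<open>theta_factor\<close> of the generator with lower row
  \<open>(4, 1)\<close>, evaluated at \<open>z - 1/4\<close>, to the root of the Fricke involution.
  The argument of \<open>csqrt (-2 * \<i> * z)\<close> is below \<open>pi/4\<close> in modulus, so a
  rotation by \<open>pi/4\<close> keeps it principal.\<close>

lemma csqrt_rotate:
 assumes "z \<in> \<H>"
 shows "csqrt (4 * z) = (1 + \<i>) * csqrt (-2 * \<i> * z)"
proof (rule csqrt_unique)
 let ?b = "csqrt (-2 * \<i> * z)"
 have "((1 + \<i>) * ?b)\<^sup>2 = (1 + \<i>)\<^sup>2 * (-2 * \<i> * z)" by (simp add: power_mult_distrib)
 also have "(1 + \<i>)\<^sup>2 = 2 * \<i>" by (simp add: power2_eq_square algebra_simps)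
 finally show "((1 + \<i>) * ?b)\<^sup>2 = 4 * z" by simp
 have "Re (-2 * \<i> * z) > 0" using assms by (simp add: H_iff)
 from Re_csqrt_gt_abs_Im[OF this] have "0 < Re ((1 + \<i>) * ?b)" by simp
 thus "0 < Re ((1 + \<i>) * ?b) \<or> Re ((1 + \<i>) * ?b) = 0 \<and> 0 \<le> Im ((1 + \<i>) * ?b)" by blast
qed

subsection \<open>Fourier expansions\<close>

text \<open>The clause off \<open>\<H>\<close> makes the function, and not only its restriction,
  determined by its coefficients, so operators can be compared through coefficient
  sequences.\<close>

definition has_qexp :: "cfun => (nat => complex) => bool"
 where "has_qexp f a \<longleftrightarrow> (\<forall>z. z \<notin> \<H> \<longrightarrow> f z = 0) \<and>
  (\<forall>z\<in>\<H>. (\<lambda>n. a n * exp (\<omega> * of_nat n * z)) sums f z)"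

lemma exp_nat_power: "exp (\<omega> * of_nat n * z) = exp (\<omega> * z) ^ n"
 by (simp flip: exp_of_nat_mult add: algebra_simps)

lemma norm_exp_2pi_i: "norm (exp (\<omega> * z)) = exp (- 2 * pi * Im z)" by simp

lemma ex_H_exp:
 assumes "q \<noteq> 0" "norm q < 1"
 obtains z where "z \<in> \<H>" "exp (\<omega> * z) = q"
proof -
 let ?z = "Ln q / \<omega>"
 have eq: "exp (\<omega> * ?z) = q" using assms by simp
 hence "norm q = exp (- 2 * pi * Im ?z)" by (metis norm_exp_2pi_i)
 with assms(2) have "- 2 * pi * Im ?z < 0" by simp
 hence "?z \<in> \<H>" unfolding H_iff by (simp add: zero_less_mult_iff)
 with eq that show thesis by blast
qed

text \<open>The value \<open>q = 0\<close> is not of the form \<open>exp (2 \<pi> i z)\<close>, so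
  nothing is known there. Shifting the coefficients by one multiplies the series by \<open>q\<close>
  and supplies the value 0 at the centre.\<close>

lemma powser_eq_0_punctured:
 fixes c :: "nat => complex"
 assumes "\<And>q. q \<noteq> 0 ==> norm q < 1 ==> (\<lambda>n. c n * q ^ n) sums 0"
 shows "c n = 0"
proof (rule ccontr)
 assume "c n \<noteq> 0"
 define d where "d n = (case n of 0 => 0 | Suc m => c m)" for n
 have sm: "(\<lambda>n. d n * (q - 0) ^ n) sums 0" if "norm (q - 0) < 1" for q
 proof (cases "q = 0")
  case True
  hence "(\<lambda>n. d n * (q - 0) ^ n) = (\<lambda>_. 0)" by (auto simp: d_def fun_eq_iff split: nat.splits)
  thus ?thesis by simp
 next
  case False
  have "(\<lambda>n. q * (c n * q ^ n)) sums (q * 0)" using assms[OF False] that by (intro sums_mult) auto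
  hence "(\<lambda>n. d (Suc n) * q ^ Suc n) sums 0" by (simp add: d_def algebra_simps)
  hence "(\<lambda>n. d n * q ^ n) sums (0 + d 0 * q ^ 0)" by (rule sums_Suc)
  thus ?thesis by (simp add: d_def)
 qed
 have "d (Suc n) \<noteq> 0" using `c n \<noteq> 0` by (simp add: d_def)
 from powser_0_nonzero[of 1 0 d "\<lambda>_. 0", OF _ sm _ this] obtain s :: real where
  "s > 0" "\<And>z::complex. z \<in> cball 0 s - {0} ==> (0::complex) \<noteq> 0" by auto
 from this(1) this(2)[of "of_real s"] show False by simp
qed

lemma has_qexp_0: "has_qexp (\<lambda>_. 0) (\<lambda>_. 0)" by (simp add: has_qexp_def)

lemma has_qexp_add:
 "has_qexp f a ==> has_qexp g b ==> has_qexp (\<lambda>z. f z + g z) (\<lambda>n. a n + b n)"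
 unfolding has_qexp_def by (auto simp: distrib_right intro!: sums_add)

lemma has_qexp_cmult: "has_qexp f a ==> has_qexp (\<lambda>z. c * f z) (\<lambda>n. c * a n)"
 unfolding has_qexp_def by (auto simp: mult.assoc intro!: sums_mult)

lemma has_qexp_sum:
 "(\<And>i. i \<in> I ==> has_qexp (f i) (a i)) ==> has_qexp (\<lambda>z. \<Sum>i\<in>I. f i z) (\<lambda>n. \<Sum>i\<in>I. a i n)"
 by (induction I rule: infinite_finite_induct) (auto simp: has_qexp_0 has_qexp_add)

lemma has_qexp_unique:
 assumes "has_qexp f a" "has_qexp f b"
 shows "a = b"
proof
 fix n
 have "(\<lambda>n. (a n - b n) * q ^ n) sums 0" if q: "q \<noteq> 0" "norm q < 1" for q
 proof -
  from ex_H_exp[OF q] obtain z where z: "z \<in> \<H>" "exp (\<omega> * z) = q" by blast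
  have "(\<lambda>n. a n * exp (\<omega> * of_nat n * z) - b n * exp (\<omega> * of_nat n * z))
   sums (f z - f z)" using assms z(1) unfolding has_qexp_def by (intro sums_diff) auto
  thus ?thesis unfolding exp_nat_power z(2) by (simp add: algebra_simps)
 qed
 from powser_eq_0_punctured[OF this] show "a n = b n" by simp
qed

lemma has_qexp_unique_fun: "has_qexp f a ==> has_qexp g a ==> f = g"
 unfolding has_qexp_def fun_eq_iff using sums_unique2 by metis

lemma qcoeff_eqI:
 assumes "has_qexp f a"
 shows "qcoeff f = a"
 unfolding qcoeff_def
proof (rule the_equality)
 show "\<forall>z\<in>\<H>. (\<lambda>n. a n * exp (\<omega> * of_nat n * z)) sums f z" using assms by (simp add: has_qexp_def)
next
 fix b assume "\<forall>z\<in>\<H>. (\<lambda>n. b n * exp (\<omega> * of_nat n * z)) sums f z"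
 with assms have "has_qexp f b" by (simp add: has_qexp_def)
 with assms show "b = a" by (rule has_qexp_unique[symmetric])
qed

lemma qseries_eqI: "has_qexp f a ==> qseries a = f"
 unfolding qseries_def has_qexp_def by (auto simp: fun_eq_iff sums_iff)

lemma has_qexp_shift:
 assumes "has_qexp f a"
 shows "has_qexp (\<lambda>z. f (z + of_real x)) (\<lambda>n. a n * exp (\<omega> * of_nat n * of_real x))"
 unfolding has_qexp_def
proof (intro conjI allI impI ballI)
 fix z assume "z \<notin> \<H>"
 hence "z + of_real x \<notin> \<H>" by (simp add: H_iff)
 thus "f (z + of_real x) = 0" using assms by (simp add: has_qexp_def)
next
 fix z assume "z \<in> \<H>"
 hence "z + of_real x \<in> \<H>" by (simp add: H_iff)
 with assms have "(\<lambda>n. a n * exp (\<omega> * of_nat n * (z + of_real x))) sums f (z + of_real x)"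
  by (simp add: has_qexp_def)
 thus "(\<lambda>n. a n * exp (\<omega> * of_nat n * of_real x) * exp (\<omega> * of_nat n * z))
   sums f (z + of_real x)" by (simp add: distrib_left exp_add mult_ac)
qed

lemma has_qexp_dilate:
 assumes "has_qexp f a" "m > 0"
 shows "has_qexp (\<lambda>z. f (of_nat m * z)) (\<lambda>n. if m dvd n then a (n div m) else 0)"
 unfolding has_qexp_def
proof (intro conjI allI impI ballI)
 fix z assume "z \<notin> \<H>"
 hence "of_nat m * z \<notin> \<H>" by (simp add: H_iff zero_less_mult_iff)
 thus "f (of_nat m * z) = 0" using assms by (simp add: has_qexp_def)
next
 fix z assume "z \<in> \<H>"
 hence "of_nat m * z \<in> \<H>" using assms(2) by (simp add: H_iff)
 with assms have *: "(\<lambda>n. a n * exp (\<omega> * of_nat n * (of_nat m * z))) sums f (of_nat m * z)"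
  by (simp add: has_qexp_def)
 let ?g = "\<lambda>n. (if m dvd n then a (n div m) else 0) * exp (\<omega> * of_nat n * z)"
 have "(\<lambda>n. ?g (m * n)) sums f (of_nat m * z) \<longleftrightarrow> ?g sums f (of_nat m * z)"
  using assms(2) by (intro sums_mono_reindex) (auto simp: strict_mono_def)
 with * show "?g sums f (of_nat m * z)" using assms(2) by (simp add: mult_ac)
qed

lemma sum_exp_root_unity:
 assumes "m > 0"
 shows "(\<Sum>j<m. exp (\<omega> * of_nat n * (of_nat j / of_nat m))) = (if m dvd n then of_nat m else 0)"
proof -
 let ?w = "exp (\<omega> * of_nat n / of_nat m)"
 have wj: "exp (\<omega> * of_nat n * (of_nat j / of_nat m)) = ?w ^ j" for j
  by (simp flip: exp_of_nat_mult add: algebra_simps)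
 have w1: "?w = 1 \<longleftrightarrow> m dvd n" using complex_root_unity_eq_1[of m n] assms by (simp add: mult_ac)
 have wm: "?w ^ m = 1"
 proof -
  have "?w ^ m = exp (\<omega> * of_nat n)" using assms by (simp flip: exp_of_nat_mult)
  also have "... = exp \<omega> ^ n" by (simp flip: exp_of_nat_mult add: mult_ac)
  finally show ?thesis by (simp add: exp_two_pi_i mult_ac)
 qed
 show ?thesis
 proof (cases "m dvd n")
  case True
  thus ?thesis using w1 wj by simp
 next
  case False
  hence "(\<Sum>j<m. ?w ^ j) = 0" using w1 wm by (simp add: sum_gp_strict)
  with False show ?thesis unfolding wj by simp
 qed
qed

text \<open>Averaging over \<open>z + j\<close> is the root of unity filter: only the coefficients
  whose index is divisible by \<open>m\<close> survive.\<close>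

lemma has_qexp_U:
 assumes "has_qexp f a" "m > 0"
 shows "has_qexp (\<lambda>z. (\<Sum>j<m. f ((z + of_nat j) / of_nat m)) / of_nat m) (\<lambda>n. a (m * n))"
 unfolding has_qexp_def
proof (intro conjI allI impI ballI)
 fix z assume "z \<notin> \<H>"
 hence "f ((z + of_nat j) / of_nat m) = 0" for j
  using assms by (simp add: has_qexp_def H_iff zero_less_divide_iff)
 thus "(\<Sum>j<m. f ((z + of_nat j) / of_nat m)) / of_nat m = 0" by simp
next
 fix z assume z: "z \<in> \<H>"
 let ?e = "\<lambda>n. exp (\<omega> * of_nat n * (z / of_nat m))"
 let ?S = "(\<Sum>j<m. f ((z + of_nat j) / of_nat m)) / of_nat m"
 let ?g = "\<lambda>n. if m dvd n then a n * ?e n else 0"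
 have "(\<lambda>n. a n * exp (\<omega> * of_nat n * ((z + of_nat j) / of_nat m))) sums f ((z + of_nat j) / of_nat m)" for j
 proof -
  have "(z + of_nat j) / of_nat m \<in> \<H>" using assms z by (simp add: H_iff)
  with assms(1) show ?thesis unfolding has_qexp_def by blast
 qed
 hence "(\<lambda>n. (\<Sum>j<m. a n * exp (\<omega> * of_nat n * ((z + of_nat j) / of_nat m))) / of_nat m) sums ?S"
  by (intro sums_divide sums_sum)
 also have "(\<lambda>n. (\<Sum>j<m. a n * exp (\<omega> * of_nat n * ((z + of_nat j) / of_nat m))) / of_nat m) = ?g"
 proof
  fix n
  have eq: "(\<Sum>j<m. a n * exp (\<omega> * of_nat n * ((z + of_nat j) / of_nat m)))
    = a n * ?e n * (\<Sum>j<m. exp (\<omega> * of_nat n * (of_nat j / of_nat m)))"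
   by (simp add: sum_distrib_left add_divide_distrib distrib_left exp_add mult.assoc)
  show "(\<Sum>j<m. a n * exp (\<omega> * of_nat n * ((z + of_nat j) / of_nat m))) / of_nat m = ?g n"
   unfolding eq sum_exp_root_unity[OF assms(2)] using assms(2) by simp
 qed
 finally have "?g sums ?S" .
 moreover have "(\<lambda>n. ?g (m * n)) sums ?S \<longleftrightarrow> ?g sums ?S"
  using assms(2) by (intro sums_mono_reindex) (auto simp: strict_mono_def)
 ultimately show "(\<lambda>n. a (m * n) * exp (\<omega> * of_nat n * z)) sums ?S" using assms(2) by (simp add: mult_ac)
qed

text \<open>Without a constant term, every term of the series is at most \<open>|q| / r\<close>
  times the corresponding term at radius \<open>r\<close>, so the whole sum is bounded by a multiple
  of \<open>|q|\<close>.\<close>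

lemma fourier_decay:
 assumes a0: "a 0 = 0" and h: "h > 0" and y0: "y0 > 0"
  and sums: "\<forall>z\<in>\<H>. (\<lambda>n. a n * exp (\<omega> * of_nat n * z / of_nat h)) sums F z"
 obtains B where "B \<ge> 0" "\<And>z. Im z \<ge> y0 ==> norm (F z) \<le> B * exp (- 2 * pi * Im z / real h)"
proof -
 define q where "q z = exp (\<omega> * (z / of_nat h))" for z :: complex
 have qs: "(\<lambda>n. a n * q z ^ n) sums F z" if "z \<in> \<H>" for z
  using bspec[OF sums that] exp_nat_power[of _ "z / of_nat h"] by (simp add: q_def)
 have nq: "norm (q z) = exp (- 2 * pi * Im z / real h)" for z by (simp add: q_def)
 define r where "r = exp (- 2 * pi * y0 / real h)"
 have r: "r > 0" by (simp add: r_def)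
 \<comment> \<open>The point of height \<open>y0 / 2\<close> has larger \<open>|q|\<close> than
   \<open>r\<close>; convergence there gives absolute convergence at \<open>r\<close>.\<close>
 have "norm (complex_of_real r) < norm (q (\<i> * of_real (y0 / 2)))"
  using y0 h by (simp add: nq r_def divide_strict_right_mono)
 moreover have "summable (\<lambda>n. a n * q (\<i> * of_real (y0 / 2)) ^ n)"
  using qs[of "\<i> * of_real (y0 / 2)"] y0 by (auto simp: sums_iff H_iff)
 ultimately have sm: "summable (\<lambda>n. norm (a n * of_real r ^ n))" by (intro powser_insidea)
 define B where "B = (\<Sum>n. norm (a n * of_real r ^ n)) / r"
 show thesis
 proof
  show "B \<ge> 0" unfolding B_def using r sm by (simp add: suminf_nonneg)
  fix z assume z: "Im z \<ge> y0"
  have le: "norm (q z) \<le> r" using z h unfolding nq r_def by (simp add: divide_right_mono)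
  have trm: "norm (a n * q z ^ n) \<le> norm (q z) / r * norm (a n * of_real r ^ n)" for n
  proof (cases n)
   case (Suc m)
   have "norm (q z) ^ n = norm (q z) / r * (r * norm (q z) ^ m)" using r Suc by simp
   also have "... \<le> norm (q z) / r * (r * r ^ m)" using r le by (intro mult_left_mono power_mono) auto
   finally have "norm (a n) * norm (q z) ^ n \<le> norm (a n) * (norm (q z) / r * r ^ n)"
    using Suc by (intro mult_left_mono) auto
   thus ?thesis using r by (simp add: norm_mult norm_power mult_ac)
  qed (simp add: a0)
  have sm2: "summable (\<lambda>n. norm (q z) / r * norm (a n * of_real r ^ n))" using sm by (rule summable_mult)
  have sm3: "summable (\<lambda>n. norm (a n * q z ^ n))"
   by (rule summable_comparison_test'[OF sm2, of 0]) (use trm in auto)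
  have "norm (F z) = norm (\<Sum>n. a n * q z ^ n)" using qs[of z] z y0 by (simp add: sums_iff H_iff)
  also have "... \<le> (\<Sum>n. norm (a n * q z ^ n))" by (rule summable_norm[OF sm3])
  also have "... \<le> (\<Sum>n. norm (q z) / r * norm (a n * of_real r ^ n))" by (rule suminf_le[OF trm sm3 sm2])
  also have "... = B * norm (q z)" unfolding suminf_mult[OF sm] B_def by simp
  finally show "norm (F z) \<le> B * exp (- 2 * pi * Im z / real h)" by (simp add: nq)
 qed
qed

lemma periodic_int:
 fixes F :: cfun
 assumes "\<And>z. z \<in> \<H> ==> F (z + 1) = F z" "z \<in> \<H>"
 shows "F (z + of_int n) = F z"
proof -
 have nat: "F (w + of_nat m) = F w" if "w \<in> \<H>" for w m
 proof (induction m)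
  case (Suc m)
  have "w + of_nat m \<in> \<H>" using that by (simp add: H_iff)
  from assms(1)[OF this] Suc show ?case by (simp add: add_ac)
 qed simp
 show ?thesis
 proof (cases "n \<ge> 0")
  case True
  thus ?thesis using nat[OF assms(2), of "nat n"] by simp
 next
  case False
  thus ?thesis using nat[of "z + of_int n" "nat (- n)"] assms(2) by (simp add: H_iff)
 qed
qed

text \<open>\<open>F\<close> descends to the punctured disc in \<open>q = exp (2 \<pi> i z)\<close>; the growth bound makes
  the singularity at \<open>q = 0\<close> removable with value \<open>0\<close>.\<close>
lemma fourier_expansion:
 assumes hol: "F holomorphic_on \<H>"
  and per: "\<And>z. z \<in> \<H> ==> F (z + 1) = F z"
  and bound: "\<And>z. z \<in> \<H> ==> norm (F z) \<le> C * Im z powr (-s)" and s: "s > 0"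
 obtains a where "a 0 = 0"
  "\<And>z. z \<in> \<H> ==> (\<lambda>n. a n * exp (\<omega> * of_nat n * z)) sums F z"
proof -
 define L where "L q = Ln q / \<omega>" for q
 define G where "G q = (if q = 0 then 0 else F (L q))" for q
 have expL: "exp (\<omega> * L q) = q" if "q \<noteq> 0" for q using that by (simp add: L_def)
 have inH: "w \<in> \<H>" if "norm (exp (\<omega> * w)) < 1" for w using that by (simp add: H_iff zero_less_mult_iff)
 have LH: "L q \<in> \<H>" if "q \<noteq> 0" "norm q < 1" for q by (rule inH) (simp only: expL[OF that(1)] that(2))
 have key: "F z = G (exp (\<omega> * z))" if z: "z \<in> \<H>" for z
 proof -
  let ?q = "exp (\<omega> * z)"
  have q: "?q \<noteq> 0" "norm ?q < 1" using z by (auto simp: H_iff)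
  have "exp (\<omega> * z) = exp (\<omega> * L ?q)" using expL[OF q(1)] by simp
  then obtain n :: int where "\<omega> * z = \<omega> * L ?q + of_int (2 * n) * pi * \<i>" unfolding exp_eq by blast
  hence "\<omega> * z = \<omega> * (L ?q + of_int n)" by (simp add: algebra_simps)
  hence "z = L ?q + of_int n" by (subst (asm) mult_cancel_left) simp
  hence "F z = F (L ?q)" using periodic_int[of F, OF per LH[OF q]] by metis
  thus ?thesis using q by (simp add: G_def)
 qed
 have "G field_differentiable at q0" if q0: "q0 \<in> ball 0 1 - {0}" for q0
 proof -
  \<comment> \<open>\<open>L\<close> jumps on the negative axis. Near \<open>q0\<close> this branch
    of the logarithm uses only \<open>Ln (q / q0)\<close> with \<open>|q / q0 - 1| < 1\<close>, and
    \<open>key\<close> shows that \<open>F\<close> does not see the choice of the branch.\<close>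
  define L' where "L' q = L q0 + Ln (q / q0) / \<omega>" for q
  let ?S = "ball q0 (norm q0) \<inter> ball 0 1"
  have nonneg: "q / q0 \<notin> \<real>\<^sub>\<le>\<^sub>0" "q \<noteq> 0" if "q \<in> ?S" for q
  proof -
   have "norm (1 - q / q0) * norm q0 = norm (q0 - q)" using q0 by (simp flip: norm_mult add: algebra_simps)
   also have "... < norm q0" using that by (simp add: dist_norm)
   finally have "norm (1 - q / q0) < 1" using q0 by simp
   hence "Re (1 - q / q0) < 1" using complex_Re_le_cmod[of "1 - q / q0"] by linarith
   thus "q / q0 \<notin> \<real>\<^sub>\<le>\<^sub>0" by (auto simp: complex_nonpos_Reals_iff)
   thus "q \<noteq> 0" by auto
  qed
  have expL': "exp (\<omega> * L' q) = q" if "q \<in> ?S" for q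
  proof -
   have "exp (\<omega> * L' q) = exp (\<omega> * L q0) * exp (Ln (q / q0))" by (simp add: L'_def distrib_left exp_add)
   thus ?thesis using nonneg[OF that] q0 expL[of q0] by simp
  qed
  have L'H: "L' q \<in> \<H>" if "q \<in> ?S" for q
   using inH[of "L' q"] that by (simp add: expL'[OF that] del: norm_exp_eq_Re)
  have "L' holomorphic_on ?S" unfolding L'_def using nonneg q0 by (intro holomorphic_intros) auto
  hence "(F \<circ> L') holomorphic_on ?S" by (rule holomorphic_on_compose_gen[OF _ hol]) (use L'H in auto)
  hence "G holomorphic_on ?S" by (rule holomorphic_transform) (use key L'H expL' in auto)
  thus ?thesis using q0 by (intro holomorphic_on_imp_differentiable_at[of G ?S]) auto
 qed
 hence hol1: "G holomorphic_on (ball 0 1 - {0})"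
  by (auto simp: holomorphic_on_def field_differentiable_at_within)
 have ImL: "Im (L q) = - ln (norm q) / (2 * pi)" if "q \<noteq> 0" for q
  using that by (simp add: L_def Im_divide power2_eq_square)
 have "((\<lambda>q. G q) \<longlongrightarrow> 0) (at 0)"
 proof (rule Lim_null_comparison)
  \<comment> \<open>As \<open>Im (L q) = - ln |q| / (2 \<pi>)\<close> tends to infinity for
    \<open>q\<close> tending to 0, the growth bound with its negative exponent tends to 0.\<close>
  have lim: "((\<lambda>x. C * (- ln x / (2 * pi)) powr (-s)) \<longlongrightarrow> 0) (at_right 0)" using s by real_asymp
  have "filterlim (norm :: complex => real) (at_right 0) (at 0)"
   unfolding filterlim_at by (auto simp: eventually_at_filter intro!: tendsto_eq_intros)
  from filterlim_compose[OF lim this]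
  show "((\<lambda>q. C * (- ln (norm q) / (2 * pi)) powr (-s)) \<longlongrightarrow> 0) (at (0::complex))" .
  have "norm (G q) \<le> C * (- ln (norm q) / (2 * pi)) powr (-s)" if "q \<noteq> 0" "dist q 0 < 1" for q
   using bound[of "L q"] LH[of q] ImL[of q] that by (simp add: G_def)
  thus "\<forall>\<^sub>F q in at 0. norm (G q) \<le> C * (- ln (norm q) / (2 * pi)) powr (-s)"
   unfolding eventually_at by (intro exI[of _ 1]) auto
 qed
 moreover have "G 0 = 0" by (simp add: G_def)
 ultimately have "isCont G 0" by (simp add: isCont_def)
 moreover have "isCont G q" if "q \<in> ball 0 1 - {0}" for q
  using hol1 that by (meson field_differentiable_imp_continuous_at holomorphic_on_imp_differentiable_at open_ball open_delete)
 ultimately have "continuous_on (ball 0 1) G" by (metis DiffI continuous_at_imp_continuous_on singletonD)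
 hence hol2: "G holomorphic_on ball 0 1" by (rule no_isolated_singularity[OF _ hol1]) auto
 define a where "a n = (deriv ^^ n) G 0 / fact n" for n
 show thesis
 proof
  show "a 0 = 0" by (simp add: a_def G_def)
  fix z assume z: "z \<in> \<H>"
  let ?q = "exp (\<omega> * z)"
  have "?q \<in> ball 0 1" using z by (simp add: H_iff)
  from holomorphic_power_series[OF hol2 this] have "(\<lambda>n. a n * ?q ^ n) sums G ?q" by (simp add: a_def)
  thus "(\<lambda>n. a n * exp (\<omega> * of_nat n * z)) sums F z" unfolding exp_nat_power using key[OF z] by simp
 qed
qed

subsection \<open>The hyperbolic measure\<close>

text \<open>The invariant measure \<open>dx dy / y^2\<close> of the upper half plane, as a measure
  on all complex numbers.\<close>

definition hyp :: "complex measure"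
 where "hyp = density lborel (\<lambda>z. ennreal (indicator \<H> z / (Im z)\<^sup>2))"

lemma borel_H [measurable, simp]: "\<H> \<in> sets borel" by (simp add: borel_open)

lemma sets_hyp [simp, measurable_cong]: "sets hyp = sets borel" by (simp add: hyp_def)

lemma space_hyp [simp]: "space hyp = UNIV" by (simp add: hyp_def)

lemma AE_hyp_H: "AE z in hyp. z \<in> \<H>" unfolding hyp_def by (subst AE_density) (auto simp: indicator_def)

lemma sigma_finite_hyp: "sigma_finite_measure hyp" unfolding hyp_def
 by (subst sigma_finite_measure.sigma_finite_iff_density_finite'[OF sigma_finite_lborel]) auto

interpretation hyp: sigma_finite_measure hyp by (rule sigma_finite_hyp)

text \<open>The change of variables theorem speaks about \<open>real^n\<close>, so the complex plane
  is identified with \<open>real^2\<close>.\<close>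

definition of_vec2 :: "real^2 => complex" where "of_vec2 v = Complex (v$1) (v$2)"
definition to_vec2 :: "complex => real^2" where "to_vec2 z = vector [Re z, Im z]"

lemma of_to_vec2 [simp]: "of_vec2 (to_vec2 z) = z" "to_vec2 (of_vec2 v) = v"
 by (simp_all add: of_vec2_def to_vec2_def vec_eq_iff forall_2)

lemma to_vec2_nth [simp]: "to_vec2 z $ 1 = Re z" "to_vec2 z $ 2 = Im z" by (simp_all add: to_vec2_def)

lemma of_vec2_sel [simp]: "Re (of_vec2 v) = v$1" "Im (of_vec2 v) = v$2" by (simp_all add: of_vec2_def)

lemma bounded_linear_of_vec2: "bounded_linear of_vec2"
proof -
 have "linear of_vec2" by (rule linearI) (auto simp: complex_eq_iff)
 thus ?thesis by (rule linear_linear[THEN iffD2])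
qed

lemma bounded_linear_to_vec2: "bounded_linear to_vec2"
proof -
 have "linear to_vec2" by (rule linearI) (auto simp: vec_eq_iff forall_2)
 thus ?thesis by (rule linear_linear[THEN iffD2])
qed

lemma measurable_of_vec2 [measurable]: "of_vec2 \<in> borel_measurable borel"
 by (intro borel_measurable_continuous_onI linear_continuous_on bounded_linear_of_vec2)

lemma Basis_vec2: "(Basis :: (real^2) set) = {axis 1 1, axis 2 1}" by (auto simp: Basis_vec_def UNIV_2)

lemma lborel_complex: "lborel = distr lborel borel of_vec2"
proof (rule lborel_eqI)
 fix l u :: complex
 assume le: "\<And>b. b \<in> Basis ==> l \<bullet> b \<le> u \<bullet> b"
 have lu: "Re l \<le> Re u" "Im l \<le> Im u" using le[of 1] le[of \<i>] by (auto simp: Basis_complex_def)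
 have "of_vec2 -` box l u = box (to_vec2 l) (to_vec2 u)"
  by (auto simp: box_def Basis_vec2 Basis_complex_def inner_axis)
 hence "emeasure (distr lborel borel of_vec2) (box l u) = emeasure lborel (box (to_vec2 l) (to_vec2 u))"
  by (subst emeasure_distr) auto
 also have "... = (\<Prod>b\<in>Basis. (to_vec2 u - to_vec2 l) \<bullet> b)"
  using lu by (intro emeasure_lborel_box) (auto simp: Basis_vec2 inner_axis)
 also have "... = (\<Prod>b\<in>Basis. (u - l) \<bullet> b)" by (simp add: Basis_vec2 Basis_complex_def inner_axis axis_eq_axis)
 finally show "emeasure (distr lborel borel of_vec2) (box l u) = (\<Prod>b\<in>Basis. (u - l) \<bullet> b)" .
qed simp

lemma absolutely_integrable_on_iff_nn_integral:
 fixes h :: "'a::euclidean_space => real"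
 assumes [measurable]: "T \<in> sets borel" "h \<in> borel_measurable borel" and nonneg: "\<And>x. h x \<ge> 0"
 shows "h absolutely_integrable_on T \<longleftrightarrow> (\<integral>\<^sup>+x. ennreal (indicator T x * h x) \<partial>lborel) < \<infinity>"
  and "h absolutely_integrable_on T ==>
   (\<integral>\<^sup>+x. ennreal (indicator T x * h x) \<partial>lborel) = ennreal (integral T h)"
proof -
 have meas: "(\<lambda>x. indicator T x * h x) \<in> borel_measurable lborel" by simp
 have *: "h absolutely_integrable_on T \<longleftrightarrow> integrable lborel (\<lambda>x. indicator T x * h x)"
  unfolding set_integrable_def using integrable_completion[OF meas] by simp
 thus "h absolutely_integrable_on T \<longleftrightarrow> (\<integral>\<^sup>+x. ennreal (indicator T x * h x) \<partial>lborel) < \<infinity>"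
  unfolding integrable_iff_bounded using nonneg meas by simp
 assume abs: "h absolutely_integrable_on T"
 hence int: "integrable lborel (\<lambda>x. indicator T x * h x)" using * by simp
 have "integral T h = (LINT x:T|lebesgue. h x)" using set_lebesgue_integral_eq_integral(2)[OF abs] by simp
 also have "... = (LINT x|lborel. indicator T x * h x)"
  unfolding set_lebesgue_integral_def using integral_completion[OF meas] by simp
 finally show "(\<integral>\<^sup>+x. ennreal (indicator T x * h x) \<partial>lborel) = ennreal (integral T h)"
  using nn_integral_eq_integral[OF int] nonneg by simp
qed

lemma emeasure_hyp:
 assumes [measurable]: "S \<in> sets borel" and "S \<subseteq> \<H>"
 shows "emeasure hyp S = (\<integral>\<^sup>+v. ennreal (indicator (of_vec2 -` S) v * (1 / (v$2)\<^sup>2)) \<partial>lborel)"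
proof -
 have "emeasure hyp S = (\<integral>\<^sup>+z. ennreal (indicator \<H> z / (Im z)\<^sup>2) * indicator S z \<partial>lborel)"
  unfolding hyp_def by (subst emeasure_density) auto
 also have "... = (\<integral>\<^sup>+v. ennreal (indicator \<H> (of_vec2 v) / (Im (of_vec2 v))\<^sup>2) * indicator S (of_vec2 v) \<partial>lborel)"
  by (subst lborel_complex, subst nn_integral_distr) auto
 also have "... = (\<integral>\<^sup>+v. ennreal (indicator (of_vec2 -` S) v * (1 / (v$2)\<^sup>2)) \<partial>lborel)"
  using assms(2) by (intro nn_integral_cong) (auto simp: indicator_def)
 finally show ?thesis .
qed

lemma has_field_derivative_moebius:
 assumes "det A > 0" "z \<in> \<H>"
 shows "(moebius A has_field_derivative of_int (det A) / (cocycle A z)\<^sup>2) (at z)"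
proof -
 have nz: "of_int (A$2$1) * z + of_int (A$2$2) \<noteq> 0" using cocycle_nonzero[OF assms] by (simp add: cocycle_def)
 have "((\<lambda>z. (of_int (A$1$1) * z + of_int (A$1$2)) / (of_int (A$2$1) * z + of_int (A$2$2)))
   has_field_derivative of_int (det A) / (cocycle A z)\<^sup>2) (at z)"
  using nz by (auto intro!: derivative_eq_intros simp: cocycle_def det_2 power2_eq_square algebra_simps)
 thus ?thesis by (simp add: moebius_def[abs_def] cocycle_def[of A])
qed

lemma inj_on_moebius:
 assumes "det A > 0"
 shows "inj_on (moebius A) \<H>"
 by (rule inj_on_inverseI[of _ "moebius (adj2 A)"]) (use moebius_adj2_left assms in auto)

lemma measurable_moebius [measurable]: "moebius A \<in> borel_measurable borel"
 unfolding moebius_def cocycle_def by measurable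

lemma moebius_image:
 assumes "det A > 0" "S \<subseteq> \<H>"
 shows "moebius A ` S = moebius (adj2 A) -` S \<inter> \<H>"
proof (intro equalityI subsetI)
 fix w assume "w \<in> moebius A ` S"
 with assms show "w \<in> moebius (adj2 A) -` S \<inter> \<H>" by (auto simp: moebius_adj2_left subset_iff)
next
 fix w assume "w \<in> moebius (adj2 A) -` S \<inter> \<H>"
 hence "w \<in> \<H>" "moebius (adj2 A) w \<in> S" by auto
 with assms show "w \<in> moebius A ` S"
  by (intro image_eqI[of _ _ "moebius (adj2 A) w"]) (auto simp: moebius_adj2_right)
qed

text \<open>The Jacobian of \<open>moebius A\<close> as a real map is the squared modulus of its
  derivative \<open>det A / (c z + d)^2\<close>. This is the square of the factor by which the
  imaginary part changes, so it cancels against the density \<open>1 / y^2\<close>.\<close>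

lemma emeasure_hyp_moebius_image:
 assumes A: "det A > 0" and [measurable]: "S \<in> sets borel" and SH: "S \<subseteq> \<H>"
 shows "emeasure hyp (moebius A ` S) = emeasure hyp S"
proof -
 define g where "g v = to_vec2 (moebius A (of_vec2 v))" for v
 define D where "D v = of_int (det A) / (cocycle A (of_vec2 v))\<^sup>2" for v
 define g' where "g' v w = to_vec2 (D v * of_vec2 w)" for v w
 define h where "h v = 1 / (v$2)\<^sup>2" for v :: "real^2"
 let ?T = "of_vec2 -` S"
 have im: "g ` ?T = of_vec2 -` (moebius A ` S)"
 proof (intro equalityI subsetI)
  fix v assume "v \<in> of_vec2 -` (moebius A ` S)"
  then obtain z where "z \<in> S" "of_vec2 v = moebius A z" by auto
  hence "v = g (to_vec2 z)" "to_vec2 z \<in> ?T" by (auto simp: g_def) (metis of_to_vec2(2))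
  thus "v \<in> g ` ?T" by blast
 qed (auto simp: g_def)
 have [measurable]: "moebius A ` S \<in> sets borel" unfolding moebius_image[OF A SH] by measurable
 have T [measurable]: "?T \<in> sets borel" "g ` ?T \<in> sets borel"
  unfolding im using measurable_sets[OF measurable_of_vec2] by auto
 have [measurable]: "h \<in> borel_measurable borel" unfolding h_def by measurable
 have der: "(g has_derivative g' v) (at v within ?T)" if "v \<in> ?T" for v
 proof -
  have "of_vec2 v \<in> \<H>" using that SH by auto
  from has_field_derivative_moebius[OF A this]
  have "(moebius A has_derivative (*) (D v)) (at (of_vec2 v))" by (simp add: has_field_derivative_def D_def)
  from has_derivative_compose[OF bounded_linear_imp_has_derivative[OF bounded_linear_of_vec2] this]
  have "((\<lambda>x. moebius A (of_vec2 x)) has_derivative (\<lambda>w. D v * of_vec2 w)) (at v within ?T)" .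
  from bounded_linear.has_derivative[OF bounded_linear_to_vec2 this]
  show ?thesis unfolding g_def[abs_def] g'_def[abs_def] .
 qed
 have inj: "inj_on g ?T" unfolding g_def using inj_on_subset[OF inj_on_moebius[OF A] SH]
  by (auto simp: inj_on_def) (metis of_to_vec2)
 have det': "det (matrix (g' v)) = (cmod (D v))\<^sup>2" for v
  unfolding cmod_power2 by (simp add: det_2 matrix_def g'_def axis_def power2_eq_square)
 have eq: "\<bar>det (matrix (g' v))\<bar> * h (g v) = h v" if "v \<in> ?T" for v
 proof -
  let ?z = "of_vec2 v"
  have z: "?z \<in> \<H>" using that SH by auto
  have nz: "cocycle A ?z \<noteq> 0" "Im ?z > 0" using cocycle_nonzero[OF A z] z by (auto simp: H_iff)
  have "h (g v) = 1 / (of_int (det A) * Im ?z / (cmod (cocycle A ?z))\<^sup>2)\<^sup>2"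
   by (simp add: h_def g_def Im_moebius[OF A z])
  moreover have "\<bar>det (matrix (g' v))\<bar> = (of_int (det A) / (cmod (cocycle A ?z))\<^sup>2)\<^sup>2"
   using A by (simp add: det' D_def norm_divide norm_power)
  ultimately show ?thesis using nz A by (simp add: h_def power_divide power_mult_distrib)
 qed
 have h0: "h v \<ge> 0" for v by (simp add: h_def)
 have cov: "h absolutely_integrable_on ?T \<and> integral ?T h = b \<longleftrightarrow>
  h absolutely_integrable_on (g ` ?T) \<and> integral (g ` ?T) h = b" for b
 proof -
  have T': "?T \<in> sets lebesgue" using T(1) by simp
  note * = has_absolute_integral_change_of_variables[OF T' der inj, of "\<lambda>v. vec (h v) :: real^1" "vec b"]
  have ae: "(\<lambda>v. \<bar>det (matrix (g' v))\<bar> *\<^sub>R (vec (h (g v)) :: real^1)) absolutely_integrable_on ?T \<longleftrightarrow>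
    (\<lambda>v. vec (h v) :: real^1) absolutely_integrable_on ?T"
   by (rule absolutely_integrable_spike_eq[of "{}"]) (use eq in \<open>auto simp: vec_eq_iff\<close>)
  have ie: "integral ?T (\<lambda>v. \<bar>det (matrix (g' v))\<bar> *\<^sub>R (vec (h (g v)) :: real^1)) =
    integral ?T (\<lambda>v. vec (h v) :: real^1)" by (rule integral_cong) (use eq in \<open>auto simp: vec_eq_iff\<close>)
  show ?thesis using * unfolding ae ie by (simp add: absolutely_integrable_on_1_iff integral_on_1_eq)
 qed
 note hT = absolutely_integrable_on_iff_nn_integral[OF T(1) `h \<in> _` h0]
 note hgT = absolutely_integrable_on_iff_nn_integral[OF T(2) `h \<in> _` h0]
 have e1: "emeasure hyp S = (\<integral>\<^sup>+v. ennreal (indicator ?T v * h v) \<partial>lborel)"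
  unfolding h_def by (rule emeasure_hyp) (use SH in auto)
 have "moebius A ` S \<subseteq> \<H>" using SH A by (auto simp: subset_iff)
 hence e2: "emeasure hyp (moebius A ` S) = (\<integral>\<^sup>+v. ennreal (indicator (g ` ?T) v * h v) \<partial>lborel)"
  unfolding h_def im by (intro emeasure_hyp) auto
 \<comment> \<open>The change of variables compares convergent integrals; if one side diverges so
   does the other, and then both measures are infinite.\<close>
 show ?thesis
 proof (cases "h absolutely_integrable_on ?T")
  case True
  with cov[of "integral ?T h"] have "h absolutely_integrable_on (g ` ?T)" "integral (g ` ?T) h = integral ?T h"
   by auto
  with True show ?thesis unfolding e1 e2 using hT(2) hgT(2) by simp
 next
  case False
  with cov[of "integral (g ` ?T) h"] have "\<not> h absolutely_integrable_on (g ` ?T)" by auto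
  with False show ?thesis unfolding e1 e2 using hT(1) hgT(1) by (simp add: not_less top_unique)
 qed
qed

lemma distr_hyp_moebius:
 assumes A: "det A > 0"
 shows "distr hyp borel (moebius A) = hyp"
proof (rule measure_eqI)
 fix S assume "S \<in> sets (distr hyp borel (moebius A))"
 hence S [measurable]: "S \<in> sets borel" by simp
 have "emeasure (distr hyp borel (moebius A)) S = emeasure hyp (moebius A -` S)" by (subst emeasure_distr) auto
 also have "... = emeasure hyp (moebius A -` S \<inter> \<H>)"
  by (rule emeasure_eq_AE) (use AE_hyp_H measurable_sets[OF measurable_moebius S] in auto)
 also have "moebius A -` S \<inter> \<H> = moebius (adj2 A) ` (S \<inter> \<H>)"
  using A by (subst moebius_image) (auto simp: moebius_adj2_left)
 also have "emeasure hyp ... = emeasure hyp (S \<inter> \<H>)" using A by (intro emeasure_hyp_moebius_image) auto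
 also have "... = emeasure hyp S" by (rule emeasure_eq_AE) (use AE_hyp_H in auto)
 finally show "emeasure (distr hyp borel (moebius A)) S = emeasure hyp S" .
qed simp

lemma nn_integral_hyp_moebius:
 assumes "det A > 0" "F \<in> borel_measurable borel"
 shows "(\<integral>\<^sup>+z. F (moebius A z) \<partial>hyp) = (\<integral>\<^sup>+z. F z \<partial>hyp)"
 using assms by (subst (2) distr_hyp_moebius[symmetric, of A]) (auto simp: nn_integral_distr)

lemma integral_hyp_moebius:
 fixes F :: cfun
 assumes "det A > 0" "F \<in> borel_measurable borel"
 shows "(\<integral>z. F (moebius A z) \<partial>hyp) = (\<integral>z. F z \<partial>hyp)"
 using assms by (subst (2) distr_hyp_moebius[symmetric, of A]) (auto simp: integral_distr)

lemma integrable_hyp_moebius: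
 fixes F :: cfun
 assumes "det A > 0" "F \<in> borel_measurable borel"
 shows "integrable hyp (\<lambda>z. F (moebius A z)) \<longleftrightarrow> integrable hyp F"
 using assms by (subst (2) distr_hyp_moebius[symmetric, of A]) (auto simp: integrable_distr_eq)

lemma AE_hyp_moebius:
 assumes "det A > 0" "AE z in hyp. P z"
 shows "AE z in hyp. P (moebius A z)"
proof -
 from assms(2) have "AE z in distr hyp borel (moebius A). P z" unfolding distr_hyp_moebius[OF assms(1)] .
 thus ?thesis by (rule AE_distrD[rotated]) simp
qed

subsection \<open>Fundamental domains\<close>

lemma ford_domain_sets [measurable, simp]: "ford_domain N \<in> sets borel"
proof -
 have "closed {z. 1 \<le> cmod (cocycle \<gamma> z)}" for \<gamma>
  unfolding cocycle_def by (intro closed_Collect_le continuous_intros)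
 hence "closed (\<Inter>\<gamma>\<in>{\<gamma>\<in>Gamma0 N. \<gamma>$2$1 \<noteq> 0}. {z. 1 \<le> cmod (cocycle \<gamma> z)})" by (intro closed_INT) auto
 moreover have "closed {z. \<bar>Re z\<bar> \<le> 1 / 2}" by (intro closed_Collect_le continuous_intros)
 moreover have "ford_domain N = \<H> \<inter> {z. \<bar>Re z\<bar> \<le> 1 / 2} \<inter>
   (\<Inter>\<gamma>\<in>{\<gamma>\<in>Gamma0 N. \<gamma>$2$1 \<noteq> 0}. {z. 1 \<le> cmod (cocycle \<gamma> z)})" unfolding ford_domain_def by auto
 ultimately show ?thesis by (simp add: borel_closed sets.Int)
qed

lemma ford_domain_subset_H: "ford_domain N \<subseteq> \<H>" by (auto simp: ford_domain_def)

text \<open>Only finitely many values of \<open>|c z + d|\<close> are at most 1. A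
  \<open>\<gamma>\<close> with the least value moves \<open>z\<close> as high as possible; by the
  cocycle relation no element can then have \<open>|c w + d| < 1\<close> at the image
  \<open>w\<close>, and a translation brings \<open>w\<close> into the strip.\<close>

lemma ex_moebius_in_ford_domain:
 assumes z: "z \<in> \<H>"
 shows "\<exists>\<gamma>\<in>Gamma0 N. moebius \<gamma> z \<in> ford_domain N"
proof -
 define S where "S = {cmod (cocycle \<gamma> z) | \<gamma>. \<gamma> \<in> Gamma0 N \<and> cmod (cocycle \<gamma> z) \<le> 1}"
 have y: "Im z > 0" using z by (simp add: H_iff)
 \<comment> \<open>The imaginary part of \<open>c z + d\<close> bounds \<open>c\<close>, and then
   the triangle inequality bounds \<open>d\<close>.\<close>
 define M where "M = \<lceil>1 / Im z\<rceil> + \<lceil>1 + cmod z * (1 / Im z)\<rceil>"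
 have "S \<subseteq> (\<lambda>(c, d). cmod (of_int c * z + of_int d)) ` ({-M..M} \<times> {-M..M})"
 proof
  fix s assume "s \<in> S"
  then obtain \<gamma> where \<gamma>: "s = cmod (cocycle \<gamma> z)" "cmod (cocycle \<gamma> z) \<le> 1" by (auto simp: S_def)
  let ?c = "\<gamma>$2$1" and ?d = "\<gamma>$2$2"
  have "\<bar>Im (cocycle \<gamma> z)\<bar> \<le> 1" using \<gamma> abs_Im_le_cmod order_trans by blast
  hence "\<bar>real_of_int ?c\<bar> * Im z \<le> 1" using y by (simp add: cocycle_def abs_mult)
  hence c: "\<bar>real_of_int ?c\<bar> \<le> 1 / Im z" using y by (simp add: field_simps)
  have "cmod (of_int ?d) \<le> cmod (cocycle \<gamma> z) + cmod (of_int ?c * z)"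
   unfolding cocycle_def by (metis add_diff_cancel_left' norm_triangle_ineq4 add.commute)
  also have "... \<le> 1 + cmod z * (1 / Im z)"
   using \<gamma>(2) mult_left_mono[OF c, of "cmod z"] by (simp add: norm_mult mult.commute)
  finally have d: "\<bar>real_of_int ?d\<bar> \<le> 1 + cmod z * (1 / Im z)" by simp
  have "\<bar>?c\<bar> \<le> \<lceil>1 / Im z\<rceil>" "\<bar>?d\<bar> \<le> \<lceil>1 + cmod z * (1 / Im z)\<rceil>" using c d by linarith+
  moreover have "0 \<le> \<lceil>1 / Im z\<rceil>" "0 \<le> \<lceil>1 + cmod z * (1 / Im z)\<rceil>" using calculation by linarith+
  ultimately have "?c \<in> {-M..M}" "?d \<in> {-M..M}" by (auto simp: M_def)
  thus "s \<in> (\<lambda>(c, d). cmod (of_int c * z + of_int d)) ` ({-M..M} \<times> {-M..M})"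
   using \<gamma>(1) by (intro image_eqI[of _ _ "(?c, ?d)"]) (auto simp: cocycle_def)
 qed
 hence fin: "finite S" by (rule finite_subset) auto
 have "1 \<in> S" unfolding S_def using Gamma0_one[of N] by (intro CollectI exI[of _ "mat2 1 0 0 1"]) simp
 hence "Min S \<in> S" using fin by (intro Min_in) auto
 then obtain \<gamma> where \<gamma>: "\<gamma> \<in> Gamma0 N" "cmod (cocycle \<gamma> z) = Min S" by (auto simp: S_def)
 have min: "Min S \<le> cmod (cocycle \<delta> z)" if "\<delta> \<in> Gamma0 N" for \<delta>
 proof (cases "cmod (cocycle \<delta> z) \<le> 1")
  case True
  hence "cmod (cocycle \<delta> z) \<in> S" using that by (auto simp: S_def)
  thus ?thesis using fin by simp
 next
  case False
  moreover have "Min S \<le> 1" using fin \<open>1 \<in> S\<close> by simp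
  ultimately show ?thesis by linarith
 qed
 have pos: "Min S > 0" using cocycle_nonzero[of \<gamma> z] \<gamma> z by (metis Gamma0_det zero_less_norm_iff zero_less_one)
 define n where "n = - round (Re (moebius \<gamma> z))"
 define w where "w = moebius (mat2 1 n 0 1 ** \<gamma>) z"
 have TG: "mat2 1 n 0 1 ** \<gamma> \<in> Gamma0 N" using Gamma0_mult[OF Gamma0_T \<gamma>(1)] .
 have w: "w = moebius \<gamma> z + of_int n"
  unfolding w_def using z \<gamma>(1) by (subst moebius_mult) (auto simp: moebius_mat2)
 have wH: "w \<in> \<H>" unfolding w_def using TG z by (intro moebius_in_H) auto
 have "\<bar>Re w\<bar> \<le> 1 / 2"
  unfolding w n_def using of_int_round_abs_le[of "Re (moebius \<gamma> z)"] by (simp add: abs_minus_commute)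
 moreover have "1 \<le> cmod (cocycle \<delta> w)" if \<delta>: "\<delta> \<in> Gamma0 N" for \<delta>
 proof -
  have c1: "cocycle (mat2 1 n 0 1 ** \<gamma>) z = cocycle \<gamma> z" using z \<gamma>(1) by (subst cocycle_mult) auto
  have "cocycle (\<delta> ** (mat2 1 n 0 1 ** \<gamma>)) z = cocycle \<delta> w * cocycle \<gamma> z"
   using TG z by (subst cocycle_mult) (auto simp: c1 w_def)
  hence "Min S \<le> cmod (cocycle \<delta> w) * Min S" using min[OF Gamma0_mult[OF \<delta> TG]] \<gamma>(2) by (simp add: norm_mult)
  thus ?thesis using pos by simp
 qed
 ultimately have "w \<in> ford_domain N" using wH by (auto simp: ford_domain_def)
 thus ?thesis using TG by (auto simp: w_def)
qed

lemma AE_hyp_not_closed_negligible: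
 assumes "closed S" "negligible S"
 shows "AE z in hyp. z \<notin> S"
proof -
 have "S \<in> null_sets lborel"
  using assms by (simp add: negligible_iff_null_sets null_sets_completion_iff borel_closed)
 hence "AE z in lborel. z \<notin> S" by (rule AE_not_in)
 thus ?thesis unfolding hyp_def by (subst AE_density) auto
qed

text \<open>Full lines and circles instead of the actual boundary arcs: the set is still null, being
  a countable union of curves, and membership is easier to test.\<close>

definition ford_boundary :: "nat => complex set"
 where "ford_boundary N = {z. \<bar>Re z\<bar> = 1 / 2} \<union>
  (\<Union>\<gamma>\<in>{\<gamma>\<in>Gamma0 N. \<gamma>$2$1 \<noteq> 0}. {z. cmod (cocycle \<gamma> z) = 1})"

lemma AE_hyp_not_ford_boundary: "AE z in hyp. z \<notin> ford_boundary N"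
proof -
 have "AE z in hyp. z \<notin> {z. cmod (cocycle \<gamma> z) = 1}" if "\<gamma>$2$1 \<noteq> 0" for \<gamma>
 proof (rule AE_hyp_not_closed_negligible)
  let ?c = "of_int (\<gamma>$2$1) :: complex" and ?d = "of_int (\<gamma>$2$2) :: complex"
  show "closed {z. cmod (cocycle \<gamma> z) = 1}"
   unfolding cocycle_def by (intro closed_Collect_eq continuous_intros)
  have "cmod (cocycle \<gamma> z) = cmod ?c * dist (- ?d / ?c) z" for z
  proof -
   have "cocycle \<gamma> z = - ?c * (- ?d / ?c - z)" using that by (simp add: cocycle_def field_simps)
   thus ?thesis by (metis dist_norm norm_minus_cancel norm_mult)
  qed
  hence "{z. cmod (cocycle \<gamma> z) = 1} = sphere (- ?d / ?c) (1 / cmod ?c)"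
   using that by (auto simp: field_simps)
  thus "negligible {z. cmod (cocycle \<gamma> z) = 1}" by (simp add: negligible_sphere)
 qed
 hence "AE z in hyp. \<forall>\<gamma>\<in>{\<gamma>\<in>Gamma0 N. \<gamma>$2$1 \<noteq> 0}. z \<notin> {z. cmod (cocycle \<gamma> z) = 1}"
  by (subst AE_ball_countable) auto
 moreover have "AE z in hyp. z \<notin> {z. \<bar>Re z\<bar> = 1 / 2}"
 proof (rule AE_hyp_not_closed_negligible)
  show "closed {z. \<bar>Re z\<bar> = 1 / 2}" by (intro closed_Collect_eq continuous_intros)
  have "negligible ({x. 1 \<bullet> x = 1 / 2} \<union> {x::complex. 1 \<bullet> x = - 1 / 2})"
   by (intro negligible_Un negligible_hyperplane) auto
  thus "negligible {z. \<bar>Re z\<bar> = 1 / 2}" by (rule negligible_subset) (auto simp: inner_complex_def)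
 qed
 ultimately show ?thesis by eventually_elim (auto simp: ford_boundary_def)
qed

text \<open>The factors of \<open>\<gamma>\<close> at \<open>z\<close> and of its inverse at
  \<open>\<gamma> z\<close> multiply to 1. If \<open>c\<close> were not 0, both would have modulus
  at least 1 and \<open>z\<close> would lie on an isometric circle. So \<open>\<gamma>\<close> is a
  translation up to sign, and the width of the strip makes it trivial.\<close>

lemma ford_domain_unique:
 assumes z: "z \<in> ford_domain N" "z \<notin> ford_boundary N" and \<gamma>: "\<gamma> \<in> Gamma0 N"
  and \<gamma>z: "moebius \<gamma> z \<in> ford_domain N" "moebius \<gamma> z \<notin> ford_boundary N"
 shows "\<gamma> = mat2 1 0 0 1 \<or> \<gamma> = mat2 (-1) 0 0 (-1)"
proof -
 have zH: "z \<in> \<H>" using z ford_domain_subset_H by auto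
 have det: "det \<gamma> = 1" using \<gamma> by simp
 have c0: "\<gamma>$2$1 = 0"
 proof (rule ccontr)
  assume c: "\<gamma>$2$1 \<noteq> 0"
  have 1: "1 \<le> cmod (cocycle \<gamma> z)" using z(1) \<gamma> c by (auto simp: ford_domain_def)
  have "1 \<le> cmod (cocycle (adj2 \<gamma>) (moebius \<gamma> z))"
   using \<gamma>z(1) Gamma0_adj2[OF \<gamma>] c by (auto simp: ford_domain_def)
  moreover have "cocycle (adj2 \<gamma>) (moebius \<gamma> z) * cocycle \<gamma> z = 1"
   using cocycle_mult[of \<gamma> z "adj2 \<gamma>"] det zH by (simp add: adj2_mult_self)
  hence "cmod (cocycle (adj2 \<gamma>) (moebius \<gamma> z)) * cmod (cocycle \<gamma> z) = 1" by (metis norm_mult norm_one)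
  ultimately have "cmod (cocycle \<gamma> z) \<le> 1"
   using mult_right_mono[of 1 "cmod (cocycle (adj2 \<gamma>) (moebius \<gamma> z))" "cmod (cocycle \<gamma> z)"] by simp
  with 1 have "cmod (cocycle \<gamma> z) = 1" by simp
  with z(2) \<gamma> c show False by (auto simp: ford_boundary_def)
 qed
 have ad: "\<gamma>$1$1 * \<gamma>$2$2 = 1" using det c0 by (simp add: det_2)
 hence d: "\<gamma>$1$1 = 1 \<and> \<gamma>$2$2 = 1 \<or> \<gamma>$1$1 = -1 \<and> \<gamma>$2$2 = -1" using zmult_eq_1_iff by blast
 then obtain n where n: "moebius \<gamma> z = z + of_int n" "\<bar>n\<bar> = \<bar>\<gamma>$1$2\<bar>"
 proof
  assume "\<gamma>$1$1 = 1 \<and> \<gamma>$2$2 = 1"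
  with that[of "\<gamma>$1$2"] show ?thesis by (simp add: moebius_def cocycle_def c0)
 next
  assume "\<gamma>$1$1 = -1 \<and> \<gamma>$2$2 = -1"
  with that[of "- \<gamma>$1$2"] show ?thesis by (simp add: moebius_def cocycle_def c0)
 qed
 have "\<bar>Re z\<bar> < 1 / 2" using z by (auto simp: ford_domain_def ford_boundary_def)
 moreover have "\<bar>Re z + of_int n\<bar> < 1 / 2"  using \<gamma>z n by (auto simp: ford_domain_def ford_boundary_def)
 ultimately have "\<bar>real_of_int n\<bar> < 1" by linarith
 hence "n = 0" by linarith
 thus ?thesis using n(2) d c0 by (auto simp: mat2_eq_iff)
qed

text \<open>\<open>fundamental G u\<close>: the weight \<open>u\<close> plays the role of the indicator function of
  a fundamental domain of \<open>G\<close>; the total weight of an orbit is \<open>2\<close> because \<open>G\<close> contains \<open>-1\<close>.\<close>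
definition fundamental :: "(int^2^2) set => (complex => real) => bool"
 where "fundamental G u \<longleftrightarrow> u \<in> borel_measurable borel \<and> (\<forall>z. u z \<ge> 0) \<and>
  (AE z in hyp. (\<integral>\<^sup>+\<gamma>. ennreal (u (moebius \<gamma> z)) \<partial>count_space G) = 2)"

lemma fundamental_ford_domain: "fundamental (Gamma0 N) (indicator (ford_domain N))"
proof -
 have "AE z in hyp. \<forall>\<gamma>\<in>Gamma0 N. moebius \<gamma> z \<notin> ford_boundary N"
  by (subst AE_ball_countable) (auto intro!: AE_hyp_moebius AE_hyp_not_ford_boundary)
 with AE_hyp_H have "AE z in hyp. (\<integral>\<^sup>+\<gamma>. ennreal (indicator (ford_domain N) (moebius \<gamma> z)) \<partial>count_space (Gamma0 N)) = 2"
 proof eventually_elim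
  case (elim z)
  from ex_moebius_in_ford_domain[OF elim(1)] obtain \<gamma>0 
   where \<gamma>0: "\<gamma>0 \<in> Gamma0 N" "moebius \<gamma>0 z \<in> ford_domain N" by blast
  let ?S = "{\<gamma>\<in>Gamma0 N. moebius \<gamma> z \<in> ford_domain N}"
  have "\<gamma> = \<gamma>0 \<or> \<gamma> = - \<gamma>0" if \<gamma>: "\<gamma> \<in> ?S" for \<gamma>
  proof -
   let ?\<delta> = "\<gamma> ** adj2 \<gamma>0"
   have \<delta>: "?\<delta> \<in> Gamma0 N" using \<gamma> \<gamma>0 by (auto intro!: Gamma0_mult Gamma0_adj2)
   have inv: "?\<delta> ** \<gamma>0 = \<gamma>"
   proof -
    have "?\<delta> ** \<gamma>0 = \<gamma> ** (adj2 \<gamma>0 ** \<gamma>0)" by (simp add: matrix_mul_assoc)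
    thus ?thesis using \<gamma>0 by (simp add: adj2_mult_self mat2_scalar_mult)
   qed
   have "moebius ?\<delta> (moebius \<gamma>0 z) = moebius \<gamma> z"
    using moebius_mult[of ?\<delta> \<gamma>0 z] \<delta> \<gamma>0 elim(1) by (simp add: inv)
   with ford_domain_unique[OF \<gamma>0(2) _ \<delta>] elim(2) \<gamma> \<gamma>0
   have "?\<delta> = mat2 1 0 0 1 \<or> ?\<delta> = mat2 (-1) 0 0 (-1)" by auto
   hence "\<gamma> = mat2 1 0 0 1 ** \<gamma>0 \<or> \<gamma> = mat2 (-1) 0 0 (-1) ** \<gamma>0" using inv by metis
   thus ?thesis by (auto simp: mat2_eq_iff matmul_nth)
  qed
  moreover have "\<gamma>0 \<in> ?S" "- \<gamma>0 \<in> ?S" using \<gamma>0 Gamma0_uminus by auto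
  ultimately have S: "?S = {\<gamma>0, - \<gamma>0}" by blast
  have "\<gamma>0 \<noteq> - \<gamma>0"
  proof
   assume "\<gamma>0 = - \<gamma>0"
   hence "\<gamma>0 $ i $ j = (- \<gamma>0) $ i $ j" for i j by (rule arg_cong)
   hence "\<gamma>0 $ i $ j = 0" for i j by simp
   hence "det \<gamma>0 = 0" by (simp add: det_2)
   with \<gamma>0 show False by simp
  qed
  hence card: "card ?S = 2" unfolding S by simp
  have "(\<integral>\<^sup>+\<gamma>. ennreal (indicator (ford_domain N) (moebius \<gamma> z)) \<partial>count_space (Gamma0 N)) =
    (\<integral>\<^sup>+\<gamma>. indicator ?S \<gamma> \<partial>count_space (Gamma0 N))" by (intro nn_integral_cong) (auto simp: indicator_def)
  also have "... = emeasure (count_space (Gamma0 N)) ?S" by simp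
  also have "... = 2" using card S by (subst emeasure_count_space_finite) auto
  finally show ?case .
 qed
 thus ?thesis by (auto simp: fundamental_def)
qed

text \<open>Substituting the inverse of \<open>\<gamma>\<close> preserves the measure and inversion
  permutes \<open>G\<close>, so the roles of the two weights can be exchanged.\<close>

lemma nn_integral_swap_group:
 fixes u v :: "complex => ennreal"
 assumes [measurable]: "u \<in> borel_measurable borel" "v \<in> borel_measurable borel"
  and G: "\<And>\<gamma>. \<gamma> \<in> G ==> adj2 \<gamma> \<in> G" "\<And>\<gamma>. \<gamma> \<in> G ==> det \<gamma> = 1"
 shows "(\<integral>\<^sup>+z. u z * (\<integral>\<^sup>+\<gamma>. v (moebius \<gamma> z) \<partial>count_space G) \<partial>hyp) =
     (\<integral>\<^sup>+z. v z * (\<integral>\<^sup>+\<gamma>. u (moebius \<gamma> z) \<partial>count_space G) \<partial>hyp)"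
proof -
 have bij: "bij_betw adj2 G G" by (rule bij_betw_byWitness[of _ adj2]) (use G in auto)
 have swap: "(\<integral>\<^sup>+z. u z * (\<integral>\<^sup>+\<gamma>. v (moebius \<gamma> z) \<partial>count_space G) \<partial>hyp) =
   (\<integral>\<^sup>+\<gamma>. (\<integral>\<^sup>+z. u z * v (moebius \<gamma> z) \<partial>hyp) \<partial>count_space G)" 
  if [measurable]: "u \<in> borel_measurable borel" "v \<in> borel_measurable borel" for u v
 proof -
  have "(\<integral>\<^sup>+z. u z * (\<integral>\<^sup>+\<gamma>. v (moebius \<gamma> z) \<partial>count_space G) \<partial>hyp) =
   (\<integral>\<^sup>+z. (\<integral>\<^sup>+\<gamma>. u z * v (moebius \<gamma> z) \<partial>count_space G) \<partial>hyp)"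
   by (intro nn_integral_cong nn_integral_cmult[symmetric]) auto
  also have "... = (\<integral>\<^sup>+\<gamma>. (\<integral>\<^sup>+z. u z * v (moebius \<gamma> z) \<partial>hyp) \<partial>count_space G)"
   by (rule nn_integral_count_space_nn_integral) auto
  finally show ?thesis .
 qed
 have "(\<integral>\<^sup>+\<gamma>. (\<integral>\<^sup>+z. u z * v (moebius \<gamma> z) \<partial>hyp) \<partial>count_space G) =
  (\<integral>\<^sup>+\<gamma>. (\<integral>\<^sup>+z. v z * u (moebius (adj2 \<gamma>) z) \<partial>hyp) \<partial>count_space G)"
 proof (rule nn_integral_cong)
  fix \<gamma> assume "\<gamma> \<in> space (count_space G)"
  hence \<gamma>: "det \<gamma> = 1" using G by auto
  have "(\<integral>\<^sup>+z. u z * v (moebius \<gamma> z) \<partial>hyp) = (\<integral>\<^sup>+z. u (moebius (adj2 \<gamma>) (moebius \<gamma> z)) * v (moebius \<gamma> z) \<partial>hyp)"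
   using AE_hyp_H by (intro nn_integral_cong_AE) (auto simp: moebius_adj2_left \<gamma> elim!: eventually_mono)
  also have "... = (\<integral>\<^sup>+z. u (moebius (adj2 \<gamma>) z) * v z \<partial>hyp)" by (rule nn_integral_hyp_moebius) (auto simp: \<gamma>)
  finally show "(\<integral>\<^sup>+z. u z * v (moebius \<gamma> z) \<partial>hyp) = (\<integral>\<^sup>+z. v z * u (moebius (adj2 \<gamma>) z) \<partial>hyp)"
   by (simp add: mult.commute)
 qed
 also have "... = (\<integral>\<^sup>+\<gamma>. (\<integral>\<^sup>+z. v z * u (moebius \<gamma> z) \<partial>hyp) \<partial>count_space G)"
  by (rule nn_integral_bij_count_space[OF bij])
 finally show ?thesis by (simp add: swap)
qed

text \<open>Cut the strip into rectangles of heights \<open>2^n / 2\<close> to \<open>2^n\<close>: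
  Lebesgue area \<open>2^n / 2\<close> times density at most \<open>4 / 4^n\<close> gives a
  geometric series.\<close>

lemma emeasure_hyp_strip: "emeasure hyp {z. \<bar>Re z\<bar> \<le> 1 / 2 \<and> Im z \<ge> 1 / 2} < \<infinity>"
proof -
 define R where "R n = cbox (Complex (- 1 / 2) (2 ^ n / 2)) (Complex (1 / 2) (2 ^ n))" for n :: nat
 have "{z. \<bar>Re z\<bar> \<le> 1 / 2 \<and> Im z \<ge> 1 / 2} \<subseteq> (\<Union>n. R n)"
 proof
  fix z assume z: "z \<in> {z. \<bar>Re z\<bar> \<le> 1 / 2 \<and> Im z \<ge> 1 / 2}"
  obtain n0 :: nat where "Im z < 2 ^ n0" using real_arch_pow[of 2 "Im z"] by auto
  define n where "n = (LEAST n::nat. Im z < 2 ^ n)"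
  have n: "Im z < 2 ^ n" unfolding n_def using `Im z < 2 ^ n0` by (rule LeastI)
  have "2 ^ n / 2 \<le> Im z"
  proof (cases n)
   case (Suc m)
   hence "\<not> Im z < 2 ^ m" using not_less_Least[of m "\<lambda>n. Im z < 2 ^ n"] unfolding n_def by simp
   thus ?thesis using Suc by simp
  qed (use z in simp)
  hence "z \<in> R n" using n z by (auto simp: R_def mem_box Basis_complex_def)
  thus "z \<in> (\<Union>n. R n)" by blast
 qed
 hence "emeasure hyp {z. \<bar>Re z\<bar> \<le> 1 / 2 \<and> Im z \<ge> 1 / 2} \<le> emeasure hyp (\<Union>n. R n)"
  by (rule emeasure_mono) (auto simp: R_def)
 also have "... \<le> (\<Sum>n. emeasure hyp (R n))" by (rule emeasure_subadditive_countably) (auto simp: R_def)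
 also have "... \<le> (\<Sum>n. ennreal (2 * (1 / 2) ^ n))"
 proof (intro suminf_le summableI)
  fix n
  have "emeasure hyp (R n) = (\<integral>\<^sup>+z. ennreal (indicator \<H> z / (Im z)\<^sup>2) * indicator (R n) z \<partial>lborel)"
   unfolding hyp_def by (subst emeasure_density) (auto simp: R_def)
  also have "... \<le> (\<integral>\<^sup>+z. ennreal (4 / 4 ^ n) * indicator (R n) z \<partial>lborel)"
  proof (rule nn_integral_mono)
   fix z :: complex
   show "ennreal (indicator \<H> z / (Im z)\<^sup>2) * indicator (R n) z \<le> ennreal (4 / 4 ^ n) * indicator (R n) z"
   proof (cases "z \<in> R n")
    case True
    hence "2 ^ n / 2 \<le> Im z" by (auto simp: R_def mem_box Basis_complex_def)
    hence "(2 ^ n / 2)\<^sup>2 \<le> (Im z)\<^sup>2" by (intro power_mono) auto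
    moreover have "(2 ^ n)\<^sup>2 = (4::real) ^ n" by (simp add: power2_eq_square flip: power_mult_distrib)
    ultimately have *: "4 ^ n / 4 \<le> (Im z)\<^sup>2" by (simp add: power_divide)
    have "indicator \<H> z / (Im z)\<^sup>2 \<le> 1 / (Im z)\<^sup>2" by (auto simp: indicator_def)
    also have "... \<le> 1 / (4 ^ n / 4)"
     using * by (intro divide_left_mono mult_pos_pos less_le_trans[OF _ *]) auto
    finally show ?thesis using True by (auto intro!: ennreal_leI)
   qed auto
  qed
  also have "... = ennreal (4 / 4 ^ n) * emeasure lborel (R n)"
   by (subst nn_integral_cmult_indicator) (auto simp: R_def)
  also have "emeasure lborel (R n) = ennreal (2 ^ n / 2)"
   unfolding R_def by (subst emeasure_lborel_cbox) (auto simp: Basis_complex_def)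
  also have "ennreal (4 / 4 ^ n) * ... = ennreal (2 * (1 / 2) ^ n)"
  proof -
   have "(4::real) ^ n = 2 ^ n * 2 ^ n" by (simp flip: power_mult_distrib)
   thus ?thesis by (simp flip: ennreal_mult add: field_simps)
  qed
  finally show "emeasure hyp (R n) \<le> ennreal (2 * (1 / 2) ^ n)" .
 qed
 also have "... = ennreal (\<Sum>n. 2 * (1 / 2) ^ n)"
  by (rule suminf_ennreal2) (auto intro!: summable_mult summable_geometric)
 also have "... < \<infinity>" by simp
 finally show ?thesis .
qed

lemma Im_ford_domain_1:
 assumes "z \<in> ford_domain 1"
 shows "Im z \<ge> 1 / 2"
proof -
 have "mat2 0 (-1) 1 0 \<in> Gamma0 1" by (simp add: Gamma0_iff)
 with assms have "1 \<le> cmod z" "\<bar>Re z\<bar> \<le> 1 / 2" "Im z > 0" by (force simp: ford_domain_def H_iff)+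
 hence "1 \<le> (Re z)\<^sup>2 + (Im z)\<^sup>2" by (metis cmod_power2 one_le_power)
 moreover have "(Re z)\<^sup>2 \<le> (1 / 2)\<^sup>2" using `\<bar>Re z\<bar> \<le> 1 / 2` by (simp only: abs_le_square_iff[symmetric])
 ultimately have "(1 / 2)\<^sup>2 \<le> (Im z)\<^sup>2" by (simp add: power2_eq_square)
 thus ?thesis by (rule power2_le_imp_le) (use `Im z > 0` in simp)
qed

text \<open>Two elements whose lower rows agree modulo \<open>N\<close> differ by an element of
  \<open>Gamma0 N\<close>, because the lower left entry of \<open>\<gamma> \<rho>^(-1)\<close> is
  the determinant formed by the two rows. A coset may occur several times in \<open>R\<close>; only
  covering matters.\<close>

lemma finite_coset_reps:
 assumes "N > 0"
 obtains R where "finite R" "R \<subseteq> Gamma0 1"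
  "\<And>\<gamma>. \<gamma> \<in> Gamma0 1 ==> \<exists>\<rho>\<in>R. \<exists>\<eta>\<in>Gamma0 N. \<gamma> = \<eta> ** \<rho>"
proof -
 define key where "key \<gamma> = (\<gamma>$2$1 mod int N, \<gamma>$2$2 mod int N)" for \<gamma> :: "int^2^2"
 define R where "R = (\<lambda>k. SOME \<gamma>. \<gamma> \<in> Gamma0 1 \<and> key \<gamma> = k) ` (key ` Gamma0 1)"
 have rep: "(SOME \<gamma>'. \<gamma>' \<in> Gamma0 1 \<and> key \<gamma>' = key \<gamma>) \<in> Gamma0 1 \<and>
    key (SOME \<gamma>'. \<gamma>' \<in> Gamma0 1 \<and> key \<gamma>' = key \<gamma>) = key \<gamma>" if "\<gamma> \<in> Gamma0 1" for \<gamma>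
  by (rule someI[of "\<lambda>\<gamma>'. \<gamma>' \<in> Gamma0 1 \<and> key \<gamma>' = key \<gamma>" \<gamma>]) (use that in auto)
 show thesis
 proof
  have "key ` Gamma0 1 \<subseteq> {0..<int N} \<times> {0..<int N}" using assms by (auto simp: key_def)
  hence "finite (key ` Gamma0 1)" by (rule finite_subset) auto
  thus "finite R" unfolding R_def by auto
  show "R \<subseteq> Gamma0 1" using rep by (auto simp: R_def)
  fix \<gamma> assume \<gamma>: "\<gamma> \<in> Gamma0 1"
  define \<rho> where "\<rho> = (SOME \<gamma>'. \<gamma>' \<in> Gamma0 1 \<and> key \<gamma>' = key \<gamma>)"
  have \<rho>: "\<rho> \<in> Gamma0 1" "key \<rho> = key \<gamma>" "\<rho> \<in> R" using rep[OF \<gamma>] \<gamma> by (auto simp: \<rho>_def R_def)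
  let ?\<eta> = "\<gamma> ** adj2 \<rho>"
  have "[\<gamma>$2$1 * \<rho>$2$2 - \<gamma>$2$2 * \<rho>$2$1 = \<gamma>$2$1 * \<gamma>$2$2 - \<gamma>$2$2 * \<gamma>$2$1] (mod int N)"
   using \<rho>(2) by (intro cong_diff cong_mult) (auto simp: key_def cong_def)
  hence "int N dvd ?\<eta>$2$1" by (simp add: matmul_nth cong_0_iff mult.commute)
  hence "?\<eta> \<in> Gamma0 N" using \<gamma> \<rho>(1) by (auto simp: Gamma0_iff det_mul)
  moreover have "\<gamma> = ?\<eta> ** \<rho>"
  proof -
   have "?\<eta> ** \<rho> = \<gamma> ** (adj2 \<rho> ** \<rho>)" by (simp add: matrix_mul_assoc)
   thus ?thesis using \<rho>(1) by (simp add: adj2_mult_self mat2_scalar_mult)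
  qed
  ultimately show "\<exists>\<rho>\<in>R. \<exists>\<eta>\<in>Gamma0 N. \<gamma> = \<eta> ** \<rho>" using \<rho>(3) by blast
 qed
qed

text \<open>An orbit of the full modular group consists of at most \<open>card R\<close> orbits of
  \<open>Gamma0 N\<close>, so it meets the level \<open>N\<close> domain with weight at most
  \<open>2 * card R\<close>. Exchanging the two domains bounds the area by that of level 1.\<close>

lemma emeasure_hyp_ford_domain:
 assumes "N > 0"
 shows "emeasure hyp (ford_domain N) < \<infinity>"
proof -
 let ?D = "indicator (ford_domain N) :: complex => real" and ?D1 = "indicator (ford_domain 1) :: complex => real"
 from finite_coset_reps[OF assms] obtain R where R: "finite R" "R \<subseteq> Gamma0 1"
  "\<And>\<gamma>. \<gamma> \<in> Gamma0 1 ==> \<exists>\<rho>\<in>R. \<exists>\<eta>\<in>Gamma0 N. \<gamma> = \<eta> ** \<rho>" by blast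
 have fund: "AE z in hyp. (\<integral>\<^sup>+\<gamma>. ennreal (indicator (ford_domain M) (moebius \<gamma> z)) \<partial>count_space (Gamma0 M)) = 2" for M
  using fundamental_ford_domain by (auto simp: fundamental_def)
 have "AE z in hyp. \<forall>\<rho>\<in>R. (\<integral>\<^sup>+\<eta>. ennreal (?D (moebius \<eta> (moebius \<rho> z))) \<partial>count_space (Gamma0 N)) = 2"
 proof (subst AE_finite_all[OF R(1)], intro ballI)
  fix \<rho> assume "\<rho> \<in> R"
  with R have "det \<rho> > 0" by auto
  from AE_hyp_moebius[OF this fund[of N]]
  show "AE z in hyp. (\<integral>\<^sup>+\<eta>. ennreal (?D (moebius \<eta> (moebius \<rho> z))) \<partial>count_space (Gamma0 N)) = 2" .
 qed
 with AE_hyp_H have bound: "AE z in hyp. (\<integral>\<^sup>+\<gamma>. ennreal (?D (moebius \<gamma> z)) \<partial>count_space (Gamma0 1)) \<le> 2 * of_nat (card R)"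
 proof eventually_elim
  case (elim z)
  have "(\<integral>\<^sup>+\<gamma>. ennreal (?D (moebius \<gamma> z)) \<partial>count_space (Gamma0 1)) \<le>
    (\<integral>\<^sup>+\<gamma>. (\<Sum>\<rho>\<in>R. ennreal (?D (moebius \<gamma> z)) * indicator ((\<lambda>\<eta>. \<eta> ** \<rho>) ` Gamma0 N) \<gamma>) \<partial>count_space UNIV)"
  proof (subst nn_integral_count_space_indicator, simp, rule nn_integral_mono)
   fix \<gamma>
   show "ennreal (?D (moebius \<gamma> z)) * indicator (Gamma0 1) \<gamma> \<le> 
    (\<Sum>\<rho>\<in>R. ennreal (?D (moebius \<gamma> z)) * indicator ((\<lambda>\<eta>. \<eta> ** \<rho>) ` Gamma0 N) \<gamma>)"
   proof (cases "\<gamma> \<in> Gamma0 1")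
    case True
    from R(3)[OF this] obtain \<rho> \<eta> where "\<rho> \<in> R" "\<eta> \<in> Gamma0 N" "\<gamma> = \<eta> ** \<rho>" by blast
    hence "ennreal (?D (moebius \<gamma> z)) * indicator (Gamma0 1) \<gamma> \<le> 
      ennreal (?D (moebius \<gamma> z)) * indicator ((\<lambda>\<eta>. \<eta> ** \<rho>) ` Gamma0 N) \<gamma>" by (auto simp: indicator_def)
    also have "... \<le> (\<Sum>\<rho>\<in>R. ennreal (?D (moebius \<gamma> z)) * indicator ((\<lambda>\<eta>. \<eta> ** \<rho>) ` Gamma0 N) \<gamma>)"
     using R(1) `\<rho> \<in> R` by (intro member_le_sum) auto
    finally show ?thesis .
   qed auto
  qed
  also have "... = (\<Sum>\<rho>\<in>R. \<integral>\<^sup>+\<gamma>. ennreal (?D (moebius \<gamma> z)) \<partial>count_space ((\<lambda>\<eta>. \<eta> ** \<rho>) ` Gamma0 N))"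
   by (simp add: nn_integral_sum nn_integral_count_space_indicator)
  also have "... = (\<Sum>\<rho>\<in>R. 2)"
  proof (rule sum.cong[OF refl])
   fix \<rho> assume \<rho>: "\<rho> \<in> R"
   with R have d\<rho>: "det \<rho> = 1" by auto
   have "inj_on (\<lambda>\<eta>. \<eta> ** \<rho>) (Gamma0 N)"
   proof (rule inj_on_inverseI[of _ "\<lambda>\<gamma>. \<gamma> ** adj2 \<rho>"])
    fix \<eta> :: "int^2^2"
    have "\<eta> ** \<rho> ** adj2 \<rho> = \<eta> ** (\<rho> ** adj2 \<rho>)" by (simp add: matrix_mul_assoc)
    thus "\<eta> ** \<rho> ** adj2 \<rho> = \<eta>" by (simp add: mult_adj2 d\<rho> mat2_scalar_mult)
   qed
   hence "bij_betw (\<lambda>\<eta>. \<eta> ** \<rho>) (Gamma0 N) ((\<lambda>\<eta>. \<eta> ** \<rho>) ` Gamma0 N)" by (simp add: bij_betw_def)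
   from nn_integral_bij_count_space[OF this, symmetric]
   have "(\<integral>\<^sup>+\<gamma>. ennreal (?D (moebius \<gamma> z)) \<partial>count_space ((\<lambda>\<eta>. \<eta> ** \<rho>) ` Gamma0 N)) =
    (\<integral>\<^sup>+\<eta>. ennreal (?D (moebius (\<eta> ** \<rho>) z)) \<partial>count_space (Gamma0 N))" .
   also have "... = (\<integral>\<^sup>+\<eta>. ennreal (?D (moebius \<eta> (moebius \<rho> z))) \<partial>count_space (Gamma0 N))"
    using d\<rho> elim(1) by (intro nn_integral_cong) (auto simp: moebius_mult)
   finally show "(\<integral>\<^sup>+\<gamma>. ennreal (?D (moebius \<gamma> z)) \<partial>count_space ((\<lambda>\<eta>. \<eta> ** \<rho>) ` Gamma0 N)) = 2"
    using elim(2) \<rho> by simp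
  qed
  finally show ?case by (simp add: mult.commute)
 qed
 have "2 * emeasure hyp (ford_domain N) = (\<integral>\<^sup>+z. 2 * indicator (ford_domain N) z \<partial>hyp)"
  by (subst nn_integral_cmult) auto
 also have "... = (\<integral>\<^sup>+z. ennreal (?D z) * (\<integral>\<^sup>+\<gamma>. ennreal (?D1 (moebius \<gamma> z)) \<partial>count_space (Gamma0 1)) \<partial>hyp)"
  using fund[of 1] by (intro nn_integral_cong_AE) (auto simp: indicator_def elim!: eventually_mono)
 also have "... = (\<integral>\<^sup>+z. ennreal (?D1 z) * (\<integral>\<^sup>+\<gamma>. ennreal (?D (moebius \<gamma> z)) \<partial>count_space (Gamma0 1)) \<partial>hyp)"
  by (rule nn_integral_swap_group) (auto intro: Gamma0_adj2)
 also have "... \<le> (\<integral>\<^sup>+z. 2 * of_nat (card R) * indicator (ford_domain 1) z \<partial>hyp)"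
  using bound by (intro nn_integral_mono_AE) (auto simp: indicator_def elim!: eventually_mono)
 also have "... = 2 * of_nat (card R) * emeasure hyp (ford_domain 1)"
  by (subst nn_integral_cmult_indicator) auto
 also have "... < \<infinity>"
 proof -
  have "emeasure hyp (ford_domain 1) \<le> emeasure hyp {z. \<bar>Re z\<bar> \<le> 1 / 2 \<and> Im z \<ge> 1 / 2}"
  proof (rule emeasure_mono)
   show "ford_domain 1 \<subseteq> {z. \<bar>Re z\<bar> \<le> 1 / 2 \<and> Im z \<ge> 1 / 2}"
    using Im_ford_domain_1 by (auto simp: ford_domain_def)
   have "closed {z. \<bar>Re z\<bar> \<le> 1 / 2 \<and> Im z \<ge> 1 / 2}"
    by (intro closed_Collect_conj closed_Collect_le continuous_intros)
   thus "{z. \<bar>Re z\<bar> \<le> 1 / 2 \<and> Im z \<ge> 1 / 2} \<in> sets hyp" by (simp add: borel_closed)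
  qed
  hence "emeasure hyp (ford_domain 1) < \<infinity>" using emeasure_hyp_strip by (rule le_less_trans)
  thus ?thesis by (simp add: ennreal_mult_less_top of_nat_less_top)
 qed
 finally show ?thesis by (auto simp: ennreal_mult_less_top)
qed

subsection \<open>Unfolding\<close>

text \<open>The weight \<open>v\<close> summed over the coset \<open>G r\<close> is 2 almost
  everywhere, so Fubini spreads the integral of \<open>\<Psi>\<close> over the coset. Besides the
  identity, \<open>r\<close> will be a Hecke representative.\<close>

lemma unfold_fundamental:
 fixes \<Psi> :: cfun
 assumes v: "fundamental G v" and r: "det r > 0" and int: "integrable hyp \<Psi>"
  and G: "\<And>\<gamma>. \<gamma> \<in> G ==> det \<gamma> = 1"
 shows "((\<lambda>\<gamma>. \<integral>z. of_real (v (moebius (\<gamma> ** r) z)) * \<Psi> z \<partial>hyp) has_sum (2 * (\<integral>z. \<Psi> z \<partial>hyp))) G"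
proof -
 have [measurable]: "v \<in> borel_measurable borel" and v0: "\<And>z. v z \<ge> 0" using v by (auto simp: fundamental_def)
 have [measurable]: "\<Psi> \<in> borel_measurable borel" using int by (auto simp: integrable_iff_bounded)
 have "AE z in hyp. (\<integral>\<^sup>+\<gamma>. ennreal (v (moebius \<gamma> (moebius r z))) \<partial>count_space G) = 2"
  using v r by (intro AE_hyp_moebius) (auto simp: fundamental_def)
 with AE_hyp_H have cnt: "AE z in hyp. (\<integral>\<^sup>+\<gamma>. ennreal (v (moebius (\<gamma> ** r) z)) \<partial>count_space G) = 2"
 proof eventually_elim
  case (elim z)
  have "(\<integral>\<^sup>+\<gamma>. ennreal (v (moebius (\<gamma> ** r) z)) \<partial>count_space G) =
   (\<integral>\<^sup>+\<gamma>. ennreal (v (moebius \<gamma> (moebius r z))) \<partial>count_space G)"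
   using elim r G by (intro nn_integral_cong) (auto simp: moebius_mult)
  with elim show ?case by simp
 qed
 define K where "K = (\<lambda>(\<gamma>, z). of_real (v (moebius (\<gamma> ** r) z)) * \<Psi> z)"
 interpret C: sigma_finite_measure "count_space G" by (rule sigma_finite_measure_count_space_countable) simp
 interpret P: pair_sigma_finite "count_space G" hyp ..
 have [measurable]: "K \<in> borel_measurable (count_space G \<Otimes>\<^sub>M hyp)"
  by (rule measurable_pair_measure_countable1) (auto simp: K_def)
 have intK: "integrable (count_space G \<Otimes>\<^sub>M hyp) K"
 proof (rule integrableI_bounded)
  have "(\<integral>\<^sup>+p. ennreal (norm (K p)) \<partial>(count_space G \<Otimes>\<^sub>M hyp)) =
    (\<integral>\<^sup>+\<gamma>. \<integral>\<^sup>+z. ennreal (norm (K (\<gamma>, z))) \<partial>hyp \<partial>count_space G)"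
   by (rule hyp.nn_integral_fst[symmetric]) auto
  also have "... = (\<integral>\<^sup>+\<gamma>. \<integral>\<^sup>+z. ennreal (norm (\<Psi> z)) * ennreal (v (moebius (\<gamma> ** r) z)) \<partial>hyp \<partial>count_space G)"
   using v0 by (intro nn_integral_cong) (auto simp: K_def norm_mult ennreal_mult mult.commute)
  also have "... = (\<integral>\<^sup>+z. \<integral>\<^sup>+\<gamma>. ennreal (norm (\<Psi> z)) * ennreal (v (moebius (\<gamma> ** r) z)) \<partial>count_space G \<partial>hyp)"
   by (rule nn_integral_count_space_nn_integral[symmetric]) auto
  also have "... = (\<integral>\<^sup>+z. ennreal (norm (\<Psi> z)) * 2 \<partial>hyp)"
   using cnt by (intro nn_integral_cong_AE) (auto simp: nn_integral_cmult elim!: eventually_mono)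
  also have "... = (\<integral>\<^sup>+z. ennreal (norm (\<Psi> z)) \<partial>hyp) * 2" by (rule nn_integral_multc) auto
  also have "... < \<infinity>" using int by (simp add: integrable_iff_bounded ennreal_mult_less_top)
  finally show "(\<integral>\<^sup>+p. ennreal (norm (K p)) \<partial>(count_space G \<Otimes>\<^sub>M hyp)) < \<infinity>" .
 qed auto
 have "(\<integral>\<gamma>. (\<integral>z. K (\<gamma>, z) \<partial>hyp) \<partial>count_space G) = (\<integral>z. (\<integral>\<gamma>. K (\<gamma>, z) \<partial>count_space G) \<partial>hyp)"
  using P.Fubini_integral[of "\<lambda>\<gamma> z. K (\<gamma>, z)"] intK by simp
 also have "... = (\<integral>z. 2 * \<Psi> z \<partial>hyp)"
 proof (rule integral_cong_AE)
  show "AE z in hyp. (\<integral>\<gamma>. K (\<gamma>, z) \<partial>count_space G) = 2 * \<Psi> z" using cnt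
  proof eventually_elim
   case (elim z)
   have "(\<integral>\<gamma>. v (moebius (\<gamma> ** r) z) \<partial>count_space G) = 2"
    using elim v0 by (subst integral_eq_nn_integral) auto
   thus ?case by (simp add: K_def)
  qed
  show "(\<lambda>z. \<integral>\<gamma>. K (\<gamma>, z) \<partial>count_space G) \<in> borel_measurable hyp"
   by (rule C.borel_measurable_lebesgue_integral) auto
 qed auto
 finally have eq: "(\<integral>\<gamma>. (\<integral>z. K (\<gamma>, z) \<partial>hyp) \<partial>count_space G) = 2 * (\<integral>z. \<Psi> z \<partial>hyp)" by simp
 have "integrable (count_space G) (\<lambda>\<gamma>. \<integral>z. K (\<gamma>, z) \<partial>hyp)"
  using P.integrable_fst[of "\<lambda>\<gamma> z. K (\<gamma>, z)"] intK by simp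
 hence "Infinite_Set_Sum.abs_summable_on (\<lambda>\<gamma>. \<integral>z. K (\<gamma>, z) \<partial>hyp) G"
  by (simp add: Infinite_Set_Sum.abs_summable_on_def)
 from infsetsum_infsum[OF this] abs_summable_equivalent this
 have "((\<lambda>\<gamma>. \<integral>z. K (\<gamma>, z) \<partial>hyp) has_sum infsetsum (\<lambda>\<gamma>. \<integral>z. K (\<gamma>, z) \<partial>hyp) G) G"
  using abs_summable_summable has_sum_infsum by metis
 thus ?thesis unfolding infsetsum_def eq by (simp add: K_def)
qed

text \<open>Both sides unfold to \<open>\<Sum>\<gamma>. \<integral> u z * v (\<gamma> z) * \<Phi> z\<close>.\<close>
lemma integral_fundamental_unique:
 fixes \<Phi> :: cfun
 assumes u: "fundamental G u" and v: "fundamental G v"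
  and G: "\<And>\<gamma>. \<gamma> \<in> G ==> adj2 \<gamma> \<in> G" "\<And>\<gamma>. \<gamma> \<in> G ==> det \<gamma> = 1"
  and inv: "\<And>\<gamma> z. \<gamma> \<in> G ==> z \<in> \<H> ==> \<Phi> (moebius \<gamma> z) = \<Phi> z"
  and [measurable]: "\<Phi> \<in> borel_measurable borel"
  and int: "integrable hyp (\<lambda>z. of_real (u z) * \<Phi> z)" "integrable hyp (\<lambda>z. of_real (v z) * \<Phi> z)"
 shows "(\<integral>z. of_real (u z) * \<Phi> z \<partial>hyp) = (\<integral>z. of_real (v z) * \<Phi> z \<partial>hyp)"
proof -
 have [measurable]: "u \<in> borel_measurable borel" "v \<in> borel_measurable borel"
  using u v by (auto simp: fundamental_def)
 have one: "\<gamma> ** mat2 1 0 0 1 = \<gamma>" for \<gamma> :: "int^2^2" by (rule mat2_scalar_mult)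
 have bij: "bij_betw adj2 G G" by (rule bij_betw_byWitness[of _ adj2]) (use G in auto)
 have 1: "((\<lambda>\<gamma>. \<integral>z. of_real (v (moebius \<gamma> z)) * (of_real (u z) * \<Phi> z) \<partial>hyp) has_sum
   (2 * (\<integral>z. of_real (u z) * \<Phi> z \<partial>hyp))) G"
  using unfold_fundamental[OF v _ int(1) G(2), of "mat2 1 0 0 1"] by (simp add: one)
 have 2: "((\<lambda>\<gamma>. \<integral>z. of_real (u (moebius \<gamma> z)) * (of_real (v z) * \<Phi> z) \<partial>hyp) has_sum
   (2 * (\<integral>z. of_real (v z) * \<Phi> z \<partial>hyp))) G"
  using unfold_fundamental[OF u _ int(2) G(2), of "mat2 1 0 0 1"] by (simp add: one)
 have "(\<integral>z. of_real (v (moebius \<gamma> z)) * (of_real (u z) * \<Phi> z) \<partial>hyp) =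
    (\<integral>z. of_real (u (moebius (adj2 \<gamma>) z)) * (of_real (v z) * \<Phi> z) \<partial>hyp)" if "\<gamma> \<in> G" for \<gamma>
 proof -
  have d: "det \<gamma> = 1" using that G by auto
  have "(\<integral>z. of_real (u (moebius (adj2 \<gamma>) z)) * (of_real (v z) * \<Phi> z) \<partial>hyp) =
   (\<integral>z. of_real (u (moebius (adj2 \<gamma>) (moebius \<gamma> z))) * (of_real (v (moebius \<gamma> z)) * \<Phi> (moebius \<gamma> z)) \<partial>hyp)"
   by (rule integral_hyp_moebius[symmetric]) (auto simp: d)
  also have "... = (\<integral>z. of_real (v (moebius \<gamma> z)) * (of_real (u z) * \<Phi> z) \<partial>hyp)" using AE_hyp_H
   by (intro integral_cong_AE) (auto simp: moebius_adj2_left d inv that elim!: eventually_mono)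
  finally show ?thesis by simp
 qed
 hence "((\<lambda>\<gamma>. \<integral>z. of_real (u (moebius (adj2 \<gamma>) z)) * (of_real (v z) * \<Phi> z) \<partial>hyp) has_sum
   (2 * (\<integral>z. of_real (u z) * \<Phi> z \<partial>hyp))) G" using 1 by (subst has_sum_cong[symmetric]) auto
 hence "((\<lambda>\<gamma>. \<integral>z. of_real (u (moebius \<gamma> z)) * (of_real (v z) * \<Phi> z) \<partial>hyp) has_sum
   (2 * (\<integral>z. of_real (u z) * \<Phi> z \<partial>hyp))) G" using has_sum_reindex_bij_betw[OF bij] by blast
 from has_sum_unique[OF this 2] show ?thesis by simp
qed

subsection \<open>Growth of cusp forms\<close>

text \<open>The modulus of \<open>f\<close> made invariant under the weight \<open>\<kappa>\<close>
  action; its boundedness replaces the conditions at the cusps.\<close>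

definition growth :: "real => cfun => complex => real"
 where "growth \<kappa> f z = cmod (f z) * Im z powr (\<kappa> / 2)"

definition growth_bounded :: "real => cfun => bool"
 where "growth_bounded \<kappa> f \<longleftrightarrow> (\<exists>C. \<forall>z\<in>\<H>. growth \<kappa> f z \<le> C)"

lemma growth_nonneg [simp]: "growth \<kappa> f z \<ge> 0" by (simp add: growth_def)

lemma growth_boundedI: "(\<And>z. z \<in> \<H> ==> growth \<kappa> f z \<le> C) ==> growth_bounded \<kappa> f"
 by (auto simp: growth_bounded_def)

lemma growth_boundedE:
 assumes "growth_bounded \<kappa> f"
 obtains C where "C \<ge> 0" "\<And>z. z \<in> \<H> ==> growth \<kappa> f z \<le> C"
proof -
 from assms obtain C where C: "\<And>z. z \<in> \<H> ==> growth \<kappa> f z \<le> C" by (auto simp: growth_bounded_def)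
 have "\<i> \<in> \<H>" by (simp add: H_iff)
 from order_trans[OF growth_nonneg C[OF this]] C that show thesis by blast
qed

lemma norm_le_growth:
 assumes "z \<in> \<H>"
 shows "cmod (f z) = growth \<kappa> f z * Im z powr (- \<kappa> / 2)"
 using assms by (simp add: growth_def H_iff mult.assoc flip: powr_add)

lemma growth_moebius:
 assumes "det A > 0" "z \<in> \<H>"
 shows "growth \<kappa> f (moebius A z) =
  cmod (f (moebius A z)) * of_int (det A) powr (\<kappa> / 2) * cmod (cocycle A z) powr (- \<kappa>) * Im z powr (\<kappa> / 2)"
proof -
 have pos: "cmod (cocycle A z) > 0" "Im z > 0" using cocycle_nonzero[OF assms] assms by (auto simp: H_iff)
 have "(cmod (cocycle A z))\<^sup>2 powr (\<kappa> / 2) = cmod (cocycle A z) powr \<kappa>"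
  using pos by (simp add: powr_powr flip: powr_numeral)
 hence "Im (moebius A z) powr (\<kappa> / 2) = of_int (det A) powr (\<kappa> / 2) * Im z powr (\<kappa> / 2) / cmod (cocycle A z) powr \<kappa>"
  using assms pos by (simp add: Im_moebius powr_divide powr_mult)
 thus ?thesis by (simp add: growth_def powr_minus field_simps)
qed

lemma growth_add_le: "growth \<kappa> (\<lambda>z. f z + g z) z \<le> growth \<kappa> f z + growth \<kappa> g z"
 unfolding growth_def by (simp add: norm_triangle_ineq mult_right_mono flip: distrib_right)

lemma growth_cmult: "growth \<kappa> (\<lambda>z. c * f z) z = cmod c * growth \<kappa> f z" by (simp add: growth_def norm_mult)

lemma growth_bounded_0: "growth_bounded \<kappa> (\<lambda>_. 0)" by (rule growth_boundedI[of _ _ 0]) (simp add: growth_def)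

lemma growth_bounded_add:
 assumes "growth_bounded \<kappa> f" "growth_bounded \<kappa> g"
 shows "growth_bounded \<kappa> (\<lambda>z. f z + g z)"
proof -
 from assms obtain C D where "\<And>z. z \<in> \<H> ==> growth \<kappa> f z \<le> C" "\<And>z. z \<in> \<H> ==> growth \<kappa> g z \<le> D"
  by (auto simp: growth_bounded_def)
 thus ?thesis by (intro growth_boundedI[of _ _ "C + D"] order_trans[OF growth_add_le] add_mono) auto
qed

lemma growth_bounded_cmult:
 assumes "growth_bounded \<kappa> f"
 shows "growth_bounded \<kappa> (\<lambda>z. c * f z)"
proof -
 from assms obtain C where "\<And>z. z \<in> \<H> ==> growth \<kappa> f z \<le> C" by (auto simp: growth_bounded_def)
 thus ?thesis by (intro growth_boundedI[of _ _ "cmod c * C"]) (simp add: growth_cmult mult_left_mono)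
qed

lemma growth_bounded_sum:
 "(\<And>i. i \<in> I ==> growth_bounded \<kappa> (f i)) ==> growth_bounded \<kappa> (\<lambda>z. \<Sum>i\<in>I. f i z)"
 by (induction I rule: infinite_finite_induct) (auto simp: growth_bounded_0 growth_bounded_add)

lemma growth_bounded_affine:
 assumes "growth_bounded \<kappa> f" "a > 0" "d > 0"
 shows "growth_bounded \<kappa> (\<lambda>z. f ((of_real a * z + of_real b) / of_real d))"
proof -
 from assms(1) obtain C where C: "C \<ge> 0" "\<And>z. z \<in> \<H> ==> growth \<kappa> f z \<le> C" by (rule growth_boundedE) auto
 show ?thesis
 proof (rule growth_boundedI)
  fix z assume z: "z \<in> \<H>"
  let ?w = "(of_real a * z + of_real b) / of_real d"
  have Im: "Im ?w = a / d * Im z" using assms by simp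
  hence w: "?w \<in> \<H>" using z assms by (simp add: H_iff)
  have "Im z powr (\<kappa> / 2) = (d / a) powr (\<kappa> / 2) * Im ?w powr (\<kappa> / 2)"
   using z assms by (simp add: Im H_iff flip: powr_mult)
  hence "growth \<kappa> (\<lambda>z. f ((of_real a * z + of_real b) / of_real d)) z = (d / a) powr (\<kappa> / 2) * growth \<kappa> f ?w"
   by (simp add: growth_def)
  also have "... \<le> (d / a) powr (\<kappa> / 2) * C" using C(2)[OF w] by (intro mult_left_mono) auto
  finally show "growth \<kappa> (\<lambda>z. f ((of_real a * z + of_real b) / of_real d)) z \<le> (d / a) powr (\<kappa> / 2) * C" .
 qed
qed

lemma exp_times_powr_bounded:
 assumes "t > (0::real)"
 obtains C where "\<And>y. y \<ge> 1 / 2 ==> exp (- t * y) * y powr s \<le> C"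
proof -
 have "((\<lambda>y. exp (- t * y) * y powr s) \<longlongrightarrow> 0) at_top" using assms by real_asymp
 hence "\<forall>\<^sub>F y in at_top. exp (- t * y) * y powr s < 1" by (rule order_tendstoD) simp
 then obtain Y where Y: "\<And>y. y \<ge> Y ==> exp (- t * y) * y powr s < 1" by (auto simp: eventually_at_top_linorder)
 have "compact ((\<lambda>y. exp (- t * y) * y powr s) ` {1 / 2..Y})"
  by (intro compact_continuous_image continuous_intros) auto
 hence "bounded ((\<lambda>y. exp (- t * y) * y powr s) ` {1 / 2..Y})" by (rule compact_imp_bounded)
 then obtain B where "\<forall>x\<in>(\<lambda>y. exp (- t * y) * y powr s) ` {1 / 2..Y}. norm x \<le> B"
  unfolding bounded_iff by blast
 hence B: "exp (- t * y) * y powr s \<le> B" if "y \<in> {1 / 2..Y}" for y using that by fastforce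
 show thesis
 proof (rule that[of "max B 1"])
  fix y :: real assume "y \<ge> 1 / 2"
  thus "exp (- t * y) * y powr s \<le> max B 1" using Y[of y] B[of y] by (cases "y \<ge> Y") auto
 qed
qed

text \<open>Only powers of the automorphy factors are compared with \<open>cocycle\<close>, so that
  one argument covers both kinds of weight: \<open>m = 1\<close> for integral weight and
  \<open>m = 8\<close> for half-integral weight, with \<open>\<kappa> = e / m\<close>. What the
  comparison leaves open is a root of unity of order dividing \<open>m\<close>.\<close>

locale cusp_weight =
 fixes N :: nat and J \<mu> :: "int^2^2 => complex => complex" and m e :: nat and \<kappa> :: real
 assumes N: "N > 0" and m: "m > 0" and \<kappa>: "\<kappa> > 0" "real e = \<kappa> * real m"
  and J_power: "\<And>\<gamma> z. \<gamma> \<in> Gamma0 N ==> z \<in> \<H> ==> J \<gamma> z ^ m = cocycle \<gamma> z ^ e"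
  and \<mu>_power: "\<And>\<gamma> z. \<gamma> \<in> Gamma0 1 ==> z \<in> \<H> ==> \<mu> \<gamma> z ^ m = cocycle \<gamma> z ^ e"
  and J_continuous: "\<And>\<gamma>. \<gamma> \<in> Gamma0 N ==> continuous_on \<H> (J \<gamma>)"
  and \<mu>_holomorphic: "\<And>\<gamma>. \<gamma> \<in> Gamma0 1 ==> \<mu> \<gamma> holomorphic_on \<H>"
begin

lemma norm_powr_of_power:
 assumes "x ^ m = c ^ e" "c \<noteq> (0::complex)"
 shows "cmod x = cmod c powr \<kappa>"
proof -
 have "cmod x ^ m = cmod c ^ e" by (metis assms(1) norm_power)
 also have "... = (cmod c powr \<kappa>) ^ m" using assms(2) \<kappa> by (simp add: powr_powr flip: powr_realpow)
 finally show ?thesis using m by (metis norm_ge_zero power_eq_imp_eq_base powr_ge_zero)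
qed

lemma norm_J: "\<gamma> \<in> Gamma0 N ==> z \<in> \<H> ==> cmod (J \<gamma> z) = cmod (cocycle \<gamma> z) powr \<kappa>"
 using norm_powr_of_power[OF J_power] cocycle_nonzero[of \<gamma> z] by simp

lemma norm_\<mu>: "\<gamma> \<in> Gamma0 1 ==> z \<in> \<H> ==> cmod (\<mu> \<gamma> z) = cmod (cocycle \<gamma> z) powr \<kappa>"
 using norm_powr_of_power[OF \<mu>_power] cocycle_nonzero[of \<gamma> z] by simp

lemma \<mu>_nonzero: "\<gamma> \<in> Gamma0 1 ==> z \<in> \<H> ==> \<mu> \<gamma> z \<noteq> 0" using norm_\<mu>[of \<gamma> z] cocycle_nonzero[of \<gamma> z] by auto

lemma growth_invariant:
 assumes "f (moebius \<gamma> z) = J \<gamma> z * f z" "\<gamma> \<in> Gamma0 N" "z \<in> \<H>"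
 shows "growth \<kappa> f (moebius \<gamma> z) = growth \<kappa> f z"
proof -
 have "cocycle \<gamma> z \<noteq> 0" using cocycle_nonzero assms by simp
 thus ?thesis using assms norm_J[OF assms(2,3)]
  by (simp add: growth_moebius) (simp add: growth_def norm_mult powr_minus field_simps)
qed

lemma growth_slash:
 assumes "\<gamma> \<in> Gamma0 1" "z \<in> \<H>"
 shows "growth \<kappa> f (moebius \<gamma> z) = growth \<kappa> (\<lambda>z. f (moebius \<gamma> z) / \<mu> \<gamma> z) z"
proof -
 have "cocycle \<gamma> z \<noteq> 0" using cocycle_nonzero assms by simp
 thus ?thesis using assms norm_\<mu>[OF assms]
  by (simp add: growth_moebius) (simp add: growth_def norm_divide powr_minus field_simps)
qed

text \<open>The decay is exponential and absorbs any power of \<open>Im w\<close>. The form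
  \<open>C / Im w\<close> is enough to bound the growth function and to make it attain its
  maximum.\<close>

lemma cusp_forms_decay:
 assumes f: "f \<in> cusp_forms N J \<mu>" and \<rho>: "\<rho> \<in> Gamma0 1"
 obtains C where "C \<ge> 0" "\<And>w. Im w \<ge> 1 / 2 ==> growth \<kappa> f (moebius \<rho> w) \<le> C / Im w"
proof -
 from f \<rho> obtain h :: nat and a where ha: "h > 0" "a 0 = 0"
  "\<forall>z\<in>\<H>. (\<lambda>n. a n * exp (\<omega> * of_nat n * z / of_nat h)) sums (f (moebius \<rho> z) / \<mu> \<rho> z)"
  by (auto simp: cusp_forms_def vanishes_at_cusps_def)
 obtain B where B: "B \<ge> 0" "\<And>z. Im z \<ge> 1 / 2 ==> cmod (f (moebius \<rho> z) / \<mu> \<rho> z) \<le> B * exp (- 2 * pi * Im z / real h)"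
  using fourier_decay[OF ha(2,1) _ ha(3), of "1 / 2"] by auto
 obtain C where C: "\<And>y. y \<ge> 1 / 2 ==> exp (- (2 * pi / real h) * y) * y powr (\<kappa> / 2 + 1) \<le> C"
  using exp_times_powr_bounded[of "2 * pi / real h" "\<kappa> / 2 + 1"] ha(1) by auto
 show thesis
 proof
  have "0 \<le> exp (- (2 * pi / real h) * 1) * 1 powr (\<kappa> / 2 + 1)" by simp
  also have "... \<le> C" by (rule C) simp
  finally show "B * C \<ge> 0" using B(1) by simp
  fix w :: complex assume w: "Im w \<ge> 1 / 2"
  have "w \<in> \<H>" using w by (simp add: H_iff)
  hence "growth \<kappa> f (moebius \<rho> w) = cmod (f (moebius \<rho> w) / \<mu> \<rho> w) * Im w powr (\<kappa> / 2)"
   using growth_slash[OF \<rho>] by (simp add: growth_def)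
  also have "... \<le> B * exp (- 2 * pi * Im w / real h) * Im w powr (\<kappa> / 2)"
   using B(2)[OF w] by (intro mult_right_mono) auto
  also have "... = B * (exp (- (2 * pi / real h) * Im w) * Im w powr (\<kappa> / 2 + 1)) / Im w"
   using w by (simp add: powr_add)
  also have "... \<le> B * C / Im w" using w by (intro divide_right_mono mult_left_mono C B(1)) auto
  finally show "growth \<kappa> f (moebius \<rho> w) \<le> B * C / Im w" .
 qed
qed

text \<open>Every point is a \<open>Gamma0 N\<close>-translate of some \<open>\<rho> w\<close> with
  \<open>w\<close> in the level 1 domain, where \<open>Im w \<ge> 1 / 2\<close>; finitely many
  expansions then control \<open>f\<close> everywhere.\<close>

lemma ex_coset_moebius:
 assumes R: "\<And>\<gamma>. \<gamma> \<in> Gamma0 1 ==> \<exists>\<rho>\<in>R. \<exists>\<eta>\<in>Gamma0 N. \<gamma> = \<eta> ** \<rho>" "R \<subseteq> Gamma0 1"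
  and f: "\<And>\<gamma> z. \<gamma> \<in> Gamma0 N ==> z \<in> \<H> ==> f (moebius \<gamma> z) = J \<gamma> z * f z" and z: "z \<in> \<H>"
 obtains \<rho> w where "\<rho> \<in> R" "w \<in> ford_domain 1" "growth \<kappa> f z = growth \<kappa> f (moebius \<rho> w)"
proof -
 from ex_moebius_in_ford_domain[OF z, of 1] obtain \<delta> where \<delta>: "\<delta> \<in> Gamma0 1" "moebius \<delta> z \<in> ford_domain 1" by blast
 define w where "w = moebius \<delta> z"
 have w: "w \<in> \<H>" using \<delta> ford_domain_subset_H by (auto simp: w_def)
 from R(1)[OF Gamma0_adj2[OF \<delta>(1)]] obtain \<rho> \<eta> where \<rho>: "\<rho> \<in> R" "\<eta> \<in> Gamma0 N" "adj2 \<delta> = \<eta> ** \<rho>" by blast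
 have d: "det \<rho> = 1" "det \<eta> = 1" "det \<delta> = 1" using \<rho> R(2) \<delta> by auto
 have "z = moebius (adj2 \<delta>) w" using z d by (simp add: w_def moebius_adj2_left)
 also have "... = moebius \<eta> (moebius \<rho> w)" using w d unfolding \<rho>(3) by (simp add: moebius_mult)
 finally have "growth \<kappa> f z = growth \<kappa> f (moebius \<rho> w)"
  using growth_invariant[OF f \<rho>(2), of "moebius \<rho> w"] \<rho>(2) w d by auto
 with \<rho>(1) \<delta>(2) show thesis by (intro that) (auto simp: w_def)
qed

lemma cusp_forms_growth_bounded:
 assumes f: "f \<in> cusp_forms N J \<mu>"
 shows "growth_bounded \<kappa> f"
proof -
 have trans: "f (moebius \<gamma> z) = J \<gamma> z * f z" if "\<gamma> \<in> Gamma0 N" "z \<in> \<H>" for \<gamma> z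
  using f that by (auto simp: cusp_forms_def)
 from finite_coset_reps[OF N] obtain R where R: "finite R" "R \<subseteq> Gamma0 1"
  "\<And>\<gamma>. \<gamma> \<in> Gamma0 1 ==> \<exists>\<rho>\<in>R. \<exists>\<eta>\<in>Gamma0 N. \<gamma> = \<eta> ** \<rho>" by blast
 have "\<exists>C\<ge>0. \<forall>w. Im w \<ge> 1 / 2 \<longrightarrow> growth \<kappa> f (moebius \<rho> w) \<le> C / Im w" if "\<rho> \<in> R" for \<rho>
  using cusp_forms_decay[OF f, of \<rho>] R(2) that by (metis subsetD)
 then obtain C where C: "\<And>\<rho>. \<rho> \<in> R ==> C \<rho> \<ge> 0"
  "\<And>\<rho> w. \<rho> \<in> R ==> Im w \<ge> 1 / 2 ==> growth \<kappa> f (moebius \<rho> w) \<le> C \<rho> / Im w" by metis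
 show ?thesis
 proof (rule growth_boundedI)
  fix z assume z: "z \<in> \<H>"
  obtain \<rho> w where \<rho>: "\<rho> \<in> R" "w \<in> ford_domain 1" "growth \<kappa> f z = growth \<kappa> f (moebius \<rho> w)"
   by (rule ex_coset_moebius[OF R(3,2) trans z])
  have w: "Im w \<ge> 1 / 2" using Im_ford_domain_1 \<rho> by auto
  have "growth \<kappa> f z \<le> C \<rho> / Im w" using C(2) \<rho> w by auto
  also have "... \<le> C \<rho> / (1 / 2)" using C(1)[OF \<rho>(1)] w by (intro divide_left_mono) auto
  also have "... \<le> (\<Sum>\<rho>\<in>R. 2 * C \<rho>)"
   using member_le_sum[of \<rho> R "\<lambda>\<rho>. 2 * C \<rho>"] \<rho>(1) R(1) C(1) by (simp add: mult.commute)
  finally show "growth \<kappa> f z \<le> (\<Sum>\<rho>\<in>R. 2 * C \<rho>)" .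
 qed
qed

text \<open>\<open>f\<close> slashed with \<open>\<gamma>\<close> is periodic up to a root of unity, and the growth bound forces
  its Fourier expansion to have no constant term.\<close>
lemma cusp_formsI:
 assumes hol: "f holomorphic_on \<H>" and zero: "\<And>z. z \<notin> \<H> ==> f z = 0"
  and trans: "\<And>\<gamma> z. \<gamma> \<in> Gamma0 N ==> z \<in> \<H> ==> f (moebius \<gamma> z) = J \<gamma> z * f z"
  and growth: "growth_bounded \<kappa> f"
 shows "f \<in> cusp_forms N J \<mu>"
proof -
 from growth obtain C where C: "C \<ge> 0" "\<And>z. z \<in> \<H> ==> growth \<kappa> f z \<le> C" by (rule growth_boundedE) auto
 have "\<exists>h>0. \<exists>a::nat => complex. a 0 = 0 \<and> (\<forall>z\<in>\<H>.
    (\<lambda>n. a n * exp (\<omega> * of_nat n * z / of_nat h)) sums (f (moebius \<gamma> z) / \<mu> \<gamma> z))"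
  if \<gamma>: "\<gamma> \<in> Gamma0 1" for \<gamma>
 proof -
  define F where "F z = f (moebius \<gamma> z) / \<mu> \<gamma> z" for z
  have d\<gamma>: "det \<gamma> = 1" using \<gamma> by simp
  have "(f \<circ> moebius \<gamma>) holomorphic_on \<H>"
   by (rule holomorphic_on_compose_gen[OF holomorphic_moebius hol]) (auto simp: d\<gamma>)
  hence Fhol: "F holomorphic_on \<H>"
   unfolding F_def[abs_def] o_def using \<mu>_nonzero[OF \<gamma>] by (intro holomorphic_on_divide \<mu>_holomorphic \<gamma>) auto
  \<comment> \<open>The conjugate \<open>\<gamma> T^N \<gamma>^(-1)\<close> lies in
    \<open>Gamma0 N\<close> because it is the identity modulo \<open>N\<close>.\<close>
  define \<delta> where "\<delta> = \<gamma> ** mat2 1 (int N) 0 1 ** adj2 \<gamma>"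
  have \<delta>: "\<delta> \<in> Gamma0 N" using d\<gamma> by (auto simp: \<delta>_def Gamma0_iff det_mul matmul_nth algebra_simps)
  have \<delta>\<gamma>: "\<delta> ** \<gamma> = \<gamma> ** mat2 1 (int N) 0 1"
  proof -
   have "\<delta> ** \<gamma> = \<gamma> ** mat2 1 (int N) 0 1 ** (adj2 \<gamma> ** \<gamma>)" by (simp add: \<delta>_def matrix_mul_assoc)
   thus ?thesis by (simp add: adj2_mult_self d\<gamma> mat2_scalar_mult)
  qed
  have T: "moebius (mat2 1 (int N) 0 1) z = z + of_nat N" for z by (simp add: moebius_mat2)
  have shiftH: "z + of_nat N \<in> \<H>" if "z \<in> \<H>" for z using that by (simp add: H_iff)
  define \<zeta> where "\<zeta> z = J \<delta> (moebius \<gamma> z) * \<mu> \<gamma> z / \<mu> \<gamma> (z + of_nat N)" for z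
  have F_shift: "F (z + of_nat N) = \<zeta> z * F z" if z: "z \<in> \<H>" for z
  proof -
   have "moebius \<gamma> (z + of_nat N) = moebius \<delta> (moebius \<gamma> z)"
    using moebius_mult[of \<delta> \<gamma> z] moebius_mult[of \<gamma> "mat2 1 (int N) 0 1" z] \<delta> d\<gamma> z by (simp add: \<delta>\<gamma> T)
   hence "f (moebius \<gamma> (z + of_nat N)) = J \<delta> (moebius \<gamma> z) * f (moebius \<gamma> z)"
    using trans[OF \<delta>, of "moebius \<gamma> z"] z d\<gamma> by simp
   thus ?thesis using \<mu>_nonzero[OF \<gamma> z] by (simp add: F_def \<zeta>_def)
  qed
  have \<zeta>m: "\<zeta> z ^ m = 1" if z: "z \<in> \<H>" for z
  proof -
   have "cocycle \<delta> (moebius \<gamma> z) * cocycle \<gamma> z = cocycle \<gamma> (z + of_nat N)"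
    using cocycle_mult[of \<gamma> z \<delta>] cocycle_mult[of "mat2 1 (int N) 0 1" z \<gamma>] \<delta> d\<gamma> z by (simp add: \<delta>\<gamma> T)
   hence "(cocycle \<delta> (moebius \<gamma> z) * cocycle \<gamma> z) ^ e / cocycle \<gamma> (z + of_nat N) ^ e = 1"
    using cocycle_nonzero[of \<gamma> "z + of_nat N"] d\<gamma> shiftH[OF z] by simp
   thus ?thesis using J_power[OF \<delta>, of "moebius \<gamma> z"] \<mu>_power[OF \<gamma>] z shiftH[OF z] d\<gamma>
    by (simp add: \<zeta>_def power_divide power_mult_distrib)
  qed
  \<comment> \<open>A continuous function with finitely many values on a connected set is constant;
    hence the multiplier of \<open>F\<close> under \<open>z + N\<close> is one fixed root of
    unity.\<close>
  have "continuous_on \<H> \<zeta>" unfolding \<zeta>_def using \<mu>_nonzero[OF \<gamma>] shiftH d\<gamma>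
   by (intro continuous_intros continuous_on_compose2[OF J_continuous[OF \<delta>] continuous_on_moebius]
     continuous_on_compose2[OF holomorphic_on_imp_continuous_on[OF \<mu>_holomorphic[OF \<gamma>]]]) auto
  moreover have "finite (\<zeta> ` \<H>)"
   by (rule finite_subset[of _ "{x. x ^ m = 1}"]) (use \<zeta>m m in \<open>auto intro!: finite_roots_unity\<close>)
  ultimately have "\<zeta> constant_on \<H>" by (intro continuous_finite_range_constant) auto
  then obtain \<zeta>0 where \<zeta>0: "\<And>z. z \<in> \<H> ==> \<zeta> z = \<zeta>0" by (auto simp: constant_on_def)
  have "\<i> \<in> \<H>" by (simp add: H_iff)
  with \<zeta>m[of \<i>] \<zeta>0 have \<zeta>0m: "\<zeta>0 ^ m = 1" by auto
  have F_shift': "F (z + of_nat j * of_nat N) = \<zeta>0 ^ j * F z" if z: "z \<in> \<H>" for z j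
  proof (induction j)
   case (Suc j)
   have "z + of_nat j * of_nat N \<in> \<H>" using z by (simp add: H_iff)
   from F_shift[OF this] \<zeta>0[OF this] Suc show ?case by (simp add: algebra_simps)
  qed simp
  \<comment> \<open>After \<open>m\<close> steps of length \<open>N\<close> the root of unity
    disappears, so \<open>m * N\<close> is a true period.\<close>
  define h where "h = m * N"
  have h: "h > 0" using m N by (simp add: h_def)
  have hH: "of_nat h * z \<in> \<H>" if "z \<in> \<H>" for z using that h by (simp add: H_iff)
  obtain a where a: "a 0 = 0"
   "\<And>z. z \<in> \<H> ==> (\<lambda>n. a n * exp (\<omega> * of_nat n * z)) sums F (of_nat h * z)"
  proof (rule fourier_expansion)
   have "(F \<circ> (\<lambda>z. of_nat h * z)) holomorphic_on \<H>"
    by (rule holomorphic_on_compose_gen[OF _ Fhol]) (use hH in \<open>auto intro!: holomorphic_intros\<close>)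
   thus "(\<lambda>z. F (of_nat h * z)) holomorphic_on \<H>" by (simp add: o_def)
   show "F (of_nat h * (z + 1)) = F (of_nat h * z)" if "z \<in> \<H>" for z
    using F_shift'[OF hH[OF that], of m] \<zeta>0m by (simp add: h_def algebra_simps)
   show "cmod (F (of_nat h * z)) \<le> (C * real h powr (- \<kappa> / 2)) * Im z powr - (\<kappa> / 2)" if z: "z \<in> \<H>" for z
   proof -
    have "cmod (F (of_nat h * z)) = growth \<kappa> F (of_nat h * z) * Im (of_nat h * z) powr (- \<kappa> / 2)"
     by (rule norm_le_growth[OF hH[OF z]])
    also have "growth \<kappa> F (of_nat h * z) = growth \<kappa> f (moebius \<gamma> (of_nat h * z))"
     unfolding F_def[abs_def] by (rule growth_slash[symmetric, OF \<gamma> hH[OF z]])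
    also have "... * Im (of_nat h * z) powr (- \<kappa> / 2) \<le> C * Im (of_nat h * z) powr (- \<kappa> / 2)"
     using hH[OF z] d\<gamma> by (intro mult_right_mono C) auto
    also have "... = (C * real h powr (- \<kappa> / 2)) * Im z powr - (\<kappa> / 2)"
     using z by (simp add: powr_mult H_iff)
    finally show ?thesis .
   qed
   show "\<kappa> / 2 > 0" using \<kappa> by simp
  qed auto
  have "(\<lambda>n. a n * exp (\<omega> * of_nat n * z / of_nat h)) sums F z" if "z \<in> \<H>" for z
   using a(2)[of "z / of_nat h"] that h by (simp add: H_iff)
  with h a(1) show ?thesis unfolding F_def by blast
 qed
 hence "vanishes_at_cusps \<mu> f" unfolding vanishes_at_cusps_def by blast
 thus ?thesis using hol zero trans by (auto simp: cusp_forms_def)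
qed

text \<open>Trades the expansions at all cusps for a single bound; later proofs of membership in a
  space of cusp forms go through it.\<close>

lemma cusp_forms_iff:
 "f \<in> cusp_forms N J \<mu> \<longleftrightarrow> f holomorphic_on \<H> \<and> (\<forall>z. z \<notin> \<H> \<longrightarrow> f z = 0) \<and>
  (\<forall>\<gamma>\<in>Gamma0 N. \<forall>z\<in>\<H>. f (moebius \<gamma> z) = J \<gamma> z * f z) \<and> growth_bounded \<kappa> f"
 using cusp_forms_growth_bounded[of f] cusp_formsI[of f] by (auto simp: cusp_forms_def)

lemma subspace_cusp_forms: "fun_vs.subspace (cusp_forms N J \<mu>)"
proof (rule fun_vs.subspaceI)
 show "0 \<in> cusp_forms N J \<mu>" by (simp add: cusp_forms_iff zero_fun_def growth_bounded_0)
 show "f + g \<in> cusp_forms N J \<mu>" if "f \<in> cusp_forms N J \<mu>" "g \<in> cusp_forms N J \<mu>" for f g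
  using that by (auto simp: cusp_forms_iff plus_fun_def growth_bounded_add algebra_simps intro!: holomorphic_intros)
 show "(\<lambda>z. c * f z) \<in> cusp_forms N J \<mu>" if "f \<in> cusp_forms N J \<mu>" for c f
  using that by (auto simp: cusp_forms_iff growth_bounded_cmult intro!: holomorphic_intros)
qed

lemma cusp_forms_growth_max:
 assumes f: "f \<in> cusp_forms N J \<mu>"
 obtains z0 where "z0 \<in> \<H>" "\<And>z. z \<in> \<H> ==> growth \<kappa> f z \<le> growth \<kappa> f z0"
proof (cases "\<exists>z\<in>\<H>. growth \<kappa> f z > 0")
 case False
 hence "growth \<kappa> f z \<le> growth \<kappa> f \<i>" if "z \<in> \<H>" for z
  using that growth_nonneg[of \<kappa> f \<i>] by (meson not_less order_trans)
 thus thesis by (intro that[of \<i>]) (auto simp: H_iff)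
next
 case True
 then obtain z1 where z1: "z1 \<in> \<H>" "growth \<kappa> f z1 > 0" by blast
 from f have hol: "f holomorphic_on \<H>" and trans: "\<And>\<gamma> z. \<gamma> \<in> Gamma0 N ==> z \<in> \<H> ==> f (moebius \<gamma> z) = J \<gamma> z * f z"
  by (auto simp: cusp_forms_def)
 from finite_coset_reps[OF N] obtain R where R: "finite R" "R \<subseteq> Gamma0 1"
  "\<And>\<gamma>. \<gamma> \<in> Gamma0 1 ==> \<exists>\<rho>\<in>R. \<exists>\<eta>\<in>Gamma0 N. \<gamma> = \<eta> ** \<rho>" by blast
 have "\<exists>C\<ge>0. \<forall>w. Im w \<ge> 1 / 2 \<longrightarrow> growth \<kappa> f (moebius \<rho> w) \<le> C / Im w" if "\<rho> \<in> R" for \<rho>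
  using cusp_forms_decay[OF f, of \<rho>] R(2) that by (metis subsetD)
 then obtain C where C: "\<And>\<rho>. \<rho> \<in> R ==> C \<rho> \<ge> 0"
  "\<And>\<rho> w. \<rho> \<in> R ==> Im w \<ge> 1 / 2 ==> growth \<kappa> f (moebius \<rho> w) \<le> C \<rho> / Im w" by metis
 \<comment> \<open>Above height \<open>Y\<close> the decay pushes every translate below the value at
   \<open>z1\<close>, so the maximum over the compact set \<open>X\<close> is the global
   one.\<close>
 define Y where "Y = (\<Sum>\<rho>\<in>R. C \<rho>) / growth \<kappa> f z1"
 define K where "K = cbox (Complex (- 1 / 2) (1 / 2)) (Complex (1 / 2) Y)"
 have KH: "K \<subseteq> \<H>" by (auto simp: K_def mem_box Basis_complex_def H_iff)
 define X where "X = insert z1 (\<Union>\<rho>\<in>R. moebius \<rho> ` K)"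
 have det: "det \<rho> = 1" if "\<rho> \<in> R" for \<rho> using R(2) that by auto
 have XH: "X \<subseteq> \<H>" using z1 KH det by (auto simp: X_def)
 have "compact X" unfolding X_def using R(1) KH det
  by (intro compact_insert compact_UN compact_continuous_image continuous_on_subset[OF continuous_on_moebius])
    (auto simp: K_def)
 moreover have "continuous_on X (growth \<kappa> f)"
 proof -
  have "continuous_on \<H> (growth \<kappa> f)" unfolding growth_def using hol
   by (intro continuous_intros holomorphic_on_imp_continuous_on) (auto simp: H_iff)
  thus ?thesis using XH by (rule continuous_on_subset)
 qed
 ultimately obtain z0 where z0: "z0 \<in> X" "\<And>z. z \<in> X ==> growth \<kappa> f z \<le> growth \<kappa> f z0"
  using continuous_attains_sup[of X "growth \<kappa> f"] by (auto simp: X_def)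
 show thesis
 proof (rule that)
  show "z0 \<in> \<H>" using z0 XH by auto
  fix z assume z: "z \<in> \<H>"
  obtain \<rho> w where \<rho>: "\<rho> \<in> R" "w \<in> ford_domain 1" "growth \<kappa> f z = growth \<kappa> f (moebius \<rho> w)"
   by (rule ex_coset_moebius[OF R(3,2) trans z])
  have w: "Im w \<ge> 1 / 2" using Im_ford_domain_1 \<rho> by auto
  show "growth \<kappa> f z \<le> growth \<kappa> f z0"
  proof (cases "Im w \<le> Y")
   case True
   hence "w \<in> K" using w \<rho>(2) by (auto simp: K_def mem_box Basis_complex_def ford_domain_def)
   hence "moebius \<rho> w \<in> X" using \<rho>(1) by (auto simp: X_def)
   thus ?thesis using z0(2) \<rho>(3) by simp
  next
   case False
   have "growth \<kappa> f z \<le> C \<rho> / Im w" using C(2) \<rho> w by auto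
   also have "... \<le> (\<Sum>\<rho>\<in>R. C \<rho>) / Im w"
    using member_le_sum[of \<rho> R C] \<rho>(1) R(1) C(1) w by (intro divide_right_mono) auto
   also have "... \<le> growth \<kappa> f z1" using False w z1(2) by (simp add: Y_def field_simps)
   also have "... \<le> growth \<kappa> f z0" by (rule z0(2)) (simp add: X_def)
   finally show ?thesis .
  qed
 qed
qed

lemma cusp_forms_has_qexp:
 assumes f: "f \<in> cusp_forms N J \<mu>" and T: "\<And>z. z \<in> \<H> ==> J (mat2 1 1 0 1) z = 1"
 obtains a where "has_qexp f a" "a 0 = 0"
proof -
 from f have f': "f holomorphic_on \<H>" "\<And>z. z \<notin> \<H> ==> f z = 0"
  "\<And>\<gamma> z. \<gamma> \<in> Gamma0 N ==> z \<in> \<H> ==> f (moebius \<gamma> z) = J \<gamma> z * f z" "growth_bounded \<kappa> f"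
  by (auto simp: cusp_forms_iff)
 from f'(4) obtain C where C: "\<And>z. z \<in> \<H> ==> growth \<kappa> f z \<le> C" by (rule growth_boundedE) auto
 obtain a where "a 0 = 0" "\<And>z. z \<in> \<H> ==> (\<lambda>n. a n * exp (\<omega> * of_nat n * z)) sums f z"
 proof (rule fourier_expansion[OF f'(1)])
  show "f (z + 1) = f z" if "z \<in> \<H>" for z
   using f'(3)[OF Gamma0_T[of 1] that] T[OF that] by (simp add: moebius_mat2)
  show "cmod (f z) \<le> C * Im z powr - (\<kappa> / 2)" if "z \<in> \<H>" for z
   using C[OF that] by (simp add: norm_le_growth[OF that, of f \<kappa>] mult_right_mono)
  show "\<kappa> / 2 > 0" using \<kappa> by simp
 qed auto
 thus thesis using f'(2) by (intro that[of a]) (auto simp: has_qexp_def)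
qed

end

subsection \<open>The Petersson product\<close>

lemma measurable_cnj [measurable]: "cnj \<in> borel_measurable borel"
 by (intro borel_measurable_continuous_onI continuous_intros)

lemma petersson_hyp:
 assumes [measurable]: "f \<in> borel_measurable borel" "g \<in> borel_measurable borel"
 shows "petersson w N f g =
  (\<integral>z. of_real (indicator (ford_domain N) z) * (f z * cnj (g z) * of_real (Im z powr w)) \<partial>hyp)"
proof -
 have [measurable]: "ford_domain N \<in> sets lborel" by simp
 have "petersson w N f g = (\<integral>z. indicator (ford_domain N) z *\<^sub>R
   (f z * cnj (g z) * of_real (Im z powr w / (Im z)\<^sup>2)) \<partial>lborel)"
  by (simp add: petersson_def set_lebesgue_integral_def)
 also have "... = (\<integral>z. (indicator \<H> z / (Im z)\<^sup>2) *\<^sub>R (of_real (indicator (ford_domain N) z) *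
   (f z * cnj (g z) * of_real (Im z powr w))) \<partial>lborel)" using ford_domain_subset_H[of N]
  by (intro Bochner_Integration.integral_cong) (auto simp: indicator_def scaleR_conv_of_real)
 also have "... = (\<integral>z. of_real (indicator (ford_domain N) z) * (f z * cnj (g z) * of_real (Im z powr w)) \<partial>hyp)"
  unfolding hyp_def by (subst integral_density) auto
 finally show ?thesis .
qed

lemma holomorphic_H_measurable:
 assumes "f holomorphic_on \<H>" "\<And>z. z \<notin> \<H> ==> f z = 0"
 shows "f \<in> borel_measurable borel"
proof -
 have "(\<lambda>z. indicator \<H> z *\<^sub>R f z) \<in> borel_measurable borel"
  using assms(1) by (intro borel_measurable_continuous_on_indicator holomorphic_on_imp_continuous_on) auto
 also have "(\<lambda>z. indicator \<H> z *\<^sub>R f z) = f" using assms(2) by (auto simp: indicator_def fun_eq_iff)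
 finally show ?thesis .
qed

text \<open>\<open>cuspidal \<kappa> f\<close> collects the properties of weight-\<open>\<kappa>\<close> cusp forms that do not depend on
  the automorphy factor; they suffice for the Petersson integrals to converge.\<close>
definition cuspidal :: "real => cfun => bool"
 where "cuspidal \<kappa> f \<longleftrightarrow> f holomorphic_on \<H> \<and> (\<forall>z. z \<notin> \<H> \<longrightarrow> f z = 0) \<and> growth_bounded \<kappa> f"

lemma (in cusp_weight) cusp_forms_cuspidal: "f \<in> cusp_forms N J \<mu> ==> cuspidal \<kappa> f"
 by (simp add: cusp_forms_iff cuspidal_def)

lemma cuspidal_measurable: "cuspidal \<kappa> f ==> f \<in> borel_measurable borel"
 by (auto simp: cuspidal_def intro: holomorphic_H_measurable)

definition pet_integrand :: "real => cfun => cfun => cfun"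
 where "pet_integrand \<kappa> f g z = f z * cnj (g z) * of_real (Im z powr \<kappa>)"

lemma pet_integrand_measurable:
 assumes "cuspidal \<kappa> f" "cuspidal \<kappa> g"
 shows "pet_integrand \<kappa> f g \<in> borel_measurable borel"
proof -
 note [measurable] = assms[THEN cuspidal_measurable]
 show ?thesis unfolding pet_integrand_def by measurable
qed

lemma norm_pet_integrand:
 assumes "z \<in> \<H>"
 shows "cmod (pet_integrand \<kappa> f g z) = growth \<kappa> f z * growth \<kappa> g z"
proof -
 have "Im z powr \<kappa> = Im z powr (\<kappa> / 2) * Im z powr (\<kappa> / 2)" by (simp flip: powr_add)
 thus ?thesis by (simp add: pet_integrand_def growth_def norm_mult)
qed

text \<open>The integrand is bounded by the product of the two growth bounds, so any weight
  \<open>u\<close> of finite mass will do: the Ford domain, its translates, and later a union of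
  four of them.\<close>

lemma integrable_pet_integrand:
 assumes f: "cuspidal \<kappa> f" and g: "cuspidal \<kappa> g"
  and u: "u \<in> borel_measurable borel" "\<And>z. 0 \<le> u z" "(\<integral>\<^sup>+z. ennreal (u z) \<partial>hyp) < \<infinity>"
 shows "integrable hyp (\<lambda>z. of_real (u z) * pet_integrand \<kappa> f g z)"
proof -
 note [measurable] = pet_integrand_measurable[OF f g] u(1)
 from f obtain C where C: "C \<ge> 0" "\<And>z. z \<in> \<H> ==> growth \<kappa> f z \<le> C"
  by (auto simp: cuspidal_def elim: growth_boundedE)
 from g obtain D where D: "D \<ge> 0" "\<And>z. z \<in> \<H> ==> growth \<kappa> g z \<le> D"
  by (auto simp: cuspidal_def elim: growth_boundedE)
 show ?thesis
 proof (rule integrableI_bounded)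
  have "(\<integral>\<^sup>+z. ennreal (norm (of_real (u z) * pet_integrand \<kappa> f g z)) \<partial>hyp) \<le>
    (\<integral>\<^sup>+z. ennreal (C * D) * ennreal (u z) \<partial>hyp)"
  proof (rule nn_integral_mono_AE)
   show "AE z in hyp. ennreal (norm (of_real (u z) * pet_integrand \<kappa> f g z)) \<le> ennreal (C * D) * ennreal (u z)"
    using AE_hyp_H
   proof eventually_elim
    case (elim z)
    have "growth \<kappa> f z * growth \<kappa> g z \<le> C * D" using C D elim by (intro mult_mono) auto
    hence "norm (of_real (u z) * pet_integrand \<kappa> f g z) \<le> C * D * u z"
     using u(2)[of z] norm_pet_integrand[OF elim, of \<kappa> f g]
     by (simp add: norm_mult mult_left_mono mult.commute)
    hence "ennreal (norm (of_real (u z) * pet_integrand \<kappa> f g z)) \<le> ennreal (C * D * u z)"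
     by (rule ennreal_leI)
    also have "... = ennreal (C * D) * ennreal (u z)" using C D u(2)[of z] by (simp add: ennreal_mult)
    finally show ?case .
   qed
  qed
  also have "... = ennreal (C * D) * (\<integral>\<^sup>+z. ennreal (u z) \<partial>hyp)" by (rule nn_integral_cmult) auto
  also have "... < \<infinity>" using u(3) by (simp add: ennreal_mult_less_top)
  finally show "(\<integral>\<^sup>+z. ennreal (norm (of_real (u z) * pet_integrand \<kappa> f g z)) \<partial>hyp) < \<infinity>" .
 qed auto
qed

lemma petersson_eq_integral:
 assumes "cuspidal \<kappa> f" "cuspidal \<kappa> g"
 shows "petersson \<kappa> N f g = (\<integral>z. of_real (indicator (ford_domain N) z) * pet_integrand \<kappa> f g z \<partial>hyp)"
 using petersson_hyp[OF assms[THEN cuspidal_measurable]] by (simp add: pet_integrand_def)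

lemma nn_integral_ford_domain:
 "N > 0 ==> (\<integral>\<^sup>+z. ennreal (indicator (ford_domain N) z) \<partial>hyp) < \<infinity>"
 using emeasure_hyp_ford_domain[of N] by (simp add: ennreal_indicator)

lemma integrable_petersson:
 assumes "N > 0" "cuspidal \<kappa> f" "cuspidal \<kappa> g"
 shows "integrable hyp (\<lambda>z. of_real (indicator (ford_domain N) z) * pet_integrand \<kappa> f g z)"
 using assms nn_integral_ford_domain by (intro integrable_pet_integrand) auto

lemma cuspidal_add: "cuspidal \<kappa> f ==> cuspidal \<kappa> g ==> cuspidal \<kappa> (\<lambda>z. f z + g z)"
 by (auto simp: cuspidal_def intro!: holomorphic_intros growth_bounded_add)

lemma cuspidal_cmult: "cuspidal \<kappa> f ==> cuspidal \<kappa> (\<lambda>z. c * f z)"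
 by (auto simp: cuspidal_def intro!: holomorphic_intros growth_bounded_cmult)

lemma petersson_add_left:
 assumes "N > 0" "cuspidal \<kappa> f" "cuspidal \<kappa> g" "cuspidal \<kappa> h"
 shows "petersson \<kappa> N (\<lambda>z. f z + g z) h = petersson \<kappa> N f h + petersson \<kappa> N g h"
proof -
 have "of_real (indicator (ford_domain N) z) * pet_integrand \<kappa> (\<lambda>z. f z + g z) h z =
  of_real (indicator (ford_domain N) z) * pet_integrand \<kappa> f h z +
  of_real (indicator (ford_domain N) z) * pet_integrand \<kappa> g h z" for z
  by (simp add: pet_integrand_def algebra_simps)
 thus ?thesis using assms integrable_petersson[of N \<kappa>] by (simp add: petersson_eq_integral cuspidal_add)
qed

lemma petersson_cmult_left:
 assumes "cuspidal \<kappa> f" "cuspidal \<kappa> h"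
 shows "petersson \<kappa> N (\<lambda>z. c * f z) h = c * petersson \<kappa> N f h"
proof -
 have eq: "(\<lambda>z. of_real (indicator (ford_domain N) z) * pet_integrand \<kappa> (\<lambda>z. c * f z) h z) =
  (\<lambda>z. c * (of_real (indicator (ford_domain N) z) * pet_integrand \<kappa> f h z))"
  by (simp add: pet_integrand_def algebra_simps)
 show ?thesis
  unfolding petersson_eq_integral[OF cuspidal_cmult[OF assms(1)] assms(2)] petersson_eq_integral[OF assms] eq
  by (rule integral_mult_right_zero)
qed

lemma petersson_cnj: "cnj (petersson \<kappa> N f g) = petersson \<kappa> N g f"
 unfolding petersson_def set_lebesgue_integral_def
 by (subst Bochner_Integration.integral_cnj[symmetric]) (intro Bochner_Integration.integral_cong, auto)

text \<open>The Ford domain of every level contains the part of the open strip above height 1, as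
  \<open>|c z + d| \<ge> |c| Im z\<close>. A vanishing integral forces \<open>f\<close> to vanish on
  this open set, hence everywhere.\<close>

lemma petersson_definite:
 assumes N: "N > 0" and f: "cuspidal \<kappa> f" and eq: "petersson \<kappa> N f f = 0"
 shows "f = (\<lambda>_. 0)"
proof -
 let ?D = "indicator (ford_domain N) :: complex => real"
 have fH: "f holomorphic_on \<H>" and f0: "\<And>z. z \<notin> \<H> ==> f z = 0" using f by (auto simp: cuspidal_def)
 have re: "of_real (?D z) * pet_integrand \<kappa> f f z = of_real (?D z * (cmod (f z))\<^sup>2 * Im z powr \<kappa>)" for z
  unfolding pet_integrand_def by (simp add: complex_norm_square[unfolded of_real_power])
 have "integrable hyp (\<lambda>z. complex_of_real (?D z * (cmod (f z))\<^sup>2 * Im z powr \<kappa>))"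
  using integrable_petersson[OF N f f] unfolding re .
 hence int: "integrable hyp (\<lambda>z. ?D z * (cmod (f z))\<^sup>2 * Im z powr \<kappa>)"
  by (simp only: complex_of_real_integrable_eq)
 have "complex_of_real (\<integral>z. ?D z * (cmod (f z))\<^sup>2 * Im z powr \<kappa> \<partial>hyp) = petersson \<kappa> N f f"
  unfolding petersson_eq_integral[OF f f] re by (rule integral_complex_of_real[symmetric])
 hence "(\<integral>z. ?D z * (cmod (f z))\<^sup>2 * Im z powr \<kappa> \<partial>hyp) = 0" unfolding eq by (simp only: of_real_eq_0_iff)
 hence ae: "AE z in hyp. ?D z * (cmod (f z))\<^sup>2 * Im z powr \<kappa> = 0"
  using integral_nonneg_eq_0_iff_AE[OF int] by auto
 define S where "S = {z. \<bar>Re z\<bar> < 1 / 2 \<and> Im z > 1}"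
 have S: "open S" "S \<subseteq> \<H>"
  unfolding S_def by (auto simp: H_iff intro!: open_Collect_conj open_Collect_less continuous_intros)
 have SD: "S \<subseteq> ford_domain N"
 proof
  fix z assume z: "z \<in> S"
  have "1 \<le> cmod (cocycle \<gamma> z)" if "\<gamma>$2$1 \<noteq> 0" for \<gamma>
  proof -
   have "1 \<le> \<bar>real_of_int (\<gamma>$2$1)\<bar>" using that by linarith
   hence "1 \<le> \<bar>real_of_int (\<gamma>$2$1)\<bar> * Im z"
    using z mult_mono[of 1 "\<bar>real_of_int (\<gamma>$2$1)\<bar>" 1 "Im z"] by (simp add: S_def)
   also have "... = \<bar>Im (cocycle \<gamma> z)\<bar>" using z by (simp add: cocycle_def abs_mult S_def)
   finally show ?thesis using abs_Im_le_cmod order_trans by blast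
  qed
  thus "z \<in> ford_domain N" using z by (auto simp: ford_domain_def S_def H_iff)
 qed
 have "AE z in lborel. z \<in> S \<longrightarrow> f z = 0"
 proof -
  from ae have "AE z in lborel. 0 < ennreal (indicator \<H> z / (Im z)\<^sup>2) \<longrightarrow> ?D z * (cmod (f z))\<^sup>2 * Im z powr \<kappa> = 0"
   unfolding hyp_def by (subst (asm) AE_density) auto
  thus ?thesis
  proof eventually_elim
   case (elim z)
   show ?case
   proof
    assume z: "z \<in> S"
    hence "z \<in> \<H>" "Im z > 0" "z \<in> ford_domain N" using S SD by (auto simp: H_iff)
    with elim show "f z = 0" by auto
   qed
  qed
 qed
 hence ae0: "AE z in lborel. z \<notin> {z \<in> S. f z \<noteq> 0}" by eventually_elim simp
 have op: "open {z \<in> S. f z \<noteq> 0}"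
 proof -
  have "open (S \<inter> f -` (- {0}))"
   using S fH by (intro continuous_open_preimage) (auto intro: holomorphic_on_imp_continuous_on holomorphic_on_subset)
  moreover have "{z \<in> S. f z \<noteq> 0} = S \<inter> f -` (- {0})" by auto
  ultimately show ?thesis by simp
 qed
 have null: "{z \<in> S. f z \<noteq> 0} \<in> null_sets lborel"
  using ae0 op by (simp only: AE_iff_null_sets[of _ lborel] borel_open sets_lborel)
 have "negligible {z \<in> S. f z \<noteq> 0}" using null by (simp add: negligible_iff_null_sets null_sets_completionI)
 hence "{z \<in> S. f z \<noteq> 0} = {}" using op open_not_negligible by blast
 hence f0S: "f z = 0" if "z \<in> S" for z using that by blast
 have "Complex 0 2 \<in> S" by (simp add: S_def)
 have "f z = 0" if "z \<in> \<H>" for z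
 proof (rule analytic_continuation_open[OF S(1) open_upper_half_plane _ connected_upper_half_plane S(2) fH, of "\<lambda>_. 0"])
  show "S \<noteq> {}" using `Complex 0 2 \<in> S` by auto
 qed (use f0S that in auto)
 thus ?thesis using f0 by auto
qed

subsection \<open>Commuting Hermitian operators on spaces of functions\<close>

abbreviation (input) cscale :: "complex => cfun => cfun"
 where "cscale c f \<equiv> (\<lambda>z. c * f z)"

text \<open>Finite dimension phrased by independent sets, so that it passes to subsets and yields an
  induction measure without a chosen basis.\<close>

definition dim_atmost :: "nat => cfun set => bool"
 where "dim_atmost n V \<longleftrightarrow> (\<forall>B. B \<subseteq> V \<longrightarrow> fun_vs.independent B \<longrightarrow> finite B \<and> card B \<le> n)"

lemma dim_atmost_span: "finite B ==> V \<subseteq> fun_vs.span B ==> dim_atmost (card B) V"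
 unfolding dim_atmost_def using fun_vs.independent_span_bound by (meson order_trans)

lemma dim_atmost_subset: "dim_atmost n V ==> W \<subseteq> V ==> dim_atmost n W" by (auto simp: dim_atmost_def)

lemma dim_atmost_basis:
 assumes "dim_atmost n V"
 obtains B where "finite B" "B \<subseteq> V" "fun_vs.independent B" "V \<subseteq> fun_vs.span B"
proof -
 obtain B where B: "B \<subseteq> V" "fun_vs.independent B" "V \<subseteq> fun_vs.span B"
  by (rule fun_vs.maximal_independent_subset)
 moreover have "finite B" using assms B(1,2) unfolding dim_atmost_def by blast
 ultimately show thesis using that by blast
qed

lemma dim_atmost_strict_subspace:
 assumes "dim_atmost n V" "E \<subseteq> V" "fun_vs.subspace E" "x \<in> V" "x \<notin> E"
 shows "n > 0" "dim_atmost (n - 1) E"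
proof -
 have *: "finite B \<and> card B + 1 \<le> n" if B: "B \<subseteq> E" "fun_vs.independent B" for B
 proof -
  have "fun_vs.span B \<subseteq> E" using B assms(3) by (intro fun_vs.span_minimal)
  hence x: "x \<notin> fun_vs.span B" "x \<notin> B" using assms(5) B by auto
  have ind: "fun_vs.independent (insert x B)" using x(1) B(2) by (rule fun_vs.independent_insertI)
  have "insert x B \<subseteq> V" using assms B by auto
  from assms(1)[unfolded dim_atmost_def, rule_format, OF this ind]
  have *: "finite (insert x B) \<and> card (insert x B) \<le> n" .
  hence fin: "finite B" by (simp only: finite_insert)
  have "card (insert x B) = Suc (card B)" by (rule card_insert_disjoint[OF fin x(2)])
  with * fin show ?thesis by linarith
 qed
 show "n > 0" using *[of "{}"] by (auto simp: fun_vs.independent_empty)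
 show "dim_atmost (n - 1) E" unfolding dim_atmost_def
 proof (intro allI impI)
  fix B assume "B \<subseteq> E" "fun_vs.independent B"
  from *[OF this] show "finite B \<and> card B \<le> n - 1" by linarith
 qed
qed

text \<open>Induction on \<open>I\<close>: the kernel of one functional together with one vector
  outside it spans the space.\<close>

lemma dim_atmost_from_functionals:
 fixes \<phi> :: "'i => cfun => complex"
 assumes "finite I" "fun_vs.subspace V"
  and "\<And>i f g. i \<in> I ==> f \<in> V ==> g \<in> V ==> \<phi> i (f + g) = \<phi> i f + \<phi> i g"
  and "\<And>i c f. i \<in> I ==> f \<in> V ==> \<phi> i (cscale c f) = c * \<phi> i f"
  and "\<And>f. f \<in> V ==> (\<And>i. i \<in> I ==> \<phi> i f = 0) ==> f = 0"
 shows "\<exists>n. dim_atmost n V"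
proof -
 have "\<exists>B. finite B \<and> V \<subseteq> fun_vs.span B" using assms
 proof (induction I arbitrary: V rule: finite_induct)
  case empty
  have "f \<in> fun_vs.span {}" if "f \<in> V" for f
   using empty(4)[OF that] fun_vs.span_zero[of "{}"] by (metis empty_iff)
  thus ?case by blast
 next
  case (insert i I)
  note sub = insert.prems(1) and add = insert.prems(2)[OF insertI1] and scale = insert.prems(3)[OF insertI1]
  define V' where "V' = {f \<in> V. \<phi> i f = 0}"
  have 0: "\<phi> i 0 = 0" using scale[of 0 0] fun_vs.subspace_0[OF sub] by (simp add: zero_fun_def)
  have "fun_vs.subspace V'" using sub 0 unfolding fun_vs.subspace_def V'_def by (auto simp: add scale)
  then obtain B where B: "finite B" "V' \<subseteq> fun_vs.span B"
   using insert.IH[of V'] insert.prems(2-4) by (fastforce simp: V'_def)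
  show ?case
  proof (cases "\<exists>f0\<in>V. \<phi> i f0 \<noteq> 0")
   case True
   then obtain f0 where f0: "f0 \<in> V" "\<phi> i f0 \<noteq> 0" by blast
   have "f \<in> fun_vs.span (insert f0 B)" if f: "f \<in> V" for f
   proof -
    let ?k = "\<phi> i f / \<phi> i f0"
    have m: "cscale (- ?k) f0 \<in> V" using fun_vs.subspace_scale[OF sub f0(1)] .
    have eq: "f - cscale ?k f0 = f + cscale (- ?k) f0" by (auto simp: fun_eq_iff)
    have "f + cscale (- ?k) f0 \<in> V" using fun_vs.subspace_add[OF sub f m] .
    moreover have "\<phi> i (f + cscale (- ?k) f0) = 0" unfolding add[OF f m] scale[OF f0(1)] using f0 by simp
    ultimately have "f - cscale ?k f0 \<in> V'" unfolding V'_def eq by blast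
    thus ?thesis using B(2) fun_vs.span_breakdown_eq[of f f0 B] by blast
   qed
   thus ?thesis using B(1) by (intro exI[of _ "insert f0 B"]) auto
  next
   case False
   hence "V = V'" by (auto simp: V'_def)
   thus ?thesis using B by auto
  qed
 qed
 thus ?thesis using dim_atmost_span by blast
qed

section \<open>Linear operators and eigenvectors on subspaces\<close>

definition linear_op :: "cfun set => (cfun => cfun) => bool"
 where "linear_op V T \<longleftrightarrow> (\<forall>f\<in>V. T f \<in> V) \<and> (\<forall>f\<in>V. \<forall>g\<in>V. T (f + g) = T f + T g) \<and>
  (\<forall>c. \<forall>f\<in>V. T (cscale c f) = cscale c (T f))"

lemma linear_opD:
 assumes "linear_op V T"
 shows "f \<in> V ==> T f \<in> V" "f \<in> V ==> g \<in> V ==> T (f + g) = T f + T g"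
  "f \<in> V ==> T (cscale c f) = cscale c (T f)" using assms by (auto simp: linear_op_def)

lemma linear_op_0: "linear_op V T ==> fun_vs.subspace V ==> T 0 = 0"
 using linear_opD(3)[of V T 0 0] fun_vs.subspace_0[of V] by (simp add: zero_fun_def)

lemma linear_op_sum:
 assumes "linear_op V T" "fun_vs.subspace V" "\<And>i. i \<in> I ==> f i \<in> V"
 shows "T (\<Sum>i\<in>I. f i) = (\<Sum>i\<in>I. T (f i))"
 using assms(3)
proof (induction I rule: infinite_finite_induct)
 case (insert i I)
 have "T (f i + sum f I) = T (f i) + T (sum f I)"
  by (rule linear_opD(2)[OF assms(1)], use insert.prems in blast,
    rule fun_vs.subspace_sum[OF assms(2)], use insert.prems in blast)
 moreover have "T (sum f I) = (\<Sum>i\<in>I. T (f i))" by (rule insert.IH) (use insert.prems in blast)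
 ultimately show ?case by (simp only: sum.insert[OF insert.hyps])
qed (use linear_op_0[OF assms(1,2)] in auto)

lemma linear_op_restrict: "linear_op V T ==> W \<subseteq> V ==> (\<And>f. f \<in> W ==> T f \<in> W) ==> linear_op W T"
 unfolding linear_op_def by blast

text \<open>Take a polynomial \<open>p\<close> of least degree among the nonzero ones with
  \<open>p(T) v = 0\<close>. For a root \<open>l\<close>, the quotient \<open>q\<close> of
  \<open>p\<close> by \<open>X - l\<close> gives the eigenvector \<open>q(T) v\<close>, nonzero by
  minimality.\<close>

lemma ex_eigenvector:
 assumes T: "linear_op V T" and V: "fun_vs.subspace V" and n: "dim_atmost n V" and v: "v \<in> V" "v \<noteq> 0"
 obtains e l where "e \<in> V" "e \<noteq> 0" "T e = cscale l e"
proof -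
 define w where "w i = (T ^^ i) v" for i
 have wV: "w i \<in> V" for i by (induction i) (auto simp: w_def v linear_opD(1)[OF T])
 have wSuc: "w (Suc i) = T (w i)" for i by (simp add: w_def)
 define A where "A p = (\<Sum>i\<le>degree p. cscale (poly.coeff p i) (w i))" for p
 have A_eq: "A p = (\<Sum>i\<le>N. cscale (poly.coeff p i) (w i))" if "degree p \<le> N" for p N
  unfolding A_def by (rule sum.mono_neutral_left) (use that in \<open>auto simp: coeff_eq_0 zero_fun_def\<close>)
 have cV: "cscale c (w i) \<in> V" for c i using fun_vs.subspace_scale[OF V wV] .
 have AV: "A p \<in> V" for p unfolding A_def by (intro fun_vs.subspace_sum[OF V] cV)
 have A_pCons: "A (pCons 0 q) = T (A q)" for q
 proof -
  have "A (pCons 0 q) = (\<Sum>i\<le>Suc (degree q). cscale (poly.coeff (pCons 0 q) i) (w i))"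
   by (rule A_eq) (rule degree_pCons_le)
  also have "... = (\<Sum>i\<le>degree q. cscale (poly.coeff q i) (w (Suc i)))"
   by (subst sum.atMost_Suc_shift) (simp add: zero_fun_def[symmetric])
  also have "... = (\<Sum>i\<le>degree q. T (cscale (poly.coeff q i) (w i)))"
   by (intro sum.cong) (simp_all add: wSuc linear_opD(3)[OF T wV])
  also have "... = T (A q)" unfolding A_def by (rule linear_op_sum[OF T V cV, symmetric])
  finally show ?thesis .
 qed
 have A_add: "A (p + q) = A p + A q" for p q
 proof -
  let ?N = "max (degree p) (degree q)"
  have "A (p + q) = (\<Sum>i\<le>?N. cscale (poly.coeff (p + q) i) (w i))" by (rule A_eq) (rule degree_add_le_max)
  also have "... = (\<Sum>i\<le>?N. cscale (poly.coeff p i) (w i)) + (\<Sum>i\<le>?N. cscale (poly.coeff q i) (w i))"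
   by (subst sum.distrib[symmetric], rule sum.cong) (auto simp: fun_eq_iff algebra_simps)
  finally show ?thesis by (simp add: A_eq[of p ?N] A_eq[of q ?N])
 qed
 have A_smult: "A (Polynomial.smult c q) = cscale c (A q)" for c q
 proof -
  have "A (Polynomial.smult c q) = (\<Sum>i\<le>degree q. cscale (poly.coeff (Polynomial.smult c q) i) (w i))" by (rule A_eq) simp
  also have "... = (\<Sum>i\<le>degree q. cscale c (cscale (poly.coeff q i) (w i)))"
   by (simp only: Polynomial.coeff_smult mult.assoc)
  also have "... = cscale c (A q)" unfolding A_def by (rule fun_vs.scale_sum_right[symmetric])
  finally show ?thesis .
 qed
 \<comment> \<open>Among the first \<open>n + 1\<close> iterates either two coincide, and a
   difference of monomials annihilates \<open>v\<close>, or they are dependent by the bound on the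
   dimension.\<close>
 have "\<exists>p. p \<noteq> 0 \<and> A p = 0"
 proof (cases "inj_on w {..n}")
  case True
  hence "card (w ` {..n}) = Suc n" by (simp add: card_image)
  moreover have "w ` {..n} \<subseteq> V" using wV by auto
  ultimately have "fun_vs.dependent (w ` {..n})" using n unfolding dim_atmost_def by (metis Suc_n_not_le_n)
  then obtain u i0 where u: "(\<Sum>x\<in>w ` {..n}. cscale (u x) x) = 0" "i0 \<le> n" "u (w i0) \<noteq> 0"
   by (subst (asm) fun_vs.dependent_finite) auto
  define p where "p = (\<Sum>i\<le>n. Polynomial.monom (u (w i)) i)"
  have cp: "poly.coeff p i = (if i \<le> n then u (w i) else 0)" for i by (simp add: p_def coeff_sum)
  have "degree p \<le> n" by (rule degree_le) (simp add: cp)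
  hence "A p = (\<Sum>i\<le>n. cscale (u (w i)) (w i))" by (simp add: A_eq cp)
  also have "... = 0" using u(1) by (simp add: sum.reindex[OF True])
  finally have "A p = 0" .
  moreover have "poly.coeff p i0 \<noteq> 0" using u by (simp add: cp)
  ultimately show ?thesis by (intro exI[of _ p]) auto
 next
  case False
  then obtain i j where ij: "i \<noteq> j" "w i = w j" by (auto simp: inj_on_def)
  have Am: "A (Polynomial.monom c i) = cscale c (w i)" for c i
  proof -
   have "A (Polynomial.monom c i) = (\<Sum>l\<le>i. cscale (poly.coeff (Polynomial.monom c i) l) (w l))" by (rule A_eq) (rule degree_monom_le)
   also have "... = (\<Sum>l\<le>i. if l = i then cscale c (w i) else 0)" by (intro sum.cong) (auto simp: zero_fun_def)
   finally show ?thesis by simp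
  qed
  have "A (Polynomial.monom 1 i + Polynomial.monom (-1) j) = 0" using ij by (auto simp: A_add Am fun_eq_iff)
  moreover have "poly.coeff (Polynomial.monom 1 i + Polynomial.monom (-1) j) i \<noteq> (0::complex)" using ij by simp
  ultimately show ?thesis by (metis coeff_0)
 qed
 then obtain p where p: "p \<noteq> 0" "A p = 0" and min: "\<And>q. q \<noteq> 0 ==> A q = 0 ==> degree p \<le> degree q"
  using ex_has_least_nat[of "\<lambda>p. p \<noteq> 0 \<and> A p = 0" _ degree] by metis
 have "degree p \<noteq> 0"
 proof
  assume "degree p = 0"
  hence "A p = cscale (poly.coeff p 0) v" by (simp add: A_def w_def)
  moreover have "poly.coeff p 0 \<noteq> 0" using p(1) `degree p = 0` by (metis leading_coeff_0_iff)
  ultimately show False using p(2) v(2) by (auto simp: fun_eq_iff)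
 qed
 then obtain l where "poly p l = 0" using alg_closed_imp_poly_has_root[of p] by auto
 then obtain q where q: "p = [:- l, 1:] * q" by (auto simp: poly_eq_0_iff_dvd)
 have q0: "q \<noteq> 0" using p(1) q by auto
 hence "degree p = degree q + 1" unfolding q by (subst degree_mult_eq) auto
 hence Aq: "A q \<noteq> 0" using min[of q] q0 by auto
 have "p = pCons 0 q + Polynomial.smult (- l) q" by (simp add: q)
 hence "T (A q) + cscale (- l) (A q) = 0" using p(2) A_add A_pCons A_smult by metis
 hence "T (A q) = cscale l (A q)" by (auto simp: fun_eq_iff add_eq_0_iff)
 with Aq AV that show thesis by blast
qed

lemma subspace_eigenspace:
 assumes "linear_op V T" "fun_vs.subspace V"
 shows "fun_vs.subspace {f \<in> V. T f = cscale l f}"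
proof (rule fun_vs.subspaceI)
 show "0 \<in> {f \<in> V. T f = cscale l f}"
  using linear_op_0[OF assms] fun_vs.subspace_0[OF assms(2)] by (simp add: zero_fun_def)
 fix f g assume f: "f \<in> {f \<in> V. T f = cscale l f}" and g: "g \<in> {f \<in> V. T f = cscale l f}"
 have "T (f + g) = cscale l f + cscale l g" using f g linear_opD(2)[OF assms(1), of f g] by simp
 also have "... = cscale l (f + g)" by (auto simp: fun_eq_iff algebra_simps)
 finally show "f + g \<in> {f \<in> V. T f = cscale l f}" using f g fun_vs.subspace_add[OF assms(2), of f g] by simp
next
 fix c f assume f: "f \<in> {f \<in> V. T f = cscale l f}"
 have "T (cscale c f) = cscale c (cscale l f)" using f linear_opD(3)[OF assms(1), of f c] by simp
 also have "... = cscale l (cscale c f)" by (rule ext) (rule mult.left_commute)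
 finally show "cscale c f \<in> {f \<in> V. T f = cscale l f}"
  using f fun_vs.subspace_scale[OF assms(2), of f c] by simp
qed

lemma ex_common_eigenvector:
 assumes "dim_atmost n V" "fun_vs.subspace V" "\<And>p. p \<in> P ==> linear_op V (T p)"
  and "\<And>p q f. p \<in> P ==> q \<in> P ==> f \<in> V ==> T p (T q f) = T q (T p f)"
  and "v \<in> V" "v \<noteq> 0"
 obtains e where "e \<in> V" "e \<noteq> 0" "\<And>p. p \<in> P ==> \<exists>l. T p e = cscale l e" using assms
proof (induction n arbitrary: V v thesis)
 case (0 V v)
 have "fun_vs.subspace {0}" by (auto simp: fun_vs.subspace_def zero_fun_def)
 from dim_atmost_strict_subspace(1)[OF 0(2) _ this 0(6)] fun_vs.subspace_0[OF 0(3)] 0(7)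
 have "0 < (0::nat)" by blast
 thus ?case by simp
next
 case (Suc n V v)
 show ?case
 proof (cases "\<forall>p\<in>P. \<exists>l. T p v = cscale l v")
  case True
  with Suc.prems show ?thesis by blast
 next
  case False
  then obtain p where p: "p \<in> P" "\<And>l. T p v \<noteq> cscale l v" by blast
  obtain e l where e: "e \<in> V" "e \<noteq> 0" "T p e = cscale l e"
   using ex_eigenvector[OF Suc.prems(4)[OF p(1)] Suc.prems(3,2,6,7)] by blast
  define E where "E = {f \<in> V. T p f = cscale l f}"
  have sub: "fun_vs.subspace E" unfolding E_def by (rule subspace_eigenspace[OF Suc.prems(4)[OF p(1)] Suc.prems(3)])
  have "dim_atmost n E"
   using dim_atmost_strict_subspace(2)[OF Suc.prems(2) _ sub Suc.prems(6)] p(2) by (auto simp: E_def)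
  moreover have "linear_op E (T q)" if q: "q \<in> P" for q
  proof (rule linear_op_restrict[OF Suc.prems(4)[OF q]])
   fix f assume f: "f \<in> E"
   hence "T p (T q f) = T q (cscale l f)" using Suc.prems(5)[OF p(1) q] by (simp add: E_def)
   thus "T q f \<in> E" using f linear_opD(1,3)[OF Suc.prems(4)[OF q]] by (simp add: E_def)
  qed (auto simp: E_def)
  moreover have "T q (T r f) = T r (T q f)" if "q \<in> P" "r \<in> P" "f \<in> E" for q r f
   using Suc.prems(5) that by (simp add: E_def)
  moreover have "e \<in> E" using e by (simp add: E_def)
  ultimately obtain e' where "e' \<in> E" "e' \<noteq> 0" "\<And>p. p \<in> P ==> \<exists>l. T p e' = cscale l e'"
   using Suc.IH[OF _ _ sub] e(2) by metis
  thus ?thesis by (intro Suc.prems(1)[of e']) (auto simp: E_def)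
 qed
qed

section \<open>Hermitian spaces and commuting Hermitian operators\<close>

locale hermitian_space =
 fixes V :: "cfun set" and ip :: "cfun => cfun => complex"
 assumes subspace: "fun_vs.subspace V"
  and ip_add: "f \<in> V ==> g \<in> V ==> h \<in> V ==> ip (f + g) h = ip f h + ip g h"
  and ip_scale: "f \<in> V ==> h \<in> V ==> ip (cscale c f) h = c * ip f h"
  and ip_cnj: "f \<in> V ==> g \<in> V ==> cnj (ip f g) = ip g f"
  and ip_definite: "f \<in> V ==> ip f f = 0 ==> f = 0"
begin

lemma V_add: "f \<in> V ==> g \<in> V ==> f + g \<in> V" using fun_vs.subspace_add[OF subspace] .
lemma V_scale: "f \<in> V ==> cscale c f \<in> V" using fun_vs.subspace_scale[OF subspace] .
lemma V_diff: "f \<in> V ==> g \<in> V ==> f - g \<in> V" using fun_vs.subspace_diff[OF subspace] .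

lemma ip_diff: "f \<in> V ==> g \<in> V ==> h \<in> V ==> ip (f - g) h = ip f h - ip g h"
proof -
 assume *: "f \<in> V" "g \<in> V" "h \<in> V"
 have eq: "f - g = f + cscale (-1) g" by (auto simp: fun_eq_iff)
 show ?thesis unfolding eq ip_add[OF *(1) V_scale[OF *(2)] *(3)] ip_scale[OF *(2,3)] by simp
qed

lemma ip_add_right: "f \<in> V ==> g \<in> V ==> h \<in> V ==> ip h (f + g) = ip h f + ip h g"
 using ip_add[of f g h] by (metis V_add complex_cnj_add ip_cnj)

lemma ip_scale_right: "f \<in> V ==> h \<in> V ==> ip h (cscale c f) = cnj c * ip h f"
 using ip_scale[of f h c] by (metis V_scale complex_cnj_mult ip_cnj)

lemma ip_sym_0: "f \<in> V ==> g \<in> V ==> ip f g = 0 \<longleftrightarrow> ip g f = 0" by (metis complex_cnj_zero_iff ip_cnj)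

lemma V_0: "0 \<in> V" using fun_vs.subspace_0[OF subspace] .

lemma ip_0 [simp]: "h \<in> V ==> ip 0 h = 0" "h \<in> V ==> ip h 0 = 0"
 using ip_diff[OF V_0 V_0, of h] ip_sym_0[OF V_0, of h] by simp_all

lemma subspace_orthogonal:
 assumes "W \<subseteq> V"
 shows "fun_vs.subspace {f \<in> V. \<forall>g\<in>W. ip f g = 0}"
proof (rule fun_vs.subspaceI)
 show "0 \<in> {f \<in> V. \<forall>g\<in>W. ip f g = 0}" using V_0 assms by (simp add: subset_iff)
qed (use assms V_add V_scale in \<open>auto simp: ip_add ip_scale subset_iff\<close>)

lemma orthogonal_projection:
 assumes "finite B" "W = fun_vs.span B" "W \<subseteq> V" "f \<in> V"
 obtains w where "w \<in> W" "\<And>g. g \<in> W ==> ip (f - w) g = 0" using assms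
proof (induction B arbitrary: W f thesis rule: finite_induct)
 case (empty W f)
 have "ip (f - 0) g = 0" if "g \<in> W" for g using that empty by simp
 moreover have "0 \<in> W" using empty by simp
 ultimately show ?case using empty(1) by blast
next
 case (insert b B W f)
 define W0 where "W0 = fun_vs.span B"
 have W0: "W0 \<subseteq> W" using insert.prems fun_vs.span_mono[of B "insert b B"] by (auto simp: W0_def)
 have bW: "b \<in> W" using insert.prems by (auto intro: fun_vs.span_base)
 have sW: "fun_vs.subspace W" using insert.prems by simp
 have W0V: "W0 \<subseteq> V" and bV: "b \<in> V" using W0 insert.prems bW by auto
 obtain wb where wb: "wb \<in> W0" "\<And>g. g \<in> W0 ==> ip (b - wb) g = 0" using insert.IH[OF _ W0_def W0V bV] by blast
 obtain wf where wf: "wf \<in> W0" "\<And>g. g \<in> W0 ==> ip (f - wf) g = 0"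
  using insert.IH[OF _ W0_def W0V] insert.prems by blast
 define b' where "b' = b - wb"
 have b': "b' \<in> W" unfolding b'_def using fun_vs.subspace_diff[OF sW] bW wb W0 by auto
 have b'V: "b' \<in> V" using b' insert.prems by auto
 \<comment> \<open>\<open>b\<close> may already lie in the span of \<open>B\<close>; then its
   orthogonalised form \<open>b'\<close> is 0 and any coefficient serves.\<close>
 define c where "c = (if b' = 0 then 0 else ip (f - wf) b' / ip b' b')"
 define w where "w = wf + cscale c b'"
 have wW: "w \<in> W" unfolding w_def using wf W0 b' fun_vs.subspace_add[OF sW] fun_vs.subspace_scale[OF sW b'] by auto
 have fw: "f - w = (f - wf) - cscale c b'" by (simp add: w_def)
 have fwfV: "f - wf \<in> V" using wf W0V insert.prems by (auto intro: V_diff)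
 have key: "ip (f - w) g = 0" if "g \<in> W0" for g unfolding fw using that wf(2) wb(2) W0V fwfV b'V
  by (subst ip_diff) (auto simp: V_scale ip_scale b'_def[symmetric] subset_iff)
 have key2: "ip (f - w) b' = 0"
 proof (cases "b' = 0")
  case True
  have "f - w \<in> V" using wW insert.prems by (auto intro: V_diff)
  thus ?thesis unfolding True by simp
 next
  case False
  hence "ip b' b' \<noteq> 0" using ip_definite[OF b'V] by blast
  moreover have "ip (f - w) b' = ip (f - wf) b' - c * ip b' b'"
   by (simp only: fw ip_diff[OF fwfV V_scale[OF b'V] b'V] ip_scale[OF b'V b'V])
  ultimately show ?thesis using False by (simp add: c_def)
 qed
 have "ip (f - w) g = 0" if "g \<in> W" for g
 proof -
  from that insert.prems obtain k where "g - cscale k b \<in> W0"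
   using fun_vs.span_breakdown_eq[of g b B] by (auto simp: W0_def)
  moreover have "g = (g - cscale k b + cscale k wb) + cscale k b'" by (auto simp: b'_def fun_eq_iff algebra_simps)
  moreover have sW0: "fun_vs.subspace W0" by (simp add: W0_def)
  ultimately obtain g0 where g0: "g0 \<in> W0" "g = g0 + cscale k b'"
   using fun_vs.subspace_add[OF sW0] fun_vs.subspace_scale[OF sW0 wb(1)] by blast
  have "f - w \<in> V" using wW insert.prems by (auto intro: V_diff)
  thus ?thesis
   unfolding g0(2) using g0(1) W0V b'V key[OF g0(1)] key2 by (subst ip_add_right) (auto simp: V_scale ip_scale_right)
 qed
 with wW insert.prems(1) show ?case by blast
qed

lemma orthogonal_projection_dim:
 assumes "dim_atmost n V" "W \<subseteq> V" "fun_vs.subspace W" "f \<in> V"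
 obtains w where "w \<in> W" "\<And>g. g \<in> W ==> ip (f - w) g = 0"
proof -
 obtain B where B: "finite B" "B \<subseteq> W" "W \<subseteq> fun_vs.span B"
  using dim_atmost_basis[OF dim_atmost_subset[OF assms(1,2)]] by metis
 have "W = fun_vs.span B" using B assms(3) fun_vs.span_minimal by blast
 from orthogonal_projection[OF B(1) this assms(2,4)] that show thesis by blast
qed

lemma orthogonal_stable:
 assumes "linear_op V T" "\<And>f g. f \<in> V ==> g \<in> V ==> ip (T f) g = ip f (T g)"
  and "W \<subseteq> V" "\<And>g. g \<in> W ==> T g \<in> W" "f \<in> {f \<in> V. \<forall>g\<in>W. ip f g = 0}"
 shows "T f \<in> {f \<in> V. \<forall>g\<in>W. ip f g = 0}"
 using assms linear_opD(1)[OF assms(1)] by (auto simp: subset_iff)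

text \<open>The orthogonal complement, inside \<open>W\<close>, of the span of the common
  eigenvectors is again stable. If it were not 0 it would contain a common eigenvector, which would
  then be orthogonal to itself.\<close>

theorem spectral_decomposition:
 assumes n: "dim_atmost n V" and T: "\<And>p. p \<in> P ==> linear_op V (T p)"
  and comm: "\<And>p q f. p \<in> P ==> q \<in> P ==> f \<in> V ==> T p (T q f) = T q (T p f)"
  and herm: "\<And>p f g. p \<in> P ==> f \<in> V ==> g \<in> V ==> ip (T p f) g = ip f (T p g)"
  and W: "W \<subseteq> V" "fun_vs.subspace W" "\<And>p f. p \<in> P ==> f \<in> W ==> T p f \<in> W"
 shows "W \<subseteq> fun_vs.span {e \<in> W. e \<noteq> 0 \<and> (\<forall>p\<in>P. \<exists>l. T p e = cscale l e)}"
proof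
 define X where "X = {e \<in> W. e \<noteq> 0 \<and> (\<forall>p\<in>P. \<exists>l. T p e = cscale l e)}"
 define S where "S = fun_vs.span X"
 have XW: "X \<subseteq> W" by (auto simp: X_def)
 have SW: "S \<subseteq> W" unfolding S_def using XW W(2) by (rule fun_vs.span_minimal)
 have SV: "S \<subseteq> V" using SW W by auto
 have sS: "fun_vs.subspace S" by (simp add: S_def)
 have S_stable: "T p g \<in> S" if p: "p \<in> P" and g: "g \<in> S" for p g
 proof -
  have "g \<in> S \<and> T p g \<in> S" using g unfolding S_def
  proof (induction g rule: fun_vs.span_induct_alt)
   case base
   show ?case using linear_op_0[OF T[OF p] subspace] fun_vs.span_zero[of X] by (simp only: simp_thms)
  next
   case (step c x y)
   have xV: "x \<in> V" and yV: "y \<in> V" using step XW W(1) SV by (auto simp: S_def)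
   from step(1) p obtain l where "T p x = cscale l x" by (auto simp: X_def)
   hence "T p (cscale c x + y) = cscale (c * l) x + T p y"
    by (simp only: linear_opD(2)[OF T[OF p] V_scale[OF xV] yV] linear_opD(3)[OF T[OF p] xV] mult.assoc)
   moreover have "cscale d x \<in> fun_vs.span X" for d using step(1) fun_vs.span_scale fun_vs.span_base by blast
   ultimately show ?case using step(2) fun_vs.span_add by (simp only:)
  qed
  thus ?thesis by simp
 qed
 define Y where "Y = {f \<in> W. \<forall>g\<in>S. ip f g = 0}"
 have Yeq: "Y = W \<inter> {f \<in> V. \<forall>g\<in>S. ip f g = 0}" using W by (auto simp: Y_def)
 have sY: "fun_vs.subspace Y" unfolding Yeq by (intro fun_vs.subspace_inter W subspace_orthogonal SV)
 have YV: "Y \<subseteq> V" using W by (auto simp: Y_def)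
 have "f = 0" if f: "f \<in> Y" for f
 proof (rule ccontr)
  assume f0: "f \<noteq> 0"
  have TY: "linear_op Y (T p)" if p: "p \<in> P" for p
  proof (rule linear_op_restrict[OF T[OF p]])
   show "T p f \<in> Y" if "f \<in> Y" for f
    using orthogonal_stable[OF T[OF p] herm[OF p] SV S_stable[OF p]] W(3)[OF p] that unfolding Yeq by auto
  qed (use W in \<open>auto simp: Y_def\<close>)
  obtain e where e: "e \<in> Y" "e \<noteq> 0" "\<And>p. p \<in> P ==> \<exists>l. T p e = cscale l e"
  proof (rule ex_common_eigenvector[OF dim_atmost_subset[OF n YV] sY TY _ f f0])
   show "T p (T q g) = T q (T p g)" if "p \<in> P" "q \<in> P" "g \<in> Y" for p q g using comm that YV by blast
  qed blast+
  hence "e \<in> X" by (auto simp: X_def Y_def)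
  hence "e \<in> S" by (auto simp: S_def fun_vs.span_base)
  hence "ip e e = 0" using e by (simp add: Y_def)
  with ip_definite e(1,2) W show False by (auto simp: Y_def)
 qed
 note Y0 = this
 fix f assume f: "f \<in> W"
 hence fV: "f \<in> V" using W by auto
 from orthogonal_projection_dim[OF n SV sS fV] obtain w where w: "w \<in> S" "\<And>g. g \<in> S ==> ip (f - w) g = 0" by blast
 have "f - w \<in> Y" using w f SW fun_vs.subspace_diff[OF W(2)] by (auto simp: Y_def)
 from Y0[OF this] have "f = w" by simp
 with w show "f \<in> fun_vs.span {e \<in> W. e \<noteq> 0 \<and> (\<forall>p\<in>P. \<exists>l. T p e = cscale l e)}" by (simp add: S_def X_def)
qed

end

subsection \<open>Hecke operators in integral weight\<close>

lemma cusp_weight_int: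
 assumes "N > 0" "w > 0"
 shows "cusp_weight N (\<lambda>\<gamma> z. cocycle \<gamma> z ^ w) (\<lambda>\<gamma> z. cocycle \<gamma> z ^ w) 1 w (real w)"
proof
 fix \<gamma>
 have hol: "(\<lambda>z. cocycle \<gamma> z ^ w) holomorphic_on \<H>" unfolding cocycle_def by (intro holomorphic_intros)
 thus "(\<lambda>z. cocycle \<gamma> z ^ w) holomorphic_on \<H>" .
 from hol show "continuous_on \<H> (\<lambda>z. cocycle \<gamma> z ^ w)" by (rule holomorphic_on_imp_continuous_on)
qed (use assms in auto)

lemma S_int_iff:
 assumes "N > 0" "w > 0"
 shows "f \<in> S_int w N \<longleftrightarrow> f holomorphic_on \<H> \<and> (\<forall>z. z \<notin> \<H> \<longrightarrow> f z = 0) \<and>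
  (\<forall>\<gamma>\<in>Gamma0 N. \<forall>z\<in>\<H>. f (moebius \<gamma> z) = cocycle \<gamma> z ^ w * f z) \<and> growth_bounded (real w) f"
 unfolding S_int_def by (rule cusp_weight.cusp_forms_iff[OF cusp_weight_int[OF assms]])

lemma subspace_S_int: "N > 0 ==> w > 0 ==> fun_vs.subspace (S_int w N)"
 unfolding S_int_def by (rule cusp_weight.subspace_cusp_forms[OF cusp_weight_int])

lemma S_int_cuspidal: "N > 0 ==> w > 0 ==> f \<in> S_int w N ==> cuspidal (real w) f"
 unfolding S_int_def by (rule cusp_weight.cusp_forms_cuspidal[OF cusp_weight_int])

lemma S_int_has_qexp:
 assumes "N > 0" "w > 0" "f \<in> S_int w N"
 shows "has_qexp f (qcoeff f)" "qcoeff f 0 = 0"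
proof -
 obtain a where "has_qexp f a" "a 0 = 0"
  by (rule cusp_weight.cusp_forms_has_qexp[OF cusp_weight_int[OF assms(1,2)] assms(3)[unfolded S_int_def]]) simp
 thus "has_qexp f (qcoeff f)" "qcoeff f 0 = 0" using qcoeff_eqI by auto
qed

lemma hermitian_space_cuspidal:
 assumes "N > 0" "fun_vs.subspace V" "\<And>f. f \<in> V ==> cuspidal \<kappa> f"
 shows "hermitian_space V (petersson \<kappa> N)"
proof
 fix f g h assume "f \<in> V" "g \<in> V" "h \<in> V"
 thus "petersson \<kappa> N (f + g) h = petersson \<kappa> N f h + petersson \<kappa> N g h"
  using petersson_add_left[OF assms(1), of \<kappa> f g h] assms(3) by (simp add: plus_fun_def)
next
 fix f assume f: "f \<in> V" "petersson \<kappa> N f f = 0"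
 show "f = 0" unfolding zero_fun_def by (rule petersson_definite[OF assms(1) assms(3)[OF f(1)] f(2)])
qed (use assms petersson_cmult_left petersson_cnj in auto)

text \<open>The weight \<open>w\<close> action without a power of the determinant; the normalisation
  of the Hecke operator sits in \<open>hecke_fun\<close>.\<close>

definition slash :: "nat => int^2^2 => cfun => cfun"
 where "slash w \<alpha> f z = (if z \<in> \<H> then f (moebius \<alpha> z) / cocycle \<alpha> z ^ w else 0)"

lemma slash_mult:
 assumes "det \<alpha> > 0" "det \<beta> > 0" "z \<in> \<H>"
 shows "slash w (\<alpha> ** \<beta>) f z = slash w \<alpha> f (moebius \<beta> z) / cocycle \<beta> z ^ w"
 using assms by (simp add: slash_def moebius_mult cocycle_mult power_mult_distrib)

lemma slash_invariant:
 assumes "N > 0" "w > 0" "f \<in> S_int w N" "\<gamma> \<in> Gamma0 N" "z \<in> \<H>"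
 shows "slash w \<gamma> f z = f z"
 using assms cocycle_nonzero[of \<gamma> z] by (simp add: slash_def S_int_iff)

lemma slash_Gamma0_mult:
 assumes "N > 0" "w > 0" "f \<in> S_int w N" "\<gamma> \<in> Gamma0 N" "det \<alpha> > 0"
 shows "slash w (\<gamma> ** \<alpha>) f = slash w \<alpha> f"
proof
 fix z show "slash w (\<gamma> ** \<alpha>) f z = slash w \<alpha> f z"
 proof (cases "z \<in> \<H>")
  case True
  have "slash w (\<gamma> ** \<alpha>) f z = slash w \<gamma> f (moebius \<alpha> z) / cocycle \<alpha> z ^ w"
   using assms(4,5) True by (intro slash_mult) auto
  also have "slash w \<gamma> f (moebius \<alpha> z) = f (moebius \<alpha> z)"
   using assms(5) True by (intro slash_invariant[OF assms(1-4)]) auto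
  finally show ?thesis using True by (simp add: slash_def)
 qed (simp add: slash_def)
qed

definition hecke_mats :: "nat => nat => (int^2^2) set"
 where "hecke_mats N p = {\<alpha>. det \<alpha> = int p \<and> int N dvd \<alpha>$2$1}"

text \<open>Upper triangular representatives of the orbits of \<open>Gamma0 N\<close>, acting from
  the left on \<open>hecke_mats N p\<close>, for a prime \<open>p\<close> not dividing
  \<open>N\<close>.\<close>

definition hecke_reps :: "nat => (int^2^2) set"
 where "hecke_reps p = insert (mat2 (int p) 0 0 1) ((\<lambda>j. mat2 1 (int j) 0 (int p)) ` {..<p})"

lemma finite_hecke_reps [simp]: "finite (hecke_reps p)" by (simp add: hecke_reps_def)

lemma hecke_reps_det [simp]: "\<rho> \<in> hecke_reps p ==> det \<rho> = int p" by (auto simp: hecke_reps_def)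

lemma hecke_reps_triangular:
 assumes "\<rho> \<in> hecke_reps p"
 shows "\<rho>$2$1 = 0" "p > 0 ==> \<rho>$1$1 > 0" "p > 0 ==> \<rho>$2$2 > 0"
 using assms by (auto simp: hecke_reps_def)

lemma hecke_reps_subset: "hecke_reps p \<subseteq> hecke_mats N p" by (auto simp: hecke_reps_def hecke_mats_def)

lemma Gamma0_mult_hecke_mats: "\<gamma> \<in> Gamma0 N ==> \<alpha> \<in> hecke_mats N p ==> \<gamma> ** \<alpha> \<in> hecke_mats N p"
 by (auto simp: Gamma0_iff hecke_mats_def det_mul matmul_nth)

lemma hecke_mats_mult_Gamma0: "\<gamma> \<in> Gamma0 N ==> \<alpha> \<in> hecke_mats N p ==> \<alpha> ** \<gamma> \<in> hecke_mats N p"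
 by (auto simp: Gamma0_iff hecke_mats_def det_mul matmul_nth)

lemma hecke_reps_unique:
 assumes "p > 0" "\<eta> \<in> Gamma0 N" "\<rho> \<in> hecke_reps p" "\<rho>' \<in> hecke_reps p" "\<eta> ** \<rho> = \<rho>'"
 shows "\<rho> = \<rho>'" "\<eta> = mat2 1 0 0 1"
proof -
 have e: "\<eta>$1$1 * \<rho>$1$1 + \<eta>$1$2 * \<rho>$2$1 = \<rho>'$1$1" "\<eta>$1$1 * \<rho>$1$2 + \<eta>$1$2 * \<rho>$2$2 = \<rho>'$1$2"
  "\<eta>$2$1 * \<rho>$1$1 + \<eta>$2$2 * \<rho>$2$1 = \<rho>'$2$1" "\<eta>$2$1 * \<rho>$1$2 + \<eta>$2$2 * \<rho>$2$2 = \<rho>'$2$2"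
  using assms(5) by (simp_all flip: matmul_nth)
 note t = hecke_reps_triangular[OF assms(3)] hecke_reps_triangular[OF assms(4)]
 have c: "\<eta>$2$1 = 0" using e(3) t assms(1) by auto
 have "\<eta>$1$1 * \<eta>$2$2 = 1" using assms(2) c by (simp add: Gamma0_iff det_2)
 moreover have "\<eta>$2$2 > 0" using e(4) c t assms(1) by (simp add: zero_less_mult_iff) (metis not_less_iff_gr_or_eq zero_less_mult_iff)
 ultimately have d: "\<eta>$2$2 = 1" "\<eta>$1$1 = 1" using zmult_eq_1_iff by fastforce+
 have n: "\<rho>$1$2 + \<eta>$1$2 * \<rho>$2$2 = \<rho>'$1$2" "\<rho>$1$1 = \<rho>'$1$1" "\<rho>$2$2 = \<rho>'$2$2" using e d c t by auto
 have bound: "0 \<le> x$1$2 \<and> x$1$2 < x$2$2" if "x \<in> hecke_reps p" for x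
  using that assms(1) by (auto simp: hecke_reps_def)
 have "\<rho>'$1$2 = \<rho>'$1$2 mod \<rho>$2$2" using bound[OF assms(4)] n by simp
 also have "... = \<rho>$1$2 mod \<rho>$2$2" by (simp flip: n(1))
 also have "... = \<rho>$1$2" using bound[OF assms(3)] by simp
 finally have "\<rho>'$1$2 = \<rho>$1$2" .
 thus "\<rho> = \<rho>'" using n t by (simp add: mat2_eq_iff)
 have "\<eta>$1$2 = 0" using `\<rho>'$1$2 = \<rho>$1$2` n(1) t assms(1) by auto
 thus "\<eta> = mat2 1 0 0 1" using c d by (simp add: mat2_eq_iff)
qed

text \<open>The gcd \<open>g\<close> of the first column divides \<open>p\<close>. Dividing the
  column by \<open>g\<close> keeps the level condition as \<open>p\<close> does not divide
  \<open>N\<close>, and a Bezout relation completes it to an element of \<open>Gamma0 N\<close>;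
  what remains is upper triangular with diagonal \<open>(1, p)\<close> or
  \<open>(p, 1)\<close>.\<close>

lemma hecke_mats_decompose:
 assumes p: "prime p" "\<not> p dvd N" and \<alpha>: "\<alpha> \<in> hecke_mats N p"
 obtains \<gamma> \<rho> where "\<gamma> \<in> Gamma0 N" "\<rho> \<in> hecke_reps p" "\<alpha> = \<gamma> ** \<rho>"
proof -
 let ?a = "\<alpha>$1$1" and ?b = "\<alpha>$1$2" and ?c = "\<alpha>$2$1" and ?d = "\<alpha>$2$2"
 define g where "g = gcd ?a ?c"
 have det: "?a * ?d - ?b * ?c = int p" and Nc: "int N dvd ?c" using \<alpha> by (auto simp: hecke_mats_def det_2)
 have g0: "g > 0"
 proof -
  have "p > 0" using p(1) prime_gt_0_nat by simp
  hence "?a \<noteq> 0 \<or> ?c \<noteq> 0" using det by auto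
  thus ?thesis by (simp add: g_def gcd_pos_int)
 qed
 have gp: "g dvd int p" unfolding det[symmetric] g_def by (intro dvd_diff) auto
 obtain a' c' where ac: "?a = g * a'" "?c = g * c'" by (metis g_def gcd_dvd1 gcd_dvd2 dvdE)
 have "coprime (int N) g"
 proof -
  have "coprime p N" using p prime_imp_coprime by blast
  hence "coprime (int p) (int N)" by simp
  thus ?thesis using gp by (meson coprime_commute coprime_divisors dvd_refl)
 qed
 hence Nc': "int N dvd c'" using Nc unfolding ac by (simp add: coprime_dvd_mult_right_iff)
 obtain x y where xy: "x * ?a + y * ?c = g" unfolding g_def using bezout_int by blast
 have xy1: "x * a' + y * c' = 1"
 proof -
  have "g * (x * a' + y * c') = g * 1" using xy ac by (simp add: algebra_simps)
  thus ?thesis using g0 by simp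
 qed
 define \<gamma> where "\<gamma> = mat2 a' (- y) c' x"
 have \<gamma>: "\<gamma> \<in> Gamma0 N" using xy1 Nc' by (simp add: \<gamma>_def Gamma0_iff mult.commute add.commute)
 define b' where "b' = x * ?b + y * ?d"
 define d' where "d' = a' * ?d - c' * ?b"
 have gd: "g * d' = int p" using det by (simp add: d'_def ac algebra_simps)
 have \<alpha>eq: "\<alpha> = \<gamma> ** mat2 g b' 0 d'"
 proof -
  have "a' * b' - y * d' = (x * a' + y * c') * ?b" "c' * b' + x * d' = (x * a' + y * c') * ?d"
   by (simp_all add: b'_def d'_def algebra_simps)
  hence "a' * b' - y * d' = ?b" "c' * b' + x * d' = ?d" unfolding xy1 by simp_all
  thus ?thesis by (simp add: mat2_eq_iff \<gamma>_def matmul_nth ac mult.commute)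
 qed
 have "g = 1 \<or> g = int p"
  using p(1) gp g0 by (metis abs_of_pos int_dvd_int_iff nat_0_le nat_int of_nat_1 order_less_imp_le prime_nat_iff zero_le_imp_eq_int)
 thus thesis
 proof
  assume g: "g = int p"
  have "d' = 1" using gd g p(1) by (simp add: prime_gt_0_nat)
  hence "\<alpha> = \<gamma> ** mat2 1 b' 0 1 ** mat2 (int p) 0 0 1"
   unfolding \<alpha>eq matrix_mul_assoc[symmetric] by (simp add: g)
  thus thesis using Gamma0_mult[OF \<gamma> Gamma0_T[of b']] by (intro that) (auto simp: hecke_reps_def)
 next
  assume g: "g = 1"
  have d': "d' = int p" using gd g by simp
  define j where "j = nat (b' mod int p)"
  have j: "int j = b' mod int p" "j < p" using p(1) prime_gt_0_nat[of p] by (auto simp: j_def nat_less_iff)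
  have "b' = int j + int p * (b' div int p)" by (simp add: j)
  hence "\<alpha> = \<gamma> ** mat2 1 (b' div int p) 0 1 ** mat2 1 (int j) 0 (int p)"
   unfolding \<alpha>eq matrix_mul_assoc[symmetric] by (simp add: g d' mult.commute)
  moreover have "mat2 1 (int j) 0 (int p) \<in> hecke_reps p" using j(2) by (auto simp: hecke_reps_def)
  ultimately show thesis using Gamma0_mult[OF \<gamma> Gamma0_T[of "b' div int p"]] that by blast
 qed
qed

lemma hecke_mats_decompose_unique:
 assumes "p > 0" "\<gamma> \<in> Gamma0 N" "\<gamma>' \<in> Gamma0 N" "\<rho> \<in> hecke_reps p" "\<rho>' \<in> hecke_reps p" "\<gamma> ** \<rho> = \<gamma>' ** \<rho>'"
 shows "\<rho> = \<rho>'" "\<gamma> = \<gamma>'"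
proof -
 have d: "det \<gamma>' = 1" using assms by simp
 have "(adj2 \<gamma>' ** \<gamma>) ** \<rho> = (adj2 \<gamma>' ** \<gamma>') ** \<rho>'" by (simp add: matrix_mul_assoc[symmetric] assms(6))
 hence eq: "(adj2 \<gamma>' ** \<gamma>) ** \<rho> = \<rho>'" by (simp add: adj2_mult_self d mat2_scalar_mult)
 note u = hecke_reps_unique[OF assms(1) Gamma0_mult[OF Gamma0_adj2[OF assms(3)] assms(2)] assms(4,5) eq]
 show "\<rho> = \<rho>'" by (rule u(1))
 have "\<gamma> = (\<gamma>' ** adj2 \<gamma>') ** \<gamma>" by (simp add: mult_adj2 d mat2_scalar_mult)
 also have "... = \<gamma>'" unfolding matrix_mul_assoc[symmetric] u(2) by (rule mat2_scalar_mult)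
 finally show "\<gamma> = \<gamma>'" .
qed

definition hecke_fun :: "nat => nat => cfun => cfun"
 where "hecke_fun w p f = (\<lambda>z. of_nat p ^ (w - 1) * (\<Sum>\<rho>\<in>hecke_reps p. slash w \<rho> f z))"

lemma hecke_fun_eq:
 assumes "p > 1" "w > 0" and f0: "\<And>z. z \<notin> \<H> ==> f z = 0"
 shows "hecke_fun w p f = (\<lambda>z. (\<Sum>j<p. f ((z + of_nat j) / of_nat p)) / of_nat p + of_nat p ^ (w - 1) * f (of_nat p * z))"
proof
 fix z
 show "hecke_fun w p f z = (\<Sum>j<p. f ((z + of_nat j) / of_nat p)) / of_nat p + of_nat p ^ (w - 1) * f (of_nat p * z)"
 proof (cases "z \<in> \<H>")
  case True
  have inj: "inj_on (\<lambda>j. mat2 1 (int j) 0 (int p)) {..<p}" by (auto simp: inj_on_def)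
  have nin: "mat2 (int p) 0 0 1 \<notin> (\<lambda>j. mat2 1 (int j) 0 (int p)) ` {..<p}" using assms(1) by auto
  have pw: "of_nat p ^ (w - 1) * (x / of_nat p ^ w) = x / of_nat p" for x :: complex
   using assms by (cases w) auto
  have "hecke_fun w p f z = of_nat p ^ (w - 1) * f (of_nat p * z) +
    (\<Sum>j<p. of_nat p ^ (w - 1) * (f ((z + of_nat j) / of_nat p) / of_nat p ^ w))" using nin True
   by (simp add: hecke_fun_def hecke_reps_def sum.reindex[OF inj] slash_def moebius_mat2 distrib_left sum_distrib_left)
  thus ?thesis unfolding pw by (simp add: sum_divide_distrib add.commute)
 next
  case False
  hence "(z + of_nat j) / of_nat p \<notin> \<H>" "of_nat p * z \<notin> \<H>" for j
   using assms(1) by (auto simp: H_iff zero_less_divide_iff zero_less_mult_iff)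
  hence "f ((z + of_nat j) / of_nat p) = 0" "f (of_nat p * z) = 0" for j using f0 by blast+
  thus ?thesis using False by (simp add: hecke_fun_def slash_def)
 qed
qed

lemma hecke_fun_qexp:
 assumes "p > 1" "w > 0" "has_qexp f a"
 shows "has_qexp (hecke_fun w p f) (\<lambda>n. a (p * n) + of_nat p ^ (w - 1) * (if p dvd n then a (n div p) else 0))"
proof -
 have p: "p > 0" using assms(1) by simp
 have f0: "f z = 0" if "z \<notin> \<H>" for z using assms(3) that by (simp add: has_qexp_def)
 show ?thesis
  using hecke_fun_eq[OF assms(1,2), of f] f0 has_qexp_add[OF has_qexp_U[OF assms(3) p] has_qexp_cmult[OF has_qexp_dilate[OF assms(3) p], of "of_nat p ^ (w - 1)"]]
  by simp
qed

lemma T_int_eq: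
 assumes "p > 1" "w > 0" "has_qexp f a"
 shows "T_int w p f = hecke_fun w p f"
 unfolding T_int_def qcoeff_eqI[OF assms(3)] by (rule qseries_eqI[OF hecke_fun_qexp[OF assms]])

lemma cuspidal_slash_triangular:
 assumes f: "cuspidal (real w) f" and \<rho>: "\<rho>$2$1 = 0" "\<rho>$1$1 > 0" "\<rho>$2$2 > 0"
 shows "cuspidal (real w) (slash w \<rho> f)"
proof -
 let ?a = "real_of_int (\<rho>$1$1)" and ?b = "real_of_int (\<rho>$1$2)" and ?d = "real_of_int (\<rho>$2$2)"
 have f0: "f z = 0" if "z \<notin> \<H>" for z using f that by (simp add: cuspidal_def)
 have inH: "(of_real ?a * z + of_real ?b) / of_real ?d \<in> \<H> \<longleftrightarrow> z \<in> \<H>" for z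
  using \<rho> by (simp add: H_iff zero_less_divide_iff zero_less_mult_iff)
 have eq: "slash w \<rho> f = (\<lambda>z. (1 / of_int (\<rho>$2$2) ^ w) * f ((of_real ?a * z + of_real ?b) / of_real ?d))"
 proof
  fix z show "slash w \<rho> f z = (1 / of_int (\<rho>$2$2) ^ w) * f ((of_real ?a * z + of_real ?b) / of_real ?d)"
   using f0[of "(of_real ?a * z + of_real ?b) / of_real ?d"] inH[of z]
   by (cases "z \<in> \<H>") (simp_all add: slash_def moebius_def cocycle_def \<rho>(1))
 qed
 have "(f \<circ> (\<lambda>z. (of_real ?a * z + of_real ?b) / of_real ?d)) holomorphic_on \<H>"
  by (rule holomorphic_on_compose_gen[of _ _ f \<H>])
   (use f inH \<rho> in \<open>auto simp: cuspidal_def intro!: holomorphic_intros simp del: of_real_of_int_eq\<close>)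
 moreover have "f ((of_real ?a * z + of_real ?b) / of_real ?d) = 0" if "z \<notin> \<H>" for z
  by (rule f0) (simp only: inH that not_False_eq_True)
 moreover have "growth_bounded (real w) (\<lambda>z. f ((of_real ?a * z + of_real ?b) / of_real ?d))"
  by (rule growth_bounded_affine) (use f \<rho> in \<open>auto simp: cuspidal_def\<close>)
 ultimately have "cuspidal (real w) (\<lambda>z. f ((of_real ?a * z + of_real ?b) / of_real ?d))"
  unfolding cuspidal_def o_def by blast
 thus ?thesis unfolding eq by (rule cuspidal_cmult)
qed

lemma cuspidal_sum: "(\<And>i. i \<in> I ==> cuspidal \<kappa> (f i)) ==> cuspidal \<kappa> (\<lambda>z. \<Sum>i\<in>I. f i z)"
 by (auto simp: cuspidal_def intro!: holomorphic_intros growth_bounded_sum)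

lemma cuspidal_hecke_fun:
 assumes "p > 0" "cuspidal (real w) f"
 shows "cuspidal (real w) (hecke_fun w p f)"
 unfolding hecke_fun_def
 using assms hecke_reps_triangular by (intro cuspidal_cmult cuspidal_sum cuspidal_slash_triangular) auto

text \<open>Right multiplication by \<open>\<gamma>\<close> permutes the cosets represented by
  \<open>hecke_reps p\<close>, and \<open>slash\<close> does not depend on the
  representative.\<close>

lemma hecke_fun_in_S_int:
 assumes p: "prime p" "\<not> p dvd N" and N: "N > 0" "w > 0" and f: "f \<in> S_int w N"
 shows "hecke_fun w p f \<in> S_int w N"
proof -
 have p0: "p > 0" using p prime_gt_0_nat by blast
 have "hecke_fun w p f (moebius \<gamma> z) = cocycle \<gamma> z ^ w * hecke_fun w p f z" if \<gamma>: "\<gamma> \<in> Gamma0 N" and z: "z \<in> \<H>" for \<gamma> z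
 proof -
  have "\<exists>\<rho>'\<in>hecke_reps p. \<exists>\<eta>\<in>Gamma0 N. \<rho> ** \<gamma> = \<eta> ** \<rho>'" if "\<rho> \<in> hecke_reps p" for \<rho>
   using hecke_mats_decompose[OF p hecke_mats_mult_Gamma0[OF \<gamma>]] hecke_reps_subset that by (metis subsetD)
  then obtain r \<eta> where r: "\<And>\<rho>. \<rho> \<in> hecke_reps p ==> r \<rho> \<in> hecke_reps p"
   "\<And>\<rho>. \<rho> \<in> hecke_reps p ==> \<eta> \<rho> \<in> Gamma0 N" "\<And>\<rho>. \<rho> \<in> hecke_reps p ==> \<rho> ** \<gamma> = \<eta> \<rho> ** r \<rho>" by metis
  have "inj_on r (hecke_reps p)"
  proof (rule inj_onI)
   fix \<rho> \<rho>' assume \<rho>: "\<rho> \<in> hecke_reps p" "\<rho>' \<in> hecke_reps p" "r \<rho> = r \<rho>'"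
   have d: "det (\<eta> \<rho>) = 1" "det \<gamma> = 1" using Gamma0_det[OF r(2)[OF \<rho>(1)]] \<gamma> by auto
   have "(adj2 (\<eta> \<rho>) ** \<rho>) ** \<gamma> = (adj2 (\<eta> \<rho>') ** \<rho>') ** \<gamma>"
    using r(3)[OF \<rho>(1)] r(3)[OF \<rho>(2)] r(2)[OF \<rho>(1)] r(2)[OF \<rho>(2)] \<rho>(3)
    by (simp add: matrix_mul_assoc[symmetric]) (simp add: matrix_mul_assoc adj2_mult_self mat2_scalar_mult)
   hence "(adj2 (\<eta> \<rho>) ** \<rho>) ** (\<gamma> ** adj2 \<gamma>) = (adj2 (\<eta> \<rho>') ** \<rho>') ** (\<gamma> ** adj2 \<gamma>)"
    by (simp only: matrix_mul_assoc)
   hence "adj2 (\<eta> \<rho>) ** \<rho> = adj2 (\<eta> \<rho>') ** \<rho>'" by (simp add: mult_adj2 d mat2_scalar_mult)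
   from hecke_mats_decompose_unique(1)[OF p0 Gamma0_adj2[OF r(2)[OF \<rho>(1)]] Gamma0_adj2[OF r(2)[OF \<rho>(2)]] \<rho>(1,2) this]
   show "\<rho> = \<rho>'" .
  qed
  moreover from this have "r ` hecke_reps p = hecke_reps p"
   using r(1) by (intro card_subset_eq) (auto simp: card_image)
  ultimately have bij: "bij_betw r (hecke_reps p) (hecke_reps p)" by (simp add: bij_betw_def)
  have "slash w \<rho> f (moebius \<gamma> z) = cocycle \<gamma> z ^ w * slash w (r \<rho>) f z" if \<rho>: "\<rho> \<in> hecke_reps p" for \<rho>
  proof -
   have dd: "det \<rho> > 0" "det (r \<rho>) > 0" "det \<gamma> > 0" using \<rho> r(1)[OF \<rho>] \<gamma> p0 by auto
   have "slash w \<rho> f (moebius \<gamma> z) = cocycle \<gamma> z ^ w * slash w (\<rho> ** \<gamma>) f z"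
    using slash_mult[OF dd(1,3) z, of w f] cocycle_nonzero[OF dd(3) z] by simp
   also have "slash w (\<rho> ** \<gamma>) f = slash w (r \<rho>) f"
    unfolding r(3)[OF \<rho>] by (rule slash_Gamma0_mult[OF N f r(2)[OF \<rho>] dd(2)])
   finally show ?thesis .
  qed
  hence "hecke_fun w p f (moebius \<gamma> z) =
    of_nat p ^ (w - 1) * (cocycle \<gamma> z ^ w * (\<Sum>\<rho>\<in>hecke_reps p. slash w (r \<rho>) f z))"
   by (simp add: hecke_fun_def sum_distrib_left)
  also have "(\<Sum>\<rho>\<in>hecke_reps p. slash w (r \<rho>) f z) = (\<Sum>\<rho>\<in>hecke_reps p. slash w \<rho> f z)"
   by (rule sum.reindex_bij_betw[OF bij])
  finally show ?thesis by (simp add: hecke_fun_def)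
 qed
 moreover have "cuspidal (real w) (hecke_fun w p f)" by (intro cuspidal_hecke_fun p0 S_int_cuspidal[OF N f])
 ultimately show ?thesis unfolding S_int_iff[OF N] by (auto simp: cuspidal_def)
qed

subsection \<open>Hecke operators are Hermitian\<close>

text \<open>The share of \<open>\<alpha>\<close> in the unfolded product of \<open>T_p f\<close>
  with \<open>g\<close>. Cutting off with the Ford domain at both \<open>z\<close> and
  \<open>\<alpha> z\<close> is what makes it symmetric.\<close>

definition hecke_kernel :: "nat => nat => cfun => cfun => int^2^2 => complex"
 where "hecke_kernel w N f g \<alpha> = (\<integral>z. of_real (indicator (ford_domain N) (moebius \<alpha> z)) *
  (of_real (indicator (ford_domain N) z) * pet_integrand (real w) (slash w \<alpha> f) g z) \<partial>hyp)"

lemma measurable_slash: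
 assumes "f \<in> borel_measurable borel"
 shows "slash w \<alpha> f \<in> borel_measurable borel"
proof -
 have [measurable]: "(\<lambda>z. f (moebius \<alpha> z)) \<in> borel_measurable borel"
  using assms measurable_moebius by measurable
 have [measurable]: "(\<lambda>z. cocycle \<alpha> z) \<in> borel_measurable borel" unfolding cocycle_def by measurable
 show ?thesis unfolding slash_def by measurable
qed

text \<open>The substitution of \<open>\<alpha>^(-1) z\<close> for \<open>z\<close> exchanges the
  two cut-offs and moves the factor of automorphy from \<open>f\<close> to \<open>g\<close>.\<close>

lemma hecke_kernel_adj2:
 assumes \<alpha>: "det \<alpha> = int p" "p > 0" and f: "cuspidal (real w) f" and g: "cuspidal (real w) g"
 shows "hecke_kernel w N f g \<alpha> = cnj (hecke_kernel w N g f (adj2 \<alpha>))"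
proof -
 note [measurable] = cuspidal_measurable[OF f] cuspidal_measurable[OF g]
  measurable_slash[OF cuspidal_measurable[OF f]] measurable_slash[OF cuspidal_measurable[OF g]]
 have da: "det \<alpha> > 0" "det (adj2 \<alpha>) > 0" using \<alpha> by auto
 define F where "F z = of_real (indicator (ford_domain N) (moebius \<alpha> z)) *
  (of_real (indicator (ford_domain N) z) * pet_integrand (real w) (slash w \<alpha> f) g z)" for z
 have [measurable]: "F \<in> borel_measurable borel" unfolding F_def pet_integrand_def by measurable
 have "hecke_kernel w N f g \<alpha> = (\<integral>z. F (moebius (adj2 \<alpha>) z) \<partial>hyp)"
  unfolding hecke_kernel_def F_def[symmetric] by (rule integral_hyp_moebius[symmetric, OF da(2)]) measurable
 also have "... = (\<integral>z. cnj (of_real (indicator (ford_domain N) (moebius (adj2 \<alpha>) z)) *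
  (of_real (indicator (ford_domain N) z) * pet_integrand (real w) (slash w (adj2 \<alpha>) g) f z)) \<partial>hyp)"
 proof (rule integral_cong_AE)
  show "AE z in hyp. F (moebius (adj2 \<alpha>) z) = cnj (of_real (indicator (ford_domain N) (moebius (adj2 \<alpha>) z)) *
   (of_real (indicator (ford_domain N) z) * pet_integrand (real w) (slash w (adj2 \<alpha>) g) f z))"
   using AE_hyp_H
  proof eventually_elim
   case (elim z)
   let ?z = "moebius (adj2 \<alpha>) z" and ?c = "cocycle (adj2 \<alpha>) z"
   have z': "?z \<in> \<H>" "moebius \<alpha> ?z = z" using elim da by (auto simp: moebius_adj2_right)
   have nz: "?c \<noteq> 0" using cocycle_nonzero[OF da(2) elim] .
   have "cocycle \<alpha> ?z * ?c = cocycle (\<alpha> ** adj2 \<alpha>) z" by (rule cocycle_mult[symmetric, OF da(2) elim])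
   also have "... = of_nat p" by (simp add: mult_adj2 \<alpha>)
   finally have c1: "cocycle \<alpha> ?z = of_nat p / ?c" using nz by (simp add: field_simps)
   have Im: "Im ?z = real p * Im z / (cmod ?c)\<^sup>2" using Im_moebius[OF da(2) elim] \<alpha> by simp
   have pw: "Im ?z powr real w = (Im ?z) ^ w" "Im z powr real w = (Im z) ^ w"
    using z'(1) elim by (auto simp: powr_realpow H_iff)
   have "pet_integrand (real w) (slash w \<alpha> f) g ?z =
    f z / (of_nat p / ?c) ^ w * cnj (g ?z) * of_real ((Im ?z) ^ w)"
    using z' by (simp add: pet_integrand_def slash_def c1 pw(1))
   also have "... = cnj (g ?z) * f z * of_real (Im z ^ w) * (?c ^ w / of_real (((cmod ?c)\<^sup>2) ^ w))"
    using \<alpha>(2) by (simp add: Im power_divide power_mult_distrib)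
   also have "?c ^ w / of_real (((cmod ?c)\<^sup>2) ^ w) = 1 / cnj ?c ^ w"
   proof -
    have "of_real ((cmod ?c)\<^sup>2) = ?c * cnj ?c" by (rule complex_norm_square)
    hence "complex_of_real (((cmod ?c)\<^sup>2) ^ w) = ?c ^ w * cnj ?c ^ w"
     by (metis of_real_power power_mult_distrib)
    thus ?thesis using nz by simp
   qed
   finally have "pet_integrand (real w) (slash w \<alpha> f) g ?z =
    cnj (pet_integrand (real w) (slash w (adj2 \<alpha>) g) f z)"
    using elim by (simp add: pet_integrand_def slash_def pw(2))
   thus ?case by (simp add: F_def z'(2))
  qed
  show "(\<lambda>z. cnj (of_real (indicator (ford_domain N) (moebius (adj2 \<alpha>) z)) *
   (of_real (indicator (ford_domain N) z) * pet_integrand (real w) (slash w (adj2 \<alpha>) g) f z))) \<in> borel_measurable hyp"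
   unfolding pet_integrand_def by measurable
 qed measurable
 also have "... = cnj (hecke_kernel w N g f (adj2 \<alpha>))"
  unfolding hecke_kernel_def by (rule Bochner_Integration.integral_cnj)
 finally show ?thesis .
qed

text \<open>Each coset of \<open>Gamma0 N\<close> contributes the unfolded integral of a single
  summand \<open>slash w \<rho> f\<close>, and the disjoint cosets fill all of
  \<open>hecke_mats N p\<close>. The factor 2 accounts for \<open>-1\<close> in
  \<open>Gamma0 N\<close>.\<close>

lemma hecke_fun_unfold:
 assumes p: "prime p" "\<not> p dvd N" and N: "N > 0" "w > 0" and f: "f \<in> S_int w N" and g: "g \<in> S_int w N"
 shows "((\<lambda>\<alpha>. of_nat p ^ (w - 1) * hecke_kernel w N f g \<alpha>) has_sum (2 * petersson (real w) N (hecke_fun w p f) g)) (hecke_mats N p)"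
proof -
 have p0: "p > 0" using p prime_gt_0_nat by blast
 note cf = S_int_cuspidal[OF N f] and cg = S_int_cuspidal[OF N g]
 have cs: "cuspidal (real w) (slash w \<rho> f)" if "\<rho> \<in> hecke_reps p" for \<rho>
  using that hecke_reps_triangular p0 cf by (intro cuspidal_slash_triangular) auto
 define I where "I \<rho> = 2 * petersson (real w) N (slash w \<rho> f) g" for \<rho>
 have 1: "(hecke_kernel w N f g has_sum I \<rho>) ((\<lambda>\<gamma>. \<gamma> ** \<rho>) ` Gamma0 N)" if \<rho>: "\<rho> \<in> hecke_reps p" for \<rho>
 proof -
  have inj: "inj_on (\<lambda>\<gamma>. \<gamma> ** \<rho>) (Gamma0 N)"
   using hecke_mats_decompose_unique(2)[OF p0 _ _ \<rho> \<rho>] by (auto simp: inj_on_def)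
  have d: "det \<rho> > 0" using \<rho> p0 by auto
  have "((\<lambda>\<gamma>. \<integral>z. of_real (indicator (ford_domain N) (moebius (\<gamma> ** \<rho>) z)) *
   (of_real (indicator (ford_domain N) z) * pet_integrand (real w) (slash w \<rho> f) g z) \<partial>hyp) has_sum I \<rho>) (Gamma0 N)"
   unfolding I_def petersson_eq_integral[OF cs[OF \<rho>] cg]
   by (rule unfold_fundamental[OF fundamental_ford_domain d integrable_petersson[OF N(1) cs[OF \<rho>] cg]]) auto
  also have "?this \<longleftrightarrow> ((\<lambda>\<gamma>. hecke_kernel w N f g (\<gamma> ** \<rho>)) has_sum I \<rho>) (Gamma0 N)"
   by (rule has_sum_cong) (simp add: hecke_kernel_def slash_Gamma0_mult[OF N f _ d])
  finally show ?thesis by (subst has_sum_reindex[OF inj]) (simp add: o_def)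
 qed
 have UN: "(\<Union>\<rho>\<in>hecke_reps p. (\<lambda>\<gamma>. \<gamma> ** \<rho>) ` Gamma0 N) = hecke_mats N p"
 proof (intro equalityI subsetI)
  fix \<alpha> assume "\<alpha> \<in> (\<Union>\<rho>\<in>hecke_reps p. (\<lambda>\<gamma>. \<gamma> ** \<rho>) ` Gamma0 N)"
  thus "\<alpha> \<in> hecke_mats N p" using Gamma0_mult_hecke_mats hecke_reps_subset by blast
 next
  fix \<alpha> assume "\<alpha> \<in> hecke_mats N p"
  from hecke_mats_decompose[OF p this] obtain \<gamma> \<rho> where "\<gamma> \<in> Gamma0 N" "\<rho> \<in> hecke_reps p" "\<alpha> = \<gamma> ** \<rho>" by blast
  thus "\<alpha> \<in> (\<Union>\<rho>\<in>hecke_reps p. (\<lambda>\<gamma>. \<gamma> ** \<rho>) ` Gamma0 N)" by blast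
 qed
 have "(hecke_kernel w N f g has_sum sum I (hecke_reps p)) (\<Union>\<rho>\<in>hecke_reps p. (\<lambda>\<gamma>. \<gamma> ** \<rho>) ` Gamma0 N)"
 proof (rule sum_has_sum)
  fix \<rho> \<rho>' assume \<rho>: "\<rho> \<in> hecke_reps p" "\<rho>' \<in> hecke_reps p" "\<rho> \<noteq> \<rho>'"
  thus "(\<lambda>\<gamma>. \<gamma> ** \<rho>) ` Gamma0 N \<inter> (\<lambda>\<gamma>. \<gamma> ** \<rho>') ` Gamma0 N = {}"
   using hecke_mats_decompose_unique(1)[OF p0 _ _ \<rho>(1,2)] by blast
 qed (use 1 in auto)
 hence 2: "((\<lambda>\<alpha>. of_nat p ^ (w - 1) * hecke_kernel w N f g \<alpha>) has_sum (of_nat p ^ (w - 1) * sum I (hecke_reps p))) (hecke_mats N p)"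
  unfolding UN by (rule has_sum_cmult_right)
 have sum: "petersson (real w) N (\<lambda>z. \<Sum>\<rho>\<in>R. slash w \<rho> f z) g = (\<Sum>\<rho>\<in>R. petersson (real w) N (slash w \<rho> f) g)"
  if "R \<subseteq> hecke_reps p" for R using finite_subset[OF that finite_hecke_reps] that
 proof (induction R rule: finite_induct)
  case empty
  have "cuspidal (real w) (\<lambda>_. 0)" using cuspidal_cmult[OF cg, of 0] by simp
  thus ?case using petersson_cmult_left[OF cg cg, of N 0] by simp
 next
  case (insert \<rho> R)
  hence "petersson (real w) N (\<lambda>z. slash w \<rho> f z + (\<Sum>\<rho>\<in>R. slash w \<rho> f z)) g =
   petersson (real w) N (slash w \<rho> f) g + petersson (real w) N (\<lambda>z. \<Sum>\<rho>\<in>R. slash w \<rho> f z) g"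
   using cs by (intro petersson_add_left N(1) cg cuspidal_sum) auto
  with insert show ?case by simp
 qed
 have "cuspidal (real w) (\<lambda>z. \<Sum>\<rho>\<in>hecke_reps p. slash w \<rho> f z)" using cs by (intro cuspidal_sum)
 hence "petersson (real w) N (hecke_fun w p f) g = of_nat p ^ (w - 1) * (\<Sum>\<rho>\<in>hecke_reps p. petersson (real w) N (slash w \<rho> f) g)"
  unfolding hecke_fun_def using petersson_cmult_left[OF _ cg] sum by simp
 hence "of_nat p ^ (w - 1) * sum I (hecke_reps p) = 2 * petersson (real w) N (hecke_fun w p f) g"
  by (simp add: I_def sum_distrib_left[symmetric])
 with 2 show ?thesis by simp
qed

text \<open>The sum over all integral matrices of determinant \<open>p\<close> is symmetric under \<open>\<alpha> \<mapsto> p / \<alpha>\<close>.\<close>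
lemma hecke_fun_hermitian:
 assumes p: "prime p" "\<not> p dvd N" and N: "N > 0" "w > 0" and f: "f \<in> S_int w N" and g: "g \<in> S_int w N"
 shows "petersson (real w) N (hecke_fun w p f) g = petersson (real w) N f (hecke_fun w p g)"
proof -
 have p0: "p > 0" using p prime_gt_0_nat by blast
 have bij: "bij_betw adj2 (hecke_mats N p) (hecke_mats N p)"
  by (rule bij_betw_byWitness[of _ adj2]) (auto simp: hecke_mats_def)
 let ?K = "\<lambda>f g \<alpha>. of_nat p ^ (w - 1) * hecke_kernel w N f g \<alpha>"
 have "((\<lambda>\<alpha>. cnj (?K g f \<alpha>)) has_sum cnj (2 * petersson (real w) N (hecke_fun w p g) f)) (hecke_mats N p)"
  unfolding has_sum_cnj_iff by (rule hecke_fun_unfold[OF p N g f])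
 hence "((\<lambda>\<alpha>. cnj (?K g f (adj2 \<alpha>))) has_sum cnj (2 * petersson (real w) N (hecke_fun w p g) f)) (hecke_mats N p)"
  using has_sum_reindex_bij_betw[OF bij, of "\<lambda>\<alpha>. cnj (?K g f \<alpha>)"] by blast
 also have "?this \<longleftrightarrow> (?K f g has_sum cnj (2 * petersson (real w) N (hecke_fun w p g) f)) (hecke_mats N p)"
  using hecke_kernel_adj2[OF _ p0 S_int_cuspidal[OF N f] S_int_cuspidal[OF N g]]
  by (intro has_sum_cong) (auto simp: hecke_mats_def)
 finally have "2 * petersson (real w) N (hecke_fun w p f) g = cnj (2 * petersson (real w) N (hecke_fun w p g) f)"
  using hecke_fun_unfold[OF p N f g] has_sum_unique by blast
 thus ?thesis by (simp add: petersson_cnj)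
qed

subsection \<open>Finite dimensionality\<close>

lemma growth_slash_int:
 assumes "\<rho> \<in> Gamma0 1" "z \<in> \<H>"
 shows "growth (real w) (slash w \<rho> f) z = growth (real w) f (moebius \<rho> z)"
proof -
 have "cmod (cocycle \<rho> z) > 0" using cocycle_nonzero[of \<rho> z] assms by simp
 thus ?thesis
  using assms by (simp add: growth_moebius) (simp add: growth_def slash_def norm_divide norm_power powr_minus powr_realpow field_simps)
qed

lemma slash_add: "slash w \<alpha> (\<lambda>z. f z + g z) z = slash w \<alpha> f z + slash w \<alpha> g z"
 by (simp add: slash_def add_divide_distrib)

lemma slash_cmult: "slash w \<alpha> (\<lambda>z. c * f z) z = c * slash w \<alpha> f z" by (simp add: slash_def)

text \<open>\<open>slash w \<rho> f\<close> has period \<open>N\<close>, because the conjugate of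
  the translation by \<open>N\<close> with \<open>\<rho>\<close> lies in \<open>Gamma0 N\<close>;
  the dilation by \<open>N\<close> turns this into an ordinary expansion.\<close>

lemma slash_has_qexp:
 assumes N: "N > 0" "w > 0" and f: "f \<in> S_int w N" and \<rho>: "\<rho> \<in> Gamma0 1"
 shows "\<exists>a. has_qexp (\<lambda>z. slash w \<rho> f (of_nat N * z)) a"
proof -
 have d: "det \<rho> = 1" using \<rho> by simp
 have NH: "of_nat N * z \<in> \<H> \<longleftrightarrow> z \<in> \<H>" for z using N by (simp add: H_iff zero_less_mult_iff)
 have fH: "f holomorphic_on \<H>" using f S_int_iff[OF N] by blast
 define \<delta> where "\<delta> = \<rho> ** mat2 1 (int N) 0 1 ** adj2 \<rho>"
 have \<delta>: "\<delta> \<in> Gamma0 N" using d by (auto simp: \<delta>_def Gamma0_iff det_mul matmul_nth algebra_simps)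
 have "\<delta> ** \<rho> = \<rho> ** mat2 1 (int N) 0 1 ** (adj2 \<rho> ** \<rho>)" by (simp add: \<delta>_def matrix_mul_assoc)
 hence \<delta>\<rho>: "\<delta> ** \<rho> = \<rho> ** mat2 1 (int N) 0 1" by (simp add: adj2_mult_self d mat2_scalar_mult)
 from S_int_iff[OF N] f have "growth_bounded (real w) f" by blast
 then obtain C where C: "C \<ge> 0" "\<And>z. z \<in> \<H> ==> growth (real w) f z \<le> C" by (rule growth_boundedE) auto
 obtain a where "a 0 = 0" and a: "\<And>z. z \<in> \<H> ==> (\<lambda>n. a n * exp (\<omega> * of_nat n * z)) sums slash w \<rho> f (of_nat N * z)"
 proof (rule fourier_expansion)
  have "(f \<circ> moebius \<rho>) holomorphic_on \<H>"
   by (rule holomorphic_on_compose_gen[OF holomorphic_moebius fH]) (auto simp: d)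
  hence "(\<lambda>z. f (moebius \<rho> z) / cocycle \<rho> z ^ w) holomorphic_on \<H>"
   unfolding o_def using cocycle_nonzero[of \<rho>] d unfolding cocycle_def by (intro holomorphic_intros) auto
  hence "slash w \<rho> f holomorphic_on \<H>" by (rule holomorphic_transform) (simp add: slash_def)
  hence "(slash w \<rho> f \<circ> (\<lambda>z. of_nat N * z)) holomorphic_on \<H>"
   by (intro holomorphic_on_compose_gen[of _ _ _ \<H>] holomorphic_intros) (use NH in auto)
  thus "(\<lambda>z. slash w \<rho> f (of_nat N * z)) holomorphic_on \<H>" by (simp add: o_def)
  show "slash w \<rho> f (of_nat N * (z + 1)) = slash w \<rho> f (of_nat N * z)" if z: "z \<in> \<H>" for z
  proof -
   have "slash w \<rho> f (of_nat N * (z + 1)) = slash w (\<rho> ** mat2 1 (int N) 0 1) f (of_nat N * z)"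
    using NH[of z] z d by (subst slash_mult) (auto simp: moebius_mat2 algebra_simps)
   also have "... = slash w \<rho> f (of_nat N * z)"
    unfolding \<delta>\<rho>[symmetric] using d by (subst slash_Gamma0_mult[OF N f \<delta>]) auto
   finally show ?thesis .
  qed
  show "cmod (slash w \<rho> f (of_nat N * z)) \<le> (C * real N powr (- real w / 2)) * Im z powr - (real w / 2)" if z: "z \<in> \<H>" for z
  proof -
   have Nz: "of_nat N * z \<in> \<H>" using NH z by blast
   have "cmod (slash w \<rho> f (of_nat N * z)) = growth (real w) f (moebius \<rho> (of_nat N * z)) * Im (of_nat N * z) powr (- real w / 2)"
    by (simp only: norm_le_growth[OF Nz, of _ "real w"] growth_slash_int[OF \<rho> Nz])
   also have "... \<le> C * Im (of_nat N * z) powr (- real w / 2)" using Nz d by (intro mult_right_mono C) auto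
   also have "... = (C * real N powr (- real w / 2)) * Im z powr - (real w / 2)"
    using z by (simp add: powr_mult H_iff)
   finally show ?thesis .
  qed
  show "real w / 2 > 0" using N by simp
 qed auto
 have "slash w \<rho> f (of_nat N * z) = 0" if "z \<notin> \<H>" for z using that NH[of z] by (simp add: slash_def)
 with a show ?thesis by (auto simp: has_qexp_def)
qed

text \<open>Compare \<open>\<bar>F / q^m\<bar>\<close> at the height \<open>y\<close> of the maximum of the growth function with its values at
  height \<open>y/2\<close>; by the maximum principle a zero of order \<open>m = N * w\<close> at all cusps is impossible.\<close>
lemma S_int_vanishing_order:
 assumes N: "N > 0" "w > 0" and f: "f \<in> S_int w N"
  and R: "\<And>\<gamma>. \<gamma> \<in> Gamma0 1 ==> \<exists>\<rho>\<in>R. \<exists>\<eta>\<in>Gamma0 N. \<gamma> = \<eta> ** \<rho>" "R \<subseteq> Gamma0 1"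
  and zero: "\<And>\<rho> n. \<rho> \<in> R ==> n < N * w ==> qcoeff (\<lambda>z. slash w \<rho> f (of_nat N * z)) n = 0"
 shows "f = 0"
proof (rule ccontr)
 assume "f \<noteq> 0"
 interpret W: cusp_weight N "\<lambda>\<gamma> z. cocycle \<gamma> z ^ w" "\<lambda>\<gamma> z. cocycle \<gamma> z ^ w" 1 w "real w"
  by (rule cusp_weight_int[OF N])
 obtain z0 where z0: "z0 \<in> \<H>" "\<And>z. z \<in> \<H> ==> growth (real w) f z \<le> growth (real w) f z0"
  using W.cusp_forms_growth_max f[unfolded S_int_def] by blast
 define M where "M = growth (real w) f z0"
 have f': "\<And>z. z \<notin> \<H> ==> f z = 0" "\<And>\<gamma> z. \<gamma> \<in> Gamma0 N ==> z \<in> \<H> ==> f (moebius \<gamma> z) = cocycle \<gamma> z ^ w * f z"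
  using f S_int_iff[OF N] by blast+
 have "M > 0"
 proof -
  obtain z where z: "f z \<noteq> 0" using `f \<noteq> 0` by (auto simp: fun_eq_iff)
  hence "z \<in> \<H>" using f'(1) by blast
  with z have "growth (real w) f z > 0" by (simp add: growth_def H_iff)
  with z0(2)[OF `z \<in> \<H>`] show ?thesis by (simp add: M_def)
 qed
 obtain \<rho> u where \<rho>: "\<rho> \<in> R" "u \<in> ford_domain 1" "growth (real w) f z0 = growth (real w) f (moebius \<rho> u)"
  by (rule W.ex_coset_moebius[OF R f'(2) z0(1)])
 have u: "Im u \<ge> 1 / 2" "u \<in> \<H>" using Im_ford_domain_1[OF \<rho>(2)] by (auto simp: H_iff)
 have \<rho>1: "\<rho> \<in> Gamma0 1" "det \<rho> = 1" using \<rho> R by auto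
 let ?F = "slash w \<rho> f"
 have gF: "growth (real w) ?F z \<le> M" if "z \<in> \<H>" for z
  using growth_slash_int[OF \<rho>1(1) that] z0(2)[of "moebius \<rho> z"] that \<rho>1 by (simp add: M_def)
 obtain a where a: "has_qexp (\<lambda>z. ?F (of_nat N * z)) a" using slash_has_qexp[OF N f \<rho>1(1)] by blast
 define m where "m = N * w"
 have a0: "a n = 0" if "n < m" for n using zero[OF \<rho>(1)] that qcoeff_eqI[OF a] by (simp add: m_def)
 define e where "e z = exp (\<omega> * z)" for z
 \<comment> \<open>The function \<open>F / q^m\<close>, holomorphic on the whole disc because the
   first \<open>m\<close> coefficients vanish.\<close>
 define h where "h q = (\<Sum>n. a (n + m) * q ^ n)" for q
 have hs: "(\<lambda>n. a (n + m) * e z ^ n) sums (?F (of_nat N * z) / e z ^ m)" if "z \<in> \<H>" for z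
 proof -
  have "(\<lambda>n. a n * e z ^ n) sums ?F (of_nat N * z)"
   using a that unfolding has_qexp_def exp_nat_power e_def by blast
  hence "(\<lambda>n. a (n + m) * e z ^ (n + m)) sums ?F (of_nat N * z)"
   by (subst sums_zero_iff_shift) (use a0 in auto)
  hence "(\<lambda>n. a (n + m) * e z ^ (n + m) / e z ^ m) sums (?F (of_nat N * z) / e z ^ m)" by (rule sums_divide)
  thus ?thesis by (simp add: power_add e_def)
 qed
 have h_eq: "h (e z) = ?F (of_nat N * z) / e z ^ m" if "z \<in> \<H>" for z
  using hs[OF that] by (simp add: h_def sums_iff)
 have "h holomorphic_on ball 0 1"
 proof (rule power_series_holomorphic)
  fix q :: complex assume q: "q \<in> ball 0 1"
  show "(\<lambda>n. a (n + m) * (q - 0) ^ n) sums h q"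
  proof (cases "q = 0")
   case True
   thus ?thesis using powser_sums_zero[of "\<lambda>n. a (n + m)"] by (simp add: h_def sums_iff)
  next
   case False
   have "cmod q < 1" using q by simp
   from ex_H_exp[OF False this] obtain z where "z \<in> \<H>" "e z = q" unfolding e_def by blast
   thus ?thesis using hs[of z] by (simp add: h_def sums_iff)
  qed
 qed
 note hol = this
 define y where "y = Im u"
 have y: "y \<ge> 1 / 2" using u by (simp add: y_def)
 \<comment> \<open>The modulus of \<open>q\<close> at height \<open>y / 2\<close>, in the coordinate
   stretched by \<open>N\<close>. With \<open>m = N * w\<close> the power \<open>r^(-m)\<close> is
   \<open>exp (pi * y * w)\<close>.\<close>
 define r where "r = exp (- pi * y / real N)"
 have r: "0 < r" "r < 1" using y N by (auto simp: r_def)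
 have ne: "cmod (e z) = exp (- 2 * pi * Im z)" for z by (simp add: e_def)
 define X where "X = M * (y / 2) powr (- real w / 2) * exp (pi * y * real w)"
 have bound: "cmod (h q) \<le> X" if q: "cmod q = r" for q
 proof -
  have "q \<noteq> 0" "cmod q < 1" using q r by auto
  from ex_H_exp[OF this] obtain z where z: "z \<in> \<H>" "e z = q" unfolding e_def by blast
  have "exp (- 2 * pi * Im z) = exp (- pi * y / real N)" using ne[of z] z(2) q by (simp add: r_def)
  hence Im: "Im (of_nat N * z) = y / 2" using N by (simp add: field_simps)
  hence Nz: "of_nat N * z \<in> \<H>" using y by (simp add: H_iff)
  have "cmod (?F (of_nat N * z)) \<le> M * (y / 2) powr (- real w / 2)"
   unfolding norm_le_growth[OF Nz, of ?F "real w"] Im using gF[OF Nz] by (rule mult_right_mono) simp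
  moreover have "1 / cmod (e z ^ m) = exp (pi * y * real w)"
   using N unfolding norm_power z(2) q r_def by (simp add: m_def flip: exp_of_nat_mult exp_minus inverse_eq_divide)
  ultimately have "cmod (?F (of_nat N * z)) * (1 / cmod (e z ^ m)) \<le> X"
   unfolding X_def using `M > 0` by (intro mult_mono) auto
  thus ?thesis using h_eq[OF z(1)] z(2) by (simp add: norm_divide)
 qed
 define z where "z = u / of_nat N"
 have z: "z \<in> \<H>" "of_nat N * z = u" using u N by (auto simp: z_def H_iff)
 have nq: "cmod (e z) = exp (- 2 * pi * y / real N)" by (simp add: ne z_def y_def)
 have "cmod (h (e z)) \<le> X"
 proof (rule maximum_modulus_frontier[of h "cball 0 r"])
  show "h holomorphic_on interior (cball 0 r)" using hol by (rule holomorphic_on_subset) (use r in auto)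
  show "continuous_on (closure (cball 0 r)) h"
   by (rule continuous_on_subset[OF holomorphic_on_imp_continuous_on[OF hol]]) (use r in auto)
  show "e z \<in> cball 0 r" using y N by (simp add: nq r_def divide_right_mono)
 qed (use bound in auto)
 moreover have "cmod (h (e z)) = M * y powr (- real w / 2) * exp (2 * pi * y * real w)"
 proof -
  have "cmod (?F u) = M * y powr (- real w / 2)"
   unfolding norm_le_growth[OF u(2), of ?F "real w"] growth_slash_int[OF \<rho>1(1) u(2)] M_def \<rho>(3) y_def ..
  moreover have "1 / cmod (e z ^ m) = exp (2 * pi * y * real w)"
   using N unfolding norm_power nq by (simp add: m_def flip: exp_of_nat_mult exp_minus inverse_eq_divide)
  moreover have "cmod (h (e z)) = cmod (?F u) * (1 / cmod (e z ^ m))"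
   unfolding h_eq[OF z(1)] z(2) norm_divide by simp
  ultimately show ?thesis by simp
 qed
 moreover have "(y / 2) powr (- real w / 2) = y powr (- real w / 2) * 2 powr (real w / 2)"
  using y by (simp add: powr_divide powr_minus_divide)
 ultimately have "(M * y powr (- real w / 2) * exp (pi * y * real w)) * exp (pi * y * real w) \<le>
   (M * y powr (- real w / 2) * exp (pi * y * real w)) * 2 powr (real w / 2)"
 proof -
  have "exp (2 * pi * y * real w) = exp (pi * y * real w) * exp (pi * y * real w)" by (simp flip: exp_add)
  moreover assume "cmod (h (e z)) \<le> X" "cmod (h (e z)) = M * y powr (- real w / 2) * exp (2 * pi * y * real w)"
   "(y / 2) powr (- real w / 2) = y powr (- real w / 2) * 2 powr (real w / 2)"
  ultimately show ?thesis unfolding X_def by (simp only: mult_ac)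
 qed
 \<comment> \<open>The factor gained between the two heights is \<open>exp (pi * y * w)\<close>, the
   one lost in the power of \<open>y\<close> is \<open>2^(w/2)\<close>; for
   \<open>y \<ge> 1/2\<close> the former is larger.\<close>
 hence "exp (pi * y * real w) \<le> 2 powr (real w / 2)"
  using `M > 0` y by (subst (asm) mult_le_cancel_left_pos) auto
 also have "... \<le> exp (real w / 2)"
 proof -
  have "ln 2 \<le> (1::real)" using ln_le_minus_one[of 2] by simp
  thus ?thesis by (simp add: powr_def mult_left_le)
 qed
 finally have "pi * y * real w \<le> 1 / 2 * real w" by simp
 moreover have "pi * y * real w > 1 / 2 * real w"
 proof (rule mult_strict_right_mono)
  have "1 * (1 / 2) < pi * y" using y pi_gt3 by (intro mult_less_le_imp_less) auto
  thus "1 / 2 < pi * y" by simp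
 qed (use N in simp)
 ultimately show False by simp
qed

text \<open>By the bound on the vanishing order, the first \<open>N * w\<close> coefficients at
  representatives of all cosets separate the forms.\<close>

lemma S_int_finite_dim:
 assumes N: "N > 0" "w > 0"
 shows "\<exists>n. dim_atmost n (S_int w N)"
proof -
 from finite_coset_reps[OF N(1)] obtain R where R: "finite R" "R \<subseteq> Gamma0 1"
  "\<And>\<gamma>. \<gamma> \<in> Gamma0 1 ==> \<exists>\<rho>\<in>R. \<exists>\<eta>\<in>Gamma0 N. \<gamma> = \<eta> ** \<rho>" by blast
 let ?s = "\<lambda>\<rho> f z. slash w \<rho> f (of_nat N * z)"
 have ex: "has_qexp (?s \<rho> f) (qcoeff (?s \<rho> f))" if "\<rho> \<in> R" "f \<in> S_int w N" for \<rho> f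
  using slash_has_qexp[OF N that(2), of \<rho>] that(1) R(2) qcoeff_eqI by (metis subsetD)
 show ?thesis
 proof (rule dim_atmost_from_functionals[of "R \<times> {..<N * w}" _ "\<lambda>(\<rho>, n) f. qcoeff (?s \<rho> f) n"])
  fix i f g assume i: "i \<in> R \<times> {..<N * w}" and f: "f \<in> S_int w N" and g: "g \<in> S_int w N"
  obtain \<rho> n where i_eq: "i = (\<rho>, n)" "\<rho> \<in> R" using i by auto
  have "qcoeff (?s \<rho> (f + g)) = (\<lambda>n. qcoeff (?s \<rho> f) n + qcoeff (?s \<rho> g) n)"
   using has_qexp_add[OF ex[OF i_eq(2) f] ex[OF i_eq(2) g]]
   by (intro qcoeff_eqI) (simp add: plus_fun_def slash_add)
  thus "(case i of (\<rho>, n) => \<lambda>f. qcoeff (?s \<rho> f) n) (f + g) =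
    (case i of (\<rho>, n) => \<lambda>f. qcoeff (?s \<rho> f) n) f + (case i of (\<rho>, n) => \<lambda>f. qcoeff (?s \<rho> f) n) g"
   by (simp add: i_eq)
 next
  fix i c f assume i: "i \<in> R \<times> {..<N * w}" and f: "f \<in> S_int w N"
  obtain \<rho> n where i_eq: "i = (\<rho>, n)" "\<rho> \<in> R" using i by auto
  have "qcoeff (?s \<rho> (\<lambda>z. c * f z)) = (\<lambda>n. c * qcoeff (?s \<rho> f) n)"
   using has_qexp_cmult[OF ex[OF i_eq(2) f]] by (intro qcoeff_eqI) (simp add: slash_cmult)
  thus "(case i of (\<rho>, n) => \<lambda>f. qcoeff (?s \<rho> f) n) (\<lambda>z. c * f z) =
    c * (case i of (\<rho>, n) => \<lambda>f. qcoeff (?s \<rho> f) n) f" by (simp add: i_eq)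
 next
  fix f assume f: "f \<in> S_int w N"
   and zero: "\<And>i. i \<in> R \<times> {..<N * w} ==> (case i of (\<rho>, n) => \<lambda>f. qcoeff (?s \<rho> f) n) f = 0"
  show "f = 0"
  proof (rule S_int_vanishing_order[OF N f R(3,2)])
   show "qcoeff (?s \<rho> f) n = 0" if "\<rho> \<in> R" "n < N * w" for \<rho> n using zero[of "(\<rho>, n)"] that by simp
  qed
 qed (use R(1) subspace_S_int[OF N] in auto)
qed

subsection \<open>Oldforms and newforms of level 2\<close>

abbreviation lift2 :: "cfun => cfun"
 where "lift2 h \<equiv> (\<lambda>z. h (of_nat 2 * z))"

lemma S_int_level_mono: "N > 0 ==> w > 0 ==> f \<in> S_int w 1 ==> f \<in> S_int w N"
 using Gamma0_subset[of 1 N] unfolding S_int_iff[of N w] S_int_iff[OF zero_less_one, of w] by auto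

lemma lift2_in_S_int:
 assumes "w > 0" "h \<in> S_int w 1"
 shows "lift2 h \<in> S_int w 2"
proof -
 have N: "(2::nat) > 0" "(1::nat) > 0" by auto
 have h: "h holomorphic_on \<H>" "\<And>z. z \<notin> \<H> ==> h z = 0" "growth_bounded (real w) h"
  "\<And>\<gamma> z. \<gamma> \<in> Gamma0 1 ==> z \<in> \<H> ==> h (moebius \<gamma> z) = cocycle \<gamma> z ^ w * h z"
  using assms(2) S_int_iff[OF N(2) assms(1)] by blast+
 have inH: "of_nat 2 * z \<in> \<H> \<longleftrightarrow> z \<in> \<H>" for z :: complex by (simp add: H_iff)
 have "(h \<circ> (\<lambda>z. of_nat 2 * z)) holomorphic_on \<H>"
  by (intro holomorphic_on_compose_gen[OF _ h(1)] holomorphic_intros) (use inH in auto)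
 moreover have "growth_bounded (real w) (\<lambda>z. h (of_nat 2 * z))"
  using growth_bounded_affine[OF h(3), of 2 1 0] by simp
 moreover have "h (of_nat 2 * moebius \<gamma> z) = cocycle \<gamma> z ^ w * h (of_nat 2 * z)" if \<gamma>: "\<gamma> \<in> Gamma0 2" and z: "z \<in> \<H>" for \<gamma> z
 proof -
  from \<gamma> obtain c where c: "\<gamma>$2$1 = 2 * c" by (auto simp: Gamma0_iff)
  \<comment> \<open>The conjugate of \<open>\<gamma>\<close> by the dilation
    \<open>z \<mapsto> 2 z\<close>, integral as the lower left entry of \<open>\<gamma>\<close> is
    even.\<close>
  define \<delta> where "\<delta> = mat2 (\<gamma>$1$1) (2 * \<gamma>$1$2) c (\<gamma>$2$2)"
  have \<delta>: "\<delta> \<in> Gamma0 1" using \<gamma> c by (simp add: \<delta>_def Gamma0_iff det_2)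
  have "of_nat 2 * moebius \<gamma> z = moebius \<delta> (of_nat 2 * z)" "cocycle \<gamma> z = cocycle \<delta> (of_nat 2 * z)"
   by (simp_all add: \<delta>_def moebius_def cocycle_def c algebra_simps)
  thus ?thesis using h(4)[OF \<delta>, of "of_nat 2 * z"] z inH by simp
 qed
 ultimately show ?thesis using h(2) inH unfolding S_int_iff[OF N(1) assms(1)] o_def by auto
qed

lemma S_old_iff:
 assumes "w > 0"
 shows "f \<in> S_old w 2 \<longleftrightarrow> (\<exists>g\<in>S_int w 1. \<exists>h\<in>S_int w 1. f = (\<lambda>z. g z + lift2 h z))"
proof -
 let ?X = "{\<lambda>z. f (of_nat d * z) | M d f. M * d dvd 2 \<and> M \<noteq> 2 \<and> f \<in> S_int w M}"
 let ?S = "{f. \<exists>g\<in>S_int w 1. \<exists>h\<in>S_int w 1. f = (\<lambda>z. g z + lift2 h z)}"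
 have s1: "fun_vs.subspace (S_int w 1)" using assms by (intro subspace_S_int) auto
 have z1: "0 \<in> S_int w 1" using fun_vs.subspace_0[OF s1] .
 have "?S \<subseteq> fun_vs.span ?X"
 proof
  fix f assume "f \<in> ?S"
  then obtain g h where gh: "g \<in> S_int w 1" "h \<in> S_int w 1" "f = (\<lambda>z. g z + lift2 h z)" by blast
  have "(\<lambda>z. g (of_nat 1 * z)) \<in> ?X" using gh(1) by (intro CollectI exI[of _ 1] exI[of _ g]) auto
  hence g: "g \<in> ?X" by simp
  have h: "lift2 h \<in> ?X" using gh(2) by (intro CollectI exI[of _ "1::nat"] exI[of _ "2::nat"] exI[of _ h]) auto
  have "f = g + lift2 h" by (simp add: gh(3) plus_fun_def)
  thus "f \<in> fun_vs.span ?X"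
   using fun_vs.span_add[OF fun_vs.span_base[OF g] fun_vs.span_base[OF h]] by (simp only:)
 qed
 moreover have "fun_vs.span ?X \<subseteq> ?S"
 proof (rule fun_vs.span_minimal)
  show "?X \<subseteq> ?S"
  proof
   fix f assume "f \<in> ?X"
   then obtain M d g where M: "M * d dvd 2" "M \<noteq> 2" "g \<in> S_int w M" "f = (\<lambda>z. g (of_nat d * z))" by blast
   have two: "x = 1 \<or> x = 2" if "x dvd 2" for x :: nat
    using that two_is_prime_nat unfolding prime_nat_iff by blast
   have "M dvd 2" "d dvd 2" using M(1) dvd_mult_left dvd_mult_right by blast+
   hence "M = 1" "d = 1 \<or> d = 2" using M(2) two by blast+
   thus "f \<in> ?S"
   proof (elim disjE)
    assume "M = 1" "d = 1"
    hence "f = (\<lambda>z. g z + lift2 0 z)" "g \<in> S_int w 1" using M by auto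
    thus ?thesis using z1 by blast
   next
    assume "M = 1" "d = 2"
    hence "f = (\<lambda>z. 0 z + lift2 g z)" "g \<in> S_int w 1" using M by auto
    thus ?thesis using z1 by blast
   qed
  qed
  show "fun_vs.subspace ?S"
  proof (rule fun_vs.subspaceI)
   have "0 = (\<lambda>z. 0 z + lift2 0 z)" by (auto simp: fun_eq_iff)
   thus "0 \<in> ?S" using z1 by blast
   show "x + y \<in> ?S" if xy: "x \<in> ?S" "y \<in> ?S" for x y
   proof -
    obtain g h g' h' where gh: "g \<in> S_int w 1" "h \<in> S_int w 1" "x = (\<lambda>z. g z + lift2 h z)"
     "g' \<in> S_int w 1" "h' \<in> S_int w 1" "y = (\<lambda>z. g' z + lift2 h' z)" using xy by blast
    have "x + y = (\<lambda>z. (g + g') z + lift2 (h + h') z)" by (auto simp: gh fun_eq_iff)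
    moreover have "g + g' \<in> S_int w 1" "h + h' \<in> S_int w 1" using gh fun_vs.subspace_add[OF s1] by auto
    ultimately show ?thesis by blast
   qed
   show "(\<lambda>z. c * x z) \<in> ?S" if x: "x \<in> ?S" for c x
   proof -
    obtain g h where gh: "g \<in> S_int w 1" "h \<in> S_int w 1" "x = (\<lambda>z. g z + lift2 h z)" using x by blast
    have "(\<lambda>z. c * g z) \<in> S_int w 1" "(\<lambda>z. c * h z) \<in> S_int w 1" using gh fun_vs.subspace_scale[OF s1] by auto
    thus ?thesis by (intro CollectI bexI[of _ "\<lambda>z. c * g z"] bexI[of _ "\<lambda>z. c * h z"])
      (auto simp: gh fun_eq_iff algebra_simps)
   qed
  qed
 qed
 ultimately show ?thesis unfolding S_old_def by blast
qed

lemma S_old_subset: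
 assumes "w > 0"
 shows "S_old w 2 \<subseteq> S_int w 2"
proof
 fix f assume "f \<in> S_old w 2"
 then obtain g h where gh: "g \<in> S_int w 1" "h \<in> S_int w 1" "f = (\<lambda>z. g z + lift2 h z)"
  using S_old_iff[OF assms] by blast
 have "fun_vs.subspace (S_int w 2)" using assms by (intro subspace_S_int) auto
 moreover have "f = g + lift2 h" by (simp add: gh(3) plus_fun_def)
 ultimately show "f \<in> S_int w 2"
  using lift2_in_S_int[OF assms gh(2)] S_int_level_mono[OF _ assms gh(1), of 2] by (auto intro: fun_vs.subspace_add)
qed

text \<open>Both forms obey the inversion \<open>z \<mapsto> -1/z\<close>. Applying it to
  \<open>g (z) = h (2 z)\<close> in two ways gives \<open>h (4 z) = 2^(-w) h (z)\<close>, so every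
  coefficient reduces to one of smaller index and finally to the constant term 0.\<close>

lemma old_sum_direct:
 assumes w: "w > 0" and g: "g \<in> S_int w 1" and h: "h \<in> S_int w 1" and eq: "g = lift2 h"
 shows "h = 0"
proof -
 have N: "(1::nat) > 0" by simp
 note gt = g[unfolded S_int_iff[OF N w]] and ht = h[unfolded S_int_iff[OF N w]]
 have S: "mat2 0 (-1) 1 0 \<in> Gamma0 1" by (simp add: Gamma0_iff)
 have inv: "f (- 1 / z) = z ^ w * f z" if "f \<in> S_int w 1" "z \<in> \<H>" for f z
  using that S S_int_iff[OF N w, of f] by (fastforce simp: moebius_mat2)
 have *: "h (of_nat 4 * z) = h z / of_nat (2 ^ w)" for z
 proof (cases "z \<in> \<H>")
  case True
  have z2: "2 * z \<in> \<H>" using True by (simp add: H_iff)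
  have "g (- 1 / (2 * z)) = (2 * z) ^ w * h (4 * z)"
   using inv[OF g z2] fun_cong[OF eq, of "2 * z"] by (simp add: mult.assoc[symmetric])
  moreover have "g (- 1 / (2 * z)) = h (- 1 / z)" using fun_cong[OF eq, of "- 1 / (2 * z)"] by simp
  moreover have "z \<noteq> 0" using True by (auto simp: H_iff)
  ultimately show ?thesis using inv[OF h True] by (simp add: power_mult_distrib field_simps)
 next
  case False
  hence "of_nat 4 * z \<notin> \<H>" by (simp add: H_iff)
  hence "h (of_nat 4 * z) = 0" "h z = 0" using ht False by blast+
  thus ?thesis by simp
 qed
 define b where "b = qcoeff h"
 have b: "has_qexp h b" "b 0 = 0" using S_int_has_qexp[OF N w h] by (auto simp: b_def)
 have e1: "has_qexp (\<lambda>z. h (of_nat 4 * z)) (\<lambda>n. if 4 dvd n then b (n div 4) else 0)"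
  by (rule has_qexp_dilate[OF b(1)]) simp
 have e2: "has_qexp (\<lambda>z. h (of_nat 4 * z)) (\<lambda>n. (1 / of_nat (2 ^ w)) * b n)"
  unfolding * using has_qexp_cmult[OF b(1), of "1 / of_nat (2 ^ w)"] by simp
 have bn: "(if 4 dvd n then b (n div 4) else 0) = (1 / of_nat (2 ^ w)) * b n" for n
  using fun_cong[OF has_qexp_unique[OF e1 e2], of n] .
 have "b n = 0" for n
 proof (induction n rule: less_induct)
  case (less n)
  show ?case
  proof (cases "n = 0")
   case False
   hence "(if 4 dvd n then b (n div 4) else 0) = 0" using less[of "n div 4"] by auto
   thus ?thesis using bn[of n] by simp
  qed (simp add: b)
 qed
 hence "b = (\<lambda>_. 0)" by (rule ext)
 with b(1) have "has_qexp h (\<lambda>_. 0)" by (simp only:)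
 thus "h = 0" unfolding zero_fun_def by (rule has_qexp_unique_fun[OF _ has_qexp_0])
qed

text \<open>If all odd coefficients vanish then \<open>f(z/2)\<close> is invariant under \<open>z + 1\<close>, which together
  with the conjugate of \<open>\<Gamma>\<^sub>0(2)\<close> generates the full modular group.\<close>
lemma even_coeffs_imp_lift2:
 assumes w: "w > 0" and f: "f \<in> S_int w 2" and odd: "\<And>n. odd n ==> qcoeff f n = 0"
 obtains g where "g \<in> S_int w 1" "f = lift2 g"
proof -
 have N: "(2::nat) > 0" "(1::nat) > 0" by auto
 have f': "f holomorphic_on \<H>" "\<And>z. z \<notin> \<H> ==> f z = 0" "growth_bounded (real w) f"
  "\<And>\<gamma> z. \<gamma> \<in> Gamma0 2 ==> z \<in> \<H> ==> f (moebius \<gamma> z) = cocycle \<gamma> z ^ w * f z"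
  using f S_int_iff[OF N(1) w] by blast+
 define g where "g z = f (z / 2)" for z
 have inH: "z / 2 \<in> \<H> \<longleftrightarrow> z \<in> \<H>" for z :: complex by (simp add: H_iff)
 have fq: "has_qexp f (qcoeff f)" by (rule S_int_has_qexp[OF N(1) w f])
 have "(\<lambda>n. qcoeff f n * exp (\<omega> * of_nat n * of_real (1 / 2))) = qcoeff f"
 proof
  fix n show "qcoeff f n * exp (\<omega> * of_nat n * of_real (1 / 2)) = qcoeff f n"
  proof (cases "even n")
   case True
   then obtain m where "n = 2 * m" by blast
   hence "exp (\<omega> * of_nat n * of_real (1 / 2)) = exp \<omega> ^ m" by (simp flip: exp_of_nat_mult add: mult_ac)
   thus ?thesis by (simp add: exp_two_pi_i mult_ac)
  qed (simp add: odd)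
 qed
 hence "has_qexp (\<lambda>z. f (z + of_real (1 / 2))) (qcoeff f)" using has_qexp_shift[OF fq, of "1 / 2"] by simp
 from has_qexp_unique_fun[OF fq this] have "f z = f (z + of_real (1 / 2))" for z by (rule fun_cong)
 hence shift: "f (z + 1 / 2) = f z" for z by simp
 have g1: "g (z + 1) = g z" if "z \<in> \<H>" for z using shift[of "z / 2"] by (simp add: g_def add_divide_distrib)
 have inv: "\<forall>z\<in>\<H>. g (moebius \<gamma> z) = cocycle \<gamma> z ^ w * g z" if \<gamma>: "\<gamma> \<in> Gamma0 1" for \<gamma>
 proof (rule Gamma0_induct[of 1 \<gamma> "\<lambda>\<gamma>. \<forall>z\<in>\<H>. g (moebius \<gamma> z) = cocycle \<gamma> z ^ w * g z", OF _ _ \<gamma>])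
  show "\<forall>z\<in>\<H>. g (moebius (mat2 1 0 0 1) z) = cocycle (mat2 1 0 0 1) z ^ w * g z" by (simp add: moebius_mat2)
  have "(-1) ^ w * f z = f z" if "z \<in> \<H>" for z
   using f'(4)[of "mat2 (-1) 0 0 (-1)" z] that by (simp add: Gamma0_iff moebius_mat2)
  thus "\<forall>z\<in>\<H>. g (moebius (mat2 (-1) 0 0 (-1)) z) = cocycle (mat2 (-1) 0 0 (-1)) z ^ w * g z"
   using inH by (simp add: moebius_mat2 g_def)
  fix A n assume A: "A \<in> Gamma0 1" and IH: "\<forall>z\<in>\<H>. g (moebius A z) = cocycle A z ^ w * g z"
  have step: "\<forall>z\<in>\<H>. g (moebius (A ** B) z) = cocycle (A ** B) z ^ w * g z"
   if B: "det B = 1" "\<And>z. z \<in> \<H> ==> g (moebius B z) = cocycle B z ^ w * g z" for B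
   using IH B A by (simp add: moebius_mult cocycle_mult power_mult_distrib)
  show "\<forall>z\<in>\<H>. g (moebius (A ** mat2 1 n 0 1) z) = cocycle (A ** mat2 1 n 0 1) z ^ w * g z"
   by (rule step) (use periodic_int[of g, OF g1] in \<open>auto simp: moebius_mat2\<close>)
  show "\<forall>z\<in>\<H>. g (moebius (A ** mat2 1 0 (int 1 * n) 1) z) = cocycle (A ** mat2 1 0 (int 1 * n) 1) z ^ w * g z"
  proof (rule step)
   fix z assume z: "z \<in> \<H>"
   have "mat2 1 0 (2 * n) 1 \<in> Gamma0 2" by (simp add: Gamma0_iff)
   from f'(4)[OF this, of "z / 2"] z inH
   show "g (moebius (mat2 1 0 (int 1 * n) 1) z) = cocycle (mat2 1 0 (int 1 * n) 1) z ^ w * g z"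
    by (simp add: g_def moebius_mat2 mult_ac)
  qed simp
 qed auto
 have "(f \<circ> (\<lambda>z. z / 2)) holomorphic_on \<H>"
  by (intro holomorphic_on_compose_gen[OF _ f'(1)] holomorphic_intros) (use inH in auto)
 moreover have "growth_bounded (real w) (\<lambda>z. f (z / 2))"
  using growth_bounded_affine[OF f'(3), of 1 2 0] by simp
 ultimately have "g \<in> S_int w 1"
  unfolding S_int_iff[OF N(2) w] g_def[abs_def] o_def using f'(2) inH inv by (auto simp: g_def)
 moreover have "f = lift2 g" by (auto simp: g_def)
 ultimately show thesis using that by blast
qed

lemma lift2_has_qexp: "has_qexp h b ==> has_qexp (lift2 h) (\<lambda>n. if even n then b (n div 2) else 0)"
 using has_qexp_dilate[of h b 2] by simp

lemma lift2_inject: "lift2 g = lift2 h ==> g = h"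
proof
 fix z assume "lift2 g = lift2 h"
 from fun_cong[OF this, of "z / 2"] show "g z = h z" by simp
qed

lemma hecke_fun_add: "hecke_fun w p (\<lambda>z. f z + g z) = (\<lambda>z. hecke_fun w p f z + hecke_fun w p g z)"
 by (simp add: hecke_fun_def slash_add sum.distrib distrib_left)

lemma hecke_fun_cmult: "hecke_fun w p (\<lambda>z. c * f z) = (\<lambda>z. c * hecke_fun w p f z)"
 by (simp add: hecke_fun_def slash_cmult flip: sum_distrib_left)

lemma linear_op_hecke_fun:
 assumes "prime p" "\<not> p dvd N" "N > 0" "w > 0"
 shows "linear_op (S_int w N) (hecke_fun w p)"
 using hecke_fun_in_S_int[OF assms] by (auto simp: linear_op_def hecke_fun_add hecke_fun_cmult plus_fun_def)

lemma hecke_fun_lift2: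
 assumes p: "prime p" "odd p" and w: "w > 0" and h: "has_qexp h b"
 shows "hecke_fun w p (lift2 h) = lift2 (hecke_fun w p h)"
proof -
 have p1: "p > 1" using p(1) prime_gt_1_nat by blast
 note 1 = hecke_fun_qexp[OF p1 w lift2_has_qexp[OF h]]
 note 2 = lift2_has_qexp[OF hecke_fun_qexp[OF p1 w h]]
 have "(\<lambda>n. (if even (p * n) then b (p * n div 2) else 0) + of_nat p ^ (w - 1) *
   (if p dvd n then if even (n div p) then b (n div p div 2) else 0 else 0)) =
  (\<lambda>n. if even n then b (p * (n div 2)) + of_nat p ^ (w - 1) * (if p dvd n div 2 then b (n div 2 div p) else 0) else 0)"
 proof
  fix n
  show "(if even (p * n) then b (p * n div 2) else 0) + of_nat p ^ (w - 1) *
    (if p dvd n then if even (n div p) then b (n div p div 2) else 0 else 0) =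
   (if even n then b (p * (n div 2)) + of_nat p ^ (w - 1) * (if p dvd n div 2 then b (n div 2 div p) else 0) else 0)"
  proof (cases "even n")
   case True
   then obtain m where m: "n = 2 * m" by blast
   have cop: "coprime p 2" using p(2) by simp
   have "p dvd 2 * m \<longleftrightarrow> p dvd m" using cop by (simp add: coprime_dvd_mult_right_iff)
   moreover have "2 * m div p = 2 * (m div p)" if "p dvd m" using that by (auto elim!: dvdE)
   ultimately show ?thesis using p1 by (auto simp: m mult.left_commute)
  next
   case False
   hence "odd (n div p)" if "p dvd n" using that by (metis dvd_mult_div_cancel even_mult_iff)
   thus ?thesis using False p(2) by auto
  qed
 qed
 thus ?thesis using has_qexp_unique_fun[OF 1] 2 by simp
qed

lemma hecke_fun_commute:
 assumes p: "prime p" and q: "prime q" and w: "w > 0" and f: "has_qexp f a"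
 shows "hecke_fun w p (hecke_fun w q f) = hecke_fun w q (hecke_fun w p f)"
proof (cases "p = q")
 case False
 have p1: "p > 1" "q > 1" using p q prime_gt_1_nat by blast+
 have cop: "coprime p q" using p q False primes_coprime by blast
 define T where "T p a n = a (p * n) + of_nat p ^ (w - 1) * (if p dvd n then a (n div p) else 0)"
  for p n :: nat and a :: "nat => complex"
 have comm: "T p (T q a) n = T q (T p a) n" for n
 proof -
  have d: "q dvd p * n \<longleftrightarrow> q dvd n" "p dvd q * n \<longleftrightarrow> p dvd n"
   using cop by (simp_all add: coprime_dvd_mult_right_iff coprime_commute)
  have e: "q dvd n div p \<longleftrightarrow> q dvd n" "q * n div p = q * (n div p)" if "p dvd n"
  proof -
   from that obtain k where "n = p * k" by blast
   thus "q dvd n div p \<longleftrightarrow> q dvd n" "q * n div p = q * (n div p)"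
    using p1 cop by (simp_all add: coprime_dvd_mult_right_iff coprime_commute mult.left_commute)
  qed
  have e': "p dvd n div q \<longleftrightarrow> p dvd n" "p * n div q = p * (n div q)" if "q dvd n"
  proof -
   from that obtain k where "n = q * k" by blast
   thus "p dvd n div q \<longleftrightarrow> p dvd n" "p * n div q = p * (n div q)"
    using p1 cop by (simp_all add: coprime_dvd_mult_right_iff coprime_commute mult.left_commute)
  qed
  have "n div p div q = n div q div p" by (metis div_mult2_eq mult.commute)
  thus ?thesis unfolding T_def
   by (cases "p dvd n"; cases "q dvd n") (simp_all add: d e e' distrib_left mult.left_commute add_ac)
 qed
 have T: "has_qexp (hecke_fun w r g) (T r b)" if "r > 1" "has_qexp g b" for r g b
  using hecke_fun_qexp[OF that(1) w that(2)] by (simp add: T_def[abs_def])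
 have "T p (T q a) = T q (T p a)" using comm by blast
 thus ?thesis using T[OF p1(1) T[OF p1(2) f]] T[OF p1(2) T[OF p1(1) f]] has_qexp_unique_fun by metis
qed simp

text \<open>For an odd \<open>n = p m\<close> the eigenvalue equation at \<open>m\<close> expresses
  \<open>a n\<close> through the coefficients at the smaller odd indices \<open>m\<close> and
  \<open>m / p\<close>; the induction ends at \<open>a 1 = 0\<close>.\<close>

lemma hecke_eigen_coeffs:
 assumes w: "w > 0" and f: "has_qexp f a" and a1: "a 1 = 0"
  and eig: "\<And>p. prime p ==> odd p ==> hecke_fun w p f = (\<lambda>z. l p * f z)"
 shows "odd n ==> a n = 0"
proof (induction n rule: less_induct)
 case (less n)
 show ?case
 proof (cases "n = 1")
  case False
  then obtain p where p: "prime p" "p dvd n" using prime_factor_nat by blast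
  then obtain m where m: "n = p * m" by blast
  have op: "odd p" "odd m" using less.prems m by auto
  have p1: "p > 1" using p(1) prime_gt_1_nat by blast
  have m0: "m > 0" using op(2) by (rule odd_pos)
  have "has_qexp (hecke_fun w p f) (\<lambda>n. l p * a n)" unfolding eig[OF p(1) op(1)] by (rule has_qexp_cmult[OF f])
  from fun_cong[OF has_qexp_unique[OF hecke_fun_qexp[OF p1 w f] this], of m]
  have eq: "a n + of_nat p ^ (w - 1) * (if p dvd m then a (m div p) else 0) = l p * a m" by (simp add: m)
  have "a m = 0" using less.IH[of m] op(2) m p1 m0 by simp
  moreover have "(if p dvd m then a (m div p) else 0) = 0"
  proof (cases "p dvd m")
   case True
   then obtain m' where m': "m = p * m'" by blast
   have "1 < p * p" by (rule less_1_mult[OF p1 p1])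
   hence "m' * 1 < m' * (p * p)" using m0 m' by (intro mult_strict_left_mono) auto
   hence "odd m'" "m' < n" using op(2) m m' by (auto simp: mult_ac)
   thus ?thesis using less.IH[of m'] m' p1 by simp
  qed simp
  ultimately show ?thesis using eq by simp
 qed (use a1 in simp)
qed

section \<open>The operators \<open>U_m\<close>, and \<open>U_2\<close> on oldforms\<close>

lemma U_op_eq: "m > 0 ==> has_qexp f a ==> U_op m f = (\<lambda>z. (\<Sum>j<m. f ((z + of_nat j) / of_nat m)) / of_nat m)"
 unfolding U_op_def using qcoeff_eqI qseries_eqI[OF has_qexp_U] by simp

lemma has_qexp_U_op: "m > 0 ==> has_qexp f a ==> has_qexp (U_op m f) (\<lambda>n. a (m * n))"
 by (simp add: U_op_eq has_qexp_U)

lemma U_op_add: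
 assumes "m > 0" "has_qexp f a" "has_qexp g b"
 shows "U_op m (\<lambda>z. f z + g z) = (\<lambda>z. U_op m f z + U_op m g z)"
 using assms has_qexp_add[OF assms(2,3)] by (simp add: U_op_eq sum.distrib add_divide_distrib)

lemma U_op_cmult:
 assumes "m > 0" "has_qexp f a"
 shows "U_op m (\<lambda>z. c * f z) = (\<lambda>z. c * U_op m f z)"
 using assms has_qexp_cmult[OF assms(2), of c] by (simp add: U_op_eq sum_distrib_left)

text \<open>In level 1, \<open>U_2\<close> is the Hecke operator at 2 without its dilation
  term.\<close>

lemma U_op_2_level_1:
 assumes "w > 0" "has_qexp g a"
 shows "U_op 2 g = (\<lambda>z. hecke_fun w 2 g z - 2 ^ (w - 1) * lift2 g z)"
proof -
 have "\<And>z. z \<notin> \<H> ==> g z = 0" using assms(2) by (simp add: has_qexp_def)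
 thus ?thesis using hecke_fun_eq[of 2 w g] assms by (simp add: U_op_eq)
qed

lemma U_op_2_lift2:
 assumes "has_qexp h b"
 shows "U_op 2 (lift2 h) = h"
 unfolding U_op_def qcoeff_eqI[OF lift2_has_qexp[OF assms]] using qseries_eqI[OF assms] by simp

text \<open>On the pairs \<open>(g, h)\<close> this is the companion matrix of
  \<open>X^2 - T_2 X + 2^(w-1)\<close>, the Hecke polynomial at 2.\<close>

lemma U_op_2_old:
 assumes "w > 0" "has_qexp g a" "has_qexp h b"
 shows "U_op 2 (\<lambda>z. g z + lift2 h z) = (\<lambda>z. (hecke_fun w 2 g z + h z) + lift2 (\<lambda>z. - (2 ^ (w - 1)) * g z) z)"
 unfolding U_op_add[OF zero_less_numeral assms(2) lift2_has_qexp[OF assms(3)]]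
  U_op_2_level_1[OF assms(1,2)] U_op_2_lift2[OF assms(3)] by (simp add: fun_eq_iff)

lemma S_old_U_op_2:
 assumes w: "w > 0" and f: "f \<in> S_old w 2"
 shows "U_op 2 f \<in> S_old w 2"
proof -
 have N: "(1::nat) > 0" by simp
 obtain g h where gh: "g \<in> S_int w 1" "h \<in> S_int w 1" "f = (\<lambda>z. g z + lift2 h z)"
  using f S_old_iff[OF w] by blast
 have s: "fun_vs.subspace (S_int w 1)" by (rule subspace_S_int[OF N w])
 have "hecke_fun w 2 g \<in> S_int w 1" by (rule hecke_fun_in_S_int) (use gh w in auto)
 hence "(\<lambda>z. hecke_fun w 2 g z + h z) \<in> S_int w 1"
  using fun_vs.subspace_add[OF s _ gh(2), of "hecke_fun w 2 g"] by (simp add: plus_fun_def)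
 moreover have "(\<lambda>z. - (2 ^ (w - 1)) * g z) \<in> S_int w 1" by (rule fun_vs.subspace_scale[OF s gh(1)])
 ultimately show ?thesis
  unfolding S_old_iff[OF w] gh(3) U_op_2_old[OF w gh(1,2)[THEN S_int_has_qexp(1)[OF N w]]]
  by (intro bexI[of _ "\<lambda>z. - (2 ^ (w - 1)) * g z"] bexI[of _ "\<lambda>z. hecke_fun w 2 g z + h z"] refl)
qed

text \<open>The growth function of an eigenform of \<open>U\<^sub>2\<close> with the extremal eigenvalue takes its maximum
  also at \<open>z/2\<close>, hence at all \<open>z/2^n\<close>, which tend to the cusp \<open>0\<close>.\<close>
lemma U_op_2_extremal_eigenvalue:
 assumes k: "k > 0" and v: "v \<in> S_int (2 * k) 2" and c: "cmod c = 2 ^ k" and eig: "U_op 2 v = (\<lambda>z. c * v z)"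
 shows "v = 0"
proof (rule ccontr)
 assume "v \<noteq> 0"
 define w where "w = 2 * k"
 have N: "(2::nat) > 0" "w > 0" using k by (auto simp: w_def)
 interpret W: cusp_weight 2 "\<lambda>\<gamma> z. cocycle \<gamma> z ^ w" "\<lambda>\<gamma> z. cocycle \<gamma> z ^ w" 1 w "real w"
  by (rule cusp_weight_int[OF N])
 have vw: "v \<in> cusp_forms 2 (\<lambda>\<gamma> z. cocycle \<gamma> z ^ w) (\<lambda>\<gamma> z. cocycle \<gamma> z ^ w)"
  using v by (simp add: S_int_def w_def)
 obtain z0 where z0: "z0 \<in> \<H>" "\<And>z. z \<in> \<H> ==> growth (real w) v z \<le> growth (real w) v z0"
  using W.cusp_forms_growth_max vw by blast
 define M where "M = growth (real w) v z0"
 have v0: "v z = 0" if "z \<notin> \<H>" for z using v S_int_iff[OF N] that by (auto simp: w_def)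
 obtain z1 where z1: "v z1 \<noteq> 0" using `v \<noteq> 0` by (auto simp: fun_eq_iff)
 hence "z1 \<in> \<H>" using v0 by blast
 with z1 have "growth (real w) v z1 > 0" by (simp add: growth_def H_iff)
 with z0(2)[OF `z1 \<in> \<H>`] have M: "M > 0" by (simp add: M_def)
 have vq: "has_qexp v (qcoeff v)" using S_int_has_qexp[OF N] v by (simp add: w_def)
 have s2: "(\<Sum>j<(2::nat). x j) = x 0 + x 1" for x :: "nat => complex" by (simp add: numeral_2_eq_2)
 \<comment> \<open>The eigenvalue equation bounds the growth at \<open>z\<close> by the mean of the
   growths at \<open>z / 2\<close> and \<open>(z + 1) / 2\<close>; neither exceeds \<open>M\<close>,
   so the value \<open>M\<close> at \<open>z\<close> forces it at both.\<close>
 have half: "growth (real w) v (z / 2) = M" if z: "z \<in> \<H>" "growth (real w) v z = M" for z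
 proof -
  have h: "z / 2 \<in> \<H>" "(z + 1) / 2 \<in> \<H>" using z by (auto simp: H_iff)
  have g: "growth (real w) v u = cmod (v u) * (Im z ^ k / 2 ^ k)" if "Im u = Im z / 2" for u
   using z(1) by (simp add: growth_def that w_def H_iff powr_realpow power_divide)
  have gz: "growth (real w) v z = cmod (v z) * Im z ^ k"
   using z(1) by (simp add: growth_def w_def H_iff powr_realpow)
  have E: "c * v z = (v (z / 2) + v ((z + 1) / 2)) / 2"
   using fun_cong[OF eig, of z] unfolding U_op_eq[OF N(1) vq] s2 by simp
  have "cmod (c * v z) = cmod (v (z / 2) + v ((z + 1) / 2)) / 2" unfolding E by (simp add: norm_divide)
  also have "... \<le> (cmod (v (z / 2)) + cmod (v ((z + 1) / 2))) / 2"
   by (intro divide_right_mono norm_triangle_ineq) simp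
  finally have "cmod (c * v z) \<le> (cmod (v (z / 2)) + cmod (v ((z + 1) / 2))) / 2" .
  hence "2 ^ k * cmod (v z) \<le> (cmod (v (z / 2)) + cmod (v ((z + 1) / 2))) / 2" by (simp add: norm_mult c)
  hence "2 ^ k * cmod (v z) * (Im z ^ k / 2 ^ k) \<le> (cmod (v (z / 2)) + cmod (v ((z + 1) / 2))) / 2 * (Im z ^ k / 2 ^ k)"
   using z(1) by (intro mult_right_mono) (auto simp: H_iff)
  hence "growth (real w) v z \<le> (growth (real w) v (z / 2) + growth (real w) v ((z + 1) / 2)) / 2"
   using g[of "z / 2"] g[of "(z + 1) / 2"] gz by (simp add: add_divide_distrib distrib_right)
  thus ?thesis using z(2) z0(2)[OF h(1)] z0(2)[OF h(2)] by (simp add: M_def)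
 qed
 have inH: "z0 / 2 ^ n \<in> \<H>" for n
 proof -
  have "Im (z0 / 2 ^ n) = Im z0 / 2 ^ n" by (metis Im_divide_of_real of_real_numeral of_real_power)
  thus ?thesis using z0(1) by (simp add: H_iff)
 qed
 have all: "growth (real w) v (z0 / 2 ^ n) = M" for n
 proof (induction n)
  case (Suc n)
  thus ?case using half[OF inH[of n]] by (simp add: field_simps)
 qed (simp add: M_def)
 have S: "mat2 0 (-1) 1 0 \<in> Gamma0 1" by (simp add: Gamma0_iff)
 obtain C where C: "C \<ge> 0" "\<And>u. Im u \<ge> 1 / 2 ==> growth (real w) v (moebius (mat2 0 (-1) 1 0) u) \<le> C / Im u"
  by (rule W.cusp_forms_decay[OF vw S]) blast
 define b where "b = Im (- 1 / z0)"
 have b: "b > 0"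
 proof -
  have "moebius (mat2 0 (-1) 1 0) z0 \<in> \<H>" using S z0(1) by (intro moebius_in_H) auto
  thus ?thesis by (simp add: moebius_mat2 b_def H_iff)
 qed
 \<comment> \<open>Under \<open>z \<mapsto> -1/z\<close> the points \<open>z0 / 2^n\<close> rise to
   height \<open>2^n * b\<close>; past \<open>C / M\<close> the decay at the cusp 0 contradicts the
   value \<open>M\<close>.\<close>
 obtain n where n: "(1 / 2 + C / M + 1) / b < 2 ^ n" using real_arch_pow[of 2] by auto
 define u where "u = 2 ^ n * (- 1 / z0)"
 have Imu: "Im u = 2 ^ n * b"
 proof -
  have "u = of_real (2 ^ n) * (- 1 / z0)" by (simp add: u_def)
  moreover have "Im (of_real x * y) = x * Im y" for x y by simp
  ultimately show ?thesis by (simp only: b_def)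
 qed
 have "1 / 2 + C / M + 1 < Im u" using n b by (simp add: Imu pos_divide_less_eq)
 moreover have "C / M \<ge> 0" using C M by simp
 ultimately have u: "Im u \<ge> 1 / 2" "C / M < Im u" "Im u > 0" by linarith+
 have "z0 \<noteq> 0" using z0(1) by (auto simp: H_iff)
 hence "moebius (mat2 0 (-1) 1 0) u = z0 / 2 ^ n" by (simp add: moebius_mat2 u_def)
 with C(2)[OF u(1)] all[of n] have "M \<le> C / Im u" by simp
 with u M show False by (simp add: field_simps)
qed

text \<open>Comparing components in the direct sum of oldforms gives \<open>h = -2 c g\<close> and
  \<open>T_2 g = 3 c g\<close>. The Hecke polynomial of \<open>g\<close> at 2 then has the roots
  \<open>c\<close> and \<open>2 c\<close>, and the stabilisation of \<open>g\<close> for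
  \<open>2 c\<close> is an eigenform of \<open>U_2\<close> of extremal modulus \<open>2^k\<close>,
  hence 0.\<close>

lemma S_old_U_op_2_eigen:
 assumes k: "k > 0" and f: "f \<in> S_old (2 * k) 2" and eig: "U_op 2 f = (\<lambda>z. c * f z)" and c: "c\<^sup>2 = 4 ^ (k - 1)"
 shows "f = 0"
proof -
 define w where "w = 2 * k"
 have w: "w > 0" using k by (simp add: w_def)
 have N: "(1::nat) > 0" "(2::nat) > 0" by auto
 have s1: "fun_vs.subspace (S_int w 1)" by (rule subspace_S_int[OF N(1) w])
 have c0: "c \<noteq> 0" using c by auto
 have c2: "2 ^ (w - 1) = 2 * c\<^sup>2"
 proof -
  obtain j where j: "k = Suc j" using k gr0_implies_Suc by blast
  have "(2::complex) ^ (2 * j) = 4 ^ j" by (simp add: power_mult)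
  thus ?thesis unfolding c by (simp add: w_def j)
 qed
 obtain g h where gh: "g \<in> S_int w 1" "h \<in> S_int w 1" "f = (\<lambda>z. g z + lift2 h z)"
  using f S_old_iff[OF w] by (auto simp: w_def)
 have gq: "has_qexp g (qcoeff g)" and hq: "has_qexp h (qcoeff h)" using S_int_has_qexp[OF N(1) w] gh by auto
 define t where "t = hecke_fun w 2 g"
 have t: "t \<in> S_int w 1" unfolding t_def by (rule hecke_fun_in_S_int[OF two_is_prime_nat _ N(1) w gh(1)]) simp
 have eq: "t z + h z + - (2 * c\<^sup>2) * lift2 g z = c * (g z + lift2 h z)" for z
  using fun_cong[OF eig, of z] unfolding gh(3) U_op_2_old[OF w gq hq] c2 t_def .
 define x where "x = (\<lambda>z. t z + h z - c * g z)"
 define y where "y = (\<lambda>z. c * h z + 2 * c\<^sup>2 * g z)"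
 have "x = (t + h) - (\<lambda>z. c * g z)" by (auto simp: x_def)
 hence xS: "x \<in> S_int w 1"
  using t gh(1,2) fun_vs.subspace_add[OF s1] fun_vs.subspace_diff[OF s1] fun_vs.subspace_scale[OF s1] by simp
 have "y = (\<lambda>z. c * h z) + (\<lambda>z. 2 * c\<^sup>2 * g z)" by (auto simp: y_def)
 hence yS: "y \<in> S_int w 1" using gh(1,2) fun_vs.subspace_add[OF s1] fun_vs.subspace_scale[OF s1] by simp
 have xy: "x = lift2 y" using eq by (auto simp: x_def y_def fun_eq_iff algebra_simps)
 have "y = 0" by (rule old_sum_direct[OF w xS yS xy])
 have hz: "h z = - 2 * c * g z" for z
 proof -
  have "y z = 0" using `y = 0` by simp
  hence "c * (h z - (- 2 * c * g z)) = 0" by (simp add: y_def power2_eq_square algebra_simps)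
  hence "h z - (- 2 * c * g z) = 0" using c0 by (simp only: mult_eq_0_iff simp_thms)
  thus ?thesis by (simp only: right_minus_eq)
 qed
 have "x = 0" using xy `y = 0` by (simp add: fun_eq_iff)
 have tz: "t z = 3 * c * g z" for z
 proof -
  have "x z = 0" using `x = 0` by simp
  thus ?thesis using hz[of z] by (simp add: x_def algebra_simps)
 qed
 \<comment> \<open>The stabilisation of \<open>g\<close> whose \<open>U_2\<close>-eigenvalue is the
   other root \<open>2 c\<close>.\<close>
 define v where "v = (\<lambda>z. g z + (- c) * lift2 g z)"
 have "v = g + (\<lambda>z. (- c) * lift2 g z)" by (auto simp: v_def)
 moreover have s2: "fun_vs.subspace (S_int w 2)" by (rule subspace_S_int[OF N(2) w])
 ultimately have vS: "v \<in> S_int w 2"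
  using fun_vs.subspace_add[OF s2 S_int_level_mono[OF N(2) w gh(1)] fun_vs.subspace_scale[OF s2 lift2_in_S_int[OF w gh(1)]]]
  by (simp only:)
 have v': "v = (\<lambda>z. g z + lift2 (\<lambda>z. (- c) * g z) z)" by (simp add: v_def)
 have "U_op 2 v = (\<lambda>z. (2 * c) * v z)"
  unfolding v' U_op_2_old[OF w gq has_qexp_cmult[OF gq]] t_def[symmetric] c2
  by (simp add: tz power2_eq_square algebra_simps)
 moreover have "cmod (2 * c) = 2 ^ k"
 proof -
  have "(cmod (2 * c))\<^sup>2 = cmod (4 * c\<^sup>2)" by (simp add: norm_power norm_mult power_mult_distrib)
  also have "4 * c\<^sup>2 = of_real (4 ^ k)" using k unfolding c by (cases k) auto
  also have "cmod ... = 4 ^ k" by (simp add: norm_power)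
  also have "... = (2 ^ k)\<^sup>2" by (simp add: power2_eq_square flip: power_mult_distrib)
  finally show ?thesis by (rule power2_eq_imp_eq) auto
 qed
 ultimately have v0: "v = 0" using U_op_2_extremal_eigenvalue[OF k, of v "2 * c"] vS by (simp add: w_def)
 have "g z = c * g (of_nat 2 * z)" for z
 proof -
  have "v z = 0" unfolding v0 by simp
  thus ?thesis by (simp add: v_def)
 qed
 hence "g = lift2 (\<lambda>z. c * g z)" by (rule ext)
 moreover have "(\<lambda>z. c * g z) \<in> S_int w 1" using fun_vs.subspace_scale[OF s1 gh(1)] .
 ultimately have "(\<lambda>z. c * g z) = 0" using old_sum_direct[OF w gh(1)] by blast
 from fun_cong[OF this] have "g z = 0" for z using c0 by simp
 thus "f = 0" using hz by (simp add: gh(3) fun_eq_iff)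
qed

section \<open>Newforms of level 2 and multiplicity one\<close>

lemma hermitian_space_S_int:
 "N > 0 ==> w > 0 ==> hermitian_space (S_int w N) (petersson (real w) N)"
 using hermitian_space_cuspidal[OF _ subspace_S_int] S_int_cuspidal by blast

lemma odd_prime_not_dvd_2: "prime p ==> odd p ==> \<not> p dvd (2::nat)"
 using primes_dvd_imp_eq two_is_prime_nat by blast

lemma S_new_eq: "S_new w 2 = {f \<in> S_int w 2. \<forall>g\<in>S_old w 2. petersson (real w) 2 f g = 0}"
 by (simp add: S_new_def orth_complement_def)

lemma S_old_stable:
 assumes p: "prime p" "odd p" and w: "w > 0" and f: "f \<in> S_old w 2"
 shows "hecke_fun w p f \<in> S_old w 2"
proof -
 have N: "(1::nat) > 0" by simp
 obtain g h where gh: "g \<in> S_int w 1" "h \<in> S_int w 1" "f = (\<lambda>z. g z + lift2 h z)"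
  using f S_old_iff[OF w] by blast
 have "\<not> p dvd 1" using p(1) by auto
 hence "hecke_fun w p g \<in> S_int w 1" "hecke_fun w p h \<in> S_int w 1"
  using hecke_fun_in_S_int[OF p(1) _ N w] gh by auto
 moreover have "hecke_fun w p f = (\<lambda>z. hecke_fun w p g z + lift2 (hecke_fun w p h) z)"
  unfolding gh(3) hecke_fun_add hecke_fun_lift2[OF p w S_int_has_qexp(1)[OF N w gh(2)]] ..
 ultimately show ?thesis using S_old_iff[OF w] by blast
qed

context
 fixes w :: nat
 assumes w: "w > 0"
begin

interpretation H: hermitian_space "S_int w 2" "petersson (real w) 2"
 using w by (intro hermitian_space_S_int) auto

lemma subspace_S_old: "fun_vs.subspace (S_old w 2)" by (simp add: S_old_def)

lemma subspace_S_new: "fun_vs.subspace (S_new w 2)"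
 unfolding S_new_eq by (rule H.subspace_orthogonal[OF S_old_subset[OF w]])

lemma S_new_subset: "S_new w 2 \<subseteq> S_int w 2" by (auto simp: S_new_eq)

lemma S_new_inter_S_old:
 assumes "f \<in> S_new w 2" "f \<in> S_old w 2"
 shows "f = 0"
 by (rule H.ip_definite) (use assms S_new_subset in \<open>auto simp: S_new_eq\<close>)

lemma S_new_stable:
 assumes p: "prime p" "odd p" and f: "f \<in> S_new w 2"
 shows "hecke_fun w p f \<in> S_new w 2"
 unfolding S_new_eq
proof (rule H.orthogonal_stable[OF linear_op_hecke_fun[OF p(1) odd_prime_not_dvd_2[OF p] _ w] _ S_old_subset[OF w]])
 show "petersson (real w) 2 (hecke_fun w p f) g = petersson (real w) 2 f (hecke_fun w p g)"
  if "f \<in> S_int w 2" "g \<in> S_int w 2" for f g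
  by (rule hecke_fun_hermitian[OF p(1) odd_prime_not_dvd_2[OF p] _ w that]) simp
qed (use S_old_stable[OF p w] f in \<open>auto simp: S_new_eq\<close>)

lemma S_int_decompose:
 assumes "f \<in> S_int w 2"
 obtains n b where "n \<in> S_new w 2" "b \<in> S_old w 2" "f = n + b"
proof -
 obtain d where d: "dim_atmost d (S_int w 2)" using S_int_finite_dim[of 2 w] w by auto
 obtain b where b: "b \<in> S_old w 2" "\<And>g. g \<in> S_old w 2 ==> petersson (real w) 2 (f - b) g = 0"
  by (rule H.orthogonal_projection_dim[OF d S_old_subset[OF w] subspace_S_old assms]) blast
 have "f - b \<in> S_new w 2" unfolding S_new_eq using b H.V_diff[OF assms] S_old_subset[OF w] by blast
 with b(1) show thesis by (intro that[of "f - b" b]) auto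
qed

lemma S_new_span_eigenforms:
 "S_new w 2 \<subseteq> fun_vs.span {e \<in> S_new w 2. e \<noteq> 0 \<and>
  (\<forall>p\<in>{p. prime p \<and> odd p}. \<exists>l. hecke_fun w p e = (\<lambda>z. l * e z))}"
proof -
 obtain d where d: "dim_atmost d (S_int w 2)" using S_int_finite_dim[of 2 w] w by auto
 show ?thesis
 proof (rule H.spectral_decomposition[OF d])
  fix p :: nat assume p: "p \<in> {p. prime p \<and> odd p}"
  hence p': "prime p" "\<not> p dvd 2" using odd_prime_not_dvd_2 by auto
  show "linear_op (S_int w 2) (hecke_fun w p)" by (rule linear_op_hecke_fun[OF p' _ w]) simp
  show "petersson (real w) 2 (hecke_fun w p f) g = petersson (real w) 2 f (hecke_fun w p g)"
   if "f \<in> S_int w 2" "g \<in> S_int w 2" for f g by (rule hecke_fun_hermitian[OF p' _ w that]) simp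
  show "hecke_fun w p f \<in> S_new w 2" if "f \<in> S_new w 2" for f using S_new_stable p that by blast
  fix q :: nat and f assume "q \<in> {p. prime p \<and> odd p}" and f: "f \<in> S_int w 2"
  thus "hecke_fun w p (hecke_fun w q f) = hecke_fun w q (hecke_fun w p f)"
   using hecke_fun_commute[OF p'(1) _ w S_int_has_qexp(1)[OF _ w f]] by simp
 qed (use S_new_subset subspace_S_new in auto)
qed

text \<open>With \<open>a 1 = 0\<close> all odd coefficients vanish, and a form with even exponents
  only is a dilated level 1 form. The case \<open>N = 1\<close> serves eigenforms that are already
  of level 1.\<close>

lemma eigen_first_coeff_0_imp_lift2:
 assumes N: "N dvd 2" and f: "f \<in> S_int w N"
  and eig: "\<And>p. prime p ==> odd p ==> hecke_fun w p f = (\<lambda>z. l p * f z)" and 1: "qcoeff f 1 = 0"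
 obtains g where "g \<in> S_int w 1" "f = lift2 g"
proof -
 have "N = 1 \<or> N = 2" using N two_is_prime_nat unfolding prime_nat_iff by blast
 hence f2: "f \<in> S_int w 2" using f S_int_level_mono[OF _ w, of 2 f] by auto
 have "qcoeff f n = 0" if "odd n" for n
  using hecke_eigen_coeffs[OF w S_int_has_qexp(1)[OF _ w f2] 1 eig that] by simp
 from even_coeffs_imp_lift2[OF w f2 this] that show thesis by blast
qed

lemma lift2_in_S_old:
 assumes "h \<in> S_int w 1"
 shows "lift2 h \<in> S_old w 2"
proof -
 have "0 \<in> S_int w 1" using subspace_S_int[of 1 w] w fun_vs.subspace_0 by auto
 moreover have "lift2 h = (\<lambda>z. 0 z + lift2 h z)" by simp
 ultimately show ?thesis unfolding S_old_iff[OF w] using assms by blast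
qed

text \<open>Subtract from \<open>g\<close> the multiple of \<open>f\<close> with the same first
  coefficient; the rest is a dilated level 1 form \<open>h (2 z)\<close>. If \<open>h\<close> were
  not 0, it would be a level 1 eigenform with the eigenvalues of \<open>f\<close> and nonzero first
  coefficient, and subtracting a multiple of it from \<open>f\<close> would exhibit \<open>f\<close>
  as an oldform.\<close>

theorem S_new_multiplicity_one:
 assumes f: "f \<in> S_new w 2" "f \<noteq> 0" and g: "g \<in> S_int w 2"
  and eig_f: "\<And>p. prime p ==> odd p ==> hecke_fun w p f = (\<lambda>z. l p * f z)"
  and eig_g: "\<And>p. prime p ==> odd p ==> hecke_fun w p g = (\<lambda>z. l p * g z)"
 shows "\<exists>c. g = (\<lambda>z. c * f z)"
proof -
 have N: "(2::nat) > 0" "(1::nat) > 0" by auto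
 have fS: "f \<in> S_int w 2" using f S_new_subset by auto
 have fnew: "f \<notin> S_old w 2" using S_new_inter_S_old f by blast
 note s2 = subspace_S_int[OF N(1) w]
 have comb_qexp: "qcoeff (\<lambda>z. x z + c * y z) 1 = qcoeff x 1 + c * qcoeff y 1"
  if "x \<in> S_int w 2" "y \<in> S_int w 2" for x y c
  using qcoeff_eqI[OF has_qexp_add[OF S_int_has_qexp(1)[OF N(1) w that(1)]
   has_qexp_cmult[OF S_int_has_qexp(1)[OF N(1) w that(2)], of c]]] by simp
 have comb_S: "(\<lambda>z. x z + c * y z) \<in> S_int w 2" if "x \<in> S_int w 2" "y \<in> S_int w 2" for x y c
  using fun_vs.subspace_add[OF s2 that(1) fun_vs.subspace_scale[OF s2 that(2), of c]] by (simp add: plus_fun_def)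
 have comb_eig: "hecke_fun w p (\<lambda>z. x z + c * y z) = (\<lambda>z. l p * (x z + c * y z))"
  if "hecke_fun w p x = (\<lambda>z. l p * x z)" "hecke_fun w p y = (\<lambda>z. l p * y z)" for x y c p
  unfolding hecke_fun_add hecke_fun_cmult that by (simp add: algebra_simps)
 have f1: "qcoeff f 1 \<noteq> 0"
 proof
  assume "qcoeff f 1 = 0"
  obtain g where "g \<in> S_int w 1" "f = lift2 g"
   by (rule eigen_first_coeff_0_imp_lift2[of 2 f l]) (use fS eig_f `qcoeff f 1 = 0` in auto)
  thus False using fnew lift2_in_S_old by blast
 qed
 define c where "c = qcoeff g 1 / qcoeff f 1"
 define r where "r = (\<lambda>z. g z + (- c) * f z)"
 have rS: "r \<in> S_int w 2" unfolding r_def by (rule comb_S[OF g fS])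
 have r_eig: "hecke_fun w p r = (\<lambda>z. l p * r z)" if "prime p" "odd p" for p
  unfolding r_def by (rule comb_eig[OF eig_g[OF that] eig_f[OF that]])
 have "qcoeff r 1 = 0" unfolding r_def comb_qexp[OF g fS] using f1 by (simp add: c_def)
 obtain h where h: "h \<in> S_int w 1" "r = lift2 h"
  by (rule eigen_first_coeff_0_imp_lift2[of 2 r l]) (use rS r_eig `qcoeff r 1 = 0` in auto)
 have "h = 0"
 proof (rule ccontr)
  assume "h \<noteq> 0"
  have h_eig: "hecke_fun w p h = (\<lambda>z. l p * h z)" if "prime p" "odd p" for p
  proof -
   have "lift2 (hecke_fun w p h) = lift2 (\<lambda>z. l p * h z)"
    using r_eig[OF that] hecke_fun_lift2[OF that w S_int_has_qexp(1)[OF N(2) w h(1)]] unfolding h(2) by simp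
   thus ?thesis by (rule lift2_inject)
  qed
  have h2: "h \<in> S_int w 2" by (rule S_int_level_mono[OF N(1) w h(1)])
  \<comment> \<open>Otherwise \<open>h\<close> would itself be a dilated level 1 form, which
    \<open>old_sum_direct\<close> excludes.\<close>
  have h1: "qcoeff h 1 \<noteq> 0"
  proof
   assume "qcoeff h 1 = 0"
   obtain h' where "h' \<in> S_int w 1" "h = lift2 h'"
    by (rule eigen_first_coeff_0_imp_lift2[of 1 h l]) (use h h_eig `qcoeff h 1 = 0` in auto)
   moreover from this have "h' = 0" using old_sum_direct[OF w h(1)] by blast
   ultimately show False using `h \<noteq> 0` by (simp add: fun_eq_iff)
  qed
  define d where "d = qcoeff f 1 / qcoeff h 1"
  define s where "s = (\<lambda>z. f z + (- d) * h z)"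
  have sS: "s \<in> S_int w 2" unfolding s_def by (rule comb_S[OF fS h2])
  have s_eig: "hecke_fun w p s = (\<lambda>z. l p * s z)" if "prime p" "odd p" for p
   unfolding s_def by (rule comb_eig[OF eig_f[OF that] h_eig[OF that]])
  have "qcoeff s 1 = 0" unfolding s_def comb_qexp[OF fS h2] using h1 by (simp add: d_def)
  obtain u where u: "u \<in> S_int w 1" "s = lift2 u"
   by (rule eigen_first_coeff_0_imp_lift2[of 2 s l]) (use sS s_eig `qcoeff s 1 = 0` in auto)
  have "f z = d * h z + lift2 u z" for z using fun_cong[OF u(2), of z] by (simp add: s_def algebra_simps)
  hence "f = (\<lambda>z. (\<lambda>z. d * h z) z + lift2 u z)" by (rule ext)
  moreover have "(\<lambda>z. d * h z) \<in> S_int w 1" using fun_vs.subspace_scale[OF subspace_S_int[OF N(2) w] h(1)] .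
  ultimately have "f \<in> S_old w 2" unfolding S_old_iff[OF w]
   by (intro bexI[of _ "\<lambda>z. d * h z"] bexI[of _ u] u(1)) auto
  thus False using fnew by blast
 qed
 hence "r z = 0" for z by (simp add: h(2))
 hence "g z = c * f z" for z by (simp add: r_def)
 thus ?thesis by blast
qed

end

subsection \<open>Quadratic Gauss sums\<close>

lemma sum_residues_reindex:
 fixes F :: "int => 'a::comm_monoid_add" and m :: nat
 assumes m: "m > 0" and S: "finite S" "S \<subseteq> {..<m}"
  and F: "\<And>x y. [x = y] (mod int m) ==> F x = F y"
  and \<sigma>: "\<And>b. b \<in> S ==> nat (\<sigma> b mod int m) \<in> S"
  and inj: "\<And>b c. b \<in> S ==> c \<in> S ==> [\<sigma> b = \<sigma> c] (mod int m) ==> b = c"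
 shows "(\<Sum>b\<in>S. F (\<sigma> b)) = (\<Sum>b\<in>S. F (int b))"
proof -
 define \<tau> where "\<tau> b = nat (\<sigma> b mod int m)" for b
 have \<tau>: "int (\<tau> b) = \<sigma> b mod int m" for b using m by (simp add: \<tau>_def)
 have "inj_on \<tau> S"
 proof (rule inj_onI)
  fix b c assume "b \<in> S" "c \<in> S" "\<tau> b = \<tau> c"
  thus "b = c" using inj[of b c] \<tau>[of b] \<tau>[of c] by (simp add: cong_def)
 qed
 moreover have "\<tau> ` S \<subseteq> S" using \<sigma> by (auto simp: \<tau>_def)
 ultimately have "bij_betw \<tau> S S" using S(1) by (simp add: bij_betw_def endo_inj_surj)
 have "(\<Sum>b\<in>S. F (\<sigma> b)) = (\<Sum>b\<in>S. F (int (\<tau> b)))" by (intro sum.cong refl F) (simp add: \<tau> cong_def)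
 also have "... = (\<Sum>b\<in>S. F (int b))" by (rule sum.reindex_bij_betw[OF `bij_betw \<tau> S S`])
 finally show ?thesis .
qed

lemma Legendre_cong: "[a = b] (mod p) ==> Legendre a p = Legendre b p"
 by (simp add: Legendre_def QuadRes_def cong_def)

lemma Legendre_values: "Legendre a p \<in> {-1, 0, 1}" by (simp add: Legendre_def)

lemma Legendre_eq_0_iff: "Legendre a p = 0 \<longleftrightarrow> p dvd a" by (simp add: Legendre_def cong_0_iff)

lemma Legendre_power2: "\<not> p dvd a ==> (Legendre a p)\<^sup>2 = 1" by (simp add: Legendre_def cong_0_iff)

lemma Legendre_1 [simp]: "1 < p ==> Legendre 1 p = 1"
 unfolding Legendre_def QuadRes_def by (auto simp: cong_def intro: exI[of _ 1])

context
 fixes p :: nat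
 assumes p: "prime p" "odd p"
begin

lemma odd_prime_gt_2: "2 < p" using p prime_ge_2_nat[of p] by (cases "p = 2") auto

text \<open>Euler's criterion gives the congruence modulo \<open>p\<close>; both sides lie in
  \<open>{-1, 0, 1}\<close>, so for \<open>p > 2\<close> it is an equality.\<close>

lemma Legendre_mult: "Legendre (a * b) (int p) = Legendre a (int p) * Legendre b (int p)"
proof -
 let ?m = "(p - 1) div 2" and ?L = "\<lambda>a. Legendre a (int p)"
 note e = euler_criterion[OF p(1) odd_prime_gt_2]
 have "[?L (a * b) = a ^ ?m * b ^ ?m] (mod int p)" using e[of "a * b"] by (simp add: power_mult_distrib)
 moreover have "[?L a * ?L b = a ^ ?m * b ^ ?m] (mod int p)" by (intro cong_mult e)
 ultimately have c: "[?L (a * b) = ?L a * ?L b] (mod int p)" by (meson cong_sym cong_trans)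
 have "?L (a * b) \<in> {-1, 0, 1}" "?L a * ?L b \<in> {-1, 0, 1}"
  using Legendre_values[of a "int p"] Legendre_values[of b "int p"] Legendre_values[of "a * b" "int p"] by auto
 hence "\<bar>?L (a * b) - ?L a * ?L b\<bar> < int p" using odd_prime_gt_2 by auto
 moreover have "int p dvd ?L (a * b) - ?L a * ?L b" using c by (simp add: cong_iff_dvd_diff)
 ultimately show ?thesis using dvd_imp_le_int[of "?L (a * b) - ?L a * ?L b" "int p"] by linarith
qed

lemma Legendre_power: "Legendre (a ^ n) (int p) = Legendre a (int p) ^ n"
 using odd_prime_gt_2 by (induction n) (simp_all add: Legendre_mult)

lemma sum_residues_dilate:
 fixes F :: "int => 'a::comm_monoid_add"
 assumes "\<not> int p dvd a" "\<And>x y. [x = y] (mod int p) ==> F x = F y"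
 shows "(\<Sum>b<p. F (a * int b)) = (\<Sum>b<p. F (int b))"
proof (rule sum_residues_reindex[where m = p])
 fix b c assume bc: "b \<in> {..<p}" "c \<in> {..<p}" "[a * int b = a * int c] (mod int p)"
 have "coprime a (int p)" using assms(1) p(1) prime_imp_coprime[of "int p" a] by (simp add: coprime_commute)
 hence "[int b = int c] (mod int p)" using bc(3) by (simp add: cong_mult_lcancel)
 thus "b = c" using bc by (simp add: cong_def)
qed (use assms(2) odd_prime_gt_2 in \<open>auto simp: nat_less_iff\<close>)

lemma prime_not_dvd_nat: "0 < k ==> k < p ==> \<not> int p dvd int k" by (auto dest: zdvd_not_zless[rotated])

text \<open>The number of square roots of \<open>b\<close> modulo \<open>p\<close> is
  \<open>1 + (b/p)\<close>: each nonzero square is hit once by \<open>1..m\<close> and once more by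
  the reflected residues \<open>p - n\<close>.\<close>

lemma sum_squares_residues:
 fixes F :: "int => 'a::comm_ring_1"
 assumes F: "\<And>x y. [x = y] (mod int p) ==> F x = F y"
 shows "(\<Sum>n<p. F ((int n)\<^sup>2)) = (\<Sum>b<p. (1 + of_int (Legendre (int b) (int p))) * F (int b))"
proof -
 define m where "m = (p - 1) div 2"
 have m: "p = 2 * m + 1" using p(2) by (auto simp: m_def elim!: oddE)
 define f where "f n = nat ((int n)\<^sup>2 mod int p)" for n
 have f: "int (f n) = (int n)\<^sup>2 mod int p" "f n < p" for n using odd_prime_gt_2 by (simp_all add: f_def nat_less_iff)
 have reflect: "[(int (p - n))\<^sup>2 = (int n)\<^sup>2] (mod int p)" if "n \<le> p" for n
 proof -
  have "(int (p - n))\<^sup>2 - (int n)\<^sup>2 = int p * (int p - 2 * int n)"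
   using that by (simp add: of_nat_diff power2_eq_square algebra_simps)
  thus ?thesis by (simp add: cong_iff_dvd_diff)
 qed
 let ?R = "{b \<in> {1..<p}. Legendre (int b) (int p) = 1}"
 have "bij_betw f {1..m} ?R"
 proof (intro bij_betw_imageI inj_onI subset_antisym subsetI)
  fix n k assume nk: "n \<in> {1..m}" "k \<in> {1..m}" "f n = f k"
  hence "int p dvd (int n)\<^sup>2 - (int k)\<^sup>2" using f(1)[of n] f(1)[of k] by (metis mod_eq_dvd_iff)
  also have "(int n)\<^sup>2 - (int k)\<^sup>2 = (int n - int k) * (int n + int k)" by (simp add: power2_eq_square algebra_simps)
  finally have "int p dvd int n - int k \<or> int p dvd int n + int k" using p(1) by (simp add: prime_dvd_mult_iff)
  moreover have "0 < int n + int k" "int n + int k < int p" using nk m by auto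
  ultimately show "n = k" using dvd_imp_le_int[of "int n - int k" "int p"] zdvd_imp_le[of "int p" "int n + int k"] by linarith
 next
  fix b assume "b \<in> f ` {1..m}"
  then obtain n where n: "n \<in> {1..m}" "b = f n" by blast
  have "\<not> int p dvd int n" using n m by (intro prime_not_dvd_nat) auto
  hence nd: "\<not> int p dvd (int n)\<^sup>2" using p(1) by (simp add: prime_dvd_power_iff)
  have "[(int n)\<^sup>2 = int b] (mod int p)" unfolding n(2) f by (simp add: cong_def)
  moreover from this nd have "\<not> int p dvd int b" using cong_dvd_iff by blast
  moreover from this have "b \<noteq> 0" by (cases "b = 0") auto
  ultimately show "b \<in> ?R" using n(2) f(2) by (auto simp: Legendre_def QuadRes_def cong_0_iff)
 next
  fix b assume b: "b \<in> ?R"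
  then obtain y where y: "[y\<^sup>2 = int b] (mod int p)" by (auto simp: Legendre_def QuadRes_def split: if_splits)
  define n where "n = nat (y mod int p)"
  have n: "int n = y mod int p" "n < p" using odd_prime_gt_2 by (simp_all add: n_def nat_less_iff)
  have fn: "f n = b" using y b by (simp add: f_def n cong_def power_mod)
  have n0: "n \<noteq> 0" using fn b by (cases "n = 0") (auto simp: f_def)
  have "f (p - n) = b" using fn reflect[of n] n(2) by (simp add: f_def cong_def)
  moreover have "n \<in> {1..m} \<or> p - n \<in> {1..m}" using n0 n(2) m by auto
  ultimately show "b \<in> f ` {1..m}" using fn by (metis image_eqI)
 qed
 hence sum_R: "(\<Sum>n=1..m. F (int (f n))) = (\<Sum>b\<in>?R. F (int b))" by (rule sum.reindex_bij_betw)
 have Ff: "F (int (f n)) = F ((int n)\<^sup>2)" for n by (rule F) (simp add: f cong_def)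
 have "bij_betw (\<lambda>n. p - n) {1..m} {m + 1..<p}" by (rule bij_betw_byWitness[of _ "\<lambda>n. p - n"]) (use m in auto)
 hence "(\<Sum>n=m + 1..<p. F ((int n)\<^sup>2)) = (\<Sum>n=1..m. F ((int (p - n))\<^sup>2))"
  by (rule sum.reindex_bij_betw[symmetric])
 also have "... = (\<Sum>n=1..m. F ((int n)\<^sup>2))" by (intro sum.cong refl F reflect) (use m in auto)
 finally have upper: "(\<Sum>n=m + 1..<p. F ((int n)\<^sup>2)) = (\<Sum>n=1..m. F ((int n)\<^sup>2))" .
 have "(\<Sum>n\<in>{1..m} \<union> {m + 1..<p}. F ((int n)\<^sup>2)) = (\<Sum>n=1..m. F ((int n)\<^sup>2)) + (\<Sum>n=m + 1..<p. F ((int n)\<^sup>2))"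
  by (rule sum.union_disjoint) auto
 moreover have "{..<p} = insert 0 ({1..m} \<union> {m + 1..<p})" using m by auto
 ultimately have "(\<Sum>n<p. F ((int n)\<^sup>2)) = F 0 + 2 * (\<Sum>b\<in>?R. F (int b))" using upper sum_R unfolding Ff by simp
 also have "2 * (\<Sum>b\<in>?R. F (int b)) = (\<Sum>b=1..<p. (1 + of_int (Legendre (int b) (int p))) * F (int b))"
  unfolding sum_distrib_left
 proof (rule sum.mono_neutral_cong_left)
  show "\<forall>b\<in>{1..<p} - ?R. (1 + of_int (Legendre (int b) (int p))) * F (int b) = 0"
  proof
   fix b assume b: "b \<in> {1..<p} - ?R"
   hence "Legendre (int b) (int p) = -1"
    using Legendre_values[of "int b" "int p"] Legendre_eq_0_iff[of "int b" "int p"] prime_not_dvd_nat[of b] by auto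
   thus "(1 + of_int (Legendre (int b) (int p))) * F (int b) = 0" by simp
  qed
 qed auto
 also have "F 0 + ... = (\<Sum>b\<in>insert 0 {1..<p}. (1 + of_int (Legendre (int b) (int p))) * F (int b))"
  using Legendre_eq_0_iff[of 0 "int p"] by simp
 also have "insert 0 {1..<p} = {..<p}" using m by auto
 finally show ?thesis .
qed

lemma sum_Legendre: "(\<Sum>b<p. of_int (Legendre (int b) (int p)) :: complex) = 0"
 using sum_squares_residues[of "\<lambda>_. 1 :: complex"] by (simp add: sum.distrib)

definition gauss_sum :: complex
 where "gauss_sum = (\<Sum>b<p. of_int (Legendre (int b) (int p)) * exp (\<omega> * (of_nat b / of_nat p)))"

lemma exp_cong:
 assumes "[x = y] (mod int p)"
 shows "exp (\<omega> * (of_int x / of_nat p)) = exp (\<omega> * (of_int y / of_nat p))"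
proof -
 obtain k where k: "x = y + int p * k" using cong_sym[OF assms] by (auto simp: cong_iff_lin)
 have "\<omega> * (of_int x / of_nat p) = \<omega> * (of_int y / of_nat p) + of_real (2 * pi * of_int k) * \<i>"
  using odd_prime_gt_2 by (simp add: k field_simps)
 thus ?thesis using exp_eq[of "\<omega> * (of_int x / of_nat p)"] by (auto intro!: exI[of _ k])
qed

text \<open>Dilate the summation variable by \<open>n\<close>; when \<open>p\<close> divides
  \<open>n\<close>, both sides vanish.\<close>

lemma gauss_sum_twist:
 "(\<Sum>b<p. of_int (Legendre (int b) (int p)) * exp (\<omega> * (of_int (n * int b) / of_nat p))) =
  of_int (Legendre n (int p)) * gauss_sum"
proof (cases "int p dvd n")
 case True
 have "exp (\<omega> * (of_int (n * int b) / of_nat p)) = 1" for b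
  using exp_cong[of "n * int b" 0] True by (simp add: cong_0_iff)
 hence "(\<Sum>b<p. of_int (Legendre (int b) (int p)) * exp (\<omega> * (of_int (n * int b) / of_nat p)))
   = (\<Sum>b<p. of_int (Legendre (int b) (int p)))" by (simp del: of_int_mult)
 thus ?thesis using True Legendre_eq_0_iff[of n "int p"] by (simp add: sum_Legendre)
next
 case False
 let ?e = "\<lambda>x::int. exp (\<omega> * (of_int x / of_nat p)) :: complex"
 have n2: "Legendre n (int p) * Legendre n (int p) = 1" using Legendre_power2[OF False] by (simp add: power2_eq_square)
 have "Legendre (int b) (int p) = Legendre n (int p) * Legendre (n * int b) (int p)" for b
  unfolding Legendre_mult mult.assoc[symmetric] n2 by simp
 hence "(\<Sum>b<p. of_int (Legendre (int b) (int p)) * ?e (n * int b)) =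
   of_int (Legendre n (int p)) * (\<Sum>b<p. of_int (Legendre (n * int b) (int p)) * ?e (n * int b))"
  unfolding sum_distrib_left mult.assoc[symmetric] of_int_mult[symmetric] by simp
 also have "(\<Sum>b<p. of_int (Legendre (n * int b) (int p)) * ?e (n * int b)) = (\<Sum>b<p. of_int (Legendre (int b) (int p)) * ?e (int b))"
  by (rule sum_residues_dilate[OF False, where F = "\<lambda>x. of_int (Legendre x (int p)) * ?e x"])
    (metis Legendre_cong exp_cong)
 finally show ?thesis by (simp add: gauss_sum_def)
qed

lemma sum_exp_residues:
 "(\<Sum>n<p. exp (\<omega> * (of_int (int n * x) / of_nat p))) = (if int p dvd x then of_nat p else (0::complex))"
proof -
 define y where "y = nat (x mod int p)"
 have y: "int y = x mod int p" using odd_prime_gt_2 by (simp add: y_def)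
 have "exp (\<omega> * (of_int (int n * x) / of_nat p)) = exp (\<omega> * (of_int (int y * int n) / of_nat p))" for n
  by (rule exp_cong) (simp add: y cong_def mod_mult_left_eq mod_mult_right_eq mult.commute)
 hence "(\<Sum>n<p. exp (\<omega> * (of_int (int n * x) / of_nat p))) = (\<Sum>n<p. exp (\<omega> * of_nat y * (of_nat n / of_nat p)))"
  by (simp add: mult.assoc)
 also have "... = (if p dvd y then of_nat p else 0)" using odd_prime_gt_2 by (intro sum_exp_root_unity) simp
 also have "p dvd y \<longleftrightarrow> int p dvd x" using y by (metis dvd_mod_iff dvd_refl int_dvd_int_iff)
 finally show ?thesis .
qed

lemma Legendre_minus_1: "Legendre (-1) (int p) = (if p mod 4 = 1 then 1 else -1)"
proof -
 let ?m = "(p - 1) div 2"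
 have c: "[Legendre (-1) (int p) = (-1) ^ ?m] (mod int p)" by (rule euler_criterion[OF p(1) odd_prime_gt_2])
 have "Legendre (-1) (int p) \<in> {-1, 0, 1}" "(-1::int) ^ ?m \<in> {-1, 0, 1}"
  using Legendre_values[of "-1" "int p"] by (auto simp: minus_one_power_iff)
 hence "\<bar>Legendre (-1) (int p) - (-1) ^ ?m\<bar> < int p" using odd_prime_gt_2 by auto
 moreover have "int p dvd Legendre (-1) (int p) - (-1) ^ ?m" using c by (simp add: cong_iff_dvd_diff)
 ultimately have "Legendre (-1) (int p) = (-1) ^ ?m"
  using dvd_imp_le_int[of "Legendre (-1) (int p) - (-1) ^ ?m" "int p"] by linarith
 moreover have "even ?m \<longleftrightarrow> p mod 4 = 1" using p(2) by presburger
 ultimately show ?thesis by (simp add: minus_one_power_iff)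
qed

lemma theta_eps_power2: "theta_eps (int p) ^ 2 = of_int (Legendre (-1) (int p))"
proof -
 have "int p mod 4 = 1 \<longleftrightarrow> p mod 4 = 1" by presburger
 thus ?thesis by (simp add: Legendre_minus_1 theta_eps_def)
qed

end

subsection \<open>The sign of the quadratic Gauss sum\<close>

text \<open>The Gaussian binomial coefficient. For \<open>j > n\<close> the product contains the
  factor \<open>1 - q^0 = 0\<close>.\<close>

definition qbinomial :: "complex => nat => nat => complex"
 where "qbinomial q n j = (\<Prod>i<j. (1 - q ^ (n - i)) / (1 - q ^ Suc i))"

lemma qbinomial_eq_0: "n < j ==> qbinomial q n j = 0"
 unfolding qbinomial_def by (rule prod_zero) (auto intro!: bexI[of _ n])

lemma qbinomial_0 [simp]: "qbinomial q n 0 = 1" by (simp add: qbinomial_def)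

lemma qbinomial_absorb: "(1 - q ^ (Suc n - j)) * qbinomial q (Suc n) j = (1 - q ^ Suc n) * qbinomial q n j"
proof -
 have "(\<Prod>i<Suc j. 1 - q ^ (Suc n - i)) = (1 - q ^ Suc n) * (\<Prod>i<j. 1 - q ^ (n - i))"
  by (simp only: prod.lessThan_Suc_shift diff_Suc_Suc diff_zero)
 thus ?thesis by (simp add: qbinomial_def prod_dividef mult.commute)
qed

lemma qbinomial_pascal:
 assumes "j \<le> n" "q ^ Suc j \<noteq> 1"
 shows "qbinomial q (Suc n) (Suc j) = qbinomial q n (Suc j) + q ^ (n - j) * qbinomial q n j"
proof -
 have Suc: "(1 - q ^ Suc j) * qbinomial q i (Suc j) = (1 - q ^ (i - j)) * qbinomial q i j" for i
  using assms(2) by (simp add: qbinomial_def)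
 have "q ^ Suc n = q ^ (n - j) * q ^ Suc j" using assms(1) by (simp flip: power_add power_Suc)
 hence "(1 - q ^ Suc j) * qbinomial q (Suc n) (Suc j) = (1 - q ^ (n - j) * q ^ Suc j) * qbinomial q n j"
  unfolding Suc qbinomial_absorb by simp
 also have "... = (1 - q ^ Suc j) * (qbinomial q n (Suc j) + q ^ (n - j) * qbinomial q n j)"
  unfolding distrib_left Suc by (simp add: algebra_simps)
 finally show ?thesis using assms(2) by (simp del: power_Suc)
qed

text \<open>Gauss's identity. By Pascal's rule row \<open>2 m + 2\<close> becomes row
  \<open>2 m + 1\<close> weighted with \<open>1 - q^(2 m + 1 - j)\<close>, and absorption turns this
  into \<open>1 - q^(2 m + 1)\<close> times row \<open>2 m\<close>.\<close>

lemma sum_qbinomial_alternating: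
 assumes "\<And>i. 0 < i ==> i \<le> 2 * m ==> q ^ i \<noteq> 1"
 shows "(\<Sum>j\<le>2 * m. (- 1) ^ j * qbinomial q (2 * m) j) = (\<Prod>i<m. 1 - q ^ (2 * i + 1))"
 using assms
proof (induction m)
 case (Suc m)
 let ?n = "Suc (2 * m)"
 have "(\<Sum>j\<le>Suc ?n. (- 1) ^ j * qbinomial q (Suc ?n) j) =
   1 + (\<Sum>j\<le>?n. (- 1) ^ Suc j * (qbinomial q ?n (Suc j) + q ^ (?n - j) * qbinomial q ?n j))"
 proof -
  have "qbinomial q (Suc ?n) (Suc j) = qbinomial q ?n (Suc j) + q ^ (?n - j) * qbinomial q ?n j" if "j \<le> ?n" for j
   by (rule qbinomial_pascal[OF that]) (use Suc.prems[of "Suc j"] that in auto)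
  hence "(\<Sum>j\<le>?n. (- 1) ^ Suc j * qbinomial q (Suc ?n) (Suc j)) =
    (\<Sum>j\<le>?n. (- 1) ^ Suc j * (qbinomial q ?n (Suc j) + q ^ (?n - j) * qbinomial q ?n j))"
   by (intro sum.cong refl) (simp only: atMost_iff)
  thus ?thesis by (simp only: sum.atMost_Suc_shift qbinomial_0 power_0 mult_1)
 qed
 also have "... = (1 + (\<Sum>j\<le>?n. (- 1) ^ Suc j * qbinomial q ?n (Suc j)))
   - (\<Sum>j\<le>?n. (- 1) ^ j * (q ^ (?n - j) * qbinomial q ?n j))"
  by (simp add: distrib_left sum.distrib sum_subtractf sum_negf)
 also have "1 + (\<Sum>j\<le>?n. (- 1) ^ Suc j * qbinomial q ?n (Suc j)) = (\<Sum>j\<le>Suc ?n. (- 1) ^ j * qbinomial q ?n j)"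
  unfolding sum.atMost_Suc_shift by (simp add: qbinomial_def)
 also have "... = (\<Sum>j\<le>?n. (- 1) ^ j * qbinomial q ?n j)" by (simp add: qbinomial_eq_0)
 also have "... - (\<Sum>j\<le>?n. (- 1) ^ j * (q ^ (?n - j) * qbinomial q ?n j)) =
   (\<Sum>j\<le>?n. (- 1) ^ j * ((1 - q ^ (?n - j)) * qbinomial q ?n j))"
  by (simp only: sum_subtractf[symmetric] right_diff_distrib left_diff_distrib mult_1)
 also have "... = (1 - q ^ ?n) * (\<Sum>j\<le>?n. (- 1) ^ j * qbinomial q (2 * m) j)"
  unfolding qbinomial_absorb sum_distrib_left by (simp only: mult.left_commute)
 also have "(\<Sum>j\<le>?n. (- 1) ^ j * qbinomial q (2 * m) j) = (\<Prod>i<m. 1 - q ^ (2 * i + 1))"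
  using Suc by (simp add: qbinomial_eq_0)
 finally show ?case by (simp add: mult.commute)
qed (simp add: qbinomial_def)

text \<open>Gauss's evaluation: for \<open>q = exp (-4 \<pi> i / p)\<close> and \<open>n = p - 1\<close> the alternating sum of the
  \<open>q\<close>-binomial coefficients is, after completing the square, the Gauss sum.\<close>
theorem gauss_sum_value:
 assumes p: "prime p" "odd p"
 shows "gauss_sum p = theta_eps (int p) * of_real (sqrt (real p))"
proof -
 define m where "m = (p - 1) div 2"
 have m: "p = 2 * m + 1" using p(2) by (auto simp: m_def elim!: oddE)
 have p0: "p > 0" "p > 2" using odd_prime_gt_2[OF p] by auto
 define e :: "int => complex" where "e x = exp (\<omega> * (of_int x / of_nat p))" for x
 have e_add: "e (x + y) = e x * e y" for x y by (simp add: e_def add_divide_distrib ring_distribs flip: exp_add)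
 have e_cong: "e x = e y" if "[x = y] (mod int p)" for x y unfolding e_def by (rule exp_cong[OF p that])
 have e0: "e 0 = 1" by (simp add: e_def)
 have e_pow: "e x ^ n = e (x * int n)" for x n by (induction n) (simp_all add: e0 distrib_left flip: e_add)
 have e_1: "e x = 1 \<longleftrightarrow> int p dvd x" for x
 proof
  assume x: "e x = 1"
  have "(\<Sum>n<p. e (int n * x)) = of_nat p" by (simp add: mult.commute[of _ x] x flip: e_pow)
  thus "int p dvd x" unfolding e_def sum_exp_residues[OF p] using p0 by (auto split: if_splits)
 next
  assume "int p dvd x"
  thus "e x = 1" using e_cong[of x 0] e0 by (simp add: cong_0_iff)
 qed
 define q where "q = e (- 2)"
 have q: "q ^ n = e (- 2 * int n)" for n by (simp only: q_def e_pow)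
 have q1: "q ^ i \<noteq> 1" if "0 < i" "i < p" for i
 proof -
  have "\<not> int p dvd 2 * int i"
   using prime_not_dvd_nat[OF p that] prime_not_dvd_nat[OF p, of 2] p(1) p0 by (simp add: prime_dvd_mult_iff)
  thus ?thesis by (simp add: q e_1)
 qed
 \<comment> \<open>As \<open>q^p = 1\<close>, the numerator \<open>1 - q^(p - 1 - i)\<close> is
   \<open>- q^(- i - 1)\<close> times the denominator, so the coefficient collapses to a root of
   unity up to sign; the choice \<open>q = e (-2)\<close> makes the exponent
   \<open>j * (j + 1)\<close>.\<close>
 have binom: "(- 1) ^ j * qbinomial q (p - 1) j = e (int j * (int j + 1))" if "j < p" for j using that
 proof (induction j)
  case (Suc j)
  have "q ^ (p - 1 - j) = e (2 * int (Suc j))"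
   unfolding q by (rule e_cong) (use Suc.prems in \<open>simp add: cong_iff_dvd_diff of_nat_diff\<close>)
  moreover have "e (2 * int (Suc j)) * q ^ Suc j = 1" unfolding q e_add[symmetric] by (simp add: e0)
  hence "1 - e (2 * int (Suc j)) = - e (2 * int (Suc j)) * (1 - q ^ Suc j)" by (simp add: right_diff_distrib)
  moreover have nz: "1 - q ^ Suc j \<noteq> 0" using q1[of "Suc j"] Suc.prems by (simp del: power_Suc)
  ultimately have "(1 - q ^ (p - 1 - j)) / (1 - q ^ Suc j) = - e (2 * int (Suc j))"
   by (simp only: nonzero_mult_div_cancel_right[OF nz])
  hence "(- 1) ^ Suc j * qbinomial q (p - 1) (Suc j) = e (2 * int (Suc j)) * ((- 1) ^ j * qbinomial q (p - 1) j)"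
   by (simp add: qbinomial_def)
  also have "... = e (2 * int (Suc j) + int j * (int j + 1))" using Suc by (simp add: e_add)
  finally show ?case by (simp add: algebra_simps)
 qed (simp add: qbinomial_def e0)
 have translate: "(\<Sum>n<p. e ((int n + c)\<^sup>2)) = (\<Sum>n<p. e ((int n)\<^sup>2))" for c
 proof (rule sum_residues_reindex[where m = p and F = "\<lambda>x. e (x^2)"])
  fix b d assume bd: "b \<in> {..<p}" "d \<in> {..<p}" "[int b + c = int d + c] (mod int p)"
  hence "[int b = int d] (mod int p)" by (simp add: cong_iff_dvd_diff)
  thus "b = d" using bd by (simp add: cong_def)
 next
  show "e (x^2) = e (y^2)" if "[x = y] (mod int p)" for x y by (rule e_cong[OF cong_pow[OF that]])
 qed (use p0 in \<open>auto simp: nat_less_iff\<close>)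
 have sum_e: "(\<Sum>n<p. e (int n * x)) = (if int p dvd x then of_nat p else 0)" for x
  unfolding e_def by (rule sum_exp_residues[OF p])
 have "gauss_sum p = (\<Sum>b<p. of_int (Legendre (int b) (int p)) * e (int b))" by (simp add: gauss_sum_def[OF p] e_def)
 also have "... = (\<Sum>b<p. (1 + of_int (Legendre (int b) (int p))) * e (int b))"
  using sum_e[of 1] p0 by (simp add: distrib_right sum.distrib)
 also have "... = (\<Sum>n<p. e ((int n)\<^sup>2))" by (rule sum_squares_residues[OF p, symmetric]) (rule e_cong)
 finally have gs: "gauss_sum p = (\<Sum>n<p. e ((int n)\<^sup>2))" .
 \<comment> \<open>The Gauss sum has squared modulus \<open>p\<close>: after shifting
   \<open>n\<close> by \<open>k\<close>, the inner sum over \<open>k\<close> is a full character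
   sum, which leaves only \<open>n = 0\<close>.\<close>
 have "gauss_sum p * cnj (gauss_sum p) = (\<Sum>k<p. \<Sum>n<p. e ((int n + int k)\<^sup>2) * e (- ((int k)\<^sup>2)))"
  unfolding sum_distrib_right[symmetric] translate gs[symmetric] sum_distrib_left[symmetric]
  unfolding gs by (simp add: e_def exp_cnj)
 also have "... = (\<Sum>k<p. \<Sum>n<p. e ((int n)\<^sup>2) * e (int k * (2 * int n)))"
  unfolding e_add[symmetric] by (simp add: power2_eq_square algebra_simps)
 also have "... = (\<Sum>n<p. e ((int n)\<^sup>2) * (\<Sum>k<p. e (int k * (2 * int n))))"
  unfolding sum_distrib_left by (rule sum.swap)
 also have "... = (\<Sum>n<p. if n = 0 then of_nat p else 0)"
 proof (intro sum.cong refl)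
  fix n assume "n \<in> {..<p}"
  hence "int p dvd 2 * int n \<longleftrightarrow> n = 0" using q1[of n] by (cases "n = 0") (simp_all add: q e_1)
  thus "e ((int n)\<^sup>2) * (\<Sum>k<p. e (int k * (2 * int n))) = (if n = 0 then of_nat p else 0)"
   unfolding sum_e by (simp add: e0)
 qed
 finally have norm: "gauss_sum p * cnj (gauss_sum p) = of_nat p" using p0 by simp
 note gs
 \<comment> \<open>The shift \<open>m + 1\<close> is the inverse of 2 modulo \<open>p\<close>: it
   completes \<open>n^2 + n\<close> to a square.\<close>
 also have "(\<Sum>n<p. e ((int n)\<^sup>2)) = (\<Sum>n<p. e ((int n + int (m + 1))\<^sup>2))" by (rule translate[symmetric])
 also have "... = (\<Sum>n<p. e ((int (m + 1))\<^sup>2) * e (int n * (int n + 1)))"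
 proof (intro sum.cong refl)
  fix n
  have "[(int n + int (m + 1))\<^sup>2 = (int (m + 1))\<^sup>2 + int n * (int n + 1)] (mod int p)"
   by (auto simp: cong_iff_dvd_diff m power2_eq_square algebra_simps intro: dvdI[of _ _ "int n"])
  thus "e ((int n + int (m + 1))\<^sup>2) = e ((int (m + 1))\<^sup>2) * e (int n * (int n + 1))"
   using e_cong by (simp only: e_add[symmetric])
 qed
 also have "... = e ((int (m + 1))\<^sup>2) * (\<Sum>j\<le>2 * m. (- 1) ^ j * qbinomial q (2 * m) j)"
  unfolding sum_distrib_left using binom by (intro sum.cong) (auto simp: m)
 also have "(\<Sum>j\<le>2 * m. (- 1) ^ j * qbinomial q (2 * m) j) = (\<Prod>i<m. 1 - q ^ (2 * i + 1))"
  by (rule sum_qbinomial_alternating) (use q1 m in auto)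
 also have "... = (\<Prod>i<m. e (- int (2 * i + 1)) * (\<i> * of_real (2 * sin (2 * pi * real (2 * i + 1) / real p))))"
 proof (rule prod.cong[OF refl])
  fix i
  let ?t = "2 * pi * real (2 * i + 1) / real p"
  have "e x = cis (2 * pi * of_int x / real p)" for x by (simp add: e_def cis_conv_exp mult_ac)
  hence cis: "e (int (2 * i + 1)) = cis ?t" "e (- int (2 * i + 1)) = cis (- ?t)"
   by (simp_all only: of_int_minus of_int_of_nat_eq mult_minus_right divide_minus_left)
  have "q ^ (2 * i + 1) = e (- int (2 * i + 1)) * e (- int (2 * i + 1))" unfolding q e_add[symmetric] by simp
  moreover have "1 = e (- int (2 * i + 1)) * e (int (2 * i + 1))" unfolding e_add[symmetric] by (simp add: e0)
  ultimately have "1 - q ^ (2 * i + 1) = e (- int (2 * i + 1)) * (e (int (2 * i + 1)) - e (- int (2 * i + 1)))"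
   by (simp only: right_diff_distrib)
  also have "e (int (2 * i + 1)) - e (- int (2 * i + 1)) = \<i> * of_real (2 * sin ?t)"
   unfolding cis by (simp add: complex_eq_iff)
  finally show "1 - q ^ (2 * i + 1) = e (- int (2 * i + 1)) * (\<i> * of_real (2 * sin ?t))" .
 qed
 also have "... = e (- ((int m)\<^sup>2)) * (\<i> ^ m * (\<Prod>i<m. of_real (2 * sin (2 * pi * real (2 * i + 1) / real p))))"
 proof -
  have "(\<Prod>i<n. e (- int (2 * i + 1))) = e (- ((int n)\<^sup>2))" for n
   by (induction n) (simp_all add: e0 power2_eq_square algebra_simps flip: e_add)
  thus ?thesis by (simp add: prod.distrib)
 qed
 also have "e ((int (m + 1))\<^sup>2) * ... = \<i> ^ m * (\<Prod>i<m. of_real (2 * sin (2 * pi * real (2 * i + 1) / real p)))"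
 proof -
  have "(int (m + 1))\<^sup>2 + - ((int m)\<^sup>2) = int p" by (simp add: m power2_eq_square algebra_simps)
  hence "e ((int (m + 1))\<^sup>2) * e (- ((int m)\<^sup>2)) = 1" unfolding e_add[symmetric] by (simp add: e_1)
  thus ?thesis by (simp flip: mult.assoc)
 qed
 also have "(\<Prod>i<m. of_real (2 * sin (2 * pi * real (2 * i + 1) / real p)) :: complex) =
   (- 1) ^ (m div 2) * of_real (\<Prod>i<m. \<bar>2 * sin (2 * pi * real (2 * i + 1) / real p)\<bar>)"
 proof -
  \<comment> \<open>The sine is negative exactly when \<open>2 (2 i + 1) > p\<close>, which happens
    for the last \<open>m div 2\<close> indices.\<close>
  let ?x = "\<lambda>i. 2 * sin (2 * pi * real (2 * i + 1) / real p)" and ?P = "\<lambda>i. i < (m + 1) div 2"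
  have "{..<m} \<inter> - {i. ?P i} = {(m + 1) div 2..<m}" by auto
  hence "(\<Prod>i<m. if ?P i then 1 else (- 1 :: real)) = (- 1) ^ (m - (m + 1) div 2)" by (simp add: prod.If_cases)
  also have "m - (m + 1) div 2 = m div 2" by linarith
  finally have "(- 1) ^ (m div 2) * (\<Prod>i<m. \<bar>?x i\<bar>) = (\<Prod>i<m. (if ?P i then 1 else - 1) * \<bar>?x i\<bar>)"
   by (simp only: prod.distrib)
  also have "... = (\<Prod>i<m. ?x i)"
  proof (rule prod.cong[OF refl])
   fix i assume i: "i \<in> {..<m}"
   let ?t = "2 * pi * real (2 * i + 1) / real p"
   define x where "x = 2 * real (2 * i + 1) / real p"
   have t: "?t = pi * x" by (simp add: x_def)
   show "(if ?P i then 1 else - 1) * \<bar>?x i\<bar> = ?x i"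
   proof (cases "?P i")
    case True
    hence "2 * (2 * i + 1) < p" using m by presburger
    hence "2 * real (2 * i + 1) < real p" by linarith
    hence "0 < x" "x < 1" using p0 by (simp_all add: x_def field_simps)
    hence "0 < sin ?t" unfolding t by (intro sin_gt_zero) simp_all
    thus ?thesis using True by simp
   next
    case False
    hence "p < 2 * (2 * i + 1)" "2 * i + 1 < p" using i m by auto
    hence "real p < 2 * real (2 * i + 1)" "real (2 * i + 1) < real p" by linarith+
    hence "1 < x" "x < 2" using p0 by (simp_all add: x_def field_simps)
    hence "sin ?t < 0" unfolding t by (intro sin_lt_zero) simp_all
    thus ?thesis using False by simp
   qed
  qed
  finally have "(- 1) ^ (m div 2) * (\<Prod>i<m. \<bar>?x i\<bar>) = (\<Prod>i<m. ?x i)" .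
  from this[symmetric] show ?thesis unfolding of_real_prod[symmetric] by simp
 qed
 finally have G: "gauss_sum p = (\<i> ^ m * (- 1) ^ (m div 2)) * of_real (\<Prod>i<m. \<bar>2 * sin (2 * pi * real (2 * i + 1) / real p)\<bar>)"
  by (simp add: mult.assoc)
 \<comment> \<open>The product of sines is not evaluated: it is nonnegative, and the squared modulus
   found above gives it the square \<open>p\<close>.\<close>
 define R where "R = (\<Prod>i<m. \<bar>2 * sin (2 * pi * real (2 * i + 1) / real p)\<bar>)"
 have "\<i> ^ m * (- 1) ^ (m div 2) = theta_eps (int p)"
 proof -
  have "int p mod 4 = 1 \<longleftrightarrow> even m" using m by presburger
  moreover obtain n where "m = 2 * n \<or> m = 2 * n + 1" by (metis oddE evenE)
  ultimately show ?thesis by (auto simp: theta_eps_def power_mult simp flip: power_mult_distrib)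
 qed
 note G = G[folded R_def, unfolded this]
 have "gauss_sum p * cnj (gauss_sum p) = (theta_eps (int p) * cnj (theta_eps (int p))) * of_real (R^2)"
  unfolding G by (simp add: power2_eq_square mult_ac)
 also have "theta_eps (int p) * cnj (theta_eps (int p)) = 1" by (simp add: theta_eps_def)
 finally have "complex_of_real (R^2) = of_real (real p)" using norm by simp
 hence "R\<^sup>2 = real p" by (simp only: of_real_eq_iff)
 moreover have "R \<ge> 0" unfolding R_def by (rule prod_nonneg) simp
 ultimately have "R = sqrt (real p)" by (simp add: real_sqrt_unique)
 thus ?thesis using G by simp
qed

subsection \<open>Cusp forms of half-integral weight on \<open>\<Gamma>\<^sub>0(4)\<close>\<close>

lemma shimura_symbol_power2:
 assumes "coprime c d" "d \<noteq> 0"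
 shows "(shimura_symbol c d)\<^sup>2 = 1"
proof -
 have "(\<Prod>p\<in>#M. Legendre c p)\<^sup>2 = 1" if "\<And>p. p \<in># M ==> \<not> p dvd c" for M
  using that by (induction M) (auto simp: power_mult_distrib Legendre_power2)
 moreover have "\<not> p dvd c" if "p \<in># prime_factorization \<bar>d\<bar>" for p
 proof
  assume "p dvd c"
  moreover have "p dvd d" "prime p" using that by (auto simp: in_prime_factors_iff)
  ultimately show False using assms(1) by (meson coprime_common_divisor not_prime_unit)
 qed
 ultimately show ?thesis by (auto simp: shimura_symbol_def power_mult_distrib)
qed

lemma shimura_symbol_1 [simp]: "shimura_symbol c 1 = 1" by (simp add: shimura_symbol_def)

lemma shimura_symbol_prime: "prime p ==> shimura_symbol c p = Legendre c p" for p :: int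
 using prime_gt_0_int[of p] by (simp add: shimura_symbol_def prime_factorization_prime)

lemma theta_eps_1 [simp]: "theta_eps 1 = 1" by (simp add: theta_eps_def)

lemma Gamma0_4_odd:
 assumes "\<gamma> \<in> Gamma0 4"
 shows "odd (\<gamma>$2$2)" "odd (\<gamma>$1$1)" "coprime (\<gamma>$2$1) (\<gamma>$2$2)"
proof -
 have 1: "\<gamma>$1$1 * \<gamma>$2$2 - \<gamma>$1$2 * \<gamma>$2$1 = 1" "4 dvd \<gamma>$2$1" using assms by (auto simp: Gamma0_iff det_2)
 from 1(2) have "even (\<gamma>$2$1)" by (meson dvd_trans even_numeral)
 hence "odd (\<gamma>$1$1 * \<gamma>$2$2)" using 1(1) by (metis diff_add_cancel even_add even_mult_iff odd_one)
 thus "odd (\<gamma>$2$2)" "odd (\<gamma>$1$1)" by auto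
 show "coprime (\<gamma>$2$1) (\<gamma>$2$2)" by (rule coprimeI) (metis 1(1) dvd_diff dvd_mult)
qed

lemma csqrt_power8: "csqrt z ^ 8 = z ^ 4" using power_mult[of "csqrt z" 2 4] by simp

lemma csqrt_cocycle_holomorphic: "(\<lambda>z. csqrt (cocycle \<gamma> z)) holomorphic_on \<H>"
proof (cases "\<gamma>$2$1 = 0")
 case True
 thus ?thesis by (simp add: cocycle_def)
next
 case False
 have "cocycle \<gamma> z \<notin> \<real>\<^sub>\<le>\<^sub>0" if "z \<in> \<H>" for z
 proof
  assume "cocycle \<gamma> z \<in> \<real>\<^sub>\<le>\<^sub>0"
  hence "Im (cocycle \<gamma> z) = 0" by (simp add: complex_nonpos_Reals_iff)
  thus False using that False by (simp add: cocycle_def H_iff)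
 qed
 moreover have "cocycle \<gamma> holomorphic_on \<H>" unfolding cocycle_def by (intro holomorphic_intros)
 ultimately show ?thesis by (intro holomorphic_intros) auto
qed

lemma theta_factor_holomorphic: "theta_factor \<gamma> holomorphic_on \<H>"
 unfolding theta_factor_def by (intro holomorphic_intros csqrt_cocycle_holomorphic)

lemma theta_factor_power8:
 assumes "\<gamma> \<in> Gamma0 4"
 shows "theta_factor \<gamma> z ^ 8 = cocycle \<gamma> z ^ 4"
proof -
 have "shimura_symbol (\<gamma>$2$1) (\<gamma>$2$2) ^ 8 = 1"
  using Gamma0_4_odd[OF assms] shimura_symbol_power2[of "\<gamma>$2$1" "\<gamma>$2$2"]
   power_mult[of "shimura_symbol (\<gamma>$2$1) (\<gamma>$2$2)" 2 4] by fastforce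
 hence "(of_int (shimura_symbol (\<gamma>$2$1) (\<gamma>$2$2)) :: complex) ^ 8 = 1" by (metis of_int_1 of_int_power)
 moreover have "theta_eps (\<gamma>$2$2) ^ 8 = 1" by (simp add: theta_eps_def)
 ultimately show ?thesis unfolding theta_factor_def by (simp add: power_mult_distrib power_inverse csqrt_power8)
qed

lemma power_power_swap: "x ^ m = y ^ n ==> (x ^ w) ^ m = y ^ (n * w)" for x y :: complex
 by (metis power_mult mult.commute)

text \<open>The eighth power removes the quadratic symbol, \<open>theta_eps\<close> and the branch
  of the root at once.\<close>

lemma cusp_weight_half:
 "cusp_weight 4 (\<lambda>\<gamma> z. theta_factor \<gamma> z ^ (2 * k + 1)) (\<lambda>\<gamma> z. csqrt (cocycle \<gamma> z) ^ (2 * k + 1))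
  8 (4 * (2 * k + 1)) (real k + 1 / 2)"
proof
 show "(theta_factor \<gamma> z ^ (2 * k + 1)) ^ 8 = cocycle \<gamma> z ^ (4 * (2 * k + 1))" if "\<gamma> \<in> Gamma0 4" for \<gamma> z
  using theta_factor_power8[OF that, of z] by (rule power_power_swap)
 show "(csqrt (cocycle \<gamma> z) ^ (2 * k + 1)) ^ 8 = cocycle \<gamma> z ^ (4 * (2 * k + 1))" for \<gamma> z
  using csqrt_power8[of "cocycle \<gamma> z"] by (rule power_power_swap)
 show "continuous_on \<H> (\<lambda>z. theta_factor \<gamma> z ^ (2 * k + 1))" for \<gamma>
  by (intro holomorphic_on_imp_continuous_on holomorphic_intros theta_factor_holomorphic)
 show "(\<lambda>z. csqrt (cocycle \<gamma> z) ^ (2 * k + 1)) holomorphic_on \<H>" for \<gamma>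
  by (intro holomorphic_intros csqrt_cocycle_holomorphic)
qed (simp_all add: algebra_simps)

lemma S_half_iff:
 "f \<in> S_half k \<longleftrightarrow> f holomorphic_on \<H> \<and> (\<forall>z. z \<notin> \<H> \<longrightarrow> f z = 0) \<and>
  (\<forall>\<gamma>\<in>Gamma0 4. \<forall>z\<in>\<H>. f (moebius \<gamma> z) = theta_factor \<gamma> z ^ (2 * k + 1) * f z) \<and>
  growth_bounded (real k + 1 / 2) f"
 unfolding S_half_def by (rule cusp_weight.cusp_forms_iff[OF cusp_weight_half])

lemma subspace_S_half: "fun_vs.subspace (S_half k)"
 unfolding S_half_def by (rule cusp_weight.subspace_cusp_forms[OF cusp_weight_half])

lemma S_half_cuspidal: "f \<in> S_half k ==> cuspidal (real k + 1 / 2) f" by (simp add: S_half_iff cuspidal_def)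

lemma hermitian_space_S_half: "hermitian_space (S_half k) (petersson (real k + 1 / 2) 4)"
 by (rule hermitian_space_cuspidal[OF _ subspace_S_half S_half_cuspidal]) simp

lemma theta_factor_T [simp]: "theta_factor (mat2 1 n 0 1) z = 1" by (simp add: theta_factor_def)

lemma theta_factor_V [simp]: "theta_factor (mat2 a b c 1) z = csqrt (of_int c * z + 1)"
 by (simp add: theta_factor_def)

lemma S_half_has_qexp:
 assumes "f \<in> S_half k"
 shows "has_qexp f (qcoeff f)" "qcoeff f 0 = 0"
proof -
 obtain a where "has_qexp f a" "a 0 = 0"
  by (rule cusp_weight.cusp_forms_has_qexp[OF cusp_weight_half assms[unfolded S_half_def]]) simp
 thus "has_qexp f (qcoeff f)" "qcoeff f 0 = 0" using qcoeff_eqI by auto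
qed

lemma S_half_moebius:
 assumes "f \<in> S_half k" "\<gamma> \<in> Gamma0 4" "z \<in> \<H>"
 shows "f (moebius \<gamma> z) = theta_factor \<gamma> z ^ (2 * k + 1) * f z"
 using assms by (auto simp: S_half_iff)

lemma S_half_periodic:
 assumes "f \<in> S_half k"
 shows "f (z + of_int n) = f z"
proof (cases "z \<in> \<H>")
 case True
 thus ?thesis using S_half_moebius[OF assms Gamma0_T True, of n] by (simp add: moebius_mat2)
next
 case False
 hence "z + of_int n \<notin> \<H>" by (simp add: H_iff)
 thus ?thesis using False assms by (simp add: S_half_iff)
qed

lemma S_half_V:
 assumes "f \<in> S_half k" "z \<in> \<H>"
 shows "f (z / (4 * of_int n * z + 1)) = csqrt (4 * of_int n * z + 1) ^ (2 * k + 1) * f z"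
proof -
 have "mat2 1 0 (4 * n) 1 \<in> Gamma0 4" by (simp add: Gamma0_iff)
 from S_half_moebius[OF assms(1) this assms(2)] show ?thesis by (simp add: moebius_mat2)
qed

section \<open>The Fricke involution\<close>

definition fricke :: "nat => cfun => cfun"
 where "fricke k f z =
  (if z \<in> \<H> then inverse (csqrt (-2 * \<i> * z) ^ (2 * k + 1)) * f (-1 / (4 * z)) else 0)"

lemma W4_eq: "W4 k f = (\<lambda>z. of_int (shimura_symbol 2 (2 * int k + 1)) * fricke k f z)"
 by (auto simp: W4_def fricke_def fun_eq_iff)

lemma fricke_add: "fricke k (f + g) = fricke k f + fricke k g"
 by (auto simp: fricke_def fun_eq_iff algebra_simps)

lemma fricke_cmult: "fricke k (\<lambda>z. c * f z) = (\<lambda>z. c * fricke k f z)" by (auto simp: fricke_def fun_eq_iff)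

lemma H_fricke: "z \<in> \<H> ==> -1 / (4 * z) \<in> \<H>"
 using moebius_in_H[of "mat2 0 (-1) 4 0" z] by (simp add: moebius_mat2)

lemma H_nonzero: "z \<in> \<H> ==> z \<noteq> 0" by (auto simp: H_iff)

lemma Re_rotate: "z \<in> \<H> ==> Re (-2 * \<i> * z) > 0" by (simp add: H_iff)

lemma csqrt_power_nonzero: "z \<in> \<H> ==> csqrt (-2 * \<i> * z) ^ n \<noteq> 0" using H_nonzero by simp

lemma fricke_apply: "z \<in> \<H> ==> f (-1 / (4 * z)) = csqrt (-2 * \<i> * z) ^ (2 * k + 1) * fricke k f z"
 by (simp only: fricke_def if_True mult.assoc[symmetric] right_inverse[OF csqrt_power_nonzero] mult_1)

lemma fricke_fricke:
 assumes "\<And>z. z \<notin> \<H> ==> f z = 0"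
 shows "fricke k (fricke k f) = f"
proof
 fix z show "fricke k (fricke k f) z = f z"
 proof (cases "z \<in> \<H>")
  case True
  note z = H_nonzero[OF True]
  have "-2 * \<i> * (-1 / (4 * z)) = 1 / (-2 * \<i> * z)" using z by (simp add: field_simps)
  hence "csqrt (-2 * \<i> * (-1 / (4 * z))) = 1 / csqrt (-2 * \<i> * z)"
   using csqrt_divide[of 1 "-2 * \<i> * z"] Re_rotate[OF True] by simp
  moreover have "-1 / (4 * (-1 / (4 * z))) = z" using z by simp
  moreover have "csqrt (-2 * \<i> * z) \<noteq> 0" using z by simp
  ultimately show ?thesis using True H_fricke[OF True] by (simp add: fricke_def power_one_over del: power_Suc)
 qed (simp add: assms fricke_def)
qed

lemma csqrt_rotate_holomorphic: "(\<lambda>z. csqrt (-2 * \<i> * z)) holomorphic_on \<H>"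
proof -
 have "-2 * \<i> * z \<notin> \<real>\<^sub>\<le>\<^sub>0" if "z \<in> \<H>" for z
  using Re_rotate[OF that] complex_nonpos_Reals_iff[of "-2 * \<i> * z"] by linarith
 from holomorphic_on_csqrt'[of "\<lambda>z. -2 * \<i> * z", OF _ this] show ?thesis by (auto intro: holomorphic_intros)
qed

lemma norm_csqrt_power: "cmod (csqrt z ^ (2 * k + 1)) = cmod z powr (real k + 1 / 2)"
proof (cases "z = 0")
 case False
 have "cmod (csqrt z) = sqrt (cmod z)" by (metis norm_power power2_csqrt real_sqrt_unique norm_ge_zero)
 hence "cmod (csqrt z ^ (2 * k + 1)) = (cmod z powr (1 / 2)) ^ (2 * k + 1)"
  by (simp add: norm_power powr_half_sqrt del: power_Suc)
 also have "... = cmod z powr (1 / 2 * real (2 * k + 1))"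
 proof -
  have "cmod z powr (1 / 2) > 0" using False by simp
  thus ?thesis using powr_realpow[of "cmod z powr (1 / 2)" "2 * k + 1"] by (simp only: powr_powr)
 qed
 also have "1 / 2 * real (2 * k + 1) = real k + 1 / 2" by simp
 finally show ?thesis .
qed simp

lemma growth_fricke:
 assumes "z \<in> \<H>"
 shows "growth (real k + 1 / 2) (fricke k f) z = growth (real k + 1 / 2) f (-1 / (4 * z))"
proof -
 let ?\<kappa> = "real k + 1 / 2"
 have "growth ?\<kappa> f (-1 / (4 * z)) =
  cmod (f (-1 / (4 * z))) * 4 powr (?\<kappa> / 2) * (4 * cmod z) powr - ?\<kappa> * Im z powr (?\<kappa> / 2)"
  using growth_moebius[of "mat2 0 (-1) 4 0" z ?\<kappa> f] assms by (simp add: moebius_mat2 norm_mult)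
 also have "4 powr (?\<kappa> / 2) = 2 powr ?\<kappa>" using powr_powr[of 2 2 "?\<kappa> / 2"] by simp
 also have "cmod (f (-1 / (4 * z))) * 2 powr ?\<kappa> * (4 * cmod z) powr - ?\<kappa> = cmod (fricke k f z)"
 proof -
  have "cmod (csqrt (-2 * \<i> * z) ^ (2 * k + 1)) = (2 * cmod z) powr ?\<kappa>"
   unfolding norm_csqrt_power by (simp add: norm_mult)
  moreover have "(4 * cmod z) powr ?\<kappa> = 2 powr ?\<kappa> * (2 * cmod z) powr ?\<kappa>" by (simp flip: powr_mult)
  moreover have "cmod (fricke k f z) = inverse (cmod (csqrt (-2 * \<i> * z) ^ (2 * k + 1))) * cmod (f (-1 / (4 * z)))"
   using assms by (simp only: fricke_def if_True norm_mult norm_inverse)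
  moreover have "z \<noteq> 0" using H_nonzero[OF assms] .
  ultimately show ?thesis by (simp only: powr_minus) (simp add: divide_simps)
 qed
 finally show ?thesis by (simp add: growth_def)
qed

lemma cuspidal_fricke:
 assumes "cuspidal (real k + 1 / 2) f"
 shows "cuspidal (real k + 1 / 2) (fricke k f)"
proof -
 have "(\<lambda>z. inverse (csqrt (-2 * \<i> * z) ^ (2 * k + 1)) * f (moebius (mat2 0 (-1) 4 0) z)) holomorphic_on \<H>"
 proof (intro holomorphic_on_mult holomorphic_on_inverse holomorphic_on_power csqrt_rotate_holomorphic)
  show "csqrt (- 2 * \<i> * z) ^ (2 * k + 1) \<noteq> 0" if "z \<in> \<H>" for z using H_nonzero[OF that] by simp
  have "(f \<circ> moebius (mat2 0 (-1) 4 0)) holomorphic_on \<H>"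
   using assms by (intro holomorphic_on_compose_gen[where t = \<H>] holomorphic_moebius) (auto simp: cuspidal_def)
  thus "(\<lambda>z. f (moebius (mat2 0 (-1) 4 0) z)) holomorphic_on \<H>" by (simp add: o_def)
 qed
 hence "fricke k f holomorphic_on \<H>" by (rule holomorphic_transform) (simp add: fricke_def moebius_mat2)
 moreover obtain C where "\<And>z. z \<in> \<H> ==> growth (real k + 1 / 2) f z \<le> C"
  using assms unfolding cuspidal_def growth_bounded_def by blast
 hence "growth_bounded (real k + 1 / 2) (fricke k f)"
  by (intro growth_boundedI[where C = C]) (use H_fricke in \<open>simp only: growth_fricke\<close>)
 ultimately show ?thesis by (simp add: cuspidal_def fricke_def)
qed

text \<open>That the theta multiplier is a cocycle is read off from the given form,
  which avoids a proof by quadratic reciprocity.\<close>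
lemma theta_factor_mult:
 assumes f: "f \<in> S_half k" "f z1 \<noteq> 0" and A: "A \<in> Gamma0 4" and B: "B \<in> Gamma0 4" and z: "z \<in> \<H>"
 shows "theta_factor (A ** B) z ^ (2 * k + 1) =
  theta_factor A (moebius B z) ^ (2 * k + 1) * theta_factor B z ^ (2 * k + 1)"
proof (rule ccontr)
 assume ne: "\<not> ?thesis"
 define D where "D z = theta_factor (A ** B) z ^ (2 * k + 1) -
  theta_factor A (moebius B z) ^ (2 * k + 1) * theta_factor B z ^ (2 * k + 1)" for z
 have "(theta_factor A \<circ> moebius B) holomorphic_on \<H>"
  using B by (intro holomorphic_on_compose_gen[where t = \<H>] holomorphic_moebius theta_factor_holomorphic) auto
 hence "D holomorphic_on \<H>" unfolding D_def o_def by (intro holomorphic_intros theta_factor_holomorphic)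
 hence cont: "continuous_on \<H> D" by (rule holomorphic_on_imp_continuous_on)
 \<comment> \<open>At a point where the two factors differ, evaluating \<open>f (A B z)\<close> in
   two ways forces \<open>f\<close> to vanish. The set of such points is open, so if it were not
   empty, \<open>f\<close> would vanish identically.\<close>
 have prod: "f w = 0" if w: "w \<in> \<H>" "D w \<noteq> 0" for w
 proof -
  have "f (moebius (A ** B) w) = f (moebius A (moebius B w))" using A B w by (simp add: moebius_mult)
  hence "D w * f w = 0" using S_half_moebius[OF f(1) Gamma0_mult[OF A B] w(1)] S_half_moebius[OF f(1) B w(1)]
    S_half_moebius[OF f(1) A, of "moebius B w"] B w(1) by (simp add: D_def algebra_simps)
  thus ?thesis using w by simp
 qed
 define O' where "O' = {w \<in> \<H>. D w \<noteq> 0}"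
 have "openin (top_of_set \<H>) (\<H> \<inter> D -` (- {0}))" using cont by (rule continuous_openin_preimage_gen) auto
 moreover have "\<H> \<inter> D -` (- {0}) = O'" by (auto simp: O'_def)
 ultimately have "open O'" by (simp add: openin_open_eq)
 moreover have "z \<in> O'" using z ne by (simp add: O'_def D_def)
 moreover have "z1 \<in> \<H>" using f by (auto simp: S_half_iff)
 ultimately have "f z1 = (\<lambda>_. 0) z1"
  using f(1) prod by (intro analytic_continuation_open[of O' \<H> f "\<lambda>_. 0" z1]) (auto simp: O'_def S_half_iff)
 thus False using f(2) by simp
qed

text \<open>\<open>\<Gamma>\<^sub>0(4)\<close> is generated by \<open>-1\<close>, \<open>z \<mapsto> z + 1\<close> and the conjugate of the latter by the Fricke involution.\<close>
lemma S_half_criterion: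
 assumes f: "f \<in> S_half k" "f z1 \<noteq> 0" and F: "cuspidal (real k + 1 / 2) F"
  and per: "\<And>z. z \<in> \<H> ==> F (z + 1) = F z" "\<And>z. z \<in> \<H> ==> fricke k F (z + 1) = fricke k F z"
 shows "F \<in> S_half k"
proof -
 \<comment> \<open>The substitution \<open>z \<mapsto> z / (4 n z + 1)\<close> is the translation by
   \<open>-n\<close> conjugated with the Fricke involution, so it is covered by the periodicity of
   \<open>fricke k F\<close>.\<close>
 have V: "F (z / (4 * of_int n * z + 1)) = csqrt (4 * of_int n * z + 1) ^ (2 * k + 1) * F z"
  if z: "z \<in> \<H>" for n z
 proof -
  define u where "u = z / (4 * of_int n * z + 1)"
  have u: "u \<in> \<H>" using moebius_in_H[of "mat2 1 0 (4 * n) 1" z] z by (simp add: moebius_mat2 u_def)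
  note nz = H_nonzero[OF z] H_nonzero[OF u]
  have den: "4 * of_int n * z + 1 \<noteq> 0" using nz(2) by (auto simp: u_def)
  have zu: "-1 / (4 * u) = -1 / (4 * z) + of_int (- n)" using nz den by (simp add: u_def field_simps)
  have FF: "F w = fricke k (fricke k F) w" for w using fricke_fricke[of F k] F by (simp add: cuspidal_def)
  have "F u = inverse (csqrt (-2 * \<i> * u) ^ (2 * k + 1)) * fricke k F (-1 / (4 * u))"
   using u by (subst FF) (simp only: fricke_def[of k "fricke k F"] if_True)
  also have "fricke k F (-1 / (4 * u)) = fricke k F (-1 / (4 * z))"
   unfolding zu by (rule periodic_int[of "fricke k F", OF per(2) H_fricke[OF z]])
  also have "... = csqrt (-2 * \<i> * z) ^ (2 * k + 1) * F z"
   using fricke_apply[OF z, of "fricke k F" k] by (simp only: FF[symmetric])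
  also have "inverse (csqrt (-2 * \<i> * u) ^ (2 * k + 1)) * (csqrt (-2 * \<i> * z) ^ (2 * k + 1) * F z) =
   (csqrt (-2 * \<i> * z) / csqrt (-2 * \<i> * u)) ^ (2 * k + 1) * F z"
   by (simp only: divide_inverse power_mult_distrib power_inverse mult_ac)
  also have "csqrt (-2 * \<i> * z) / csqrt (-2 * \<i> * u) = csqrt ((-2 * \<i> * z) / (-2 * \<i> * u))"
   using csqrt_divide[OF Re_rotate[OF z] Re_rotate[OF u]] by simp
  also have "(-2 * \<i> * z) / (-2 * \<i> * u) = 4 * of_int n * z + 1" using nz den by (simp add: u_def)
  finally show ?thesis by (simp add: u_def)
 qed
 have "\<forall>z\<in>\<H>. F (moebius \<gamma> z) = theta_factor \<gamma> z ^ (2 * k + 1) * F z" if "\<gamma> \<in> Gamma0 4" for \<gamma>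
 proof (rule Gamma0_induct[OF _ _ that])
  show "\<forall>z\<in>\<H>. F (moebius (mat2 1 0 0 1) z) = theta_factor (mat2 1 0 0 1) z ^ (2 * k + 1) * F z" by simp
  have "theta_factor (mat2 (-1) 0 0 (-1)) z = 1" for z
   by (simp add: theta_factor_def theta_eps_def shimura_symbol_def)
  thus "\<forall>z\<in>\<H>. F (moebius (mat2 (-1) 0 0 (-1)) z) = theta_factor (mat2 (-1) 0 0 (-1)) z ^ (2 * k + 1) * F z"
   by simp
 next
  fix A n assume A: "A \<in> Gamma0 4" "\<forall>z\<in>\<H>. F (moebius A z) = theta_factor A z ^ (2 * k + 1) * F z"
  show "\<forall>z\<in>\<H>. F (moebius (A ** mat2 1 n 0 1) z) = theta_factor (A ** mat2 1 n 0 1) z ^ (2 * k + 1) * F z"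
  proof
   fix z assume z: "z \<in> \<H>"
   have zn: "moebius (mat2 1 n 0 1) z = z + of_int n" by (simp add: moebius_mat2)
   hence "z + of_int n \<in> \<H>" using z by (simp add: H_iff)
   thus "F (moebius (A ** mat2 1 n 0 1) z) = theta_factor (A ** mat2 1 n 0 1) z ^ (2 * k + 1) * F z"
    using theta_factor_mult[OF f A(1) Gamma0_T z, of n] A z periodic_int[of F, OF per(1) z, of n]
    by (simp add: moebius_mult zn)
  qed
 next
  fix A n assume A: "A \<in> Gamma0 4" "\<forall>z\<in>\<H>. F (moebius A z) = theta_factor A z ^ (2 * k + 1) * F z"
  let ?V = "mat2 1 0 (int 4 * n) 1"
  have V4: "?V \<in> Gamma0 4" by (simp add: Gamma0_iff)
  show "\<forall>z\<in>\<H>. F (moebius (A ** ?V) z) = theta_factor (A ** ?V) z ^ (2 * k + 1) * F z"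
  proof
   fix z assume z: "z \<in> \<H>"
   have "F (moebius (A ** ?V) z) = F (moebius A (moebius ?V z))" using A z by (simp add: moebius_mult)
   also have "... = theta_factor A (moebius ?V z) ^ (2 * k + 1) * F (moebius ?V z)"
    using A(2) z by (simp del: power_Suc)
   also have "F (moebius ?V z) = theta_factor ?V z ^ (2 * k + 1) * F z"
    using V[OF z, of n] by (simp add: moebius_mat2)
   finally show "F (moebius (A ** ?V) z) = theta_factor (A ** ?V) z ^ (2 * k + 1) * F z"
    unfolding theta_factor_mult[OF f A(1) V4 z] by (simp only: mult.assoc)
  qed
 qed auto
 thus ?thesis using F by (simp add: S_half_iff cuspidal_def)
qed

text \<open>\<open>fricke k (fricke k f) = f\<close> is periodic, and the periodicity of
  \<open>fricke k f\<close> is the transformation law of \<open>f\<close> under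
  \<open>z \<mapsto> z / (1 - 4 z)\<close>. The zero form is treated apart because the criterion
  asks for a point where \<open>f\<close> does not vanish.\<close>

lemma fricke_in_S_half:
 assumes f: "f \<in> S_half k"
 shows "fricke k f \<in> S_half k"
proof (cases "\<exists>z1. f z1 \<noteq> 0")
 case False
 hence "f = (\<lambda>_. 0)" by auto
 hence "fricke k f = f" by (auto simp: fricke_def)
 thus ?thesis using f by simp
next
 case True
 then obtain z1 where z1: "f z1 \<noteq> 0" by blast
 have zero: "\<And>z. z \<notin> \<H> ==> f z = 0" using f by (simp add: S_half_iff)
 show ?thesis
 proof (rule S_half_criterion[OF f z1 cuspidal_fricke[OF S_half_cuspidal[OF f]]])
  fix z assume z: "z \<in> \<H>"
  show "fricke k (fricke k f) (z + 1) = fricke k (fricke k f) z"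
   using fricke_fricke[of f k, OF zero] S_half_periodic[OF f, of z 1] by simp
  define u where "u = -1 / (4 * z)"
  have u: "u \<in> \<H>" using H_fricke[OF z] by (simp add: u_def)
  have z1: "z + 1 \<in> \<H>" using z by (simp add: H_iff)
  note nz = H_nonzero[OF z] H_nonzero[OF z1]
  have "4 * of_int (-1) * u + 1 = (z + 1) / z" using nz by (simp add: u_def field_simps)
  moreover have "u / (4 * of_int (-1) * u + 1) = -1 / (4 * (z + 1))"
   unfolding calculation using nz by (simp add: u_def)
  moreover have "(z + 1) / z = (-2 * \<i> * (z + 1)) / (-2 * \<i> * z)" using nz by (simp add: field_simps)
  hence "csqrt ((z + 1) / z) = csqrt (-2 * \<i> * (z + 1)) / csqrt (-2 * \<i> * z)"
   by (simp only: csqrt_divide[OF Re_rotate[OF z1] Re_rotate[OF z]])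
  ultimately have "f (-1 / (4 * (z + 1))) = (csqrt (-2 * \<i> * (z + 1)) / csqrt (-2 * \<i> * z)) ^ (2 * k + 1) * f u"
   using S_half_V[OF f u, of "-1"] by metis
  thus "fricke k f (z + 1) = fricke k f z"
  proof -
   let ?v = "csqrt (-2 * \<i> * z) ^ (2 * k + 1)" and ?v1 = "csqrt (-2 * \<i> * (z + 1)) ^ (2 * k + 1)"
   have "?v1 * fricke k f (z + 1) = ?v1 / ?v * (?v * fricke k f z)"
    using `f (-1 / (4 * (z + 1))) = _` unfolding u_def power_divide
    by (simp only: fricke_apply[OF z, of f k] fricke_apply[OF z1, of f k])
   moreover have "a = b" if "x * a = x / y * (y * b)" "x \<noteq> 0" "y \<noteq> 0" for a b x y :: complex
    using that by simp
   ultimately show ?thesis using csqrt_power_nonzero[OF z, of "2 * k + 1"] csqrt_power_nonzero[OF z1, of "2 * k + 1"]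
    by blast
  qed
 qed
qed

subsection \<open>Kohnen's plus space\<close>

text \<open>The involution with eigenvalue 1 on the exponents of the plus condition and -1 on the
  others, written through the translations by a quarter, whose multipliers are \<open>i^n\<close>
  and \<open>(-i)^n\<close>.\<close>

definition plus_inv :: "nat => cfun => cfun"
 where "plus_inv k f z =
  (1 - (-1) ^ k * \<i>) / 2 * f (z + 1 / 4) + (1 + (-1) ^ k * \<i>) / 2 * f (z - 1 / 4)"

definition plus_cong :: "nat => nat => bool"
 where "plus_cong k n \<longleftrightarrow> [(-1) ^ k * int n = 0] (mod 4) \<or> [(-1) ^ k * int n = 1] (mod 4)"

lemma i_power_mod_4: "\<i> ^ n = \<i> ^ (n mod 4)" "(-\<i>) ^ n = (-\<i>) ^ (n mod 4)"
proof -
 have *: "x ^ n = x ^ (n mod 4)" if "x ^ 4 = 1" for x :: complex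
  using that by (metis mod_mult_div_eq mult_1_right power_add power_mult power_one)
 show "\<i> ^ n = \<i> ^ (n mod 4)" "(-\<i>) ^ n = (-\<i>) ^ (n mod 4)" by (rule *; simp)+
qed

lemma plus_multiplier:
 "(1 - (-1) ^ k * \<i>) / 2 * \<i> ^ n + (1 + (-1) ^ k * \<i>) / 2 * (-\<i>) ^ n = (if plus_cong k n then 1 else -1)"
proof -
 have r: "n mod 4 = 0 \<or> n mod 4 = 1 \<or> n mod 4 = 2 \<or> n mod 4 = 3" by presburger
 have c: "plus_cong k n \<longleftrightarrow> (if even k then n mod 4 = 0 \<or> n mod 4 = 1 else n mod 4 = 0 \<or> n mod 4 = 3)"
 proof (cases "even k")
  case True
  have "int n mod 4 = 0 \<longleftrightarrow> n mod 4 = 0" "int n mod 4 = 1 \<longleftrightarrow> n mod 4 = 1" by (simp_all flip: zmod_int[of n 4, simplified])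
  thus ?thesis using True by (simp add: plus_cong_def cong_def)
 next
  case False
  have "- int n mod 4 = 0 \<longleftrightarrow> n mod 4 = 0" "- int n mod 4 = 1 \<longleftrightarrow> n mod 4 = 3"
   using zmod_int[of n 4] by (auto simp: zmod_zminus1_eq_if)
  thus ?thesis using False by (simp add: plus_cong_def cong_def)
 qed
 show ?thesis unfolding c i_power_mod_4[of n] using r
  by (cases "even k") (auto simp: power2_eq_square power3_eq_cube field_simps)
qed

lemma exp_quarter: "exp (\<omega> * of_nat n * of_real (1 / 4)) = \<i> ^ n"
 "exp (\<omega> * of_nat n * of_real (- 1 / 4)) = (-\<i>) ^ n"
proof -
 have "exp (of_nat n * (\<i> * of_real (pi / 2))) = \<i> ^ n"
  unfolding exp_of_nat_mult cis_conv_exp[symmetric] by simp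
 thus "exp (\<omega> * of_nat n * of_real (1 / 4)) = \<i> ^ n" by (simp add: field_simps)
 have "exp (of_nat n * (\<i> * of_real (- (pi / 2)))) = (-\<i>) ^ n"
  unfolding exp_of_nat_mult cis_conv_exp[symmetric] by simp
 thus "exp (\<omega> * of_nat n * of_real (- 1 / 4)) = (-\<i>) ^ n" by (simp add: field_simps)
qed

lemma has_qexp_plus_inv:
 assumes "has_qexp f a"
 shows "has_qexp (plus_inv k f) (\<lambda>n. (if plus_cong k n then 1 else -1) * a n)"
proof -
 let ?\<alpha> = "(1 - (-1) ^ k * \<i>) / 2" and ?\<beta> = "(1 + (-1) ^ k * \<i>) / 2"
 have "has_qexp (\<lambda>z. ?\<alpha> * f (z + of_real (1 / 4)) + ?\<beta> * f (z + of_real (- 1 / 4)))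
  (\<lambda>n. ?\<alpha> * (a n * \<i> ^ n) + ?\<beta> * (a n * (-\<i>) ^ n))"
  unfolding exp_quarter[symmetric] by (intro has_qexp_add has_qexp_cmult has_qexp_shift assms)
 also have "(\<lambda>z. ?\<alpha> * f (z + of_real (1 / 4)) + ?\<beta> * f (z + of_real (- 1 / 4))) = plus_inv k f"
  by (simp add: plus_inv_def fun_eq_iff)
 also have "(\<lambda>n. ?\<alpha> * (a n * \<i> ^ n) + ?\<beta> * (a n * (-\<i>) ^ n)) = (\<lambda>n. (if plus_cong k n then 1 else -1) * a n)"
  unfolding plus_multiplier[symmetric] by (simp add: algebra_simps)
 finally show ?thesis .
qed

lemma S_plus_iff: "f \<in> S_plus k \<longleftrightarrow> f \<in> S_half k \<and> plus_inv k f = f"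
proof (cases "f \<in> S_half k")
 case True
 note q = S_half_has_qexp(1)[OF True]
 have "plus_inv k f = f \<longleftrightarrow> (\<lambda>n. (if plus_cong k n then 1 else -1) * qcoeff f n) = qcoeff f"
  using has_qexp_plus_inv[OF q, of k] q has_qexp_unique has_qexp_unique_fun by metis
 also have "... \<longleftrightarrow> (\<forall>n. \<not> plus_cong k n \<longrightarrow> qcoeff f n = 0)" by (auto simp: fun_eq_iff)
 finally show ?thesis using True by (simp add: S_plus_def plus_cong_def)
qed (simp add: S_plus_def)

text \<open>Equal to the quadratic symbol \<open>(2 / (2 k + 1))\<close>, the sign of
  \<open>W4\<close>.\<close>

definition plus_sign :: "nat => complex"
 where "plus_sign k = (-1) ^ ((k + 1) div 2)"

lemma plus_sign_power2 [simp]: "plus_sign k * plus_sign k = 1"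
 by (simp add: plus_sign_def flip: power_mult_distrib)

lemma one_plus_minus_i_power:
 "(1 - \<i>) ^ (2 * k + 1) = 2 ^ k * plus_sign k * (1 - (-1) ^ k * \<i>)"
 "(1 + \<i>) ^ (2 * k + 1) = 2 ^ k * plus_sign k * (1 + (-1) ^ k * \<i>)"
proof -
 have sq: "(1 - \<i>)\<^sup>2 = -2 * \<i>" "(1 + \<i>)\<^sup>2 = 2 * \<i>" by (simp_all add: power2_eq_square algebra_simps)
 have 4: "(-2 * \<i>)\<^sup>2 = -4" "(2 * \<i>)\<^sup>2 = -4" by (simp_all add: power2_eq_square)
 consider m where "k = 2 * m" | m where "k = 2 * m + 1" by (metis oddE evenE)
 hence "(1 - \<i>) ^ (2 * k + 1) = 2 ^ k * plus_sign k * (1 - (-1) ^ k * \<i>) \<and>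
  (1 + \<i>) ^ (2 * k + 1) = 2 ^ k * plus_sign k * (1 + (-1) ^ k * \<i>)"
 proof cases
  case 1
  have "(2::complex) ^ k * (-1) ^ m = (-4) ^ m" unfolding 1 power_mult by (simp flip: power_mult_distrib)
  moreover have "plus_sign k = (-1) ^ m" by (simp add: plus_sign_def 1)
  ultimately show ?thesis unfolding power_add power_mult sq by (simp only: 1 power_mult 4) (simp add: mult_ac)
 next
  case 2
  have "(2::complex) ^ k * (-1) ^ (m + 1) = -2 * (-4) ^ m" unfolding 2 power_mult power_add by (simp flip: power_mult_distrib)
  moreover have "plus_sign k = (-1) ^ (m + 1)" by (simp add: plus_sign_def 2)
  ultimately have e: "2 ^ k * plus_sign k = -2 * (-4) ^ m" by simp
  show ?thesis unfolding power_add[of _ "2 * k"] power_mult[of _ 2] sq e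
   by (simp only: 2 power_add power_mult 4) (simp add: algebra_simps)
 qed
 thus "(1 - \<i>) ^ (2 * k + 1) = 2 ^ k * plus_sign k * (1 - (-1) ^ k * \<i>)"
  "(1 + \<i>) ^ (2 * k + 1) = 2 ^ k * plus_sign k * (1 + (-1) ^ k * \<i>)" by auto
qed

lemma csqrt_rotate_minus:
 assumes "z \<in> \<H>"
 shows "csqrt (-4 * z) = (1 - \<i>) * csqrt (-2 * \<i> * z)"
proof (rule csqrt_unique)
 let ?b = "csqrt (-2 * \<i> * z)"
 have "((1 - \<i>) * ?b)\<^sup>2 = (1 - \<i>)\<^sup>2 * (-2 * \<i> * z)" by (simp add: power_mult_distrib)
 also have "(1 - \<i>)\<^sup>2 = -2 * \<i>" by (simp add: power2_eq_square algebra_simps)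
 finally show "((1 - \<i>) * ?b)\<^sup>2 = -4 * z" by simp
 show "0 < Re ((1 - \<i>) * ?b) \<or> Re ((1 - \<i>) * ?b) = 0 \<and> 0 \<le> Im ((1 - \<i>) * ?b)"
  using Re_csqrt_gt_abs_Im[OF Re_rotate[OF assms]] by auto
qed

lemma quarter_in_H: "z + 1 / 4 \<in> \<H> \<longleftrightarrow> z \<in> \<H>" "z - 1 / 4 \<in> \<H> \<longleftrightarrow> z \<in> \<H>" by (simp_all add: H_iff)

text \<open>The two arguments are the images of \<open>z - 1/4\<close> and \<open>z + 1/4\<close>
  under the maps \<open>u / (4 u + 1)\<close> and \<open>u / (1 - 4 u)\<close>; the resulting roots
  \<open>csqrt (4 * z)\<close> and \<open>csqrt (-4 * z)\<close> differ from the Fricke root by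
  \<open>1 + i\<close> and \<open>1 - i\<close>.\<close>

lemma S_half_quarter:
 assumes f: "f \<in> S_half k" and z: "z \<in> \<H>"
 shows "f ((4 * z - 1) / (16 * z)) =
   2 ^ k * plus_sign k * (1 + (-1) ^ k * \<i>) * csqrt (-2 * \<i> * z) ^ (2 * k + 1) * f (z - 1 / 4)"
  and "f ((- 4 * z - 1) / (16 * z)) =
   2 ^ k * plus_sign k * (1 - (-1) ^ k * \<i>) * csqrt (-2 * \<i> * z) ^ (2 * k + 1) * f (z + 1 / 4)"
proof -
 note nz = H_nonzero[OF z]
 have "(z - 1 / 4) / (4 * of_int 1 * (z - 1 / 4) + 1) = (4 * z - 1) / (16 * z)"
  using nz by (simp add: field_simps)
 hence "f ((4 * z - 1) / (16 * z)) = csqrt (4 * z) ^ (2 * k + 1) * f (z - 1 / 4)"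
  using S_half_V[OF f, of "z - 1 / 4" 1] z by (simp add: quarter_in_H)
 thus "f ((4 * z - 1) / (16 * z)) =
   2 ^ k * plus_sign k * (1 + (-1) ^ k * \<i>) * csqrt (-2 * \<i> * z) ^ (2 * k + 1) * f (z - 1 / 4)"
  by (simp only: csqrt_rotate[OF z] power_mult_distrib[of "1 + \<i>"] one_plus_minus_i_power)
 have "(z + 1 / 4) / (4 * of_int (-1) * (z + 1 / 4) + 1) = (- 4 * z - 1) / (16 * z)"
  using nz by (simp add: field_simps)
 hence "f ((- 4 * z - 1) / (16 * z)) = csqrt (- 4 * z) ^ (2 * k + 1) * f (z + 1 / 4)"
  using S_half_V[OF f, of "z + 1 / 4" "-1"] z by (simp add: quarter_in_H)
 thus "f ((- 4 * z - 1) / (16 * z)) =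
   2 ^ k * plus_sign k * (1 - (-1) ^ k * \<i>) * csqrt (-2 * \<i> * z) ^ (2 * k + 1) * f (z + 1 / 4)"
  by (simp only: csqrt_rotate_minus[OF z] power_mult_distrib[of "1 - \<i>"] one_plus_minus_i_power)
qed

lemma fricke_4:
 assumes "z \<in> \<H>"
 shows "f (-1 / (16 * z)) = 2 * 2 ^ (2 * k) * csqrt (-2 * \<i> * z) ^ (2 * k + 1) * fricke k f (4 * z)"
proof -
 have z4: "4 * z \<in> \<H>" using assms by (simp add: H_iff)
 have "csqrt (-2 * \<i> * (4 * z)) = 2 * csqrt (-2 * \<i> * z)"
  using csqrt_of_real_mult[of 4 "-2 * \<i> * z"] by (simp add: mult_ac)
 hence "csqrt (-2 * \<i> * (4 * z)) ^ (2 * k + 1) = 2 * 2 ^ (2 * k) * csqrt (-2 * \<i> * z) ^ (2 * k + 1)"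
  by (simp add: power_mult_distrib)
 with fricke_apply[OF z4, of f k] show ?thesis by (simp add: mult.assoc[symmetric])
qed

text \<open>On \<open>S\<^sub>k\<^sub>+\<^sub>1\<^sub>/\<^sub>2(\<Gamma>\<^sub>0(4))\<close> this operator has the eigenvalues \<open>2\<^sup>k\<close> and \<open>-2\<^sup>k\<^sup>-\<^sup>1\<close>, and the plus
  space is the eigenspace of the former.\<close>
definition kohnen_op :: "nat => cfun => cfun"
 where "kohnen_op k f z = plus_sign k * fricke k (U_op 4 f) z"

text \<open>The contribution of the translate \<open>j = 2\<close> of \<open>U_4\<close> after the
  inversion: \<open>(8 z - 1) / (16 z) = 1/2 - 1/(16 z)\<close>.\<close>

definition half_part :: "nat => cfun => cfun"
 where "half_part k f z = inverse (csqrt (-2 * \<i> * z) ^ (2 * k + 1)) * f ((8 * z - 1) / (16 * z))"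

text \<open>The inversion sends the translates \<open>j = 0, 1, 2, 3\<close> of \<open>U_4\<close>
  to the points \<open>-1/(16 z) + j/4\<close>. The translate 0 gives the dilated Fricke image, 1
  and 3 combine to \<open>plus_inv\<close>, and 2 is kept as \<open>half_part\<close>.\<close>

lemma kohnen_op_eq:
 assumes f: "f \<in> S_half k" and z: "z \<in> \<H>"
 shows "kohnen_op k f z = 2 ^ k / 2 * plus_inv k f z
  + plus_sign k * 2 ^ (2 * k) / 2 * fricke k f (4 * z) + plus_sign k / 4 * half_part k f z"
proof -
 let ?c = "csqrt (-2 * \<i> * z) ^ (2 * k + 1)"
 note nz = H_nonzero[OF z] csqrt_power_nonzero[OF z, of "2 * k + 1"]
 let ?u = "-1 / (4 * z)"
 have "U_op 4 f ?u = (\<Sum>j<4. f ((?u + of_nat j) / 4)) / 4"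
  using U_op_eq[of 4, OF _ S_half_has_qexp(1)[OF f]] by simp
 also have "(\<Sum>j<4. f ((?u + of_nat j) / 4)) = f (?u / 4) + f ((?u + 1) / 4) + f ((?u + 2) / 4) + f ((?u + 3) / 4)"
  by (simp add: eval_nat_numeral)
 also have "?u / 4 = -1 / (16 * z)" by simp
 also have "(?u + 1) / 4 = (4 * z - 1) / (16 * z)" using nz(1) by (simp add: field_simps)
 also have "(?u + 2) / 4 = (8 * z - 1) / (16 * z)" using nz(1) by (simp add: field_simps)
 also have "(?u + 3) / 4 = (- 4 * z - 1) / (16 * z) + of_int 1" using nz(1) by (simp add: field_simps)
 also note S_half_periodic[OF f, of "(- 4 * z - 1) / (16 * z)" 1]
 also note S_half_quarter(1)[OF f z] 
 also note S_half_quarter(2)[OF f z]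
 also note fricke_4[OF z, of f k]
 also have "f ((8 * z - 1) / (16 * z)) = ?c * half_part k f z"
  using nz(2) by (simp add: half_part_def del: power_Suc)
 finally have U: "U_op 4 f ?u = ?c * ((2 * 2 ^ (2 * k) * fricke k f (4 * z)
   + 2 ^ k * plus_sign k * (1 + (-1) ^ k * \<i>) * f (z - 1 / 4) + half_part k f z
   + 2 ^ k * plus_sign k * (1 - (-1) ^ k * \<i>) * f (z + 1 / 4)) / 4)"
  by (simp add: algebra_simps del: power_Suc)
 have X: "fricke k (U_op 4 f) z = (2 * 2 ^ (2 * k) * fricke k f (4 * z)
   + 2 ^ k * plus_sign k * (1 + (-1) ^ k * \<i>) * f (z - 1 / 4) + half_part k f z
   + 2 ^ k * plus_sign k * (1 - (-1) ^ k * \<i>) * f (z + 1 / 4)) / 4"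
  using U fricke_apply[OF z, of "U_op 4 f" k] nz(2) by (simp del: power_Suc)
 have "kohnen_op k f z = 2 ^ k / 2 * (plus_sign k * plus_sign k) * plus_inv k f z
  + plus_sign k * 2 ^ (2 * k) / 2 * fricke k f (4 * z) + plus_sign k / 4 * half_part k f z"
  unfolding kohnen_op_def plus_inv_def X by (simp add: algebra_simps add_divide_distrib diff_divide_distrib del: plus_sign_power2)
 thus ?thesis by simp
qed

text \<open>The step by a quarter is induced by \<open>mat2 (-1) 1 (-4) 3\<close> of
  \<open>Gamma0 4\<close>, so \<open>half_part\<close> picks up only a constant, determined by
  \<open>theta_eps 3 = i\<close> and the symbol \<open>(-4/3) = -1\<close>.\<close>

lemma half_part_quarter:
 assumes f: "f \<in> S_half k" and z: "z \<in> \<H>"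
 shows "half_part k f (z + 1 / 4) = (-1) ^ k * \<i> * half_part k f z"
proof -
 define u where "u = (8 * z - 1) / (16 * z)"
 have z': "z + 1 / 4 \<in> \<H>" using z by (simp add: quarter_in_H)
 note nz = H_nonzero[OF z] H_nonzero[OF z']
 have u: "u \<in> \<H>" using moebius_in_H[of "mat2 8 (-1) 16 0" z] z by (simp add: moebius_mat2 u_def)
 let ?\<gamma> = "mat2 (-1) 1 (-4) 3"
 have \<gamma>: "?\<gamma> \<in> Gamma0 4" by (simp add: Gamma0_iff)
 have den: "-4 * u + 3 = (-2 * \<i> * (z + 1 / 4)) / (-2 * \<i> * z)" using nz by (simp add: u_def field_simps)
 have sym: "shimura_symbol (-4) 3 = -1"
 proof -
  have "Legendre (-4) 3 = -1"
  proof -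
   have "Legendre (-4) 3 = Legendre (-1) 3" by (rule Legendre_cong) (simp add: cong_def)
   thus ?thesis using Legendre_minus_1[of 3] by simp
  qed
  thus ?thesis using shimura_symbol_prime[of 3 "-4"] by simp
 qed
 have "theta_factor ?\<gamma> u = \<i> * csqrt (-4 * u + 3)" by (simp add: theta_factor_def sym theta_eps_def)
 also have "... = \<i> * (csqrt (-2 * \<i> * (z + 1 / 4)) / csqrt (-2 * \<i> * z))"
  unfolding den csqrt_divide[OF Re_rotate[OF z'] Re_rotate[OF z]] ..
 finally have th: "theta_factor ?\<gamma> u = \<i> * (csqrt (-2 * \<i> * (z + 1 / 4)) / csqrt (-2 * \<i> * z))" .
 have \<gamma>u: "moebius ?\<gamma> u = (8 * (z + 1 / 4) - 1) / (16 * (z + 1 / 4))"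
 proof -
  have "moebius ?\<gamma> u = (1 - u) / (-4 * u + 3)" by (simp add: moebius_mat2)
  also have "1 - u = (8 * z + 1) / (16 * z)" using nz by (simp add: u_def field_simps)
  also have "-4 * u + 3 = (z + 1 / 4) / z" using nz by (simp add: u_def field_simps)
  also have "(8 * z + 1) / (16 * z) / ((z + 1 / 4) / z) = (8 * z + 1) / (16 * (z + 1 / 4))"
   using nz(1) by simp
  also have "8 * z + 1 = 8 * (z + 1 / 4) - 1" by simp
  finally show ?thesis .
 qed
 have cancel: "x * (inverse x * a) = x * (t * (inverse y * b))" if "x \<noteq> 0" "a = t * (x / y) * b" for a b t x y :: complex
  using that by (simp add: divide_inverse)
 have "f (moebius ?\<gamma> u) = \<i> ^ (2 * k + 1) * (csqrt (-2 * \<i> * (z + 1 / 4)) ^ (2 * k + 1) / csqrt (-2 * \<i> * z) ^ (2 * k + 1)) * f u"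
  using S_half_moebius[OF f \<gamma> u] unfolding th power_mult_distrib power_divide .
 hence "csqrt (-2 * \<i> * (z + 1 / 4)) ^ (2 * k + 1) * half_part k f (z + 1 / 4) =
   csqrt (-2 * \<i> * (z + 1 / 4)) ^ (2 * k + 1) * (\<i> ^ (2 * k + 1) * half_part k f z)"
  unfolding half_part_def \<gamma>u[symmetric] u_def[symmetric] by (rule cancel[OF csqrt_power_nonzero[OF z']])
 moreover have "\<i> ^ (2 * k + 1) = (-1) ^ k * \<i>" by (simp add: power_mult)
 ultimately show ?thesis using csqrt_power_nonzero[OF z', of "2 * k + 1"] by (simp del: power_Suc)
qed

lemma plus_inv_fixed:
 assumes "z - 1 / 4 \<in> X" "z \<in> X" "\<And>z. z \<in> X ==> F (z + 1 / 4) = F z"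
 shows "plus_inv k F z = F z"
 using assms(3)[OF assms(1)] assms(3)[OF assms(2)] by (simp add: plus_inv_def field_simps)

text \<open>\<open>plus_inv\<close> is an involution on functions of period 1 and fixes the other
  two summands of \<open>kohnen_op_eq\<close>, hence it fixes \<open>K f + 2^(k-1) f\<close>. The
  computation is pointwise and does not ask whether \<open>plus_inv k f\<close> lies in
  \<open>S_half\<close>.\<close>

lemma kohnen_op_plus:
 assumes f: "f \<in> S_half k" and S: "kohnen_op k f \<in> S_half k"
 shows "(\<lambda>z. kohnen_op k f z + 2 ^ k / 2 * f z) \<in> S_plus k"
proof -
 let ?e = "(-1) ^ k :: complex" and ?P = "plus_inv k"
 let ?r = "half_part k f"
 have e: "?e * ?e = 1" by (simp flip: power_mult_distrib)
 have "plus_inv k (\<lambda>z. kohnen_op k f z + 2 ^ k / 2 * f z) z = kohnen_op k f z + 2 ^ k / 2 * f z" for z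
 proof (cases "z \<in> \<H>")
  case False
  hence "z + 1 / 4 \<notin> \<H>" "z - 1 / 4 \<notin> \<H>" by (simp_all add: quarter_in_H)
  thus ?thesis using False f S by (simp add: plus_inv_def S_half_iff)
 next
  case True
  have z: "z + 1 / 4 \<in> \<H>" "z - 1 / 4 \<in> \<H>" using True by (simp_all add: quarter_in_H)
  have r: "?r (z + 1 / 4) = ?e * \<i> * ?r z" "?r z = ?e * \<i> * ?r (z - 1 / 4)"
   using half_part_quarter[OF f True] half_part_quarter[OF f z(2)] by simp_all
  have r2: "?r (z - 1 / 4) = - ?e * \<i> * ?r z"
  proof -
   have "?e * \<i> * ?r z = (?e * ?e) * (\<i> * \<i>) * ?r (z - 1 / 4)" unfolding r(2) by (simp only: mult_ac)
   thus ?thesis unfolding e by simp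
  qed
  have Pr: "?P ?r z = ?r z"
  proof -
   have "?P ?r z = (1 - ?e * \<i>) / 2 * (?e * \<i> * ?r z) + (1 + ?e * \<i>) / 2 * (- ?e * \<i> * ?r z)"
    unfolding plus_inv_def r(1) r2 ..
   also have "... = (?e * ?e) * ?r z" by (simp add: field_simps)
   finally show ?thesis unfolding e by simp
  qed
  have per: "fricke k f (4 * (w + 1 / 4)) = fricke k f (4 * w)" for w
   using S_half_periodic[OF fricke_in_S_half[OF f], of "4 * w" 1] by (simp add: algebra_simps)
  have Ph: "?P (\<lambda>z. fricke k f (4 * z)) z = fricke k f (4 * z)"
   by (rule plus_inv_fixed[where X = UNIV]) (simp_all only: UNIV_I per)
  have PP: "?P (?P f) z = f z"
  proof -
   have "z - 1 / 2 + of_int 1 = z + 1 / 2" by (simp add: field_simps)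
   hence *: "f (z + 1 / 2) = f (z - 1 / 2)" using S_half_periodic[OF f, of "z - 1 / 2" 1] by metis
   have square: "((1 - e * \<i>) / 2)\<^sup>2 * x + 2 * ((1 - e * \<i>) / 2 * ((1 + e * \<i>) / 2)) * y + ((1 + e * \<i>) / 2)\<^sup>2 * x =
     (1 - e * e) / 2 * x + (1 + e * e) / 2 * y" for e x y :: complex
    by (simp add: power2_eq_square field_simps)
   have "?P (?P f) z = ((1 - ?e * \<i>) / 2)\<^sup>2 * f (z + 1 / 2) + 2 * ((1 - ?e * \<i>) / 2 * ((1 + ?e * \<i>) / 2)) * f z +
     ((1 + ?e * \<i>) / 2)\<^sup>2 * f (z - 1 / 2)"
   proof -
    have "z + 1 / 4 + 1 / 4 = z + 1 / 2" "z + 1 / 4 - 1 / 4 = z" "z - 1 / 4 + 1 / 4 = z" "z - 1 / 4 - 1 / 4 = z - 1 / 2"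
     by (simp_all add: field_simps)
    moreover have "a * (a * x + b * y) + b * (a * y + b * u) = a\<^sup>2 * x + 2 * (a * b) * y + b\<^sup>2 * u" for a b x y u :: complex
     by (simp add: power2_eq_square algebra_simps)
    ultimately show ?thesis by (simp only: plus_inv_def)
   qed
   also have "... = (1 - ?e * ?e) / 2 * f (z - 1 / 2) + (1 + ?e * ?e) / 2 * f z" unfolding * by (rule square)
   also have "... = f z" unfolding e by simp
   finally show ?thesis .
  qed
  have sum: "kohnen_op k f w + 2 ^ k / 2 * f w = 2 ^ k / 2 * ?P f w + 2 ^ k / 2 * f w
   + plus_sign k * 2 ^ (2 * k) / 2 * fricke k f (4 * w) + plus_sign k / 4 * ?r w" if "w \<in> \<H>" for w
   by (simp add: kohnen_op_eq[OF f that])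
  have "plus_inv k (\<lambda>z. kohnen_op k f z + 2 ^ k / 2 * f z) z =
    2 ^ k / 2 * ?P (?P f) z + 2 ^ k / 2 * ?P f z
   + plus_sign k * 2 ^ (2 * k) / 2 * ?P (\<lambda>z. fricke k f (4 * z)) z + plus_sign k / 4 * ?P ?r z"
   unfolding plus_inv_def[of k "\<lambda>z. kohnen_op k f z + 2 ^ k / 2 * f z"]
    plus_inv_def[of k "?P f"] plus_inv_def[of k "\<lambda>z. fricke k f (4 * z)"]
    plus_inv_def[of k ?r] plus_inv_def[of k f z] sum[OF z(1)] sum[OF z(2)]
   by (simp only: algebra_simps)
  thus ?thesis unfolding Pr Ph PP sum[OF True] by simp
 qed
 hence "?P (\<lambda>z. kohnen_op k f z + 2 ^ k / 2 * f z) = (\<lambda>z. kohnen_op k f z + 2 ^ k / 2 * f z)" by blast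
 moreover have "(\<lambda>z. kohnen_op k f z + 2 ^ k / 2 * f z) \<in> S_half k"
  using fun_vs.subspace_add[OF subspace_S_half S fun_vs.subspace_scale[OF subspace_S_half f, of "2 ^ k / 2"]]
  by (simp add: plus_fun_def)
 ultimately show ?thesis by (simp add: S_plus_iff)
qed

lemma cuspidal_affine:
 assumes "cuspidal \<kappa> f" "a > 0" "d > 0"
 shows "cuspidal \<kappa> (\<lambda>z. f ((of_real a * z + of_real b) / of_real d))"
proof -
 have H: "(of_real a * z + of_real b) / of_real d \<in> \<H> \<longleftrightarrow> z \<in> \<H>" for z
  using assms by (simp add: H_iff zero_less_divide_iff zero_less_mult_iff)
 have "(f \<circ> (\<lambda>z. (of_real a * z + of_real b) / of_real d)) holomorphic_on \<H>"
  using assms H by (intro holomorphic_on_compose_gen[where t = \<H>] holomorphic_intros) (auto simp: cuspidal_def)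
 thus ?thesis using assms H by (simp add: cuspidal_def o_def growth_bounded_affine)
qed

lemma cuspidal_U_op:
 assumes "cuspidal \<kappa> f" "has_qexp f a" "m > 0"
 shows "cuspidal \<kappa> (U_op m f)"
proof -
 have "cuspidal \<kappa> (\<lambda>z. f ((z + of_nat j) / of_nat m))" for j
  using cuspidal_affine[OF assms(1), of 1 "real m" "real j"] assms(3) by simp
 hence "cuspidal \<kappa> (\<lambda>z. (1 / of_nat m) * (\<Sum>j<m. f ((z + of_nat j) / of_nat m)))"
  by (intro cuspidal_cmult cuspidal_sum)
 thus ?thesis using assms by (simp add: U_op_eq)
qed

lemma has_qexp_periodic:
 assumes "has_qexp f a"
 shows "f (z + 1) = f z"
proof -
 have "exp (\<omega> * of_nat n) = 1" for n using exp_of_nat_mult[of n "\<omega>"] by (simp add: mult_ac)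
 hence "has_qexp (\<lambda>z. f (z + 1)) a" using has_qexp_shift[OF assms, of 1] by simp
 hence "(\<lambda>z. f (z + 1)) = f" using assms has_qexp_unique_fun by blast
 thus ?thesis by (rule fun_cong)
qed

text \<open>The Fricke image of \<open>U_4 f\<close> is \<open>kohnen_op k f\<close> up to sign, and
  each of the three summands in \<open>kohnen_op_eq\<close> has period 1: four quarter steps
  multiply \<open>half_part\<close> by a fourth power equal to 1.\<close>

lemma U_op_4_in_S_half:
 assumes f: "f \<in> S_half k"
 shows "U_op 4 f \<in> S_half k"
proof (cases "\<exists>z1. f z1 \<noteq> 0")
 case False
 hence "f = (\<lambda>_. 0)" by auto
 moreover from this have "U_op 4 f = (\<lambda>_. 0)" using U_op_eq[of 4, OF _ has_qexp_0] by simp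
 ultimately show ?thesis using f by simp
next
 case True
 then obtain z1 where z1: "f z1 \<noteq> 0" by blast
 note q = S_half_has_qexp(1)[OF f]
 show ?thesis
 proof (rule S_half_criterion[OF f z1 cuspidal_U_op[OF S_half_cuspidal[OF f] q]])
  fix z assume z: "z \<in> \<H>"
  show "U_op 4 f (z + 1) = U_op 4 f z" by (rule has_qexp_periodic[OF has_qexp_U_op[OF _ q]]) simp
  have z': "z + 1 / 4 \<in> \<H>" "z + 1 / 4 + 1 / 4 \<in> \<H>" "z + 1 / 4 + 1 / 4 + 1 / 4 \<in> \<H>" "z + 1 \<in> \<H>"
   using z by (simp_all add: H_iff)
  have "z + 1 = z + 1 / 4 + 1 / 4 + 1 / 4 + 1 / 4" by (simp add: field_simps)
  hence "half_part k f (z + 1) = half_part k f (z + 1 / 4 + 1 / 4 + 1 / 4 + 1 / 4)" by (rule arg_cong)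
  also have "... = ((-1) ^ k * \<i>) ^ 4 * half_part k f z"
   unfolding half_part_quarter[OF f z'(3)] half_part_quarter[OF f z'(2)]
    half_part_quarter[OF f z'(1)] half_part_quarter[OF f z] by (simp add: eval_nat_numeral mult_ac)
  also have "((-1) ^ k * \<i>) ^ 4 = 1" by (simp add: power_mult_distrib flip: power_mult)
  finally have r: "half_part k f (z + 1) = half_part k f z" by simp
  have h: "fricke k f (4 * (z + 1)) = fricke k f (4 * z)"
   using S_half_periodic[OF fricke_in_S_half[OF f], of "4 * z" 4] by (simp add: algebra_simps)
  have p: "plus_inv k f (z + 1) = plus_inv k f z"
   using S_half_periodic[OF f, of "z + 1 / 4" 1] S_half_periodic[OF f, of "z - 1 / 4" 1]
   by (simp add: plus_inv_def algebra_simps)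
  have "kohnen_op k f (z + 1) = kohnen_op k f z"
   unfolding kohnen_op_eq[OF f z] kohnen_op_eq[OF f z'(4)] r h p ..
  thus "fricke k (U_op 4 f) (z + 1) = fricke k (U_op 4 f) z" by (simp add: kohnen_op_def plus_sign_def)
 qed simp
qed

lemma kohnen_op_in_S_half:
 assumes "f \<in> S_half k"
 shows "kohnen_op k f \<in> S_half k"
 unfolding kohnen_op_def
 using fun_vs.subspace_scale[OF subspace_S_half fricke_in_S_half[OF U_op_4_in_S_half[OF assms]]] by simp

text \<open>In a plus form no exponent is 2 modulo 4, so averaging over the translations by
  \<open>1/4\<close> and \<open>-1/4\<close> leaves exactly the exponents divisible by 4: this is
  \<open>U_4 f (4 w)\<close>. Rewriting \<open>f (-1/(16 w))\<close> through
  \<open>plus_inv k f = f\<close> produces the same average.\<close>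

lemma S_plus_U_op:
 assumes "f \<in> S_plus k"
 shows "U_op 4 f = (\<lambda>z. 2 ^ k * plus_sign k * fricke k f z)"
proof
 from assms have f: "f \<in> S_half k" and P: "plus_inv k f = f" by (auto simp: S_plus_iff)
 note q = S_half_has_qexp(1)[OF f]
 have U: "has_qexp (U_op 4 f) (\<lambda>n. qcoeff f (4 * n))" by (rule has_qexp_U_op[OF _ q]) simp
 have "has_qexp (\<lambda>z. 1 / 2 * (f (z + of_real (1 / 4)) + f (z + of_real (- 1 / 4))))
  (\<lambda>n. 1 / 2 * (qcoeff f n * \<i> ^ n + qcoeff f n * (-\<i>) ^ n))"
  unfolding exp_quarter[symmetric] by (intro has_qexp_add has_qexp_cmult has_qexp_shift q)
 moreover have "(\<lambda>n. 1 / 2 * (qcoeff f n * \<i> ^ n + qcoeff f n * (-\<i>) ^ n)) =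
  (\<lambda>n. if 4 dvd n then qcoeff f (4 * (n div 4)) else 0)"
 proof
  fix n
  have z2: "qcoeff f n = 0" if "n mod 4 = 2"
  proof -
   have "\<not> plus_cong k n"
   proof -
    have "(if plus_cong k n then 1 else -1) = (-1 :: complex)"
     unfolding plus_multiplier[symmetric] i_power_mod_4[of n] that by (simp add: field_simps)
    thus ?thesis by auto
   qed
   thus ?thesis using assms by (simp add: S_plus_def plus_cong_def)
  qed
  consider "n mod 4 = 0" | "n mod 4 = 1" | "n mod 4 = 2" | "n mod 4 = 3" by linarith
  thus "1 / 2 * (qcoeff f n * \<i> ^ n + qcoeff f n * (-\<i>) ^ n) =
   (if 4 dvd n then qcoeff f (4 * (n div 4)) else 0)"
  proof cases
   case 1
   hence "4 dvd n" "4 * (n div 4) = n" by auto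
   thus ?thesis unfolding i_power_mod_4[of n] 1 by simp
  qed (simp_all add: z2 i_power_mod_4[of n] dvd_eq_mod_eq_0 power3_eq_cube)
 qed
 ultimately have "(\<lambda>z. 1 / 2 * (f (z + of_real (1 / 4)) + f (z + of_real (- 1 / 4)))) = (\<lambda>z. U_op 4 f (of_nat 4 * z))"
  using has_qexp_dilate[OF U, of 4] has_qexp_unique_fun by simp
 hence U4: "U_op 4 f (4 * w) = 1 / 2 * (f (w + 1 / 4) + f (w - 1 / 4))" for w by (simp add: fun_eq_iff)
 fix z show "U_op 4 f z = 2 ^ k * plus_sign k * fricke k f z"
 proof (cases "z \<in> \<H>")
  case False
  thus ?thesis using U by (simp add: has_qexp_def fricke_def)
 next
  case True
  define w where "w = z / 4"
  have w: "w \<in> \<H>" "z = 4 * w" using True by (simp_all add: w_def H_iff)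
  let ?c = "csqrt (-2 * \<i> * w) ^ (2 * k + 1)" and ?e = "(-1) ^ k :: complex" and ?s = "plus_sign k"
  note nz = H_nonzero[OF w(1)] csqrt_power_nonzero[OF w(1), of "2 * k + 1"]
  have e: "?e * ?e = 1" by (simp flip: power_mult_distrib)
  have "f (-1 / (16 * w)) = plus_inv k f (-1 / (16 * w))" unfolding P ..
  also have "... = (1 - ?e * \<i>) / 2 * f ((4 * w - 1) / (16 * w)) + (1 + ?e * \<i>) / 2 * f ((- 4 * w - 1) / (16 * w))"
  proof -
   have "-1 / (16 * w) + 1 / 4 = (4 * w - 1) / (16 * w)" "-1 / (16 * w) - 1 / 4 = (- 4 * w - 1) / (16 * w)"
    using nz(1) by (simp_all add: field_simps)
   thus ?thesis unfolding plus_inv_def by simp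
  qed
  also have "... = ((1 - ?e * \<i>) * (1 + ?e * \<i>)) * (2 ^ k * ?s * ?c * (f (w - 1 / 4) + f (w + 1 / 4))) / 2"
   unfolding S_half_quarter[OF f w(1)] by (simp add: field_simps del: power_Suc)
  also have "(1 - ?e * \<i>) * (1 + ?e * \<i>) = 2" using e by (simp add: algebra_simps)
  also have "f (w - 1 / 4) + f (w + 1 / 4) = 2 * U_op 4 f z" unfolding w(2) U4 by simp
  finally have "2 * 2 ^ (2 * k) * ?c * fricke k f z = 2 * (2 ^ k * ?s * ?c * (2 * U_op 4 f z)) / 2"
   unfolding fricke_4[OF w(1), of f k] w(2) .
  moreover have "t * x = s * u" if "2 * (t * t) * c * x = 2 * (t * s * c * (2 * u)) / 2" "t \<noteq> 0" "c \<noteq> 0" for t c s x u :: complex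
   using that by simp
  moreover have "(2::complex) ^ (2 * k) = 2 ^ k * 2 ^ k" by (simp add: mult_2 power_add)
  ultimately have "2 ^ k * fricke k f z = ?s * U_op 4 f z" using nz(2) by (metis power_not_zero zero_neq_numeral)
  hence "?s * (2 ^ k * fricke k f z) = (?s * ?s) * U_op 4 f z" by (simp only: mult.assoc)
  thus ?thesis by (simp add: mult_ac)
 qed
qed

text \<open>From \<open>K f = 2^k f\<close> it follows that
  \<open>K f + 2^(k-1) f = 3 * 2^(k-1) f\<close> is a plus form, hence so is \<open>f\<close>; the
  other inclusion is \<open>S_plus_U_op\<close> with the Fricke involution applied.\<close>

lemma S_plus_eq: "S_plus k = {f \<in> S_half k. kohnen_op k f = (\<lambda>z. 2 ^ k * f z)}"
proof (intro subset_antisym subsetI)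
 fix f assume f: "f \<in> S_plus k"
 hence f': "f \<in> S_half k" by (simp add: S_plus_iff)
 have "kohnen_op k f = (\<lambda>z. 2 ^ k * f z)"
 proof
  fix z
  have "kohnen_op k f z = 2 ^ k * (plus_sign k * plus_sign k) * fricke k (fricke k f) z"
   unfolding kohnen_op_def S_plus_U_op[OF f] fricke_cmult by (simp only: mult_ac)
  also have "fricke k (fricke k f) = f" by (rule fricke_fricke) (use f' in \<open>simp add: S_half_iff\<close>)
  finally show "kohnen_op k f z = 2 ^ k * f z" by simp
 qed
 with f' show "f \<in> {f \<in> S_half k. kohnen_op k f = (\<lambda>z. 2 ^ k * f z)}" by blast
next
 fix f assume "f \<in> {f \<in> S_half k. kohnen_op k f = (\<lambda>z. 2 ^ k * f z)}"
 hence f: "f \<in> S_half k" and K: "kohnen_op k f = (\<lambda>z. 2 ^ k * f z)" by auto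
 define h where "h = (\<lambda>z. kohnen_op k f z + 2 ^ k / 2 * f z)"
 have "h \<in> S_plus k" unfolding h_def by (rule kohnen_op_plus[OF f kohnen_op_in_S_half[OF f]])
 hence h: "plus_inv k h = h" by (simp add: S_plus_iff)
 have hf: "h z = 3 * 2 ^ k / 2 * f z" for z unfolding h_def K by (simp add: field_simps)
 have "plus_inv k f = f"
 proof
  fix z
  have "3 * 2 ^ k / 2 * plus_inv k f z = plus_inv k h z"
   unfolding plus_inv_def hf by (simp only: distrib_left mult_ac)
  also have "... = 3 * 2 ^ k / 2 * f z" unfolding h hf ..
  finally show "plus_inv k f z = f z" by simp
 qed
 thus "f \<in> S_plus k" using f by (simp add: S_plus_iff)
qed

subsection \<open>Petersson products in half-integral weight\<close>

lemma fundamental_conj: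
 assumes u: "fundamental G' u" and r: "det r > 0" and \<phi>: "bij_betw \<phi> G G'"
  and comm: "\<And>\<gamma> z. \<gamma> \<in> G ==> z \<in> \<H> ==> moebius r (moebius \<gamma> z) = moebius (\<phi> \<gamma>) (moebius r z)"
 shows "fundamental G (\<lambda>z. u (moebius r z))"
proof -
 have [measurable]: "u \<in> borel_measurable borel" using u by (simp add: fundamental_def)
 have "AE z in hyp. (\<integral>\<^sup>+\<gamma>. ennreal (u (moebius \<gamma> (moebius r z))) \<partial>count_space G') = 2"
  using u by (intro AE_hyp_moebius[OF r]) (simp add: fundamental_def)
 with AE_hyp_H have "AE z in hyp. (\<integral>\<^sup>+\<gamma>. ennreal (u (moebius r (moebius \<gamma> z))) \<partial>count_space G) = 2"
 proof eventually_elim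
  case (elim z)
  have "(\<integral>\<^sup>+\<gamma>. ennreal (u (moebius r (moebius \<gamma> z))) \<partial>count_space G) =
    (\<integral>\<^sup>+\<gamma>. ennreal (u (moebius (\<phi> \<gamma>) (moebius r z))) \<partial>count_space G)"
   using comm elim by (intro nn_integral_cong) auto
  also have "... = (\<integral>\<^sup>+\<gamma>. ennreal (u (moebius \<gamma> (moebius r z))) \<partial>count_space G')"
   by (rule nn_integral_bij_count_space[OF \<phi>])
  finally show ?case using elim by simp
 qed
 moreover have "(\<lambda>z. u (moebius r z)) \<in> borel_measurable borel" by measurable
 ultimately show ?thesis using u by (simp add: fundamental_def)
qed

text \<open>\<open>r\<close> normalises \<open>G\<close> in its action, so moving a fundamental
  weight by \<open>r\<close> gives another one for \<open>G\<close>, and invariant integrals do not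
  depend on the weight.\<close>

lemma integral_fundamental_conj:
 fixes \<Phi> :: cfun
 assumes u: "fundamental G u" and r: "det r > 0" and \<phi>: "bij_betw \<phi> G G"
  and comm: "\<And>\<gamma> z. \<gamma> \<in> G ==> z \<in> \<H> ==> moebius r (moebius \<gamma> z) = moebius (\<phi> \<gamma>) (moebius r z)"
  and G: "\<And>\<gamma>. \<gamma> \<in> G ==> adj2 \<gamma> \<in> G" "\<And>\<gamma>. \<gamma> \<in> G ==> det \<gamma> = 1"
  and inv: "\<And>\<gamma> z. \<gamma> \<in> G ==> z \<in> \<H> ==> \<Phi> (moebius \<gamma> z) = \<Phi> z"
  and [measurable]: "\<Phi> \<in> borel_measurable borel"
  and int: "integrable hyp (\<lambda>z. of_real (u z) * \<Phi> z)" "integrable hyp (\<lambda>z. of_real (u z) * \<Phi> (moebius r z))"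
 shows "(\<integral>z. of_real (u z) * \<Phi> (moebius r z) \<partial>hyp) = (\<integral>z. of_real (u z) * \<Phi> z \<partial>hyp)"
proof -
 have [measurable]: "u \<in> borel_measurable borel" using u by (simp add: fundamental_def)
 have meas: "(\<lambda>z. complex_of_real (u z) * \<Phi> z) \<in> borel_measurable borel" by measurable
 have "(\<integral>z. of_real (u z) * \<Phi> (moebius r z) \<partial>hyp) = (\<integral>z. of_real (u (moebius r z)) * \<Phi> (moebius r z) \<partial>hyp)"
 proof (rule integral_fundamental_unique[OF u fundamental_conj[OF u r \<phi> comm] G])
  show "\<Phi> (moebius r (moebius \<gamma> z)) = \<Phi> (moebius r z)" if "\<gamma> \<in> G" "z \<in> \<H>" for \<gamma> z
   using inv[of "\<phi> \<gamma>" "moebius r z"] comm[OF that] that r bij_betwE[OF \<phi>] by auto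
  show "integrable hyp (\<lambda>z. of_real (u (moebius r z)) * \<Phi> (moebius r z))"
   using integrable_hyp_moebius[OF r meas] int(1) by simp
 qed (use int in auto)
 also have "... = (\<integral>z. of_real (u z) * \<Phi> z \<partial>hyp)" by (rule integral_hyp_moebius[OF r meas])
 finally show ?thesis .
qed

lemma pet_integrand_transform:
 assumes "det \<gamma> = 1" "z \<in> \<H>" "f (moebius \<gamma> z) = j * f z" "g (moebius \<gamma> z) = j * g z"
  "cmod j = cmod (cocycle \<gamma> z) powr \<kappa>"
 shows "pet_integrand \<kappa> f g (moebius \<gamma> z) = pet_integrand \<kappa> f g z"
proof -
 have pos: "cmod (cocycle \<gamma> z) > 0" using cocycle_nonzero[of \<gamma> z] assms by simp
 have "(cmod (cocycle \<gamma> z))\<^sup>2 powr \<kappa> = (cmod j)\<^sup>2"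
  unfolding assms(5) power2_eq_square using pos by (simp add: powr_mult)
 hence Im: "Im (moebius \<gamma> z) powr \<kappa> = Im z powr \<kappa> / (cmod j)\<^sup>2"
  using assms(1,2) pos by (simp add: Im_moebius H_iff powr_divide)
 have "cmod j \<noteq> 0" using assms(5) pos by simp
 hence "j * cnj j * of_real (Im z powr \<kappa> / (cmod j)\<^sup>2) = of_real (Im z powr \<kappa>)"
  by (simp flip: complex_norm_square of_real_power)
 moreover have "(a * x) * cnj (a * y) * b = x * cnj y * d" if "a * cnj a * b = d" for a b d x y :: complex
  unfolding that[symmetric] by (simp add: mult_ac)
 ultimately show ?thesis unfolding pet_integrand_def assms(3,4) Im by blast
qed

lemma theta_factor_norm:
 assumes "\<gamma> \<in> Gamma0 4" "z \<in> \<H>"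
 shows "cmod (theta_factor \<gamma> z ^ (2 * k + 1)) = cmod (cocycle \<gamma> z) powr (real k + 1 / 2)"
 by (rule cusp_weight.norm_J[OF cusp_weight_half assms])

lemma pet_integrand_fricke:
 assumes z: "z \<in> \<H>"
 shows "pet_integrand (real k + 1 / 2) f g (moebius (mat2 0 (-1) 4 0) z) =
  pet_integrand (real k + 1 / 2) (fricke k f) (fricke k g) z"
proof -
 let ?\<kappa> = "real k + 1 / 2" and ?c = "csqrt (-2 * \<i> * z) ^ (2 * k + 1)"
 have y: "Im z > 0" "cmod z > 0" using z H_nonzero[OF z] by (auto simp: H_iff)
 have mz: "moebius (mat2 0 (-1) 4 0) z = -1 / (4 * z)" by (simp add: moebius_mat2)
 have c: "cmod ?c = (2 * cmod z) powr ?\<kappa>" unfolding norm_csqrt_power by (simp add: norm_mult)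
 have "Im (-1 / (4 * z)) = Im z / (2 * cmod z)\<^sup>2"
  using Im_moebius[of "mat2 0 (-1) 4 0" z] z by (simp add: mz norm_mult power_mult_distrib)
 moreover have "((2 * cmod z)\<^sup>2) powr ?\<kappa> = (cmod ?c)\<^sup>2" unfolding c power2_eq_square by (rule powr_mult)
 ultimately have Im: "Im (-1 / (4 * z)) powr ?\<kappa> = Im z powr ?\<kappa> / (cmod ?c)\<^sup>2"
  using y by (simp add: powr_divide del: power_Suc)
 have "cmod ?c \<noteq> 0" using csqrt_power_nonzero[OF z, of "2 * k + 1"] by (simp del: power_Suc)
 hence "?c * cnj ?c * of_real (Im z powr ?\<kappa> / (cmod ?c)\<^sup>2) = of_real (Im z powr ?\<kappa>)"
  by (simp flip: complex_norm_square of_real_power del: power_Suc complex_cnj_power)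
 moreover have "(a * x) * cnj (a * y) * b = x * cnj y * d" if "a * cnj a * b = d" for a b d x y :: complex
  unfolding that[symmetric] by (simp add: mult_ac)
 ultimately show ?thesis
  unfolding pet_integrand_def mz Im fricke_apply[OF z, of f k] fricke_apply[OF z, of g k] by blast
qed

lemma S_half_petersson_invariant:
 assumes "f \<in> S_half k" "g \<in> S_half k" "\<gamma> \<in> Gamma0 4" "z \<in> \<H>"
 shows "pet_integrand (real k + 1 / 2) f g (moebius \<gamma> z) = pet_integrand (real k + 1 / 2) f g z"
 using assms by (intro pet_integrand_transform[OF _ _ S_half_moebius S_half_moebius theta_factor_norm]) auto

lemma petersson_fricke:
 assumes f: "f \<in> S_half k" and g: "g \<in> S_half k"
 shows "petersson (real k + 1 / 2) 4 (fricke k f) (fricke k g) = petersson (real k + 1 / 2) 4 f g"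
proof -
 let ?\<kappa> = "real k + 1 / 2" and ?r = "mat2 0 (-1) 4 0"
 \<comment> \<open>Conjugation of \<open>\<gamma>\<close> by the Fricke matrix
   \<open>?r\<close>.\<close>
 let ?\<phi> = "\<lambda>\<gamma>. mat2 (\<gamma>$2$2) (- (\<gamma>$2$1 div 4)) (-4 * \<gamma>$1$2) (\<gamma>$1$1)"
 note c = S_half_cuspidal[OF f] S_half_cuspidal[OF g]
 note c' = c[THEN cuspidal_fricke]
 note [measurable] = pet_integrand_measurable[OF c] pet_integrand_measurable[OF c']
 let ?u = "indicator (ford_domain 4) :: complex => real"
 have eq: "(\<integral>z. of_real (?u z) * pet_integrand ?\<kappa> (fricke k f) (fricke k g) z \<partial>hyp) =
   (\<integral>z. of_real (?u z) * pet_integrand ?\<kappa> f g (moebius ?r z) \<partial>hyp)"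
  by (rule integral_cong_AE) (measurable, use AE_hyp_H in \<open>eventually_elim, simp add: pet_integrand_fricke\<close>)
 also have "... = (\<integral>z. of_real (?u z) * pet_integrand ?\<kappa> f g z \<partial>hyp)"
 proof (rule integral_fundamental_conj[where \<phi> = ?\<phi>, OF fundamental_ford_domain])
  show "bij_betw ?\<phi> (Gamma0 4) (Gamma0 4)"
   by (rule bij_betw_byWitness[of _ ?\<phi>]) (auto simp: Gamma0_iff det_2 mat2_eq_iff algebra_simps)
  show "moebius ?r (moebius \<gamma> z) = moebius (?\<phi> \<gamma>) (moebius ?r z)" if "\<gamma> \<in> Gamma0 4" "z \<in> \<H>" for \<gamma> z
  proof -
   have "4 * (\<gamma>$2$1 div 4) = \<gamma>$2$1" using that by (simp add: Gamma0_iff)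
   hence "?r ** \<gamma> = ?\<phi> \<gamma> ** ?r" by (simp add: mat2_eq_iff matmul_nth mult.commute)
   moreover have "det (?\<phi> \<gamma>) = 1" using that by (auto simp: Gamma0_iff det_2 algebra_simps)
   ultimately show ?thesis using that moebius_mult[of ?r \<gamma> z] moebius_mult[of "?\<phi> \<gamma>" ?r z] by simp
  qed
  show "integrable hyp (\<lambda>z. of_real (?u z) * pet_integrand ?\<kappa> f g (moebius ?r z))"
  proof (subst integrable_cong_AE)
   show "AE z in hyp. of_real (?u z) * pet_integrand ?\<kappa> f g (moebius ?r z) =
     of_real (?u z) * pet_integrand ?\<kappa> (fricke k f) (fricke k g) z"
    using AE_hyp_H by eventually_elim (simp add: pet_integrand_fricke)
   show "integrable hyp (\<lambda>z. of_real (?u z) * pet_integrand ?\<kappa> (fricke k f) (fricke k g) z)"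
    by (rule integrable_petersson[OF _ c']) simp
  qed measurable
 qed (use S_half_petersson_invariant[OF f g] integrable_petersson[OF _ c] pet_integrand_measurable[OF c] Gamma0_adj2 in auto)
 finally show ?thesis unfolding petersson_eq_integral[OF c] petersson_eq_integral[OF c'] .
qed

text \<open>The intersection of \<Gamma>_0(4) with its transpose. On it \<open>f (z / 4)\<close>
  transforms with the same factor as the forms on \<open>Gamma0 4\<close>, and it is normalised by
  \<open>z \<mapsto> -1/z\<close>. Integrating over this group makes the four translates in
  \<open>U_4\<close> a single term.\<close>

definition Gamma04 :: "(int^2^2) set"
 where "Gamma04 = {\<gamma> \<in> Gamma0 4. 4 dvd \<gamma>$1$2}"

text \<open>Four translates of the Ford domain, one for each coset of \<open>Gamma04\<close> in
  \<open>Gamma0 4\<close>.\<close>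

definition ford_strip :: "complex => real"
 where "ford_strip z = (\<Sum>j<4::nat. indicator (ford_domain 4) (moebius (mat2 1 (- int j) 0 1) z))"

lemma ford_strip_measurable [measurable]: "ford_strip \<in> borel_measurable borel"
 unfolding ford_strip_def by measurable

lemma ford_strip_nonneg: "ford_strip z \<ge> 0" unfolding ford_strip_def by (intro sum_nonneg) auto

lemma nn_integral_ford_strip: "(\<integral>\<^sup>+z. ennreal (ford_strip z) \<partial>hyp) < \<infinity>"
proof -
 have "(\<integral>\<^sup>+z. ennreal (ford_strip z) \<partial>hyp) =
  (\<Sum>j<4::nat. \<integral>\<^sup>+z. ennreal (indicator (ford_domain 4) (moebius (mat2 1 (- int j) 0 1) z)) \<partial>hyp)"
  unfolding ford_strip_def by (simp add: nn_integral_sum flip: sum_ennreal)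
 also have "... = (\<Sum>j<4::nat. \<integral>\<^sup>+z. ennreal (indicator (ford_domain 4) z) \<partial>hyp)"
  by (intro sum.cong refl nn_integral_hyp_moebius[where F = "\<lambda>z. ennreal (indicator (ford_domain 4) z)"]) auto
 also have "... < \<infinity>" using nn_integral_ford_domain[of 4] by (simp add: ennreal_mult_less_top)
 finally show ?thesis .
qed

text \<open>\<open>\<Gamma>\<^sub>0(4)\<close> is the disjoint union of the cosets \<open>T\<^sup>-\<^sup>j \<Gamma>\<close>, \<open>0 \<le> j < 4\<close>, of \<open>\<Gamma> = \<Gamma>\<^sub>0(4) \<inter> \<Gamma>\<^sup>0(4)\<close>.\<close>
lemma fundamental_ford_strip: "fundamental Gamma04 ford_strip"
proof -
 let ?T = "\<lambda>j. mat2 1 j 0 1"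
 define B where "B j = {\<gamma> \<in> Gamma0 4. 4 dvd \<gamma>$1$2 + int j * \<gamma>$2$2}" for j :: nat
 have bij: "bij_betw (\<lambda>\<gamma>. ?T (- int j) ** \<gamma>) Gamma04 (B j)" for j
  by (rule bij_betw_byWitness[of _ "\<lambda>\<gamma>. ?T (int j) ** \<gamma>"])
    (auto simp: Gamma04_def B_def Gamma0_iff det_mul matmul_nth mat2_eq_iff)
 have one: "(\<Sum>j<4::nat. indicator (B j) \<gamma>) = (1 :: ennreal)" if \<gamma>: "\<gamma> \<in> Gamma0 4" for \<gamma>
 proof -
  obtain d where d: "\<gamma>$2$2 = 2 * d + 1" using Gamma0_4_odd(1)[OF \<gamma>] by (auto elim: oddE)
  have "(\<gamma>$1$2 + int 0 * \<gamma>$2$2) mod 4 \<in> {0..<4}" by simp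
  let ?b = "\<gamma>$1$2 mod 4"
  have "4 dvd \<gamma>$1$2 + int j * \<gamma>$2$2 \<longleftrightarrow> j = nat ((- \<gamma>$1$2 * \<gamma>$2$2) mod 4)" if "j < 4" for j
  proof -
   have 1: "[\<gamma>$2$2 * \<gamma>$2$2 = 1] (mod 4)" unfolding d cong_iff_dvd_diff
    by (rule dvdI[of _ _ "d * d + d"]) (simp add: algebra_simps)
   have co: "coprime (\<gamma>$2$2) 4" using Gamma0_4_odd(1)[OF \<gamma>] coprime_power_right_iff[of "\<gamma>$2$2" 2 2] by simp
   have "4 dvd \<gamma>$1$2 + int j * \<gamma>$2$2 \<longleftrightarrow> 4 dvd \<gamma>$2$2 * (\<gamma>$1$2 + int j * \<gamma>$2$2)"
    using co by (simp add: coprime_commute coprime_dvd_mult_right_iff)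
   also have "... \<longleftrightarrow> [\<gamma>$1$2 * \<gamma>$2$2 + int j * (\<gamma>$2$2 * \<gamma>$2$2) = 0] (mod 4)"
    by (simp add: cong_0_iff algebra_simps)
   also have "... \<longleftrightarrow> [\<gamma>$1$2 * \<gamma>$2$2 + int j * 1 = 0] (mod 4)"
    using cong_add[OF cong_refl cong_mult[OF cong_refl 1]] cong_trans cong_sym by blast
   also have "... \<longleftrightarrow> [int j = - \<gamma>$1$2 * \<gamma>$2$2] (mod 4)" by (simp add: cong_iff_dvd_diff add.commute)
   also have "... \<longleftrightarrow> j = nat ((- \<gamma>$1$2 * \<gamma>$2$2) mod 4)" using that by (auto simp: cong_def nat_eq_iff)
   finally show ?thesis .
  qed
  hence "(\<Sum>j<4::nat. indicator (B j) \<gamma>) = (\<Sum>j<4::nat. if j = nat ((- \<gamma>$1$2 * \<gamma>$2$2) mod 4) then 1 else (0::ennreal))"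
   using \<gamma> by (intro sum.cong refl) (auto simp: B_def indicator_def)
  also have "... = 1" by (simp add: nat_less_iff)
  finally show ?thesis .
 qed
 have "AE z in hyp. (\<integral>\<^sup>+\<gamma>. ennreal (indicator (ford_domain 4) (moebius \<gamma> z)) \<partial>count_space (Gamma0 4)) = 2"
  using fundamental_ford_domain by (auto simp: fundamental_def)
 with AE_hyp_H have "AE z in hyp. (\<integral>\<^sup>+\<gamma>. ennreal (ford_strip (moebius \<gamma> z)) \<partial>count_space Gamma04) = 2"
 proof eventually_elim
  case (elim z)
  let ?F = "\<lambda>\<gamma>. ennreal (indicator (ford_domain 4) (moebius \<gamma> z))"
  have "(\<integral>\<^sup>+\<gamma>. ennreal (ford_strip (moebius \<gamma> z)) \<partial>count_space Gamma04) =
   (\<integral>\<^sup>+\<gamma>. (\<Sum>j<4::nat. ?F (?T (- int j) ** \<gamma>)) \<partial>count_space Gamma04)"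
   using elim by (intro nn_integral_cong) (auto simp: ford_strip_def Gamma04_def moebius_mult sum_ennreal)
  also have "... = (\<Sum>j<4::nat. \<integral>\<^sup>+\<gamma>. ?F (?T (- int j) ** \<gamma>) \<partial>count_space Gamma04)"
   by (rule nn_integral_sum) simp
  also have "... = (\<Sum>j<4::nat. \<integral>\<^sup>+\<gamma>. ?F \<gamma> \<partial>count_space (B j))"
   by (intro sum.cong refl nn_integral_bij_count_space bij)
  also have "... = (\<Sum>j<4::nat. \<integral>\<^sup>+\<gamma>. ?F \<gamma> * indicator (B j) \<gamma> \<partial>count_space UNIV)"
   by (simp add: nn_integral_count_space_indicator)
  also have "... = (\<integral>\<^sup>+\<gamma>. (\<Sum>j<4::nat. ?F \<gamma> * indicator (B j) \<gamma>) \<partial>count_space UNIV)"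
   by (rule nn_integral_sum[symmetric]) simp
  also have "... = (\<integral>\<^sup>+\<gamma>. ?F \<gamma> * indicator (Gamma0 4) \<gamma> \<partial>count_space UNIV)"
  proof (intro nn_integral_cong)
   fix \<gamma> :: "int^2^2"
   show "(\<Sum>j<4::nat. ?F \<gamma> * indicator (B j) \<gamma>) = ?F \<gamma> * indicator (Gamma0 4) \<gamma>"
   proof (cases "\<gamma> \<in> Gamma0 4")
    case True
    thus ?thesis unfolding sum_distrib_left[symmetric] one[OF True] by simp
   next
    case False
    thus ?thesis by (simp add: B_def)
   qed
  qed
  also have "... = (\<integral>\<^sup>+\<gamma>. ?F \<gamma> \<partial>count_space (Gamma0 4))" by (simp add: nn_integral_count_space_indicator)
  finally show ?case using elim by simp
 qed
 thus ?thesis by (simp add: fundamental_def ford_strip_nonneg)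
qed

text \<open>4 is a square prime to every prime factor of the odd \<open>d\<close>.\<close>

lemma shimura_symbol_4:
 assumes "odd d"
 shows "shimura_symbol (4 * c) d = shimura_symbol c d"
proof -
 have "Legendre (4 * c) p = Legendre c p" if "p \<in># prime_factorization \<bar>d\<bar>" for p
 proof -
  have p: "prime p" "p dvd d" using that by (auto simp: in_prime_factors_iff)
  hence "odd p" using assms dvd_trans by blast
  define q where "q = nat p"
  have q: "p = int q" "prime q" "odd q"
   using p `odd p` prime_gt_0_int[OF p(1)] by (auto simp: q_def even_nat_iff)
  have "p \<noteq> 2" "p \<ge> 2" using `odd p` prime_ge_2_int[OF p(1)] by auto
  hence "\<not> p dvd 2" using zdvd_imp_le[of p 2] by auto
  hence "Legendre 4 p = 1" using Legendre_power[OF q(2,3), of 2 2] Legendre_power2[of p 2] q(1) by simp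
  thus ?thesis using Legendre_mult[OF q(2,3), of 4 c] q(1) by simp
 qed
 hence "image_mset (Legendre (4 * c)) (prime_factorization \<bar>d\<bar>) = image_mset (Legendre c) (prime_factorization \<bar>d\<bar>)"
  by (rule image_mset_cong)
 thus ?thesis by (simp add: shimura_symbol_def)
qed

lemma cuspidal_quarter: "cuspidal \<kappa> f ==> cuspidal \<kappa> (\<lambda>z. f (z / 4))"
 using cuspidal_affine[of \<kappa> f 1 4 0] by simp

text \<open>Conjugating \<open>\<gamma>\<close> by \<open>z \<mapsto> z / 4\<close> gives the lower
  left entry \<open>4 c\<close>, and \<open>(4 c / d) = (c / d)\<close> for odd \<open>d\<close>, so
  both forms carry the same theta multiplier.\<close>

lemma pet_integrand_quarter_invariant:
 assumes f: "f \<in> S_half k" and g: "g \<in> S_half k" and \<gamma>: "\<gamma> \<in> Gamma04" and z: "z \<in> \<H>"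
 shows "pet_integrand (real k + 1 / 2) (\<lambda>z. f (z / 4)) g (moebius \<gamma> z) =
  pet_integrand (real k + 1 / 2) (\<lambda>z. f (z / 4)) g z"
proof (rule pet_integrand_transform)
 have \<gamma>4: "\<gamma> \<in> Gamma0 4" using \<gamma> by (simp add: Gamma04_def)
 show "g (moebius \<gamma> z) = theta_factor \<gamma> z ^ (2 * k + 1) * g z" by (rule S_half_moebius[OF g \<gamma>4 z])
 show "cmod (theta_factor \<gamma> z ^ (2 * k + 1)) = cmod (cocycle \<gamma> z) powr (real k + 1 / 2)"
  by (rule theta_factor_norm[OF \<gamma>4 z])
 obtain b where b: "\<gamma>$1$2 = 4 * b" using \<gamma> by (auto simp: Gamma04_def)
 let ?\<gamma> = "mat2 (\<gamma>$1$1) b (4 * \<gamma>$2$1) (\<gamma>$2$2)"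
 have "?\<gamma> \<in> Gamma0 4" using \<gamma>4 by (simp add: Gamma0_iff det_2 b algebra_simps)
 moreover have z4: "z / 4 \<in> \<H>" using z by (simp add: H_iff)
 moreover have "moebius ?\<gamma> (z / 4) = moebius \<gamma> z / 4"
 proof -
  have "of_int (\<gamma>$1$1) * (z / 4) + of_int b = (of_int (\<gamma>$1$1) * z + of_int (\<gamma>$1$2)) / 4"
   "of_int (4 * \<gamma>$2$1) * (z / 4) + of_int (\<gamma>$2$2) = cocycle \<gamma> z"
   by (simp_all add: b cocycle_def add_divide_distrib)
  thus ?thesis unfolding moebius_mat2 moebius_def[of \<gamma>] by (simp only: divide_divide_eq_left mult.commute)
 qed
 moreover have "theta_factor ?\<gamma> (z / 4) = theta_factor \<gamma> z"
  using Gamma0_4_odd(1)[OF \<gamma>4] by (simp add: theta_factor_def shimura_symbol_4 cocycle_def)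
 ultimately show "f (moebius \<gamma> z / 4) = theta_factor \<gamma> z ^ (2 * k + 1) * f (z / 4)"
  using S_half_moebius[OF f, of ?\<gamma> "z / 4"] by metis
qed (use \<gamma> z in \<open>auto simp: Gamma04_def\<close>)

text \<open>Under \<open>z \<mapsto> -1/z\<close> the function \<open>f (z / 4)\<close> turns into
  the Fricke image of \<open>f\<close>, and the Fricke image of \<open>g\<close> turns into
  \<open>g (z / 4)\<close>, up to factors that the power of \<open>Im z\<close> absorbs: the two
  roles are exchanged.\<close>

lemma pet_integrand_quarter_swap:
 assumes z: "z \<in> \<H>"
 shows "pet_integrand (real k + 1 / 2) (\<lambda>z. f (z / 4)) (fricke k g) (moebius (mat2 0 (-1) 1 0) z) =
  cnj (pet_integrand (real k + 1 / 2) (\<lambda>z. g (z / 4)) (fricke k f) z)"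
proof -
 let ?\<kappa> = "real k + 1 / 2" and ?c = "csqrt (-2 * \<i> * z) ^ (2 * k + 1)"
 have y: "Im z > 0" "cmod z > 0" using z H_nonzero[OF z] by (auto simp: H_iff)
 note nz = csqrt_power_nonzero[OF z, of "2 * k + 1"]
 have mz: "moebius (mat2 0 (-1) 1 0) z = -1 / z" by (simp add: moebius_mat2)
 have mH: "-1 / z \<in> \<H>" using moebius_in_H[of "mat2 0 (-1) 1 0" z] z by (simp add: mz)
 have c: "cmod ?c = 2 powr ?\<kappa> * cmod z powr ?\<kappa>" unfolding norm_csqrt_power by (simp add: norm_mult powr_mult)
 have w: "2 powr ?\<kappa> * 2 powr ?\<kappa> = 2 ^ (2 * k + 1)"
 proof -
  have "?\<kappa> + ?\<kappa> = real (2 * k + 1)" by simp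
  thus ?thesis by (simp only: powr_add[symmetric]) (simp only: powr_realpow[of 2] zero_less_numeral)
 qed
 have "Im (-1 / z) = Im z / (cmod z)\<^sup>2" using Im_moebius[of "mat2 0 (-1) 1 0" z] z by (simp add: mz)
 hence Im: "Im (-1 / z) powr ?\<kappa> = Im z powr ?\<kappa> / (cmod z powr ?\<kappa>)\<^sup>2"
  using y by (simp add: powr_divide power2_eq_square powr_mult)
 have "-2 * \<i> * (-1 / z) = of_real 4 * (1 / (-2 * \<i> * z))" using y by (simp add: field_simps)
 hence "csqrt (-2 * \<i> * (-1 / z)) = 2 * (1 / csqrt (-2 * \<i> * z))"
  using csqrt_of_real_mult[of 4 "1 / (-2 * \<i> * z)"] csqrt_divide[of 1 "-2 * \<i> * z"] Re_rotate[OF z] by simp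
 hence cs: "csqrt (-2 * \<i> * (-1 / z)) ^ (2 * k + 1) = 2 ^ (2 * k + 1) / ?c"
  by (simp only: power_divide times_divide_eq_right mult_1_right)
 have f: "f (-1 / z / 4) = ?c * fricke k f z"
  using fricke_apply[OF z, of f k] by (simp add: mult.commute del: power_Suc)
 have g: "fricke k g (-1 / z) = ?c / 2 ^ (2 * k + 1) * g (z / 4)"
  unfolding fricke_def using mH y by (simp only: if_True cs inverse_divide) simp
 have "?c * cnj (?c / 2 ^ (2 * k + 1)) * of_real (Im (-1 / z) powr ?\<kappa>) =
   of_real ((cmod ?c)\<^sup>2 / 2 ^ (2 * k + 1) * (Im z powr ?\<kappa> / (cmod z powr ?\<kappa>)\<^sup>2))"
 proof -
  have "cnj (2 ^ (2 * k + 1)) = 2 ^ (2 * k + 1)" by simp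
  thus ?thesis unfolding Im complex_cnj_divide
   by (simp add: complex_norm_square[unfolded of_real_power] del: power_Suc complex_cnj_power)
 qed
 also have "(cmod ?c)\<^sup>2 / 2 ^ (2 * k + 1) * (Im z powr ?\<kappa> / (cmod z powr ?\<kappa>)\<^sup>2) = Im z powr ?\<kappa>"
  unfolding c power_mult_distrib w[symmetric] using y by (simp add: power2_eq_square)
 finally have key: "?c * cnj (?c / 2 ^ (2 * k + 1)) * of_real (Im (-1 / z) powr ?\<kappa>) = of_real (Im z powr ?\<kappa>)" .
 moreover have "(a * x) * cnj (a' * y) * b = cnj (y * cnj x * cnj d)" if "a * cnj a' * b = d" for a a' b d x y :: complex
  unfolding that[symmetric] by (simp add: mult_ac)
 ultimately show ?thesis unfolding pet_integrand_def mz f g by (metis complex_cnj_complex_of_real)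
qed

text \<open>Each translate in \<open>U_4 f\<close> is shifted into its own copy of the Ford domain;
  the Fricke image of \<open>g\<close> has period 1 and does not notice.\<close>

lemma petersson_U_op_fricke:
 assumes f: "f \<in> S_half k" and g: "g \<in> S_half k"
 shows "4 * petersson (real k + 1 / 2) 4 (U_op 4 f) (fricke k g) =
  (\<integral>z. of_real (ford_strip z) * pet_integrand (real k + 1 / 2) (\<lambda>z. f (z / 4)) (fricke k g) z \<partial>hyp)"
proof -
 let ?\<kappa> = "real k + 1 / 2" and ?T = "\<lambda>j. mat2 1 (int j) 0 1" and ?T' = "\<lambda>j. mat2 1 (- int j) 0 1"
 let ?u = "indicator (ford_domain 4) :: complex => real"
 let ?\<Psi> = "pet_integrand ?\<kappa> (\<lambda>z. f (z / 4)) (fricke k g)"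
 note q = S_half_has_qexp(1)[OF f]
 have c: "cuspidal ?\<kappa> (\<lambda>z. f (z / 4))" "cuspidal ?\<kappa> (fricke k g)" "cuspidal ?\<kappa> (U_op 4 f)"
  using cuspidal_quarter S_half_cuspidal fricke_in_S_half U_op_4_in_S_half f g by auto
 note [measurable] = pet_integrand_measurable[OF c(1,2)]
 have int: "integrable hyp (\<lambda>z. of_real (?u (moebius (?T' j) z)) * ?\<Psi> z)" for j
 proof (rule integrable_pet_integrand[OF c(1,2)])
  show "(\<integral>\<^sup>+z. ennreal (?u (moebius (?T' j) z)) \<partial>hyp) < \<infinity>"
   using nn_integral_hyp_moebius[of "?T' j" "\<lambda>z. ennreal (?u z)"] nn_integral_ford_domain[of 4] by simp
 qed auto
 have T: "moebius (?T j) z = z + of_nat j" for j z by (simp add: moebius_mat2)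
 have shift: "?\<Psi> (moebius (?T j) z) = f ((z + of_nat j) / 4) * cnj (fricke k g z) * of_real (Im z powr ?\<kappa>)" for j z
  using S_half_periodic[OF fricke_in_S_half[OF g], of z "int j"] unfolding T pet_integrand_def by simp
 have int': "integrable hyp (\<lambda>z. of_real (?u z) * ?\<Psi> (moebius (?T j) z))" for j
 proof -
  have "integrable hyp (\<lambda>z. of_real (?u (moebius (?T' j) (moebius (?T j) z))) * ?\<Psi> (moebius (?T j) z))"
   using integrable_hyp_moebius[of "?T j" "\<lambda>z. of_real (?u (moebius (?T' j) z)) * ?\<Psi> z"] int[of j] by simp
  thus ?thesis by (simp add: T moebius_mat2)
 qed
 have "4 * petersson ?\<kappa> 4 (U_op 4 f) (fricke k g) =
   (\<integral>z. 4 * (of_real (?u z) * pet_integrand ?\<kappa> (U_op 4 f) (fricke k g) z) \<partial>hyp)"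
  unfolding petersson_eq_integral[OF c(3,2)] by (rule integral_mult_right_zero[symmetric])
 also have "... = (\<integral>z. (\<Sum>j<4. of_real (?u z) * ?\<Psi> (moebius (?T j) z)) \<partial>hyp)"
  unfolding shift unfolding pet_integrand_def U_op_eq[OF _ q, of 4, simplified]
  by (intro Bochner_Integration.integral_cong refl) (simp add: sum_distrib_left sum_distrib_right mult_ac)
 also have "... = (\<Sum>j<4. \<integral>z. of_real (?u z) * ?\<Psi> (moebius (?T j) z) \<partial>hyp)"
  by (rule Bochner_Integration.integral_sum) (rule int')
 also have "... = (\<Sum>j<4. \<integral>z. of_real (?u (moebius (?T' j) z)) * ?\<Psi> z \<partial>hyp)"
 proof (intro sum.cong refl)
  fix j
  have "(\<integral>z. of_real (?u (moebius (?T' j) (moebius (?T j) z))) * ?\<Psi> (moebius (?T j) z) \<partial>hyp) =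
    (\<integral>z. of_real (?u (moebius (?T' j) z)) * ?\<Psi> z \<partial>hyp)" by (rule integral_hyp_moebius) auto
  thus "(\<integral>z. of_real (?u z) * ?\<Psi> (moebius (?T j) z) \<partial>hyp) = (\<integral>z. of_real (?u (moebius (?T' j) z)) * ?\<Psi> z \<partial>hyp)"
   by (simp add: T moebius_mat2)
 qed
 also have "... = (\<integral>z. (\<Sum>j<4. of_real (?u (moebius (?T' j) z)) * ?\<Psi> z) \<partial>hyp)"
  by (rule Bochner_Integration.integral_sum[symmetric]) (rule int)
 also have "... = (\<integral>z. of_real (ford_strip z) * ?\<Psi> z \<partial>hyp)" by (simp add: ford_strip_def sum_distrib_right)
 finally show ?thesis .
qed

text \<open>The inversion \<open>z \<mapsto> -1/z\<close> normalises \<open>Gamma04\<close>, so it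
  preserves the integral over the strip, while it exchanges the two forms up to conjugation.\<close>

lemma petersson_U_op_fricke_swap:
 assumes f: "f \<in> S_half k" and g: "g \<in> S_half k"
 shows "petersson (real k + 1 / 2) 4 (U_op 4 f) (fricke k g) = cnj (petersson (real k + 1 / 2) 4 (U_op 4 g) (fricke k f))"
proof -
 let ?\<kappa> = "real k + 1 / 2" and ?S = "mat2 0 (-1) 1 0"
 let ?\<Psi> = "\<lambda>f g. pet_integrand ?\<kappa> (\<lambda>z. f (z / 4)) (fricke k g)"
 let ?\<phi> = "\<lambda>\<gamma>. mat2 (\<gamma>$2$2) (- \<gamma>$2$1) (- \<gamma>$1$2) (\<gamma>$1$1)"
 have c: "cuspidal ?\<kappa> (\<lambda>z. f (z / 4))" "cuspidal ?\<kappa> (\<lambda>z. g (z / 4))" "cuspidal ?\<kappa> (fricke k f)" "cuspidal ?\<kappa> (fricke k g)"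
  using cuspidal_quarter S_half_cuspidal fricke_in_S_half f g by auto
 have [measurable]: "?\<Psi> f g \<in> borel_measurable borel" "?\<Psi> g f \<in> borel_measurable borel"
  by (intro pet_integrand_measurable c)+
 note int = integrable_pet_integrand[OF _ _ ford_strip_measurable ford_strip_nonneg nn_integral_ford_strip]
 have AE: "AE z in hyp. of_real (ford_strip z) * ?\<Psi> f g (moebius ?S z) = cnj (of_real (ford_strip z) * ?\<Psi> g f z)"
  using AE_hyp_H by eventually_elim (simp add: pet_integrand_quarter_swap)
 have meas: "(\<lambda>z. of_real (ford_strip z) * ?\<Psi> f g (moebius ?S z)) \<in> borel_measurable hyp" by measurable
 have meas': "(\<lambda>z. cnj (of_real (ford_strip z) * ?\<Psi> g f z)) \<in> borel_measurable hyp"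
  by (rule measurable_compose[OF _ measurable_cnj]) measurable
 have "4 * petersson ?\<kappa> 4 (U_op 4 f) (fricke k g) = (\<integral>z. of_real (ford_strip z) * ?\<Psi> f g z \<partial>hyp)"
  by (rule petersson_U_op_fricke[OF f g])
 also have "... = (\<integral>z. of_real (ford_strip z) * ?\<Psi> f g (moebius ?S z) \<partial>hyp)"
 proof (rule integral_fundamental_conj[symmetric, where \<phi> = ?\<phi>, OF fundamental_ford_strip])
  show "bij_betw ?\<phi> Gamma04 Gamma04"
   by (rule bij_betw_byWitness[of _ ?\<phi>]) (auto simp: Gamma04_def Gamma0_iff det_2 mat2_eq_iff algebra_simps)
  show "moebius ?S (moebius \<gamma> z) = moebius (?\<phi> \<gamma>) (moebius ?S z)" if "\<gamma> \<in> Gamma04" "z \<in> \<H>" for \<gamma> z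
  proof -
   have "?S ** \<gamma> = ?\<phi> \<gamma> ** ?S" by (simp add: mat2_eq_iff matmul_nth)
   moreover have "det (?\<phi> \<gamma>) = 1" "det \<gamma> = 1" using that by (auto simp: Gamma04_def Gamma0_iff det_2 algebra_simps)
   ultimately show ?thesis using that(2) moebius_mult[of ?S \<gamma> z] moebius_mult[of "?\<phi> \<gamma>" ?S z] by simp
  qed
  show "?\<Psi> f g (moebius \<gamma> z) = ?\<Psi> f g z" if "\<gamma> \<in> Gamma04" "z \<in> \<H>" for \<gamma> z
   by (rule pet_integrand_quarter_invariant[OF f fricke_in_S_half[OF g] that])
  show "integrable hyp (\<lambda>z. of_real (ford_strip z) * ?\<Psi> f g (moebius ?S z))"
   unfolding integrable_cong_AE[OF meas meas' AE] using int[OF c(2,3)] by (rule integrable_cnj)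
  show "integrable hyp (\<lambda>z. of_real (ford_strip z) * ?\<Psi> f g z)" by (rule int[OF c(1,4)])
 qed (auto simp: Gamma04_def Gamma0_adj2)
 also have "... = (\<integral>z. cnj (of_real (ford_strip z) * ?\<Psi> g f z) \<partial>hyp)"
  by (rule integral_cong_AE[OF meas meas' AE])
 also have "... = cnj (\<integral>z. of_real (ford_strip z) * ?\<Psi> g f z \<partial>hyp)" by (rule Bochner_Integration.integral_cnj)
 also have "... = cnj (4 * petersson ?\<kappa> 4 (U_op 4 g) (fricke k f))" unfolding petersson_U_op_fricke[OF g f] ..
 finally show ?thesis by simp
qed

text \<open>Moving the unitary involution \<open>fricke\<close> across the product reduces the claim
  to the swap of \<open>f\<close> and \<open>g\<close>.\<close>

lemma kohnen_op_hermitian: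
 assumes f: "f \<in> S_half k" and g: "g \<in> S_half k"
 shows "petersson (real k + 1 / 2) 4 (kohnen_op k f) g = petersson (real k + 1 / 2) 4 f (kohnen_op k g)"
proof -
 interpret hermitian_space "S_half k" "petersson (real k + 1 / 2) 4" by (rule hermitian_space_S_half)
 let ?ip = "petersson (real k + 1 / 2) 4"
 have FF: "fricke k (fricke k h) = h" if "h \<in> S_half k" for h
  by (rule fricke_fricke) (use that in \<open>simp add: S_half_iff\<close>)
 note U = U_op_4_in_S_half and F = fricke_in_S_half
 have k: "kohnen_op k h = (\<lambda>z. plus_sign k * fricke k (U_op 4 h) z)" for h by (simp add: kohnen_op_def fun_eq_iff)
 have "?ip (kohnen_op k f) g = plus_sign k * ?ip (fricke k (U_op 4 f)) g"
  unfolding k by (rule ip_scale[OF F[OF U[OF f]] g])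
 also have "?ip (fricke k (U_op 4 f)) g = ?ip (fricke k (fricke k (U_op 4 f))) (fricke k g)"
  by (rule petersson_fricke[symmetric, OF F[OF U[OF f]] g])
 also have "... = cnj (?ip (U_op 4 g) (fricke k f))"
  unfolding FF[OF U[OF f]] by (rule petersson_U_op_fricke_swap[OF f g])
 also have "... = ?ip (fricke k f) (U_op 4 g)" by (rule ip_cnj[OF U[OF g] F[OF f]])
 also have "... = ?ip (fricke k (fricke k f)) (fricke k (U_op 4 g))"
  by (rule petersson_fricke[symmetric, OF F[OF f] U[OF g]])
 also have "plus_sign k * ... = ?ip f (kohnen_op k g)"
  unfolding FF[OF f] k using ip_scale_right[OF F[OF U[OF g]] f, of "plus_sign k"] by (simp add: plus_sign_def)
 finally show ?thesis .
qed

section \<open>The space \<open>S_minus\<close> as a joint eigenspace\<close>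

lemma A_plus_eq: "A_plus k = fricke k ` S_plus k"
proof -
 let ?s = "of_int (shimura_symbol 2 (2 * int k + 1)) :: complex"
 have "coprime 2 (2 * int k + 1)" by simp
 hence "(shimura_symbol 2 (2 * int k + 1))\<^sup>2 = 1" by (intro shimura_symbol_power2) auto
 hence s: "?s * ?s = 1" by (metis of_int_1 of_int_mult power2_eq_square)
 have S: "(\<lambda>z. ?s * f z) \<in> S_plus k" if "f \<in> S_plus k" for f
 proof -
  have "(\<lambda>z. ?s * f z) \<in> S_half k" using that fun_vs.subspace_scale[OF subspace_S_half] by (simp add: S_plus_iff)
  moreover have "plus_inv k (\<lambda>z. ?s * f z) = (\<lambda>z. ?s * plus_inv k f z)"
   by (simp add: plus_inv_def fun_eq_iff algebra_simps)
  ultimately show ?thesis using that by (simp add: S_plus_iff)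
 qed
 show ?thesis
 proof (intro subset_antisym subsetI)
  fix h assume "h \<in> A_plus k"
  then obtain f where f: "f \<in> S_plus k" "h = W4 k f" by (auto simp: A_plus_def)
  hence "h = fricke k (\<lambda>z. ?s * f z)" by (simp add: W4_eq fricke_cmult)
  thus "h \<in> fricke k ` S_plus k" using S[OF f(1)] by blast
 next
  fix h assume "h \<in> fricke k ` S_plus k"
  then obtain f where f: "f \<in> S_plus k" "h = fricke k f" by auto
  have "W4 k (\<lambda>z. ?s * f z) = (\<lambda>z. (?s * ?s) * fricke k f z)"
   unfolding W4_eq fricke_cmult by (simp only: mult.assoc)
  hence "h = W4 k (\<lambda>z. ?s * f z)" using f(2) s by simp
  thus "h \<in> A_plus k" using S[OF f(1)] by (auto simp: A_plus_def)
 qed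
qed

text \<open>For \<open>f\<close> orthogonal to the plus space, \<open>h = K f + 2^(k-1) f\<close> is
  a plus form, and as \<open>K\<close> is Hermitian, \<open>h\<close> is orthogonal to itself.
  Conversely, eigenvectors of a Hermitian operator for the distinct eigenvalues \<open>2^k\<close>
  and \<open>- 2^(k-1)\<close> are orthogonal.\<close>

lemma orth_S_plus_iff:
 assumes f: "f \<in> S_half k"
 shows "(\<forall>g\<in>S_plus k. petersson (real k + 1 / 2) 4 f g = 0) \<longleftrightarrow> kohnen_op k f = (\<lambda>z. - (2 ^ k / 2) * f z)"
proof -
 interpret hermitian_space "S_half k" "petersson (real k + 1 / 2) 4" by (rule hermitian_space_S_half)
 let ?ip = "petersson (real k + 1 / 2) 4"
 note K = kohnen_op_in_S_half
 have real: "cnj (2 ^ k) = 2 ^ k" by simp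
 have kg: "?ip (kohnen_op k f) g = 2 ^ k * ?ip f g" if "g \<in> S_plus k" for g
 proof -
  from that have g: "g \<in> S_half k" "kohnen_op k g = (\<lambda>z. 2 ^ k * g z)" by (auto simp: S_plus_eq)
  show ?thesis unfolding kohnen_op_hermitian[OF f g(1)] g(2) ip_scale_right[OF g(1) f] real ..
 qed
 show ?thesis
 proof
  assume *: "\<forall>g\<in>S_plus k. ?ip f g = 0"
  define h where "h = (\<lambda>z. kohnen_op k f z + 2 ^ k / 2 * f z)"
  have h: "h \<in> S_plus k" unfolding h_def by (rule kohnen_op_plus[OF f K[OF f]])
  hence hS: "h \<in> S_half k" by (simp add: S_plus_iff)
  have "h = kohnen_op k f + (\<lambda>z. 2 ^ k / 2 * f z)" by (simp add: h_def plus_fun_def)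
  hence "?ip h h = ?ip (kohnen_op k f) h + 2 ^ k / 2 * ?ip f h"
   using ip_add[OF K[OF f] V_scale[OF f] hS, of "2 ^ k / 2"] ip_scale[OF f hS, of "2 ^ k / 2"] by metis
  also have "... = 0" using kg[OF h] * h by simp
  finally have "h = 0" by (rule ip_definite[OF hS])
  hence "h z = 0" for z by simp
  thus "kohnen_op k f = (\<lambda>z. - (2 ^ k / 2) * f z)"
   unfolding h_def by (intro ext) (simp add: eq_neg_iff_add_eq_0)
 next
  assume e: "kohnen_op k f = (\<lambda>z. - (2 ^ k / 2) * f z)"
  show "\<forall>g\<in>S_plus k. ?ip f g = 0"
  proof
   fix g assume g: "g \<in> S_plus k"
   hence gS: "g \<in> S_half k" by (simp add: S_plus_iff)
   have "- (2 ^ k / 2) * ?ip f g = 2 ^ k * ?ip f g" using kg[OF g] unfolding e ip_scale[OF f gS] .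
   hence "2 ^ k * (3 * ?ip f g) = 0" by (simp add: field_simps)
   thus "?ip f g = 0" by simp
  qed
 qed
qed

text \<open>\<open>fricke\<close> is unitary, so orthogonality of \<open>f\<close> to the Fricke
  image of the plus space is orthogonality of \<open>fricke k f\<close> to the plus space
  itself.\<close>

lemma S_minus_eq:
 "S_minus k = {f \<in> S_half k. kohnen_op k f = (\<lambda>z. - (2 ^ k / 2) * f z) \<and>
  kohnen_op k (fricke k f) = (\<lambda>z. - (2 ^ k / 2) * fricke k f z)}"
proof -
 interpret hermitian_space "S_half k" "petersson (real k + 1 / 2) 4" by (rule hermitian_space_S_half)
 let ?ip = "petersson (real k + 1 / 2) 4"
 have FF: "fricke k (fricke k h) = h" if "h \<in> S_half k" for h
  by (rule fricke_fricke) (use that in \<open>simp add: S_half_iff\<close>)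
 have pS: "g \<in> S_half k" if "g \<in> S_plus k" for g using that by (simp add: S_plus_iff)
 have p0: "0 \<in> S_plus k" using V_0 by (simp add: S_plus_iff plus_inv_def fun_eq_iff)
 have F0: "fricke k 0 = 0" by (simp add: fricke_def fun_eq_iff)
 have main: "(\<forall>h\<in>{p + q | p q. p \<in> S_plus k \<and> q \<in> A_plus k}. ?ip f h = 0) \<longleftrightarrow>
   kohnen_op k f = (\<lambda>z. - (2 ^ k / 2) * f z) \<and>
   kohnen_op k (fricke k f) = (\<lambda>z. - (2 ^ k / 2) * fricke k f z)" if f: "f \<in> S_half k" for f
 proof -
  have fl: "?ip (fricke k f) g = ?ip f (fricke k g)" if "g \<in> S_plus k" for g
   using petersson_fricke[OF f fricke_in_S_half[OF pS[OF that]]] FF[OF pS[OF that]] by simp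
  have add: "?ip f (p + fricke k q) = ?ip f p + ?ip f (fricke k q)" if "p \<in> S_plus k" "q \<in> S_plus k" for p q
   by (rule ip_add_right[OF pS[OF that(1)] fricke_in_S_half[OF pS[OF that(2)]] f])
  have "(\<forall>h\<in>{p + q | p q. p \<in> S_plus k \<and> q \<in> A_plus k}. ?ip f h = 0) \<longleftrightarrow>
    (\<forall>p\<in>S_plus k. \<forall>q\<in>S_plus k. ?ip f (p + fricke k q) = 0)" unfolding A_plus_eq by blast
  also have "... \<longleftrightarrow> (\<forall>g\<in>S_plus k. ?ip f g = 0) \<and> (\<forall>g\<in>S_plus k. ?ip f (fricke k g) = 0)"
  proof
   assume *: "\<forall>p\<in>S_plus k. \<forall>q\<in>S_plus k. ?ip f (p + fricke k q) = 0"
   show "(\<forall>g\<in>S_plus k. ?ip f g = 0) \<and> (\<forall>g\<in>S_plus k. ?ip f (fricke k g) = 0)"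
   proof (intro conjI ballI)
    fix g assume g: "g \<in> S_plus k"
    show "?ip f g = 0" using bspec[OF bspec[OF * g] p0] F0 by simp
    show "?ip f (fricke k g) = 0" using bspec[OF bspec[OF * p0] g] by simp
   qed
  qed (simp add: add)
  also have "... \<longleftrightarrow> (\<forall>g\<in>S_plus k. ?ip f g = 0) \<and> (\<forall>g\<in>S_plus k. ?ip (fricke k f) g = 0)" by (simp add: fl)
  finally show ?thesis unfolding orth_S_plus_iff[OF f] orth_S_plus_iff[OF fricke_in_S_half[OF f]] .
 qed
 show ?thesis unfolding S_minus_def orth_complement_def by (rule Collect_cong[OF conj_cong[OF refl main]])
qed

subsection \<open>Hecke operators in half-integral weight\<close>

text \<open>The twist by the quadratic character modulo \<open>p\<close>, up to the Gauss
  sum.\<close>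

definition gauss_twist :: "nat => cfun => cfun"
 where "gauss_twist p f z = (\<Sum>b<p. of_int (Legendre (int b) (int p)) * f (z + of_nat b / of_nat p))"

definition T_half_coeff :: "nat => nat => (nat => complex) => nat => complex"
 where "T_half_coeff k p a n = a (p\<^sup>2 * n) + of_int (Legendre ((-1) ^ k * int n) (int p)) * of_nat p ^ (k - 1) * a n
  + of_nat p ^ (2 * k - 1) * (if p\<^sup>2 dvd n then a (n div p\<^sup>2) else 0)"

context
 fixes p k :: nat
 assumes p: "prime p" "odd p" and k: "k > 0"
begin

private abbreviation "c z \<equiv> csqrt (-2 * \<i> * z) ^ (2 * k + 1)"
private abbreviation "L x \<equiv> of_int (Legendre x (int p)) :: complex"
private abbreviation "twist_const \<equiv> L (-1) ^ k * of_nat p ^ (k - 1) / gauss_sum p :: complex"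

lemma p_pos: "p > 0" "p > 1" "p\<^sup>2 > 0" using odd_prime_gt_2[OF p] by auto

lemma gauss_sum_nonzero: "gauss_sum p \<noteq> 0" using p_pos by (simp add: gauss_sum_value[OF p] theta_eps_def)

lemma has_qexp_gauss_twist:
 assumes "has_qexp f a"
 shows "has_qexp (gauss_twist p f) (\<lambda>n. L (int n) * gauss_sum p * a n)"
proof -
 let ?e = "\<lambda>n b. exp (\<omega> * of_nat n * of_real (real b / real p))"
 have "has_qexp (\<lambda>z. \<Sum>b<p. L (int b) * f (z + of_real (real b / real p))) (\<lambda>n. \<Sum>b<p. L (int b) * (a n * ?e n b))"
  by (intro has_qexp_sum has_qexp_cmult has_qexp_shift assms)
 also have "(\<lambda>n. \<Sum>b<p. L (int b) * (a n * ?e n b)) = (\<lambda>n. L (int n) * gauss_sum p * a n)"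
  unfolding gauss_sum_twist[OF p, symmetric] sum_distrib_right
  by (intro ext sum.cong refl) (simp add: mult_ac)
 finally show ?thesis by (simp add: gauss_twist_def[abs_def])
qed

text \<open>The operator \<open>T_(p^2)\<close> as a sum over translates and dilations;
  \<open>twist_const\<close> divides out the Gauss sum and supplies
  \<open>((-1)^k / p) p^(k-1)\<close>.\<close>

definition T_half_fun :: "cfun => cfun"
 where "T_half_fun f z = (\<Sum>b<p\<^sup>2. f ((z + of_nat b) / of_nat (p^2))) / of_nat (p^2)
  + twist_const * gauss_twist p f z + of_nat p ^ (2 * k - 1) * f (of_nat (p^2) * z)"

lemma has_qexp_T_half_fun:
 assumes "has_qexp f a"
 shows "has_qexp (T_half_fun f) (T_half_coeff k p a)"
proof -
 have "has_qexp (T_half_fun f) (\<lambda>n. a (p\<^sup>2 * n) + twist_const * (L (int n) * gauss_sum p * a n)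
  + of_nat p ^ (2 * k - 1) * (if p\<^sup>2 dvd n then a (n div p\<^sup>2) else 0))" unfolding T_half_fun_def
  by (intro has_qexp_add has_qexp_cmult has_qexp_U has_qexp_dilate has_qexp_gauss_twist assms p_pos)
 moreover have "twist_const * (L (int n) * gauss_sum p * a n) = L ((-1) ^ k * int n) * of_nat p ^ (k - 1) * a n" for n
  unfolding Legendre_mult[OF p] Legendre_power[OF p] using gauss_sum_nonzero by simp
 ultimately show ?thesis by (simp add: T_half_coeff_def[abs_def])
qed

lemma T_half_eq:
 assumes "has_qexp f a"
 shows "T_half k p f = T_half_fun f"
 unfolding T_half_def qcoeff_eqI[OF assms] T_half_coeff_def[symmetric]
 by (rule qseries_eqI[OF has_qexp_T_half_fun[OF assms]])

text \<open>One matrix of \<open>Gamma0 4\<close> for each representative: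
  \<open>4 b b' + 1 = N a\<close> says that \<open>mat2 a b (4 * b') N\<close> has determinant 1,
  and it maps \<open>-1/(4 u)\<close> to the required point. It is applied with \<open>N = p\<close>
  or \<open>N = p^2\<close> and \<open>r = (p / N)^2\<close>.\<close>

lemma fricke_hecke_rep:
 fixes a b b' N :: int and r :: real
 assumes f: "f \<in> S_half k" and z: "z \<in> \<H>" and N: "N > 0" "4 * b * b' + 1 = N * a" and r: "r > 0"
 shows "f (of_int b / of_int N - 1 / (4 * (of_int N)\<^sup>2 * of_real r * z)) =
  (inverse (theta_eps N) * of_int (shimura_symbol (4 * b') N) * of_real (sqrt (of_int N * r))) ^ (2 * k + 1)
   * c z * fricke k f (of_real r * z + of_int b' / of_int N)"
proof -
 define u where "u = of_real r * z + of_int b' / of_int N"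
 define v where "v = -1 / (4 * u)"
 have u: "u \<in> \<H>" using z r by (simp add: u_def H_iff)
 have v: "v \<in> \<H>" unfolding v_def by (rule H_fricke[OF u])
 note nz = H_nonzero[OF z] H_nonzero[OF u]
 have Nr: "of_int N \<noteq> (0::complex)" "of_real r \<noteq> (0::complex)" using N r by auto
 have Nu: "of_int N * u = of_int N * of_real r * z + of_int b'" using Nr by (simp add: u_def distrib_left)
 let ?\<gamma> = "mat2 a b (4 * b') N"
 have \<gamma>: "?\<gamma> \<in> Gamma0 4" using N(2) by (simp add: Gamma0_iff algebra_simps)
 have den: "of_int (4 * b') * v + of_int N = of_int N * of_real r * (z / u)"
 proof -
  have "of_int (4 * b') * v + of_int N = (of_int N * u - of_int b') / u" using nz by (simp add: v_def field_simps)
  thus ?thesis unfolding Nu by simp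
 qed
 have num: "of_int a * v + of_int b = (of_int b * of_real r * z - 1 / (4 * of_int N)) / u"
 proof -
  have A: "of_int a = (4 * of_int b * of_int b' + 1) / (of_int N :: complex)"
  proof -
   have "of_int N * of_int a = (4 * of_int b * of_int b' + 1 :: complex)"
    using arg_cong[OF N(2), of "of_int :: int => complex"] by simp
   thus ?thesis using Nr by (simp add: field_simps)
  qed
  have "of_int a * v + of_int b = (of_int b * u - of_int a / 4) / u" using nz by (simp add: v_def field_simps)
  also have "of_int b * u - of_int a / 4 = of_int b * of_real r * z - 1 / (4 * of_int N)"
   unfolding A u_def using Nr by (simp add: field_simps)
  finally show ?thesis .
 qed
 have arg: "moebius ?\<gamma> v = of_int b / of_int N - 1 / (4 * (of_int N)\<^sup>2 * of_real r * z)"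
 proof -
  have "moebius ?\<gamma> v = (of_int b * of_real r * z - 1 / (4 * of_int N)) / (of_int N * of_real r * z)"
   unfolding moebius_mat2 num den using nz by simp
  also have "... = of_int b / of_int N - 1 / (4 * (of_int N)\<^sup>2 * of_real r * z)"
   using nz Nr by (simp add: field_simps power2_eq_square)
  finally show ?thesis .
 qed
 have "csqrt (of_int (4 * b') * v + of_int N) = of_real (sqrt (of_int N * r)) * (csqrt (-2 * \<i> * z) / csqrt (-2 * \<i> * u))"
 proof -
  have "of_int (4 * b') * v + of_int N = of_real (of_int N * r) * ((-2 * \<i> * z) / (-2 * \<i> * u))"
   unfolding den by simp
  moreover have "0 \<le> of_int N * r" using N r by simp
  ultimately show ?thesis by (simp only: csqrt_of_real_mult csqrt_divide[OF Re_rotate[OF z] Re_rotate[OF u]])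
 qed
 hence th: "theta_factor ?\<gamma> v = (inverse (theta_eps N) * of_int (shimura_symbol (4 * b') N) * of_real (sqrt (of_int N * r)))
   * (csqrt (-2 * \<i> * z) / csqrt (-2 * \<i> * u))" by (simp add: theta_factor_def)
 have fv: "f v = c u * fricke k f u" unfolding v_def by (rule fricke_apply[OF u])
 have "f (moebius ?\<gamma> v) = (inverse (theta_eps N) * of_int (shimura_symbol (4 * b') N) * of_real (sqrt (of_int N * r))) ^ (2 * k + 1)
   * (c z / c u) * (c u * fricke k f u)"
  using S_half_moebius[OF f \<gamma> v] unfolding th power_mult_distrib[of _ "csqrt (-2 * \<i> * z) / csqrt (-2 * \<i> * u)"] power_divide fv .
 moreover have "s * (x / y) * (y * t) = s * x * t" if "y \<noteq> 0" for s x y t :: complex using that by simp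
 ultimately show ?thesis unfolding arg u_def[symmetric] using csqrt_power_nonzero[OF u, of "2 * k + 1"] by metis
qed

private definition "units j = {b \<in> {..<p ^ j}. \<not> p dvd b}"

text \<open>The parts sort the translates \<open>b\<close> modulo \<open>p^2\<close> by
  divisibility: \<open>part0\<close> has \<open>b = 0\<close>, \<open>part1\<close> the other
  multiples of \<open>p\<close>, \<open>part2\<close> the units; \<open>part3\<close> is the twist
  and \<open>part4\<close> the dilation. The Fricke involution exchanges \<open>part0\<close> with
  \<open>part4\<close> and \<open>part1\<close> with \<open>part3\<close>, and commutes with
  \<open>part2\<close>.\<close>

private definition "part0 f z = f (z / of_nat (p^2)) / of_nat (p^2)" for f :: cfun
private definition "part1 f z = (\<Sum>b\<in>units 1. f (z / of_nat (p^2) + of_nat b / of_nat p)) / of_nat (p^2)" for f :: cfun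
private definition "part2 f z = (\<Sum>b\<in>units 2. f (z / of_nat (p^2) + of_nat b / of_nat (p^2))) / of_nat (p^2)" for f :: cfun
private definition "part3 f z = twist_const * gauss_twist p f z" for f :: cfun
private definition "part4 f z = of_nat p ^ (2 * k - 1) * f (of_nat (p^2) * z)" for f :: cfun

private lemma T_half_fun_parts: "T_half_fun f = part0 f + part1 f + part2 f + part3 f + part4 f"
proof
 fix z
 let ?F = "\<lambda>b::nat. f ((z + of_nat b) / of_nat (p^2))"
 have "x \<in> (\<lambda>b. p * b) ` units 1" if x: "x < p\<^sup>2" "p dvd x" "x \<noteq> 0" for x
 proof -
  obtain y where y: "x = p * y" using x(2) by blast
  hence "y < p" "y > 0" using x p_pos by (auto simp: power2_eq_square)
  hence "y \<in> units 1" by (auto simp: units_def dest: dvd_imp_le)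
  thus ?thesis using y by blast
 qed
 hence "{..<p\<^sup>2} = insert 0 ((\<lambda>b. p * b) ` units 1 \<union> units 2)"
  using p_pos by (auto simp: units_def power2_eq_square)
 moreover have fin: "finite (units j)" for j by (simp add: units_def)
 moreover have "0 \<notin> (\<lambda>b. p * b) ` units 1 \<union> units 2" using p_pos(1) by (force simp: units_def)
 ultimately have "(\<Sum>b<p\<^sup>2. ?F b) = ?F 0 + (\<Sum>b\<in>(\<lambda>b. p * b) ` units 1 \<union> units 2. ?F b)"
  by (simp only: sum.insert finite_UnI finite_imageI not_False_eq_True)
 also have "(\<Sum>b\<in>(\<lambda>b. p * b) ` units 1 \<union> units 2. ?F b) = (\<Sum>b\<in>(\<lambda>b. p * b) ` units 1. ?F b) + (\<Sum>b\<in>units 2. ?F b)"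
  by (rule sum.union_disjoint) (auto simp: fin, auto simp: units_def)
 also have "(\<Sum>b\<in>(\<lambda>b. p * b) ` units 1. ?F b) = (\<Sum>b\<in>units 1. ?F (p * b))"
  using p_pos by (subst sum.reindex) (auto simp: inj_on_def)
 finally have "(\<Sum>b<p\<^sup>2. ?F b) = ?F 0 + ((\<Sum>b\<in>units 1. ?F (p * b)) + (\<Sum>b\<in>units 2. ?F b))" .
 moreover have "(z + of_nat (p * b)) / of_nat (p^2) = z / of_nat (p^2) + of_nat b / of_nat p" for b
  using p_pos by (simp add: add_divide_distrib power2_eq_square)
 ultimately show "T_half_fun f z = (part0 f + part1 f + part2 f + part3 f + part4 f) z"
  unfolding T_half_fun_def part0_def part1_def part2_def part3_def part4_def plus_fun_def
  by (simp only: add_divide_distrib of_nat_0 add_0_right add.assoc)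
qed

private lemma fricke_part0:
 assumes "f \<in> S_half k"
 shows "fricke k (part0 f) = part4 (fricke k f)"
proof
 fix z
 have H: "of_nat (p^2) * z \<in> \<H> \<longleftrightarrow> z \<in> \<H>" using p_pos by (simp add: H_iff zero_less_mult_iff)
 show "fricke k (part0 f) z = part4 (fricke k f) z"
 proof (cases "z \<in> \<H>")
  case False
  thus ?thesis using H by (simp add: part4_def fricke_def)
 next
  case True
  have "csqrt (-2 * \<i> * (of_nat (p^2) * z)) = of_nat p * csqrt (-2 * \<i> * z)"
   using csqrt_of_real_mult[of "(real p)\<^sup>2" "-2 * \<i> * z"] by (simp add: mult_ac)
  hence cc: "c (of_nat (p^2) * z) = of_nat p ^ (2 * k + 1) * c z" by (simp only: power_mult_distrib)
  have "f (-1 / (4 * z) / of_nat (p^2)) = c (of_nat (p^2) * z) * fricke k f (of_nat (p^2) * z)"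
   using fricke_apply[of "of_nat (p^2) * z" f k] True H by (simp add: mult_ac)
  hence "fricke k (part0 f) z = inverse (c z) * (of_nat p ^ (2 * k + 1) * c z * fricke k f (of_nat (p^2) * z) / of_nat (p^2))"
   unfolding fricke_def[of k "part0 f"] part0_def cc using True by (simp only: if_True)
  also have "of_nat p ^ (2 * k + 1) = of_nat p ^ (2 * k - 1) * (of_nat (p^2) :: complex)"
   using k by (simp flip: power_add)
  finally show ?thesis using csqrt_power_nonzero[OF True, of "2 * k + 1"] p_pos
   by (simp add: part4_def del: power_Suc)
 qed
qed

private lemma coprime_p: "\<not> p dvd b ==> coprime (int b) (int p)"
 using prime_imp_coprime[of p b] p(1) by (simp add: coprime_commute)

private lemma ex_inverse:
 assumes "\<not> p dvd b"
 shows "\<exists>b'. [4 * int b * b' = -1] (mod int (p ^ j))"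
proof -
 have "coprime (int b) (int p)" "coprime 4 (int p)"
  using coprime_p[OF assms] p(2) coprime_power_left_iff[of 2 2 "int p"] by auto
 hence "coprime (4 * int b) (int (p ^ j))" by simp
 then obtain x where "[4 * int b * x = 1] (mod int (p ^ j))" using cong_solve_coprime_int by blast
 hence "[- (4 * int b * x) = - 1] (mod int (p ^ j))" by (simp only: cong_minus_minus_iff)
 thus ?thesis by (intro exI[of _ "- x"]) simp
qed

private lemma inverse_inj:
 assumes "[4 * int b * x = -1] (mod int (p ^ j))" "[4 * int d * y = -1] (mod int (p ^ j))" "[x = y] (mod int (p ^ j))"
 shows "[int b = int d] (mod int (p ^ j))"
proof -
 have "[int b * (4 * int d * y) = int b * -1] (mod int (p ^ j))" by (rule cong_mult[OF cong_refl assms(2)])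
 hence 1: "[4 * int b * int d * y = - int b] (mod int (p ^ j))" by (simp add: mult_ac)
 have "[int d * (4 * int b * x) = int d * -1] (mod int (p ^ j))" by (rule cong_mult[OF cong_refl assms(1)])
 hence 2: "[4 * int b * int d * x = - int d] (mod int (p ^ j))" by (simp add: mult_ac)
 have "[4 * int b * int d * x = 4 * int b * int d * y] (mod int (p ^ j))" by (rule cong_mult[OF cong_refl assms(3)])
 hence "[- int b = - int d] (mod int (p ^ j))" using 1 2 cong_sym cong_trans by blast
 thus ?thesis by (simp only: cong_minus_minus_iff)
qed

private lemma inverse_not_dvd:
 assumes "[4 * int b * x = -1] (mod int (p ^ j))" "j > 0"
 shows "\<not> int p dvd x"
proof
 assume "int p dvd x"
 hence "int p dvd 4 * int b * x" by simp
 moreover have "int p dvd int (p ^ j)" using assms(2) by (simp add: dvd_power)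
 hence "int p dvd 4 * int b * x - -1" using assms(1) dvd_trans unfolding cong_iff_dvd_diff by blast
 ultimately have "int p dvd (4 * int b * x - -1) - 4 * int b * x" by (rule dvd_diff[rotated])
 hence "int p dvd 1" by simp
 thus False using p_pos by simp
qed

private lemma nat_mod_not_dvd:
 assumes "\<not> int p dvd x" "j > 0"
 shows "\<not> p dvd nat (x mod int (p ^ j))"
proof
 assume "p dvd nat (x mod int (p ^ j))"
 hence "int p dvd int (nat (x mod int (p ^ j)))" by (simp only: int_dvd_int_iff)
 hence "int p dvd x mod int (p ^ j)" using p_pos by simp
 moreover have "int p dvd int (p ^ j)" using assms(2) by (simp add: dvd_power)
 ultimately show False using assms(1) by (simp only: dvd_mod_iff)
qed

private lemma cong_divide:
 assumes "[x = y] (mod int N)" "N > 0" "g \<in> S_half k"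
 shows "g (w + of_int x / of_nat N) = g (w + of_int y / of_nat N)"
proof -
 obtain t where "y = x + int N * t" using assms(1) by (auto simp: cong_iff_lin)
 hence eq: "w + of_int y / of_nat N = w + of_int x / of_nat N + of_int t"
  using assms(2) by (simp add: add_divide_distrib)
 show ?thesis unfolding eq by (rule S_half_periodic[OF assms(3), symmetric])
qed

private lemma shimura_symbol_prime_power: "shimura_symbol (4 * a) (int (p ^ j)) = Legendre a (int p) ^ j"
proof -
 have "prime_factorization (int p ^ j) = replicate_mset j (int p)"
  using p(1) by (intro prime_factorization_prime_power) simp
 thus ?thesis using p by (simp add: shimura_symbol_4) (simp add: shimura_symbol_def)
qed

text \<open>The substitution of \<open>b'\<close> for \<open>b\<close>, with
  \<open>4 b b' = -1\<close> modulo \<open>p^j\<close>, permutes the units. Each term gains the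
  symbol \<open>(b' / p)^j\<close>, which the odd power \<open>2 k + 1\<close> leaves
  unchanged.\<close>

private lemma fricke_units:
 assumes f: "f \<in> S_half k" and z: "z \<in> \<H>" and j: "j > 0"
 shows "(\<Sum>b\<in>units j. f (-1 / (4 * z) / of_nat (p^2) + of_nat b / of_nat (p ^ j))) =
  (inverse (theta_eps (int (p ^ j))) * of_real (sqrt (real (p^2) / real (p ^ j)))) ^ (2 * k + 1) * c z *
  (\<Sum>b\<in>units j. L (int b) ^ j * fricke k f (of_real ((real p / real (p ^ j))\<^sup>2) * z + of_nat b / of_nat (p ^ j)))"
proof -
 let ?N = "p ^ j" and ?r = "(real p / real (p ^ j))\<^sup>2" and ?g = "fricke k f"
 let ?s = "inverse (theta_eps (int ?N)) * of_real (sqrt (real (p^2) / real ?N))"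
 have pos: "?N > 0" "int ?N > 0" "?r > 0" using p_pos by simp_all
 define \<sigma> where "\<sigma> b = (SOME b'. [4 * int b * b' = -1] (mod int ?N))" for b
 have \<sigma>: "[4 * int b * \<sigma> b = -1] (mod int ?N)" if "b \<in> units j" for b
  unfolding \<sigma>_def by (rule someI_ex[OF ex_inverse]) (use that in \<open>simp add: units_def\<close>)
 have nd: "\<not> int p dvd \<sigma> b" if "b \<in> units j" for b by (rule inverse_not_dvd[OF \<sigma>[OF that] j])
 have "f (-1 / (4 * z) / of_nat (p^2) + of_nat b / of_nat ?N) =
   ?s ^ (2 * k + 1) * c z * (L (\<sigma> b) ^ j * ?g (of_real ?r * z + of_int (\<sigma> b) / of_nat ?N))" if bU: "b \<in> units j" for b
 proof -
  obtain a where a: "4 * int b * \<sigma> b + 1 = int ?N * a"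
   using \<sigma>[OF bU] unfolding cong_iff_dvd_diff by (auto elim: dvdE)
  have Lw: "(L (\<sigma> b) ^ j) ^ (2 * k + 1) = L (\<sigma> b) ^ j"
  proof -
   have "(L (\<sigma> b) ^ j)\<^sup>2 = ((L (\<sigma> b))\<^sup>2) ^ j" by (simp only: power_mult[symmetric] mult.commute)
   also have "(L (\<sigma> b))\<^sup>2 = 1" using Legendre_power2[OF nd[OF bU]] by (metis of_int_1 of_int_power)
   finally show ?thesis by (simp add: power_mult)
  qed
  have "of_int (int ?N) * ?r = real (p^2) / real ?N" using pos by (simp add: power2_eq_square)
  hence base: "inverse (theta_eps (int ?N)) * of_int (shimura_symbol (4 * \<sigma> b) (int ?N)) * of_real (sqrt (of_int (int ?N) * ?r)) =
    ?s * L (\<sigma> b) ^ j" unfolding shimura_symbol_prime_power of_int_power by (simp only: mult_ac)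
  have "(of_int (int ?N))\<^sup>2 * of_real ?r = (of_nat (p^2) :: complex)" using p_pos by (simp add: power_divide)
  hence "of_int (int b) / of_int (int ?N) - 1 / (4 * (of_int (int ?N))\<^sup>2 * of_real ?r * z) =
    -1 / (4 * z) / of_nat (p^2) + of_nat b / of_nat ?N" by (simp add: mult_ac)
  thus ?thesis using fricke_hecke_rep[OF f z pos(2) a pos(3)]
   unfolding base power_mult_distrib[of ?s "L (\<sigma> b) ^ j"] Lw by (simp only: of_int_of_nat_eq mult_ac)
 qed
 hence "(\<Sum>b\<in>units j. f (-1 / (4 * z) / of_nat (p^2) + of_nat b / of_nat ?N)) =
   ?s ^ (2 * k + 1) * c z * (\<Sum>b\<in>units j. L (\<sigma> b) ^ j * ?g (of_real ?r * z + of_int (\<sigma> b) / of_nat ?N))"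
  unfolding sum_distrib_left by (rule sum.cong[OF refl])
 also have "(\<Sum>b\<in>units j. L (\<sigma> b) ^ j * ?g (of_real ?r * z + of_int (\<sigma> b) / of_nat ?N)) =
   (\<Sum>b\<in>units j. L (int b) ^ j * ?g (of_real ?r * z + of_int (int b) / of_nat ?N))"
 proof (rule sum_residues_reindex[where m = ?N])
  fix b assume b: "b \<in> units j"
  show "nat (\<sigma> b mod int ?N) \<in> units j"
   using nat_mod_not_dvd[OF nd[OF b] j] pos by (simp add: units_def nat_less_iff)
  fix d assume d: "d \<in> units j" and eq: "[\<sigma> b = \<sigma> d] (mod int ?N)"
  have "[int b = int d] (mod int ?N)" by (rule inverse_inj[OF \<sigma>[OF b] \<sigma>[OF d] eq])
  thus "b = d" using b d by (simp add: units_def cong_def flip: zmod_int of_nat_power)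
 next
  fix x y assume xy: "[x = y] (mod int ?N)"
  hence "[x = y] (mod int p)" by (rule cong_dvd_modulus) (use j in \<open>simp add: dvd_power\<close>)
  thus "L x ^ j * ?g (of_real ?r * z + of_int x / of_nat ?N) = L y ^ j * ?g (of_real ?r * z + of_int y / of_nat ?N)"
   unfolding cong_divide[OF xy pos(1) fricke_in_S_half[OF f]] by (simp add: Legendre_cong)
 qed (use pos in \<open>auto simp: units_def\<close>)
 finally show ?thesis by simp
qed

private lemma fricke_part2:
 assumes f: "f \<in> S_half k"
 shows "fricke k (part2 f) = part2 (fricke k f)"
proof
 fix z
 show "fricke k (part2 f) z = part2 (fricke k f) z"
 proof (cases "z \<in> \<H>")
  case False
  hence "z / of_nat (p^2) + of_nat b / of_nat (p^2) \<notin> \<H>" for b using p_pos by (simp add: H_iff zero_less_divide_iff)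
  thus ?thesis using False by (simp add: part2_def fricke_def)
 next
  case True
  have "theta_eps (int (p^2)) = 1"
  proof -
   obtain q where "p = 2 * q + 1" using p(2) by (auto elim: oddE)
   hence "int (p^2) = 4 * int (q * q + q) + 1" by (simp add: power2_eq_square algebra_simps)
   thus ?thesis unfolding theta_eps_def by presburger
  qed
  moreover have "of_real ((real p / real (p^2))\<^sup>2) * z = z / of_nat (p^2)"
   using p_pos by (simp add: power2_eq_square)
  moreover have "(L (int b))\<^sup>2 = 1" if "b \<in> units 2" for b
   using that Legendre_power2[of "int p" "int b"] by (simp add: units_def flip: of_int_power)
  ultimately have "(\<Sum>b\<in>units 2. f (-1 / (4 * z) / of_nat (p^2) + of_nat b / of_nat (p^2))) =
    c z * (\<Sum>b\<in>units 2. fricke k f (z / of_nat (p^2) + of_nat b / of_nat (p^2)))"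
   using fricke_units[OF f True, of 2] p_pos by (simp cong: sum.cong)
  thus ?thesis unfolding fricke_def[of k "part2 f"] part2_def
   using True csqrt_power_nonzero[OF True, of "2 * k + 1"] by (simp del: power_Suc)
 qed
qed

text \<open>Here the exact value of the Gauss sum enters, including its sign: it turns the
  automorphy factor of the representatives modulo \<open>p\<close> into the constant of the
  twist.\<close>

private lemma twist_const_eq: "(inverse (theta_eps (int p)) * of_real (sqrt (real p))) ^ (2 * k + 1) / of_nat (p^2) = twist_const"
proof -
 let ?q = "complex_of_real (sqrt (real p))" and ?e = "theta_eps (int p)"
 let ?s = "inverse ?e * ?q"
 have q2: "?q * ?q = of_nat p" by (simp flip: of_real_mult)
 have e0: "?e \<noteq> 0" "?q \<noteq> 0" using p_pos by (simp_all add: theta_eps_def)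
 have e2: "(inverse ?e)\<^sup>2 = ?e\<^sup>2" by (simp add: theta_eps_def)
 have "?s ^ (2 * k + 1) = (?s\<^sup>2) ^ k * ?s" by (simp add: power_mult)
 also have "?s\<^sup>2 = ?e\<^sup>2 * of_nat p" unfolding power_mult_distrib e2 using q2 by (simp add: power2_eq_square)
 also have "(?e\<^sup>2 * of_nat p) ^ k = (?e\<^sup>2) ^ k * (of_nat p ^ (k - 1) * of_nat p)"
  unfolding power_mult_distrib using k power_minus_mult[of k "of_nat p :: complex"] by simp
 finally have S: "?s ^ (2 * k + 1) = (?e\<^sup>2) ^ k * (of_nat p ^ (k - 1) * of_nat p) * ?s" .
 have "?s ^ (2 * k + 1) / of_nat (p^2) = (?e\<^sup>2) ^ k * of_nat p ^ (k - 1) * (?s / of_nat p)"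
  unfolding S using p_pos by (simp add: power2_eq_square)
 also have "?s / of_nat p = 1 / (?e * ?q)" unfolding q2[symmetric] using e0 by (simp add: divide_inverse)
 finally show ?thesis unfolding gauss_sum_value[OF p] theta_eps_power2[OF p] by simp
qed

private lemma fricke_part1:
 assumes f: "f \<in> S_half k"
 shows "fricke k (part1 f) = part3 (fricke k f)"
proof
 fix z
 let ?g = "fricke k f" and ?s = "inverse (theta_eps (int p)) * of_real (sqrt (real p))"
 have twist: "gauss_twist p ?g z = (\<Sum>b\<in>units 1. L (int b) * ?g (z + of_nat b / of_nat p))"
  unfolding gauss_twist_def by (rule sum.mono_neutral_right) (auto simp: units_def Legendre_eq_0_iff)
 show "fricke k (part1 f) z = part3 ?g z"
 proof (cases "z \<in> \<H>")
  case False
  hence "z + of_nat b / of_nat p \<notin> \<H>" for b by (simp add: H_iff)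
  thus ?thesis using False by (simp add: part3_def twist fricke_def)
 next
  case True
  have "real (p^2) / real p = real p" using p_pos by (simp add: power2_eq_square)
  hence "(\<Sum>b\<in>units 1. f (-1 / (4 * z) / of_nat (p^2) + of_nat b / of_nat p)) = ?s ^ (2 * k + 1) * c z * gauss_twist p ?g z"
   using fricke_units[OF f True zero_less_one] p_pos unfolding twist power_one_right by (simp del: power_Suc)
  hence "fricke k (part1 f) z = (?s ^ (2 * k + 1) / of_nat (p^2)) * gauss_twist p ?g z"
   unfolding fricke_def[of k "part1 f"] part1_def
   using True csqrt_power_nonzero[OF True, of "2 * k + 1"] by (simp del: power_Suc)
  thus ?thesis unfolding twist_const_eq part3_def .
 qed
qed

text \<open>The identities for \<open>part3\<close> and \<open>part4\<close> follow from those for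
  \<open>part1\<close> and \<open>part0\<close> by applying the involution once more.\<close>

lemma fricke_T_half_fun:
 assumes f: "f \<in> S_half k"
 shows "fricke k (T_half_fun f) = T_half_fun (fricke k f)"
proof -
 let ?g = "fricke k f"
 have g: "?g \<in> S_half k" by (rule fricke_in_S_half[OF f])
 have zero: "h z = 0" if "h \<in> S_half k" "z \<notin> \<H>" for h z using that by (simp add: S_half_iff)
 have FF: "fricke k ?g = f" by (rule fricke_fricke) (rule zero[OF f])
 have inv: "fricke k (fricke k (part0 ?g)) = part0 ?g" "fricke k (fricke k (part1 ?g)) = part1 ?g"
 proof -
  have "part0 ?g z = 0" if "z \<notin> \<H>" for z
  proof -
   have "z / of_nat (p^2) \<notin> \<H>" using that p_pos by (simp add: H_iff zero_less_divide_iff)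
   thus ?thesis by (simp add: part0_def zero[OF g])
  qed
  thus "fricke k (fricke k (part0 ?g)) = part0 ?g" by (rule fricke_fricke)
  have "part1 ?g z = 0" if "z \<notin> \<H>" for z
  proof -
   have "z / of_nat (p^2) + of_nat b / of_nat p \<notin> \<H>" for b using that p_pos by (simp add: H_iff zero_less_divide_iff)
   thus ?thesis by (simp add: part1_def zero[OF g])
  qed
  thus "fricke k (fricke k (part1 ?g)) = part1 ?g" by (rule fricke_fricke)
 qed
 have "fricke k (part4 f) = part0 ?g" using inv(1) unfolding fricke_part0[OF g] FF .
 moreover have "fricke k (part3 f) = part1 ?g" using inv(2) unfolding fricke_part1[OF g] FF .
 ultimately show ?thesis
  unfolding T_half_fun_parts fricke_add fricke_part0[OF f] fricke_part1[OF f] fricke_part2[OF f] by (simp add: add_ac)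
qed

lemma cuspidal_T_half_fun:
 assumes "cuspidal \<kappa> f"
 shows "cuspidal \<kappa> (T_half_fun f)"
proof -
 have 1: "cuspidal \<kappa> (\<lambda>z. f ((z + of_nat b) / of_nat (p^2)))" for b
  using cuspidal_affine[OF assms, of 1 "real (p^2)" "real b"] p_pos by simp
 have 2: "cuspidal \<kappa> (\<lambda>z. f (z + of_nat b / of_nat p))" for b
  using cuspidal_affine[OF assms, of 1 1 "real b / real p"] by simp
 have 3: "cuspidal \<kappa> (\<lambda>z. f (of_nat (p^2) * z))"
  using cuspidal_affine[OF assms, of "real (p^2)" 1 0] p_pos by simp
 have "cuspidal \<kappa> (\<lambda>z. 1 / of_nat (p^2) * (\<Sum>b<p\<^sup>2. f ((z + of_nat b) / of_nat (p^2)))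
  + twist_const * (\<Sum>b<p. of_int (Legendre (int b) (int p)) * f (z + of_nat b / of_nat p)) + of_nat p ^ (2 * k - 1) * f (of_nat (p^2) * z))"
  by (intro cuspidal_add cuspidal_cmult cuspidal_sum 1 2 3)
 thus ?thesis by (simp add: T_half_fun_def[abs_def] gauss_twist_def)
qed

end

text \<open>Since \<open>T_(p^2)\<close> commutes with \<open>fricke\<close>, both periodicities in
  \<open>S_half_criterion\<close> reduce to the existence of expansions in integral powers of
  \<open>q\<close>.\<close>

lemma T_half_S_half:
 assumes p: "prime p" "odd p" and k: "k > 0" and f: "f \<in> S_half k"
 shows "T_half k p f = T_half_fun p k f" "T_half k p f \<in> S_half k" "fricke k (T_half k p f) = T_half k p (fricke k f)"
proof -
 have g: "fricke k f \<in> S_half k" by (rule fricke_in_S_half[OF f])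
 note q = S_half_has_qexp(1)[OF f] S_half_has_qexp(1)[OF g]
 note T = T_half_eq[OF p k q(1)] T_half_eq[OF p k q(2)]
 show "T_half k p f = T_half_fun p k f" by (rule T(1))
 show F: "fricke k (T_half k p f) = T_half k p (fricke k f)" unfolding T by (rule fricke_T_half_fun[OF p k f])
 show "T_half k p f \<in> S_half k"
 proof (cases "\<exists>z1. f z1 \<noteq> 0")
  case False
  hence "f = (\<lambda>_. 0)" by auto
  hence "T_half k p f = f" unfolding T(1) by (simp add: T_half_fun_def[OF p k] gauss_twist_def fun_eq_iff)
  thus ?thesis using f by simp
 next
  case True
  then obtain z1 where "f z1 \<noteq> 0" by blast
  thus ?thesis
  proof (rule S_half_criterion[OF f])
   show "cuspidal (real k + 1 / 2) (T_half k p f)"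
    unfolding T by (rule cuspidal_T_half_fun[OF p k S_half_cuspidal[OF f]])
   show "T_half k p f (z + 1) = T_half k p f z" for z
    unfolding T by (rule has_qexp_periodic[OF has_qexp_T_half_fun[OF p k q(1)]])
   show "fricke k (T_half k p f) (z + 1) = fricke k (T_half k p f) z" for z
    unfolding F unfolding T by (rule has_qexp_periodic[OF has_qexp_T_half_fun[OF p k q(2)]])
  qed
 qed
qed

lemma T_half_cmult:
 assumes p: "prime p" "odd p" and k: "k > 0" and f: "f \<in> S_half k"
 shows "T_half k p (\<lambda>z. d * f z) = (\<lambda>z. d * T_half k p f z)"
proof -
 have "(\<lambda>z. d * f z) \<in> S_half k" by (rule fun_vs.subspace_scale[OF subspace_S_half f])
 note T = T_half_S_half(1)[OF p k this] T_half_S_half(1)[OF p k f]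
 show ?thesis unfolding T
  by (intro ext) (simp add: T_half_fun_def[OF p k] gauss_twist_def sum_distrib_left sum_divide_distrib distrib_left mult_ac)
qed

text \<open>4 is a square prime to \<open>p\<close>: multiplying the index by it changes neither the
  quadratic character nor divisibility by \<open>p^2\<close>.\<close>

lemma T_half_U_op:
 assumes p: "prime p" "odd p" and k: "k > 0" and f: "f \<in> S_half k"
 shows "T_half k p (U_op 4 f) = U_op 4 (T_half k p f)"
proof -
 note q = S_half_has_qexp(1)[OF f]
 note Uq = has_qexp_U_op[OF zero_less_numeral q]
 have "T_half_coeff k p (\<lambda>n. qcoeff f (4 * n)) = (\<lambda>n. T_half_coeff k p (qcoeff f) (4 * n))"
 proof
  fix n
  have "coprime (p^2) 4" using p(2) coprime_power_right_iff[of "p\<^sup>2" 2 2] by simp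
  hence d: "p\<^sup>2 dvd 4 * n \<longleftrightarrow> p\<^sup>2 dvd n" by (simp add: coprime_dvd_mult_right_iff)
  have "4 * n div p\<^sup>2 = 4 * (n div p\<^sup>2)" if "p\<^sup>2 dvd n" using that by (simp add: div_mult_swap)
  moreover have "Legendre ((-1) ^ k * int (4 * n)) (int p) = Legendre ((-1) ^ k * int n) (int p)"
  proof -
   have "shimura_symbol (4 * ((-1) ^ k * int n)) (int p) = shimura_symbol ((-1) ^ k * int n) (int p)"
    using p by (intro shimura_symbol_4) auto
   thus ?thesis using p(1) by (simp add: shimura_symbol_prime mult_ac)
  qed
  ultimately show "T_half_coeff k p (\<lambda>n. qcoeff f (4 * n)) n = T_half_coeff k p (qcoeff f) (4 * n)"
   unfolding T_half_coeff_def d by (simp add: mult.left_commute)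
 qed
 thus ?thesis
  using has_qexp_unique_fun[OF has_qexp_T_half_fun[OF p k Uq]] has_qexp_U_op[OF zero_less_numeral has_qexp_T_half_fun[OF p k q]]
  unfolding T_half_eq[OF p k q] T_half_eq[OF p k Uq] by simp
qed

lemma kohnen_op_T_half:
 assumes p: "prime p" "odd p" and k: "k > 0" and f: "f \<in> S_half k"
 shows "kohnen_op k (T_half k p f) = T_half k p (kohnen_op k f)"
proof -
 note U = U_op_4_in_S_half[OF f]
 have "kohnen_op k (T_half k p f) = (\<lambda>z. plus_sign k * T_half k p (fricke k (U_op 4 f)) z)"
  unfolding kohnen_op_def[abs_def] T_half_U_op[OF p k f, symmetric] T_half_S_half(3)[OF p k U] ..
 also have "... = T_half k p (kohnen_op k f)"
  unfolding kohnen_op_def[abs_def] by (rule T_half_cmult[OF p k fricke_in_S_half[OF U], symmetric])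
 finally show ?thesis .
qed

subsection \<open>Comparison with the newspace\<close>

lemma fricke_fricke_S_half: "f \<in> S_half k ==> fricke k (fricke k f) = f"
 by (rule fricke_fricke) (simp add: S_half_iff)

lemma S_minus_subset: "S_minus k \<subseteq> S_half k" by (auto simp: S_minus_eq)

lemma subspace_S_minus: "fun_vs.subspace (S_minus k)"
proof -
 interpret hermitian_space "S_half k" "petersson (real k + 1 / 2) 4" by (rule hermitian_space_S_half)
 have "h \<in> S_half k" if h: "h \<in> {f + g | f g. f \<in> S_plus k \<and> g \<in> A_plus k}" for h
 proof -
  obtain f g where fg: "h = f + fricke k g" "f \<in> S_plus k" "g \<in> S_plus k" using h by (auto simp: A_plus_eq)
  hence "f \<in> S_half k" "g \<in> S_half k" by (auto simp: S_plus_iff)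
  thus ?thesis unfolding fg(1) by (intro V_add fricke_in_S_half)
 qed
 hence "{f + g | f g. f \<in> S_plus k \<and> g \<in> A_plus k} \<subseteq> S_half k" by blast
 from subspace_orthogonal[OF this] show ?thesis unfolding S_minus_def orth_complement_def .
qed

lemma U_op_4_S_minus:
 assumes "f \<in> S_minus k"
 shows "U_op 4 f = (\<lambda>z. - (2 ^ k / 2) * plus_sign k * fricke k f z)"
proof
 fix z
 have f: "f \<in> S_half k" and K: "kohnen_op k f = (\<lambda>z. - (2 ^ k / 2) * f z)" using assms by (auto simp: S_minus_eq)
 have "fricke k (kohnen_op k f) = (\<lambda>z. plus_sign k * fricke k (fricke k (U_op 4 f)) z)"
  unfolding kohnen_op_def[abs_def] by (rule fricke_cmult)
 hence "- (2 ^ k / 2) * fricke k f z = plus_sign k * U_op 4 f z"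
  unfolding K fricke_cmult fricke_fricke_S_half[OF U_op_4_in_S_half[OF f]] by (rule fun_cong)
 hence "plus_sign k * (- (2 ^ k / 2) * fricke k f z) = (plus_sign k * plus_sign k) * U_op 4 f z" by (simp only: mult.assoc)
 thus "U_op 4 f z = - (2 ^ k / 2) * plus_sign k * fricke k f z" by (simp add: mult_ac)
qed

lemma S_minus_fricke: "f \<in> S_minus k ==> fricke k f \<in> S_minus k"
 by (auto simp: S_minus_eq fricke_in_S_half fricke_fricke_S_half)

lemma S_minus_U_op: "f \<in> S_minus k ==> U_op 4 f \<in> S_minus k"
 unfolding U_op_4_S_minus by (rule fun_vs.subspace_scale[OF subspace_S_minus S_minus_fricke])

lemma S_minus_T_half:
 assumes p: "prime p" "odd p" and k: "k > 0" and f: "f \<in> S_minus k"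
 shows "T_half k p f \<in> S_minus k"
proof -
 have fS: "f \<in> S_half k" and K: "kohnen_op k f = (\<lambda>z. - (2 ^ k / 2) * f z)"
  "kohnen_op k (fricke k f) = (\<lambda>z. - (2 ^ k / 2) * fricke k f z)" using f by (auto simp: S_minus_eq)
 have gS: "fricke k f \<in> S_half k" by (rule fricke_in_S_half[OF fS])
 note T = T_half_S_half[OF p k] and c = T_half_cmult[OF p k]
 show ?thesis unfolding S_minus_eq
 proof (intro CollectI conjI)
  show "T_half k p f \<in> S_half k" by (rule T(2)[OF fS])
  show "kohnen_op k (T_half k p f) = (\<lambda>z. - (2 ^ k / 2) * T_half k p f z)"
   unfolding kohnen_op_T_half[OF p k fS] K by (rule c[OF fS])
  show "kohnen_op k (fricke k (T_half k p f)) = (\<lambda>z. - (2 ^ k / 2) * fricke k (T_half k p f) z)"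
   unfolding T(3)[OF fS] kohnen_op_T_half[OF p k gS] K by (rule c[OF gS])
 qed
qed

section \<open>Transport along the Niwa map\<close>

context
 fixes k :: nat and \<psi> :: "cfun => cfun"
 assumes k: "k > 0" and niwa: "niwa_map k \<psi>"
begin

lemma weight_pos: "2 * k > 0" using k by simp

lemmas niwa_unfolded = niwa[unfolded niwa_map_def hecke_iso_def linear_iso_on_def]
lemmas niwa_bij = niwa_unfolded[THEN conjunct1, THEN conjunct1]
lemmas niwa_hecke = niwa_unfolded[THEN conjunct2]

lemma niwa_add: "f \<in> S_half k ==> g \<in> S_half k ==> \<psi> (f + g) = \<psi> f + \<psi> g"
 by (rule bspec[OF bspec[OF niwa_unfolded[THEN conjunct1, THEN conjunct2, THEN conjunct1]]])

lemma niwa_scale: "f \<in> S_half k ==> \<psi> (\<lambda>z. c * f z) = (\<lambda>z. c * \<psi> f z)"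
 by (rule bspec[OF spec[OF niwa_unfolded[THEN conjunct1, THEN conjunct2, THEN conjunct2]]])

lemma niwa_T_int: "f \<in> S_half k ==> prime p ==> odd p ==> T_int (2 * k) p (\<psi> f) = \<psi> (T_half k p f)"
 using niwa_hecke by blast

lemma niwa_U_op: "f \<in> S_half k ==> U_op 2 (\<psi> f) = \<psi> (U_op 4 f)" using niwa_hecke by blast

lemma niwa_in: "f \<in> S_half k ==> \<psi> f \<in> S_int (2 * k) 2" using niwa_bij by (rule bij_betwE[rule_format])

lemma niwa_inject: "f \<in> S_half k ==> g \<in> S_half k ==> \<psi> f = \<psi> g ==> f = g"
 using niwa_bij by (meson bij_betw_imp_inj_on inj_onD)

lemma niwa_surj:
 assumes "h \<in> S_int (2 * k) 2"
 obtains f where "f \<in> S_half k" "\<psi> f = h"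
proof -
 have "h \<in> \<psi> ` S_half k" using assms bij_betw_imp_surj_on[OF niwa_bij] by simp
 thus thesis by (rule imageE) (rule that, simp_all)
qed

lemma niwa_T:
 assumes "prime p" "odd p" "f \<in> S_half k"
 shows "hecke_fun (2 * k) p (\<psi> f) = \<psi> (T_half k p f)"
proof -
 have "T_int (2 * k) p (\<psi> f) = \<psi> (T_half k p f)" by (rule niwa_T_int[OF assms(3,1,2)])
 moreover have "T_int (2 * k) p (\<psi> f) = hecke_fun (2 * k) p (\<psi> f)"
  by (rule T_int_eq[OF _ weight_pos S_int_has_qexp(1)[OF _ weight_pos niwa_in[OF assms(3)]]])
    (use odd_prime_gt_2[OF assms(1,2)] in auto)
 ultimately show ?thesis by simp
qed

lemma niwa_0: "\<psi> 0 = 0"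
 using niwa_scale[OF fun_vs.subspace_0[OF subspace_S_half], of 0] by (simp add: zero_fun_def)

lemma niwa_eq_0_iff: "f \<in> S_half k ==> \<psi> f = 0 \<longleftrightarrow> f = 0"
 using niwa_inject[OF _ fun_vs.subspace_0[OF subspace_S_half]] niwa_0 by metis

lemma niwa_eigen:
 assumes "prime p" "odd p" "f \<in> S_half k"
 shows "hecke_fun (2 * k) p (\<psi> f) = (\<lambda>z. l * \<psi> f z) \<longleftrightarrow> T_half k p f = (\<lambda>z. l * f z)"
proof -
 have "(\<lambda>z. l * f z) \<in> S_half k" by (rule fun_vs.subspace_scale[OF subspace_S_half assms(3)])
 thus ?thesis unfolding niwa_T[OF assms] niwa_scale[OF assms(3), symmetric]
  using niwa_inject[OF T_half_S_half(2)[OF assms(1,2) k assms(3)]] by auto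
qed

text \<open>The eigenvalue systems match under \<open>\<psi>\<close>, so multiplicity one for
  newforms of level 2 descends. Only \<open>f\<close> has to map to a newform, which admits
  \<open>fricke k f\<close> and \<open>U_op 4 f\<close> in the place of \<open>g\<close>.\<close>

lemma niwa_multiplicity_one:
 assumes f: "f \<in> S_half k" "\<psi> f \<in> S_new (2 * k) 2" "f \<noteq> 0" and g: "g \<in> S_half k"
  and eig: "\<And>p. prime p ==> odd p ==> \<exists>l. T_half k p f = (\<lambda>z. l * f z) \<and> T_half k p g = (\<lambda>z. l * g z)"
 obtains c where "g = (\<lambda>z. c * f z)"
proof -
 define l where "l p = (SOME l. T_half k p f = (\<lambda>z. l * f z) \<and> T_half k p g = (\<lambda>z. l * g z))" for p
 have l: "T_half k p f = (\<lambda>z. l p * f z)" "T_half k p g = (\<lambda>z. l p * g z)" if "prime p" "odd p" for p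
  using someI_ex[OF eig[OF that]] by (auto simp: l_def)
 have "\<psi> f \<noteq> 0" using f niwa_eq_0_iff by blast
 hence "\<exists>c. \<psi> g = (\<lambda>z. c * \<psi> f z)"
  using l niwa_eigen f(1) g by (intro S_new_multiplicity_one[OF weight_pos f(2) _ niwa_in[OF g], where l = l]) auto
 then obtain c where "\<psi> g = \<psi> (\<lambda>z. c * f z)" using niwa_scale[OF f(1)] by metis
 hence "g = (\<lambda>z. c * f z)" using niwa_inject[OF g fun_vs.subspace_scale[OF subspace_S_half f(1)]] by blast
 thus thesis by (rule that)
qed

lemma niwa_new_eigenform_S_minus:
 assumes f: "f \<in> S_half k" "\<psi> f \<in> S_new (2 * k) 2" "f \<noteq> 0"
  and eig: "\<And>p. prime p ==> odd p ==> \<exists>l. T_half k p f = (\<lambda>z. l * f z)"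
 shows "f \<in> S_minus k"
proof -
 have F: "fricke k f \<in> S_half k" and U: "U_op 4 f \<in> S_half k"
  using f(1) by (auto intro: fricke_in_S_half U_op_4_in_S_half)
 obtain c where c: "fricke k f = (\<lambda>z. c * f z)"
 proof (rule niwa_multiplicity_one[OF f F])
  fix p :: nat assume p: "prime p" "odd p"
  obtain l where l: "T_half k p f = (\<lambda>z. l * f z)" using eig[OF p] by blast
  hence "T_half k p (fricke k f) = (\<lambda>z. l * fricke k f z)"
   unfolding T_half_S_half(3)[OF p k f(1), symmetric] by (simp only: fricke_cmult)
  with l show "\<exists>l. T_half k p f = (\<lambda>z. l * f z) \<and> T_half k p (fricke k f) = (\<lambda>z. l * fricke k f z)" by blast
 qed blast
 note Uc = U_op_cmult[OF zero_less_numeral S_half_has_qexp(1)[OF f(1)]]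
 obtain u where u: "U_op 4 f = (\<lambda>z. u * f z)"
 proof (rule niwa_multiplicity_one[OF f U])
  fix p :: nat assume p: "prime p" "odd p"
  obtain l where l: "T_half k p f = (\<lambda>z. l * f z)" using eig[OF p] by blast
  hence "T_half k p (U_op 4 f) = (\<lambda>z. l * U_op 4 f z)" unfolding T_half_U_op[OF p k f(1)] by (simp only: Uc)
  with l show "\<exists>l. T_half k p f = (\<lambda>z. l * f z) \<and> T_half k p (U_op 4 f) = (\<lambda>z. l * U_op 4 f z)" by blast
 qed blast
 obtain z0 where z0: "f z0 \<noteq> 0" using f(3) by (auto simp: fun_eq_iff)
 have c2: "c * c = 1"
 proof -
  have "fricke k (fricke k f) = (\<lambda>z. c * (c * f z))" unfolding c fricke_cmult by (simp only: c)
  hence "f z0 = c * (c * f z0)" unfolding fricke_fricke_S_half[OF f(1)] by (rule fun_cong)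
  thus ?thesis using z0 by simp
 qed
 define q where "q = plus_sign k * (u * c)"
 have K: "kohnen_op k f = (\<lambda>z. q * f z)"
  unfolding kohnen_op_def[abs_def] u fricke_cmult c by (simp only: q_def mult.assoc)
 have Ks: "kohnen_op k (\<lambda>z. d * f z) = (\<lambda>z. q * (d * f z))" for d
  unfolding kohnen_op_def[abs_def] by (simp only: Uc u fricke_cmult c q_def mult_ac)
 \<comment> \<open>Applying \<open>kohnen_op_plus\<close> to an eigenvector makes
   \<open>(q + 2^(k-1)) f\<close> a plus form, on which \<open>K\<close> is \<open>2^k\<close>; so
   \<open>q\<close> is one of the two eigenvalues.\<close>
 have h: "(\<lambda>z. (q + 2 ^ k / 2) * f z) \<in> S_plus k"
  using kohnen_op_plus[OF f(1) kohnen_op_in_S_half[OF f(1)]] unfolding K by (simp only: distrib_right)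
 hence "(\<lambda>z. q * ((q + 2 ^ k / 2) * f z)) = (\<lambda>z. 2 ^ k * ((q + 2 ^ k / 2) * f z))"
  unfolding S_plus_eq by (simp only: mem_Collect_eq Ks)
 hence "q * ((q + 2 ^ k / 2) * f z0) = 2 ^ k * ((q + 2 ^ k / 2) * f z0)" by (rule fun_cong)
 hence "(q - 2 ^ k) * (q + 2 ^ k / 2) * f z0 = 0" by (simp only: left_diff_distrib mult.assoc diff_self)
 hence "(q - 2 ^ k) * (q + 2 ^ k / 2) = 0" using z0 by simp
 \<comment> \<open>As \<open>c\<close> and the sign have modulus 1, \<open>q = 2^k\<close> would
   give \<open>U_2\<close> the eigenvalue \<open>u\<close> of modulus \<open>2^k\<close> on
   \<open>\<psi> f\<close>, which is the extremal case.\<close>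
 moreover have "q \<noteq> 2 ^ k"
 proof
  assume q2: "q = 2 ^ k"
  have "c = 1 \<or> c = -1" using c2 by (simp add: square_eq_1_iff)
  hence "cmod c = 1" by auto
  moreover have "cmod (plus_sign k) = 1" by (simp add: plus_sign_def norm_power)
  ultimately have "cmod u = 2 ^ k" using arg_cong[OF q2, of cmod] by (simp add: q_def norm_mult norm_power)
  moreover have "U_op 2 (\<psi> f) = (\<lambda>z. u * \<psi> f z)" unfolding niwa_U_op[OF f(1)] u by (rule niwa_scale[OF f(1)])
  ultimately have "\<psi> f = 0" using niwa_in[OF f(1)] by (intro U_op_2_extremal_eigenvalue[OF k]) auto
  thus False using f niwa_eq_0_iff by blast
 qed
 ultimately have q: "q = - (2 ^ k / 2)" by (simp add: eq_neg_iff_add_eq_0)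
 have "kohnen_op k (fricke k f) = (\<lambda>z. q * fricke k f z)" unfolding c by (rule Ks)
 thus ?thesis unfolding S_minus_eq using f(1) K unfolding q by blast
qed

lemma subspace_niwa_image:
 assumes V: "fun_vs.subspace V" "V \<subseteq> S_half k"
 shows "fun_vs.subspace (\<psi> ` V)"
proof (rule fun_vs.subspaceI)
 show "0 \<in> \<psi> ` V" using niwa_0 fun_vs.subspace_0[OF V(1)] by (metis image_eqI)
 show "x + y \<in> \<psi> ` V" if xy: "x \<in> \<psi> ` V" "y \<in> \<psi> ` V" for x y
 proof -
  obtain f g where fg: "f \<in> V" "x = \<psi> f" "g \<in> V" "y = \<psi> g" using xy by blast
  hence "\<psi> (f + g) = x + y" using niwa_add V(2) by blast
  thus ?thesis using fun_vs.subspace_add[OF V(1) fg(1,3)] by (metis image_eqI)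
 qed
 show "(\<lambda>z. d * x z) \<in> \<psi> ` V" if x: "x \<in> \<psi> ` V" for d x
 proof -
  obtain f where f: "f \<in> V" "x = \<psi> f" using x by blast
  hence "\<psi> (\<lambda>z. d * f z) = (\<lambda>z. d * x z)" using niwa_scale V(2) by blast
  thus ?thesis using fun_vs.subspace_scale[OF V(1) f(1), of d] by (metis image_eqI)
 qed
qed

definition minus_eigs :: "cfun set"
 where "minus_eigs = {f \<in> S_minus k. f \<noteq> 0 \<and> (\<forall>p. prime p \<and> odd p \<longrightarrow> (\<exists>l. T_half k p f = (\<lambda>z. l * f z)))}"

text \<open>A new eigenform is \<open>\<psi> f\<close> for an eigenform \<open>f\<close>, which lies
  in \<open>S_minus\<close>; such eigenforms span the newspace by the spectral decomposition in
  integral weight.\<close>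

lemma S_new_subset_span: "S_new (2 * k) 2 \<subseteq> \<psi> ` fun_vs.span minus_eigs"
proof -
 let ?E = "{e \<in> S_new (2 * k) 2. e \<noteq> 0 \<and> (\<forall>p\<in>{p. prime p \<and> odd p}. \<exists>l. hecke_fun (2 * k) p e = (\<lambda>z. l * e z))}"
 have span: "fun_vs.span minus_eigs \<subseteq> S_minus k"
  by (rule fun_vs.span_minimal[OF _ subspace_S_minus]) (auto simp: minus_eigs_def)
 have "?E \<subseteq> \<psi> ` fun_vs.span minus_eigs"
 proof
  fix e assume e: "e \<in> ?E"
  hence eN: "e \<in> S_new (2 * k) 2" and e0: "e \<noteq> 0" by auto
  obtain f where f: "f \<in> S_half k" "\<psi> f = e" using eN S_new_subset[OF weight_pos] by (auto elim: niwa_surj)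
  have f0: "f \<noteq> 0" using f e0 niwa_0 by blast
  have eig: "\<exists>l. T_half k p f = (\<lambda>z. l * f z)" if "prime p" "odd p" for p
   using e that niwa_eigen[OF that f(1)] unfolding f(2) by blast
  have "f \<in> S_minus k" by (rule niwa_new_eigenform_S_minus[OF f(1) _ f0 eig]) (use f(2) eN in auto)
  hence "f \<in> minus_eigs" using f0 eig by (simp add: minus_eigs_def)
  thus "e \<in> \<psi> ` fun_vs.span minus_eigs" using f(2) fun_vs.span_base by blast
 qed
 hence "fun_vs.span ?E \<subseteq> \<psi> ` fun_vs.span minus_eigs"
  by (rule fun_vs.span_minimal[OF _ subspace_niwa_image[OF fun_vs.subspace_span order_trans[OF span S_minus_subset]]])
 thus ?thesis using S_new_span_eigenforms[OF weight_pos] by blast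
qed

text \<open>Once the newspace is known to lie in the image, subtracting the new part of
  \<open>h\<close> leaves an oldform \<open>b\<close> in the image, on which \<open>U_2^2\<close> is
  a scalar. Splitting \<open>b\<close> into eigenvectors of \<open>U_2\<close> shows that it is
  0.\<close>

lemma niwa_image_S_minus: "\<psi> ` S_minus k = S_new (2 * k) 2"
proof
 have span: "fun_vs.span minus_eigs \<subseteq> S_minus k"
  by (rule fun_vs.span_minimal[OF _ subspace_S_minus]) (auto simp: minus_eigs_def)
 thus sub: "S_new (2 * k) 2 \<subseteq> \<psi> ` S_minus k" using S_new_subset_span by blast
 show "\<psi> ` S_minus k \<subseteq> S_new (2 * k) 2"
 proof
  fix h assume "h \<in> \<psi> ` S_minus k"
  then obtain f where f: "f \<in> S_minus k" "h = \<psi> f" by blast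
  hence "h \<in> S_int (2 * k) 2" using niwa_in S_minus_subset by blast
  then obtain n b where nb: "n \<in> S_new (2 * k) 2" "b \<in> S_old (2 * k) 2" "h = n + b"
   by (rule S_int_decompose[OF weight_pos])
  have "b \<in> \<psi> ` S_minus k"
  proof -
   have "n \<in> \<psi> ` S_minus k" using nb(1) sub by blast
   hence "h - n \<in> \<psi> ` S_minus k"
    using f fun_vs.subspace_diff[OF subspace_niwa_image[OF subspace_S_minus S_minus_subset]] by blast
   thus ?thesis using nb(3) by simp
  qed
  then obtain g where g: "g \<in> S_minus k" "b = \<psi> g" by blast
  have gS: "g \<in> S_half k" "fricke k g \<in> S_half k" using g S_minus_subset fricke_in_S_half by auto
  \<comment> \<open>\<open>U_4\<close> acts on \<open>S_minus\<close> as \<open>t\<close> times the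
    Fricke involution, so \<open>U_2^2 = t^2 = 4^(k-1)\<close> on the image.\<close>
  define t where "t = - (2 ^ k / 2) * plus_sign k"
  have tt: "t * t = 4 ^ (k - 1)"
  proof -
   have "t * t = (2 ^ k / 2 * (2 ^ k / 2)) * (plus_sign k * plus_sign k)" by (simp add: t_def)
   also have "... = 4 ^ (k - 1)" using k by (cases k) (simp_all flip: power_mult_distrib)
   finally show ?thesis .
  qed
  have Ub: "U_op 2 b = (\<lambda>z. t * \<psi> (fricke k g) z)"
   unfolding g(2) niwa_U_op[OF gS(1)] U_op_4_S_minus[OF g(1)] t_def[symmetric] by (rule niwa_scale[OF gS(2)])
  have UF: "U_op 2 (\<psi> (fricke k g)) = (\<lambda>z. t * b z)"
   unfolding niwa_U_op[OF gS(2)] U_op_4_S_minus[OF S_minus_fricke[OF g(1)]] t_def[symmetric]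
    fricke_fricke_S_half[OF gS(1)] g(2) by (rule niwa_scale[OF gS(1)])
  \<comment> \<open>\<open>U_2 b + t b\<close> satisfies the eigenvalue equation for
    \<open>t\<close>, hence is 0 as an oldform; this gives \<open>b\<close> the eigenvalue
    \<open>- t\<close>, and \<open>b\<close> is 0 as well.\<close>
  define b' where "b' = (\<lambda>z. U_op 2 b z + t * b z)"
  have N: "(2::nat) > 0" by simp
  have bq: "has_qexp b (qcoeff b)" "has_qexp (\<psi> (fricke k g)) (qcoeff (\<psi> (fricke k g)))"
   using S_int_has_qexp(1)[OF N weight_pos] niwa_in gS g(2) by auto
  have "b' = (\<lambda>z. t * \<psi> (fricke k g) z + t * b z)" unfolding b'_def Ub ..
  hence "U_op 2 b' = (\<lambda>z. t * U_op 2 (\<psi> (fricke k g)) z + t * U_op 2 b z)"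
   by (simp only: U_op_add[OF N has_qexp_cmult[OF bq(2)] has_qexp_cmult[OF bq(1)]]
     U_op_cmult[OF N bq(1)] U_op_cmult[OF N bq(2)])
  also have "... = (\<lambda>z. t * (U_op 2 b z + t * b z))" unfolding UF by (simp only: distrib_left add.commute)
  finally have "U_op 2 b' = (\<lambda>z. t * b' z)" unfolding b'_def .
  moreover have "b' \<in> S_old (2 * k) 2"
  proof -
   have "U_op 2 b + (\<lambda>z. t * b z) \<in> S_old (2 * k) 2"
    by (intro fun_vs.subspace_add[OF subspace_S_old[OF weight_pos]] fun_vs.subspace_scale[OF subspace_S_old[OF weight_pos]]
      S_old_U_op_2[OF weight_pos] nb(2))
   thus ?thesis by (simp add: b'_def plus_fun_def)
  qed
  moreover have "t\<^sup>2 = 4 ^ (k - 1)" using tt by (simp add: power2_eq_square)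
  ultimately have b'0: "b' = 0" by (intro S_old_U_op_2_eigen[OF k])
  have "U_op 2 b = (\<lambda>z. (- t) * b z)"
  proof
   fix z have "b' z = 0" unfolding b'0 by simp
   thus "U_op 2 b z = (- t) * b z" by (simp add: b'_def eq_neg_iff_add_eq_0)
  qed
  moreover have "(- t)\<^sup>2 = 4 ^ (k - 1)" using tt by (simp add: power2_eq_square)
  ultimately have "b = 0" by (rule S_old_U_op_2_eigen[OF k nb(2)])
  thus "h \<in> S_new (2 * k) 2" using nb by simp
 qed
qed

text \<open>\<open>\<psi>\<close> is injective and maps the span of the eigenforms onto the
  newspace, which is the image of all of \<open>S_minus\<close>; the spanning eigenforms are thus
  inherited from integral weight.\<close>

lemma S_minus_eq_span: "S_minus k = fun_vs.span minus_eigs"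
proof
 show span: "fun_vs.span minus_eigs \<subseteq> S_minus k"
  by (rule fun_vs.span_minimal[OF _ subspace_S_minus]) (auto simp: minus_eigs_def)
 show "S_minus k \<subseteq> fun_vs.span minus_eigs"
 proof
  fix f assume f: "f \<in> S_minus k"
  then obtain g where g: "g \<in> fun_vs.span minus_eigs" "\<psi> f = \<psi> g"
   using S_new_subset_span niwa_image_S_minus by blast
  have "f \<in> S_half k" "g \<in> S_half k" using f g(1) span S_minus_subset by blast+
  hence "f = g" using g(2) by (rule niwa_inject)
  thus "f \<in> fun_vs.span minus_eigs" using g by simp
 qed
qed

text \<open>An eigenfunction is nonzero by definition, and the odd prime 3 makes the condition
  nonvacuous.\<close>

lemma hecke_eigenform_iff:
 assumes "f \<in> S_minus k"
 shows "hecke_eigenform k f \<longleftrightarrow> f \<in> minus_eigs"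
proof -
 have "prime (3::nat)" "odd (3::nat)" by auto
 hence "hecke_eigenform k f ==> f \<noteq> 0" unfolding hecke_eigenform_def eigenfunction_def by blast
 thus ?thesis using assms unfolding hecke_eigenform_def eigenfunction_def minus_eigs_def by blast
qed

lemma S_minus_multiplicity_one:
 assumes f: "f \<in> S_minus k" "f \<noteq> 0" and g: "g \<in> S_minus k"
  and eig: "\<And>p. prime p ==> odd p ==> \<exists>l. T_half k p f = (\<lambda>z. l * f z) \<and> T_half k p g = (\<lambda>z. l * g z)"
 obtains c where "g = (\<lambda>z. c * f z)"
proof (rule niwa_multiplicity_one[OF _ _ f(2) _ eig])
 show "f \<in> S_half k" "g \<in> S_half k" using f g S_minus_subset by auto
 show "\<psi> f \<in> S_new (2 * k) 2" using f(1) niwa_image_S_minus by blast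
qed

text \<open>\<open>fricke\<close> commutes with all \<open>T_(p^2)\<close> and preserves
  \<open>S_minus\<close>, so by multiplicity one it acts on an eigenform by a scalar, and
  \<open>U_4\<close> is a multiple of it.\<close>

lemma S_minus_eigen_U_op:
 assumes f: "f \<in> minus_eigs"
 shows "\<exists>l. eigenfunction (U_op 4) l f"
proof -
 have fS: "f \<in> S_minus k" "f \<noteq> 0" "f \<in> S_half k" using f S_minus_subset by (auto simp: minus_eigs_def)
 obtain c where c: "fricke k f = (\<lambda>z. c * f z)"
 proof (rule S_minus_multiplicity_one[OF fS(1,2) S_minus_fricke[OF fS(1)]])
  fix p :: nat assume p: "prime p" "odd p"
  obtain l where l: "T_half k p f = (\<lambda>z. l * f z)" using f p by (auto simp: minus_eigs_def)
  hence "T_half k p (fricke k f) = (\<lambda>z. l * fricke k f z)"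
   unfolding T_half_S_half(3)[OF p k fS(3), symmetric] by (simp only: fricke_cmult)
  with l show "\<exists>l. T_half k p f = (\<lambda>z. l * f z) \<and> T_half k p (fricke k f) = (\<lambda>z. l * fricke k f z)" by blast
 qed blast
 have "U_op 4 f = (\<lambda>z. (- (2 ^ k / 2) * plus_sign k * c) * f z)"
  unfolding U_op_4_S_minus[OF fS(1)] c by (simp only: mult.assoc)
 thus ?thesis using fS(2) unfolding eigenfunction_def by blast
qed

lemma S_minus_basis:
 "\<exists>B. B \<subseteq> S_minus k \<and> fun_vs.independent B \<and> fun_vs.span B = S_minus k \<and> (\<forall>f\<in>B. hecke_eigenform k f)"
proof -
 obtain B where B: "B \<subseteq> minus_eigs" "fun_vs.independent B" "minus_eigs \<subseteq> fun_vs.span B"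
  by (rule fun_vs.maximal_independent_subset)
 have sub: "B \<subseteq> S_minus k" using B(1) by (auto simp: minus_eigs_def)
 have "fun_vs.span B = S_minus k"
  unfolding S_minus_eq_span using fun_vs.span_mono[OF B(1)] fun_vs.span_minimal[OF B(3) fun_vs.subspace_span] by blast
 moreover have "\<forall>f\<in>B. hecke_eigenform k f" using B(1) sub hecke_eigenform_iff by blast
 ultimately show ?thesis using B(2) sub by blast
qed

lemma hecke_iso_S_minus: "hecke_iso k (S_minus k) (S_new (2 * k) 2) \<psi>"
proof -
 have "bij_betw \<psi> (S_minus k) (S_new (2 * k) 2)"
  using bij_betw_subset[OF niwa_bij S_minus_subset] niwa_image_S_minus by blast
 thus ?thesis using niwa S_minus_subset unfolding niwa_map_def hecke_iso_def linear_iso_on_def by blast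
qed

end

theorem theorem5:
  fixes k :: nat and \<psi> :: "(complex \<Rightarrow> complex) \<Rightarrow> (complex \<Rightarrow> complex)"
  assumes "k > 0" and "niwa_map k \<psi>"
  shows "(\<exists>B. B \<subseteq> S_minus k \<and> fun_vs.independent B \<and> fun_vs.span B = S_minus k \<and>
            (\<forall>f\<in>B. hecke_eigenform k f)) \<and>
         (\<forall>f\<in>S_minus k. hecke_eigenform k f \<longrightarrow> (\<exists>l. eigenfunction (U_op 4) l f)) \<and>
         (\<forall>f\<in>S_minus k. \<forall>g\<in>S_minus k.
            hecke_eigenform k f \<and> hecke_eigenform k g \<and>
            (\<forall>p. prime p \<and> odd p \<longrightarrow>
               (\<exists>l. eigenfunction (T_half k p) l f \<and> eigenfunction (T_half k p) l g)) \<longrightarrow>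
            (\<exists>c. f = (\<lambda>z. c * g z))) \<and>
         hecke_stable k (S_minus k) \<and> hecke_iso k (S_minus k) (S_new (2 * k) 2) \<psi>"
proof (intro conjI ballI impI)
 note a = assms
 show "\<exists>B. B \<subseteq> S_minus k \<and> fun_vs.independent B \<and> fun_vs.span B = S_minus k \<and> (\<forall>f\<in>B. hecke_eigenform k f)"
  by (rule S_minus_basis[OF a])
 show "\<exists>l. eigenfunction (U_op 4) l f" if "f \<in> S_minus k" "hecke_eigenform k f" for f
  using S_minus_eigen_U_op[OF a] hecke_eigenform_iff[OF a that(1)] that(2) by blast
 show "\<exists>c. f = (\<lambda>z. c * g z)" if fg: "f \<in> S_minus k" "g \<in> S_minus k"
  and e: "hecke_eigenform k f \<and> hecke_eigenform k g \<and> (\<forall>p. prime p \<and> odd p \<longrightarrow>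
   (\<exists>l. eigenfunction (T_half k p) l f \<and> eigenfunction (T_half k p) l g))" for f g
 proof -
  have "prime (3::nat)" "odd (3::nat)" by auto
  hence g0: "g \<noteq> 0" using e unfolding eigenfunction_def by blast
  have "\<exists>l. T_half k p g = (\<lambda>z. l * g z) \<and> T_half k p f = (\<lambda>z. l * f z)" if "prime p" "odd p" for p
   using e that unfolding eigenfunction_def by blast
  then obtain c where "f = (\<lambda>z. c * g z)" by (rule S_minus_multiplicity_one[OF a fg(2) g0 fg(1)])
  thus ?thesis by blast
 qed
 show "hecke_stable k (S_minus k)"
  unfolding hecke_stable_def using S_minus_T_half[OF _ _ a(1)] S_minus_U_op by blast
 show "hecke_iso k (S_minus k) (S_new (2 * k) 2) \<psi>" by (rule hecke_iso_S_minus[OF a])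
qed

end
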